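(* Let $N\geq 1$ and let $\mathcal{C}$ be an $N$-Ising fusion category equipped with any braiding. Then $\mathcal{C}$ is non-degenerate if and only if $N=1$.
   Context: Throughout, $k$ is an algebraically closed field of characteristic zero and all fusion categories are over $k$. A braided fusion category $(\mathcal{C},c)$ is non-degenerate if its Müger center (the full subcategory of objects $X$ with $c_{Y,X}c_{X,Y}=\mathrm{id}_{X\otimes Y}$ for all $Y\in\mathcal{C}$) is equivalent to $\mathrm{Vec}$. $N$-Ising categories. Let $\mathfrak{I}$ be the semisimplification of the representation category of $U_{-q}(\mathfrak{sl}_2)$, $q=\exp(i\pi/4)$. It is an Ising fusion category, i.e. a non-pointed fusion category of Frobenius-Perron dimension $4$; its simple objects are $\mathbf{1}$, an invertible object $\delta$ and a non-invertible object $Z$ with $Z\otimes Z\cong \mathbf{1}\oplus\delta$. For $N\geq 1$, $\mathfrak{I}_N$ denotes the fusion subcategory of $\mathfrak{I}\boxtimes \mathrm{Vec}_{\mathbb{Z}_{2^N}}$ generated by $Z\boxtimes 1$, where $1\in\mathbb{Z}_{2^N}$ is the canonical generator; it is graded by $\mathbb{Z}_{2^N}$, with $Y\boxtimes j$ of degree $j$. For a $2^N$th root of unity $\zeta\in k^\times$, let $\omega_\zeta$ be the 3-cocycle on $\mathbb{Z}_{2^N}$ given, for $0\le i,j,\ell<2^N$, by $\omega_\zeta(i,j,\ell)=1$ if $j+\ell<2^N$ and $\omega_\zeta(i,j,\ell)=\zeta^i$ if $j+\ell\geq 2^N$. The category $\mathfrak{I}_{N,\zeta}$ is obtained from $\mathfrak{I}_N$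 by multiplying the associativity constraint on homogeneous objects of degrees $i,j,\ell$ by $\omega_\zeta(i,j,\ell)$. An $N$-Ising fusion category is any of the categories $\mathfrak{I}_{N,\zeta}$. *)

theory Defs
  imports
    "HOL-Computational_Algebra.Polynomial"
    "Jordan_Normal_Form.Matrix"
begin

section \<open>Linear monoidal categories\<close>

text \<open>
  The data of a \<open>'k\<close>-linear monoidal category with objects in \<open>'o\<close> and morphisms in \<open>'m\<close>.  Hom-sets
  need not be disjoint, so all operations on morphisms take the objects involved as arguments:
  \<open>cat_comp C X Y Z g f\<close> is \<open>g \<circ> f\<close> for \<open>f : X \<rightarrow> Y\<close> and \<open>g : Y \<rightarrow> Z\<close>, and \<open>ten_mor C X X' Y Y' f g\<close>
  is \<open>f \<otimes> g\<close> for \<open>f : X \<rightarrow> X'\<close> and \<open>g : Y \<rightarrow> Y'\<close>.  The constraints have the directions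
  \<open>(X \<otimes> Y) \<otimes> Z \<rightarrow> X \<otimes> (Y \<otimes> Z)\<close>, \<open>\<one> \<otimes> X \<rightarrow> X\<close> and \<open>X \<otimes> \<one> \<rightarrow> X\<close>.
\<close>

record ('o, 'm, 'k) lin_mon_cat =
  cat_obj :: "'o set"
  cat_hom :: "'o \<Rightarrow> 'o \<Rightarrow> 'm set"
  cat_id :: "'o \<Rightarrow> 'm"
  cat_comp :: "'o \<Rightarrow> 'o \<Rightarrow> 'o \<Rightarrow> 'm \<Rightarrow> 'm \<Rightarrow> 'm"
  cat_zero :: "'o \<Rightarrow> 'o \<Rightarrow> 'm"
  cat_add :: "'o \<Rightarrow> 'o \<Rightarrow> 'm \<Rightarrow> 'm \<Rightarrow> 'm"
  cat_scale :: "'o \<Rightarrow> 'o \<Rightarrow> 'k \<Rightarrow> 'm \<Rightarrow> 'm"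
  ten_unit :: "'o"
  ten_obj :: "'o \<Rightarrow> 'o \<Rightarrow> 'o"
  ten_mor :: "'o \<Rightarrow> 'o \<Rightarrow> 'o \<Rightarrow> 'o \<Rightarrow> 'm \<Rightarrow> 'm \<Rightarrow> 'm"
  ten_assoc :: "'o \<Rightarrow> 'o \<Rightarrow> 'o \<Rightarrow> 'm"
  ten_lunit :: "'o \<Rightarrow> 'm"
  ten_runit :: "'o \<Rightarrow> 'm"

definition inverse_mors :: "('o, 'm, 'k) lin_mon_cat \<Rightarrow> 'o \<Rightarrow> 'o \<Rightarrow> 'm \<Rightarrow> 'm \<Rightarrow> bool" where
  "inverse_mors C X Y f g \<longleftrightarrow>
     f \<in> cat_hom C X Y \<and> g \<in> cat_hom C Y X \<and>
     cat_comp C X Y X g f = cat_id C X \<and> cat_comp C Y X Y f g = cat_id C Y"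

definition iso_mor :: "('o, 'm, 'k) lin_mon_cat \<Rightarrow> 'o \<Rightarrow> 'o \<Rightarrow> 'm \<Rightarrow> bool" where
  "iso_mor C X Y f \<longleftrightarrow> (\<exists>g. inverse_mors C X Y f g)"

definition inv_mor :: "('o, 'm, 'k) lin_mon_cat \<Rightarrow> 'o \<Rightarrow> 'o \<Rightarrow> 'm \<Rightarrow> 'm" where
  "inv_mor C X Y f = (THE g. inverse_mors C X Y f g)"

definition isomorphic_objs :: "('o, 'm, 'k) lin_mon_cat \<Rightarrow> 'o \<Rightarrow> 'o \<Rightarrow> bool" where
  "isomorphic_objs C X Y \<longleftrightarrow> (\<exists>f. iso_mor C X Y f)"

definition full_subcat :: "('o, 'm, 'k) lin_mon_cat \<Rightarrow> 'o set \<Rightarrow> ('o, 'm, 'k) lin_mon_cat" where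
  "full_subcat C S = C\<lparr>cat_obj := S\<rparr>"


subsection \<open>The fusion subcategory generated by an object\<close>

definition retract_of :: "('o, 'm, 'k) lin_mon_cat \<Rightarrow> 'o \<Rightarrow> 'o \<Rightarrow> bool" where
  "retract_of C B A \<longleftrightarrow>
     (\<exists>i\<in>cat_hom C B A. \<exists>p\<in>cat_hom C A B. cat_comp C B A B p i = cat_id C B)"

definition biproduct_of :: "('o, 'm, 'k) lin_mon_cat \<Rightarrow> 'o \<Rightarrow> 'o \<Rightarrow> 'o \<Rightarrow> bool" where
  "biproduct_of C A B S \<longleftrightarrow>
     (\<exists>i\<in>cat_hom C A S. \<exists>j\<in>cat_hom C B S. \<exists>p\<in>cat_hom C S A. \<exists>r\<in>cat_hom C S B.
        cat_comp C A S A p i = cat_id C A \<and> cat_comp C B S B r j = cat_id C B \<and>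
        cat_comp C B S A p j = cat_zero C B A \<and> cat_comp C A S B r i = cat_zero C A B \<and>
        cat_add C S S (cat_comp C S A S i p) (cat_comp C S B S j r) = cat_id C S)"

text \<open>\<open>left_dual_of C A B\<close>: \<open>B\<close> is a left dual of \<open>A\<close>, i.e. there are \<open>ev : B \<otimes> A \<rightarrow> \<one>\<close> and
  \<open>coev : \<one> \<rightarrow> A \<otimes> B\<close> satisfying the zigzag identities.\<close>

definition left_dual_of :: "('o, 'm, 'k) lin_mon_cat \<Rightarrow> 'o \<Rightarrow> 'o \<Rightarrow> bool" where
  "left_dual_of C A B \<longleftrightarrow>
     (let u = ten_unit C; t = ten_obj C in
      \<exists>ev\<in>cat_hom C (t B A) u. \<exists>coev\<in>cat_hom C u (t A B).
        cat_comp C (t u A) (t A u) A (ten_runit C A)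
          (cat_comp C (t u A) (t A (t B A)) (t A u)
            (ten_mor C A A (t B A) u (cat_id C A) ev)
            (cat_comp C (t u A) (t (t A B) A) (t A (t B A))
              (ten_assoc C A B A)
              (ten_mor C u (t A B) A A coev (cat_id C A))))
          = ten_lunit C A \<and>
        cat_comp C (t B u) (t u B) B (ten_lunit C B)
          (cat_comp C (t B u) (t (t B A) B) (t u B)
            (ten_mor C (t B A) u B B ev (cat_id C B))
            (cat_comp C (t B u) (t B (t A B)) (t (t B A) B)
              (inv_mor C (t (t B A) B) (t B (t A B)) (ten_assoc C B A B))
              (ten_mor C B B u (t A B) (cat_id C B) coev)))
          = ten_runit C B)"

text \<open>Zero objects are retracts of every object, and objects isomorphic to an object of the
  subcategory are retracts of it.\<close>

inductive_set generated_objs :: "('o, 'm, 'k) lin_mon_cat \<Rightarrow> 'o \<Rightarrow> 'o set"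
  for C :: "('o, 'm, 'k) lin_mon_cat" and X :: "'o" where
  gen_base: "X \<in> cat_obj C \<Longrightarrow> X \<in> generated_objs C X"
| gen_unit: "ten_unit C \<in> generated_objs C X"
| gen_tensor: "A \<in> generated_objs C X \<Longrightarrow> B \<in> generated_objs C X
    \<Longrightarrow> ten_obj C A B \<in> generated_objs C X"
| gen_sum: "A \<in> generated_objs C X \<Longrightarrow> B \<in> generated_objs C X \<Longrightarrow> S \<in> cat_obj C
    \<Longrightarrow> biproduct_of C A B S \<Longrightarrow> S \<in> generated_objs C X"
| gen_summand: "A \<in> generated_objs C X \<Longrightarrow> B \<in> cat_obj C \<Longrightarrow> retract_of C B A
    \<Longrightarrow> B \<in> generated_objs C X"
| gen_dual: "A \<in> generated_objs C X \<Longrightarrow> B \<in> cat_obj C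
    \<Longrightarrow> left_dual_of C A B \<or> left_dual_of C B A \<Longrightarrow> B \<in> generated_objs C X"

definition generated_subcat ::
  "('o, 'm, 'k) lin_mon_cat \<Rightarrow> 'o \<Rightarrow> ('o, 'm, 'k) lin_mon_cat" where
  "generated_subcat C X = full_subcat C (generated_objs C X)"


subsection \<open>Semisimplification\<close>

text \<open>Here \<open>tr X f\<close> is the (quantum) trace of \<open>f : X \<rightarrow> X\<close>.\<close>

definition negligible_mors ::
  "('o, 'm, 'k::zero) lin_mon_cat \<Rightarrow> ('o \<Rightarrow> 'm \<Rightarrow> 'k) \<Rightarrow> 'o \<Rightarrow> 'o \<Rightarrow> 'm set" where
  "negligible_mors C tr X Y =
     {f \<in> cat_hom C X Y. \<forall>g\<in>cat_hom C Y X. tr X (cat_comp C X Y X g f) = 0}"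

definition neg_class ::
  "('o, 'm, 'k::zero) lin_mon_cat \<Rightarrow> ('o \<Rightarrow> 'm \<Rightarrow> 'k) \<Rightarrow> 'o \<Rightarrow> 'o \<Rightarrow> 'm \<Rightarrow> 'm set" where
  "neg_class C tr X Y f = (\<lambda>h. cat_add C X Y f h) ` negligible_mors C tr X Y"

text \<open>The quotient by negligible morphisms; morphisms are cosets, and the operations are the
  induced ones (each union below is a union of equal cosets).\<close>

definition semisimplification ::
  "('o, 'm, 'k::zero) lin_mon_cat \<Rightarrow> ('o \<Rightarrow> 'm \<Rightarrow> 'k) \<Rightarrow> ('o, 'm set, 'k) lin_mon_cat" where
  "semisimplification C tr =
   \<lparr> cat_obj = cat_obj C,
     cat_hom = (\<lambda>X Y. neg_class C tr X Y ` cat_hom C X Y),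
     cat_id = (\<lambda>X. neg_class C tr X X (cat_id C X)),
     cat_comp = (\<lambda>X Y Z G F. \<Union>g\<in>G. \<Union>f\<in>F. neg_class C tr X Z (cat_comp C X Y Z g f)),
     cat_zero = (\<lambda>X Y. neg_class C tr X Y (cat_zero C X Y)),
     cat_add = (\<lambda>X Y F G. \<Union>f\<in>F. \<Union>g\<in>G. neg_class C tr X Y (cat_add C X Y f g)),
     cat_scale = (\<lambda>X Y a F. \<Union>f\<in>F. neg_class C tr X Y (cat_scale C X Y a f)),
     ten_unit = ten_unit C,
     ten_obj = ten_obj C,
     ten_mor = (\<lambda>X X' Y Y' F G. \<Union>f\<in>F. \<Union>g\<in>G.
       neg_class C tr (ten_obj C X Y) (ten_obj C X' Y') (ten_mor C X X' Y Y' f g)),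
     ten_assoc = (\<lambda>X Y Z. neg_class C tr (ten_obj C (ten_obj C X Y) Z)
       (ten_obj C X (ten_obj C Y Z)) (ten_assoc C X Y Z)),
     ten_lunit = (\<lambda>X. neg_class C tr (ten_obj C (ten_unit C) X) X (ten_lunit C X)),
     ten_runit = (\<lambda>X. neg_class C tr (ten_obj C X (ten_unit C)) X (ten_runit C X)) \<rparr>"


subsection \<open>Vector spaces\<close>

definition kron :: "'k::semiring_0 mat \<Rightarrow> 'k mat \<Rightarrow> 'k mat" where
  "kron A B = mat (dim_row A * dim_row B) (dim_col A * dim_col B)
     (\<lambda>(i, j). A $$ (i div dim_row B, j div dim_col B) * B $$ (i mod dim_row B, j mod dim_col B))"

text \<open>\<open>Vec\<close>, with the vector space of dimension \<open>n\<close> represented by the number \<open>n\<close>.  Since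
  \<open>kron\<close> is strictly associative and unital, all constraints are identity matrices.\<close>

definition Vec_cat :: "(nat, 'k::comm_ring_1 mat, 'k) lin_mon_cat" where
  "Vec_cat =
   \<lparr> cat_obj = UNIV,
     cat_hom = (\<lambda>m n. carrier_mat n m),
     cat_id = (\<lambda>n. 1\<^sub>m n),
     cat_comp = (\<lambda>_ _ _ g f. g * f),
     cat_zero = (\<lambda>m n. 0\<^sub>m n m),
     cat_add = (\<lambda>_ _ f g. f + g),
     cat_scale = (\<lambda>_ _ a f. a \<cdot>\<^sub>m f),
     ten_unit = 1,
     ten_obj = (\<lambda>m n. m * n),
     ten_mor = (\<lambda>_ _ _ _ f g. kron f g),
     ten_assoc = (\<lambda>l m n. 1\<^sub>m (l * m * n)),
     ten_lunit = (\<lambda>n. 1\<^sub>m n),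
     ten_runit = (\<lambda>n. 1\<^sub>m n) \<rparr>"


subsection \<open>Deligne product with pointed categories of cyclic groups\<close>

text \<open>
  A model of the Deligne product of an additive category \<open>C\<close> with \<open>Vec\<close> of the group
  \<open>\<int>/n = {0,\<dots>,n-1}\<close>: the object \<open>[(Y\<^sub>0, j\<^sub>0), \<dots>, (Y\<^sub>r, j\<^sub>r)]\<close> is the direct sum of the homogeneous
  objects \<open>Y\<^sub>s \<boxtimes> j\<^sub>s\<close>, and morphisms are matrices of morphisms between homogeneous objects of equal
  degree.  Summands of tensor products are ordered lexicographically, hence both bracketings of a
  triple tensor product have corresponding summands in the same positions.  On summands of degrees
  \<open>i\<close>, \<open>j\<close>, \<open>l\<close> the associativity constraint is the one of \<open>C\<close> multiplied by \<open>w i j l\<close>; the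
  unit constraints are those of \<open>C\<close>, which is adequate for normalized 3-cocycles \<open>w\<close> only.
\<close>

definition hom_sum :: "('o, 'm, 'k) lin_mon_cat \<Rightarrow> 'o \<Rightarrow> 'o \<Rightarrow> 'm list \<Rightarrow> 'm" where
  "hom_sum C X Y fs = foldr (cat_add C X Y) fs (cat_zero C X Y)"

definition diag_mor ::
  "('o, 'm, 'k) lin_mon_cat \<Rightarrow> ('o \<times> nat) list \<Rightarrow> ('o \<times> nat) list \<Rightarrow> (nat \<Rightarrow> 'm) \<Rightarrow> 'm mat" where
  "diag_mor C xs ys d = mat (length ys) (length xs)
     (\<lambda>(r, s). if r = s then d r else cat_zero C (fst (xs ! s)) (fst (ys ! r)))"

definition graded_ten_obj ::
  "('o, 'm, 'k) lin_mon_cat \<Rightarrow> nat \<Rightarrow> ('o \<times> nat) list \<Rightarrow> ('o \<times> nat) list \<Rightarrow> ('o \<times> nat) list" where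
  "graded_ten_obj C n xs ys =
     concat (map (\<lambda>x. map (\<lambda>y. (ten_obj C (fst x) (fst y), (snd x + snd y) mod n)) ys) xs)"

definition graded_cat ::
  "('o, 'm, 'k) lin_mon_cat \<Rightarrow> nat \<Rightarrow> (nat \<Rightarrow> nat \<Rightarrow> nat \<Rightarrow> 'k)
    \<Rightarrow> (('o \<times> nat) list, 'm mat, 'k) lin_mon_cat" where
  "graded_cat C n w =
   \<lparr> cat_obj = lists (cat_obj C \<times> {..<n}),
     cat_hom = (\<lambda>xs ys. {M \<in> carrier_mat (length ys) (length xs).
       \<forall>r<length ys. \<forall>s<length xs. M $$ (r, s) \<in>
         (if snd (xs ! s) = snd (ys ! r) then cat_hom C (fst (xs ! s)) (fst (ys ! r))
          else {cat_zero C (fst (xs ! s)) (fst (ys ! r))})}),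
     cat_id = (\<lambda>xs. diag_mor C xs xs (\<lambda>r. cat_id C (fst (xs ! r)))),
     cat_comp = (\<lambda>xs ys zs G F. mat (length zs) (length xs) (\<lambda>(r, s).
       hom_sum C (fst (xs ! s)) (fst (zs ! r))
         (map (\<lambda>t. cat_comp C (fst (xs ! s)) (fst (ys ! t)) (fst (zs ! r)) (G $$ (r, t)) (F $$ (t, s)))
           [0..<length ys]))),
     cat_zero = (\<lambda>xs ys. mat (length ys) (length xs)
       (\<lambda>(r, s). cat_zero C (fst (xs ! s)) (fst (ys ! r)))),
     cat_add = (\<lambda>xs ys F G. mat (length ys) (length xs)
       (\<lambda>(r, s). cat_add C (fst (xs ! s)) (fst (ys ! r)) (F $$ (r, s)) (G $$ (r, s)))),
     cat_scale = (\<lambda>xs ys a F. mat (length ys) (length xs)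
       (\<lambda>(r, s). cat_scale C (fst (xs ! s)) (fst (ys ! r)) a (F $$ (r, s)))),
     ten_unit = [(ten_unit C, 0)],
     ten_obj = graded_ten_obj C n,
     ten_mor = (\<lambda>xs xs' ys ys' F G.
       mat (length xs' * length ys') (length xs * length ys) (\<lambda>(r, s).
         ten_mor C (fst (xs ! (s div length ys))) (fst (xs' ! (r div length ys')))
           (fst (ys ! (s mod length ys))) (fst (ys' ! (r mod length ys')))
           (F $$ (r div length ys', s div length ys))
           (G $$ (r mod length ys', s mod length ys)))),
     ten_assoc = (\<lambda>xs ys zs.
       diag_mor C (graded_ten_obj C n (graded_ten_obj C n xs ys) zs)
         (graded_ten_obj C n xs (graded_ten_obj C n ys zs))
         (\<lambda>r. let x = xs ! (r div (length ys * length zs));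
                  y = ys ! (r div length zs mod length ys);
                  z = zs ! (r mod length zs)
              in cat_scale C (ten_obj C (ten_obj C (fst x) (fst y)) (fst z))
                   (ten_obj C (fst x) (ten_obj C (fst y) (fst z)))
                   (w (snd x) (snd y) (snd z)) (ten_assoc C (fst x) (fst y) (fst z)))),
     ten_lunit = (\<lambda>xs. diag_mor C (graded_ten_obj C n [(ten_unit C, 0)] xs) xs
       (\<lambda>r. ten_lunit C (fst (xs ! r)))),
     ten_runit = (\<lambda>xs. diag_mor C (graded_ten_obj C n xs [(ten_unit C, 0)]) xs
       (\<lambda>r. ten_runit C (fst (xs ! r)))) \<rparr>"


section \<open>Braidings and non-degeneracy\<close>

definition braiding ::
  "('o, 'm, 'k) lin_mon_cat \<Rightarrow> ('o \<Rightarrow> 'o \<Rightarrow> 'm) \<Rightarrow> bool" where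
  "braiding C c \<longleftrightarrow>
     (let t = ten_obj C; a = ten_assoc C; i = cat_id C;
          a' = (\<lambda>X Y Z. inv_mor C (t (t X Y) Z) (t X (t Y Z)) (ten_assoc C X Y Z)) in
      (\<forall>X\<in>cat_obj C. \<forall>Y\<in>cat_obj C. iso_mor C (t X Y) (t Y X) (c X Y)) \<and>
      (\<forall>X\<in>cat_obj C. \<forall>X'\<in>cat_obj C. \<forall>Y\<in>cat_obj C. \<forall>Y'\<in>cat_obj C.
         \<forall>f\<in>cat_hom C X X'. \<forall>g\<in>cat_hom C Y Y'.
           cat_comp C (t X Y) (t X' Y') (t Y' X') (c X' Y') (ten_mor C X X' Y Y' f g)
           = cat_comp C (t X Y) (t Y X) (t Y' X') (ten_mor C Y Y' X X' g f) (c X Y)) \<and>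
      (\<forall>X\<in>cat_obj C. \<forall>Y\<in>cat_obj C. \<forall>Z\<in>cat_obj C.
         cat_comp C (t (t X Y) Z) (t (t Y Z) X) (t Y (t Z X)) (a Y Z X)
           (cat_comp C (t (t X Y) Z) (t X (t Y Z)) (t (t Y Z) X) (c X (t Y Z)) (a X Y Z))
         = cat_comp C (t (t X Y) Z) (t Y (t X Z)) (t Y (t Z X))
             (ten_mor C Y Y (t X Z) (t Z X) (i Y) (c X Z))
             (cat_comp C (t (t X Y) Z) (t (t Y X) Z) (t Y (t X Z)) (a Y X Z)
               (ten_mor C (t X Y) (t Y X) Z Z (c X Y) (i Z)))) \<and>
      (\<forall>X\<in>cat_obj C. \<forall>Y\<in>cat_obj C. \<forall>Z\<in>cat_obj C.
         cat_comp C (t X (t Y Z)) (t Z (t X Y)) (t (t Z X) Y) (a' Z X Y)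
           (cat_comp C (t X (t Y Z)) (t (t X Y) Z) (t Z (t X Y)) (c (t X Y) Z) (a' X Y Z))
         = cat_comp C (t X (t Y Z)) (t (t X Z) Y) (t (t Z X) Y)
             (ten_mor C (t X Z) (t Z X) Y Y (c X Z) (i Y))
             (cat_comp C (t X (t Y Z)) (t X (t Z Y)) (t (t X Z) Y) (a' X Z Y)
               (ten_mor C X X (t Y Z) (t Z Y) (i X) (c Y Z)))))"

definition mueger_center ::
  "('o, 'm, 'k) lin_mon_cat \<Rightarrow> ('o \<Rightarrow> 'o \<Rightarrow> 'm) \<Rightarrow> ('o, 'm, 'k) lin_mon_cat" where
  "mueger_center C c = full_subcat C
     {X \<in> cat_obj C. \<forall>Y\<in>cat_obj C.
        cat_comp C (ten_obj C X Y) (ten_obj C Y X) (ten_obj C X Y) (c Y X) (c X Y)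
        = cat_id C (ten_obj C X Y)}"

text \<open>A linear monoidal functor from \<open>C\<close> to \<open>D\<close>, given by \<open>F\<^sub>0\<close> on objects, \<open>F\<^sub>1 X Y\<close> on
  \<open>Hom(X, Y)\<close>, and structure isomorphisms \<open>J X Y : F\<^sub>0 X \<otimes> F\<^sub>0 Y \<rightarrow> F\<^sub>0 (X \<otimes> Y)\<close> and \<open>e : \<one> \<rightarrow> F\<^sub>0 \<one>\<close>.\<close>

definition monoidal_functor ::
  "('o, 'm, 'k) lin_mon_cat \<Rightarrow> ('p, 'n, 'k) lin_mon_cat
    \<Rightarrow> ('o \<Rightarrow> 'p) \<Rightarrow> ('o \<Rightarrow> 'o \<Rightarrow> 'm \<Rightarrow> 'n) \<Rightarrow> ('o \<Rightarrow> 'o \<Rightarrow> 'n) \<Rightarrow> 'n \<Rightarrow> bool" where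
  "monoidal_functor C D F0 F1 J e \<longleftrightarrow>
     (let t = ten_obj C; s = ten_obj D in
      (\<forall>X\<in>cat_obj C. F0 X \<in> cat_obj D) \<and>
      (\<forall>X\<in>cat_obj C. \<forall>Y\<in>cat_obj C. \<forall>f\<in>cat_hom C X Y. F1 X Y f \<in> cat_hom D (F0 X) (F0 Y)) \<and>
      (\<forall>X\<in>cat_obj C. F1 X X (cat_id C X) = cat_id D (F0 X)) \<and>
      (\<forall>X\<in>cat_obj C. \<forall>Y\<in>cat_obj C. \<forall>Z\<in>cat_obj C.
         \<forall>f\<in>cat_hom C X Y. \<forall>g\<in>cat_hom C Y Z.
           F1 X Z (cat_comp C X Y Z g f) = cat_comp D (F0 X) (F0 Y) (F0 Z) (F1 Y Z g) (F1 X Y f)) \<and>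
      (\<forall>X\<in>cat_obj C. \<forall>Y\<in>cat_obj C. \<forall>f\<in>cat_hom C X Y. \<forall>g\<in>cat_hom C X Y.
         F1 X Y (cat_add C X Y f g) = cat_add D (F0 X) (F0 Y) (F1 X Y f) (F1 X Y g)) \<and>
      (\<forall>X\<in>cat_obj C. \<forall>Y\<in>cat_obj C. \<forall>f\<in>cat_hom C X Y. \<forall>a.
         F1 X Y (cat_scale C X Y a f) = cat_scale D (F0 X) (F0 Y) a (F1 X Y f)) \<and>
      (\<forall>X\<in>cat_obj C. \<forall>Y\<in>cat_obj C. iso_mor D (s (F0 X) (F0 Y)) (F0 (t X Y)) (J X Y)) \<and>
      iso_mor D (ten_unit D) (F0 (ten_unit C)) e \<and>
      (\<forall>X\<in>cat_obj C. \<forall>X'\<in>cat_obj C. \<forall>Y\<in>cat_obj C. \<forall>Y'\<in>cat_obj C.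
         \<forall>f\<in>cat_hom C X X'. \<forall>g\<in>cat_hom C Y Y'.
           cat_comp D (s (F0 X) (F0 Y)) (s (F0 X') (F0 Y')) (F0 (t X' Y')) (J X' Y')
             (ten_mor D (F0 X) (F0 X') (F0 Y) (F0 Y') (F1 X X' f) (F1 Y Y' g))
           = cat_comp D (s (F0 X) (F0 Y)) (F0 (t X Y)) (F0 (t X' Y'))
               (F1 (t X Y) (t X' Y') (ten_mor C X X' Y Y' f g)) (J X Y)) \<and>
      (\<forall>X\<in>cat_obj C. \<forall>Y\<in>cat_obj C. \<forall>Z\<in>cat_obj C.
         cat_comp D (s (s (F0 X) (F0 Y)) (F0 Z)) (F0 (t (t X Y) Z)) (F0 (t X (t Y Z)))
           (F1 (t (t X Y) Z) (t X (t Y Z)) (ten_assoc C X Y Z))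
           (cat_comp D (s (s (F0 X) (F0 Y)) (F0 Z)) (s (F0 (t X Y)) (F0 Z)) (F0 (t (t X Y) Z))
             (J (t X Y) Z)
             (ten_mor D (s (F0 X) (F0 Y)) (F0 (t X Y)) (F0 Z) (F0 Z) (J X Y) (cat_id D (F0 Z))))
         = cat_comp D (s (s (F0 X) (F0 Y)) (F0 Z)) (s (F0 X) (F0 (t Y Z))) (F0 (t X (t Y Z)))
             (J X (t Y Z))
             (cat_comp D (s (s (F0 X) (F0 Y)) (F0 Z)) (s (F0 X) (s (F0 Y) (F0 Z)))
               (s (F0 X) (F0 (t Y Z)))
               (ten_mor D (F0 X) (F0 X) (s (F0 Y) (F0 Z)) (F0 (t Y Z)) (cat_id D (F0 X)) (J Y Z))
               (ten_assoc D (F0 X) (F0 Y) (F0 Z)))) \<and>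
      (\<forall>X\<in>cat_obj C.
         cat_comp D (s (ten_unit D) (F0 X)) (F0 (t (ten_unit C) X)) (F0 X)
           (F1 (t (ten_unit C) X) X (ten_lunit C X))
           (cat_comp D (s (ten_unit D) (F0 X)) (s (F0 (ten_unit C)) (F0 X)) (F0 (t (ten_unit C) X))
             (J (ten_unit C) X)
             (ten_mor D (ten_unit D) (F0 (ten_unit C)) (F0 X) (F0 X) e (cat_id D (F0 X))))
         = ten_lunit D (F0 X)) \<and>
      (\<forall>X\<in>cat_obj C.
         cat_comp D (s (F0 X) (ten_unit D)) (F0 (t X (ten_unit C))) (F0 X)
           (F1 (t X (ten_unit C)) X (ten_runit C X))
           (cat_comp D (s (F0 X) (ten_unit D)) (s (F0 X) (F0 (ten_unit C))) (F0 (t X (ten_unit C)))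
             (J X (ten_unit C))
             (ten_mor D (F0 X) (F0 X) (ten_unit D) (F0 (ten_unit C)) (cat_id D (F0 X)) e))
         = ten_runit D (F0 X)))"

text \<open>Equivalence of linear monoidal categories: a fully faithful, essentially surjective linear
  monoidal functor (a quasi-inverse exists by choice, so the relation is symmetric).\<close>

definition monoidally_equivalent ::
  "('o, 'm, 'k) lin_mon_cat \<Rightarrow> ('p, 'n, 'k) lin_mon_cat \<Rightarrow> bool" where
  "monoidally_equivalent C D \<longleftrightarrow>
     (\<exists>F0 F1 J e. monoidal_functor C D F0 F1 J e \<and>
        (\<forall>X\<in>cat_obj C. \<forall>Y\<in>cat_obj C.
           bij_betw (F1 X Y) (cat_hom C X Y) (cat_hom D (F0 X) (F0 Y))) \<and>
        (\<forall>Z\<in>cat_obj D. \<exists>X\<in>cat_obj C. isomorphic_objs D (F0 X) Z))"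

definition nondegenerate ::
  "('o, 'm, 'k::comm_ring_1) lin_mon_cat \<Rightarrow> ('o \<Rightarrow> 'o \<Rightarrow> 'm) \<Rightarrow> bool" where
  "nondegenerate C c \<longleftrightarrow>
     monoidally_equivalent (Vec_cat :: (nat, 'k mat, 'k) lin_mon_cat) (mueger_center C c)"


section \<open>Representations of quantum \<open>sl\<^sub>2\<close>\<close>

text \<open>
  A representation of \<open>U\<^sub>v(sl\<^sub>2)\<close> on \<open>k\<^sup>n\<close> is given by the matrices of the generators
  \<open>E\<close>, \<open>F\<close>, \<open>K\<close>, \<open>K\<inverse>\<close>.
\<close>

record 'k uq_rep =
  rep_dim :: nat
  rep_E :: "'k mat"
  rep_F :: "'k mat"
  rep_K :: "'k mat"
  rep_Kinv :: "'k mat"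

definition is_uq_rep :: "'k::field \<Rightarrow> 'k uq_rep \<Rightarrow> bool" where
  "is_uq_rep v M \<longleftrightarrow>
     (let n = rep_dim M; E = rep_E M; F = rep_F M; K = rep_K M; K' = rep_Kinv M in
      E \<in> carrier_mat n n \<and> F \<in> carrier_mat n n \<and> K \<in> carrier_mat n n \<and> K' \<in> carrier_mat n n \<and>
      K * K' = 1\<^sub>m n \<and> K' * K = 1\<^sub>m n \<and>
      K * E * K' = v\<^sup>2 \<cdot>\<^sub>m E \<and>
      K * F * K' = inverse (v\<^sup>2) \<cdot>\<^sub>m F \<and>
      E * F - F * E = inverse (v - inverse v) \<cdot>\<^sub>m (K - K'))"

definition uq_trivial :: "'k::field uq_rep" where
  "uq_trivial = \<lparr>rep_dim = 1, rep_E = 0\<^sub>m 1 1, rep_F = 0\<^sub>m 1 1, rep_K = 1\<^sub>m 1, rep_Kinv = 1\<^sub>m 1\<rparr>"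

text \<open>The tensor product along the comultiplication \<open>\<Delta>(E) = E \<otimes> K + 1 \<otimes> E\<close>,
  \<open>\<Delta>(F) = F \<otimes> 1 + K\<inverse> \<otimes> F\<close>, \<open>\<Delta>(K) = K \<otimes> K\<close>.\<close>

definition uq_tensor :: "'k::field uq_rep \<Rightarrow> 'k uq_rep \<Rightarrow> 'k uq_rep" where
  "uq_tensor M N =
   \<lparr> rep_dim = rep_dim M * rep_dim N,
     rep_E = kron (rep_E M) (rep_K N) + kron (1\<^sub>m (rep_dim M)) (rep_E N),
     rep_F = kron (rep_F M) (1\<^sub>m (rep_dim N)) + kron (rep_Kinv M) (rep_F N),
     rep_K = kron (rep_K M) (rep_K N),
     rep_Kinv = kron (rep_Kinv M) (rep_Kinv N) \<rparr>"

text \<open>The two-dimensional representation of highest weight \<open>v\<close>.\<close>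

definition uq_fundamental :: "'k::field \<Rightarrow> 'k uq_rep" where
  "uq_fundamental v =
   \<lparr> rep_dim = 2,
     rep_E = mat_of_rows_list 2 [[0, 1], [0, 0]],
     rep_F = mat_of_rows_list 2 [[0, 0], [1, 0]],
     rep_K = mat_of_rows_list 2 [[v, 0], [0, inverse v]],
     rep_Kinv = mat_of_rows_list 2 [[inverse v, 0], [0, v]] \<rparr>"

definition uq_hom :: "'k::field uq_rep \<Rightarrow> 'k uq_rep \<Rightarrow> 'k mat set" where
  "uq_hom M N = {f \<in> carrier_mat (rep_dim N) (rep_dim M).
     f * rep_E M = rep_E N * f \<and> f * rep_F M = rep_F N * f \<and> f * rep_K M = rep_K N * f}"

definition Rep_Uq :: "'k::field \<Rightarrow> ('k uq_rep, 'k mat, 'k) lin_mon_cat" where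
  "Rep_Uq v =
   \<lparr> cat_obj = {M. is_uq_rep v M},
     cat_hom = uq_hom,
     cat_id = (\<lambda>M. 1\<^sub>m (rep_dim M)),
     cat_comp = (\<lambda>_ _ _ g f. g * f),
     cat_zero = (\<lambda>M N. 0\<^sub>m (rep_dim N) (rep_dim M)),
     cat_add = (\<lambda>_ _ f g. f + g),
     cat_scale = (\<lambda>_ _ a f. a \<cdot>\<^sub>m f),
     ten_unit = uq_trivial,
     ten_obj = uq_tensor,
     ten_mor = (\<lambda>_ _ _ _ f g. kron f g),
     ten_assoc = (\<lambda>L M N. 1\<^sub>m (rep_dim L * rep_dim M * rep_dim N)),
     ten_lunit = (\<lambda>M. 1\<^sub>m (rep_dim M)),
     ten_runit = (\<lambda>M. 1\<^sub>m (rep_dim M)) \<rparr>"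

text \<open>When \<open>v\<close> is a root of unity, the category to be semisimplified is that of tilting
  representations, i.e. of direct summands of direct sums of tensor powers of the fundamental
  representation (the fundamental representation is self-dual, so closing under duals adds nothing).  Only the
  generators \<open>E\<close>, \<open>F\<close>, \<open>K\<close>, and no divided powers, are used; the additional morphisms and summands
  that this creates become zero after semisimplification.\<close>

definition Tilt_Uq :: "'k::field \<Rightarrow> ('k uq_rep, 'k mat, 'k) lin_mon_cat" where
  "Tilt_Uq v = generated_subcat (Rep_Uq v) (uq_fundamental v)"

text \<open>The square of the antipode is conjugation by \<open>K\<close>, so \<open>K\<close> is a pivotal element.\<close>

definition quantum_trace :: "'k::field uq_rep \<Rightarrow> 'k mat \<Rightarrow> 'k" where
  "quantum_trace M f = (\<Sum>i<rep_dim M. (rep_K M * f) $$ (i, i))"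


section \<open>\<open>N\<close>-Ising categories\<close>

text \<open>
  The parameter \<open>q\<close> is a primitive eighth root of unity of the ground field, playing the role
  of \<open>exp(i\<pi>/4)\<close>.  The object called \<open>Z\<close> is the image of the fundamental representation.
\<close>

definition Ising_cat :: "'k::field \<Rightarrow> ('k uq_rep, 'k mat set, 'k) lin_mon_cat" where
  "Ising_cat q = semisimplification (Tilt_Uq (- q)) quantum_trace"

type_synonym 'k ising_obj = "('k uq_rep \<times> nat) list"
type_synonym 'k ising_mor = "'k mat set mat"

definition Ising_N :: "'k::field \<Rightarrow> nat \<Rightarrow> ('k ising_obj, 'k ising_mor, 'k) lin_mon_cat" where
  "Ising_N q N =
     generated_subcat (graded_cat (Ising_cat q) (2 ^ N) (\<lambda>_ _ _. 1)) [(uq_fundamental (- q), 1)]"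

definition omega_cocycle :: "nat \<Rightarrow> 'k::field \<Rightarrow> nat \<Rightarrow> nat \<Rightarrow> nat \<Rightarrow> 'k" where
  "omega_cocycle N z i j l = (if j + l < 2 ^ N then 1 else z ^ i)"

definition Ising_N_twisted ::
  "'k::field \<Rightarrow> nat \<Rightarrow> 'k \<Rightarrow> ('k ising_obj, 'k ising_mor, 'k) lin_mon_cat" where
  "Ising_N_twisted q N z =
     (Ising_N q N)\<lparr>ten_assoc :=
        ten_assoc (graded_cat (Ising_cat q) (2 ^ N) (omega_cocycle N z))\<rparr>"

definition N_Ising_category ::
  "'k::field \<Rightarrow> nat \<Rightarrow> ('k ising_obj, 'k ising_mor, 'k) lin_mon_cat \<Rightarrow> bool" where
  "N_Ising_category q N C \<longleftrightarrow> (\<exists>z. z ^ (2 ^ N) = 1 \<and> C = Ising_N_twisted q N z)"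

end

theory Submission
  imports Defs "Jordan_Normal_Form.Determinant"
begin

text \<open>
  Let \<open>n = 2^N\<close>.  A braided fusion category is non-degenerate iff each transparent object, i.e. each
  object whose double braiding with everything is trivial, is a multiple of the unit.  The objects
  here are generated by \<open>Z = (V, 1)\<close>, so an object is transparent as soon as its monodromy with \<open>Z\<close>
  is trivial (\<open>central_all\<close>).  The whole question is decided by the single endomorphism \<open>R = c(Z, Z)\<close>
  of \<open>V \<otimes> V\<close>.  It has the form \<open>R = a + b (cup \<circ> cap)\<close>, and naturality of the braiding with respect
  to \<open>cup\<close>, combined with a hexagon, yields \<open>a^2 + a b d + b^2 = 0\<close>, where \<open>d^2 = 2\<close>
  (\<open>kauffman_relation\<close>).  A twist of the associator by a cocycle multiplies each side of a hexagon
  by scalars, and these cancel in the monodromy, so the argument does not see the twist.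

  Let \<open>\<delta>\<close> be the complement of \<open>\<one>\<close> in \<open>V \<otimes> V\<close>, realised by the three-dimensional representation \<open>D\<close>.
  Evaluating the monodromy of \<open>Z \<otimes> Z\<close> with \<open>Z\<close> on its two summands, one finds that the monodromies
  of \<open>(\<one>, 2)\<close> and of \<open>(\<delta>, 2)\<close> with \<open>Z\<close> are \<open>\<chi> = a^2 b^2\<close> and \<open>- \<chi>\<close>.

  If \<open>4\<close> divides \<open>n\<close>, it follows by multiplicativity that the monodromies of \<open>(\<one>, n/2)\<close> and of
  \<open>(\<delta>, n/2)\<close> with \<open>Z\<close> are \<open>s\<close> and \<open>- s\<close> for some \<open>s\<close>; since \<open>(\<one>, n/2)\<close> squares to the unit, \<open>s^2 = 1\<close>.
  Hence one of the two is transparent (\<open>transparent_exists\<close>).  Its degree is not zero, so it receives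
  no morphism from the unit, whereas every non-zero vector space does; the centre is not \<open>Vec\<close>
  (\<open>degenerate\<close>).

  If \<open>n = 2\<close>, degrees agree with the parity by which \<open>K^4\<close> acts, so the simple homogeneous objects are
  \<open>(\<one>, 0)\<close>, \<open>(\<delta>, 0)\<close> and \<open>Z\<close>.  As \<open>2 = 0\<close> in \<open>\<int>/2\<close>, the scalar \<open>\<chi>\<close> belongs to the unit, so it is \<open>1\<close>
  and \<open>\<delta>\<close> has monodromy \<open>-1\<close> with \<open>Z\<close>.  If \<open>Z\<close> were transparent, \<open>R^2 = 1\<close> would force
  \<open>a^2 = (a + b d)^2 = 1\<close>, which the quadratic relation excludes.  So transparent objects are multiples
  of the unit, and \<open>m \<mapsto> m \<one>\<close> is an equivalence from \<open>Vec\<close> (\<open>nondegenerate_2\<close>).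

  The morphisms of the semisimplified category are handled through representatives: \<open>eqv\<close> is equality
  up to negligible morphisms.  Two facts about tilting representations are needed.  Up to negligible
  morphisms each is a sum of copies of \<open>\<one>\<close>, \<open>V\<close> and \<open>D\<close> (\<open>T_simple\<close>), because the Jones-Wenzl
  projector on three strands is negligible; and closure under duals does not lead outside the summands
  of tensor powers of \<open>V\<close> (\<open>thru_T\<close>), nor does it spoil the parity (\<open>GN_gpar\<close>).
\<close>

section \<open>Kronecker products and traces\<close>

lemma mult_assoc_dim: "dim_col A = dim_row B \<Longrightarrow> dim_col B = dim_row C \<Longrightarrow> (A * B) * C = A * (B * (C :: 'a::semiring_0 mat))"
  by (rule assoc_mult_mat[of _ "dim_row A" "dim_col A" _ "dim_col B" _ "dim_col C"]) auto

lemma add_mult_dim: "dim_row A = dim_row B \<Longrightarrow> dim_col A = dim_col B \<Longrightarrow> dim_col A = dim_row C \<Longrightarrow>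
   (A + B) * C = A * C + B * (C :: 'a::semiring_0 mat)"
  by (rule add_mult_distrib_mat[of _ "dim_row A" "dim_col A" _ _ "dim_col C"]) auto

lemma mult_add_dim: "dim_row B = dim_row C \<Longrightarrow> dim_col B = dim_col C \<Longrightarrow> dim_col A = dim_row B \<Longrightarrow>
   A * (B + C) = A * B + A * (C :: 'a::semiring_0 mat)"
  by (rule mult_add_distrib_mat[of _ "dim_row A" "dim_col A" _ "dim_col B"]) auto

lemma smult_mult_dim: "dim_col A = dim_row B \<Longrightarrow> (a \<cdot>\<^sub>m A) * B = a \<cdot>\<^sub>m (A * (B :: 'a::comm_semiring_0 mat))"
  by (rule mult_smult_assoc_mat[of _ "dim_row A" "dim_col A" _ "dim_col B"]) auto

lemma mult_smult_dim: "dim_col A = dim_row B \<Longrightarrow> A * (a \<cdot>\<^sub>m B) = a \<cdot>\<^sub>m (A * (B :: 'a::comm_semiring_0 mat))"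
  by (rule mult_smult_distrib[of _ "dim_row A" "dim_col A" _ "dim_col B"]) auto

lemma one_mult_dim: "dim_row A = n \<Longrightarrow> 1\<^sub>m n * A = (A :: 'a::semiring_1 mat)"
  by (rule left_mult_one_mat[of _ n "dim_col A"]) auto

lemma mult_one_dim: "dim_col A = n \<Longrightarrow> A * 1\<^sub>m n = (A :: 'a::semiring_1 mat)"
  by (rule right_mult_one_mat[of _ "dim_row A" n]) auto

lemma mult_index_sum:
  "i < dim_row A \<Longrightarrow> j < dim_col B \<Longrightarrow> dim_col A = dim_row B \<Longrightarrow>
     (A * B) $$ (i, j) = (\<Sum>k<dim_row B. A $$ (i, k) * B $$ (k, j))"
  by (auto simp: scalar_prod_def atLeast0LessThan intro!: sum.cong)

lemma sum_div_mod:
  fixes f :: "nat \<Rightarrow> nat \<Rightarrow> 'a::comm_monoid_add"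
  shows "(\<Sum>k<m * n. f (k div n) (k mod n)) = (\<Sum>i<m. \<Sum>j<n. f i j)"
proof -
  have "(\<Sum>k<m * n. f (k div n) (k mod n)) = (\<Sum>i<m. sum (\<lambda>k. f (k div n) (k mod n)) {i * n..<i * n + n})"
    by (rule sum.nat_group[symmetric])
  also have "\<dots> = (\<Sum>i<m. \<Sum>j<n. f i j)"
  proof (rule sum.cong)
    fix i
    have "sum (\<lambda>k. f (k div n) (k mod n)) {i * n..<i * n + n}
      = (\<Sum>j\<in>{0..<n}. f ((j + i * n) div n) ((j + i * n) mod n))"
      using sum.shift_bounds_nat_ivl[of "\<lambda>k. f (k div n) (k mod n)" 0 "i * n" n]
      by (simp only: add_0 add.commute)
    also have "\<dots> = (\<Sum>j<n. f i j)"
      by (rule sum.cong) auto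
    finally show "sum (\<lambda>k. f (k div n) (k mod n)) {i * n..<i * n + n} = (\<Sum>j<n. f i j)" .
  qed simp
  finally show ?thesis .
qed

lemma div_less_mult: "i < m * (n::nat) \<Longrightarrow> i div n < m"
  by (simp add: less_mult_imp_div_less)
lemma mod_less_mult: "i < m * (n::nat) \<Longrightarrow> i mod n < n"
  by (cases "n = 0") auto
lemma mult_add_less: "i < m \<Longrightarrow> j < n \<Longrightarrow> i * n + j < m * (n::nat)"
proof -
  assume "i < m" "j < n"
  then have "i * n + j < Suc i * n" "Suc i * n \<le> m * n" by (simp, intro mult_le_mono1) auto
  then show ?thesis by linarith
qed

lemma dim_kron [simp]: "dim_row (kron A B) = dim_row A * dim_row B" "dim_col (kron A B) = dim_col A * dim_col B"
  by (auto simp: kron_def)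

lemma index_kron [simp]: "i < dim_row A * dim_row B \<Longrightarrow> j < dim_col A * dim_col B \<Longrightarrow>
  kron A B $$ (i, j) = A $$ (i div dim_row B, j div dim_col B) * B $$ (i mod dim_row B, j mod dim_col B)"
  by (auto simp: kron_def)

lemma kron_carrier [simp]: "A \<in> carrier_mat a b \<Longrightarrow> B \<in> carrier_mat c d \<Longrightarrow> kron A B \<in> carrier_mat (a * c) (b * d)"
  by (auto simp: kron_def)

lemma kron_mult:
  fixes A :: "'a::comm_semiring_0 mat"
  assumes "dim_col A = dim_row C" "dim_col B = dim_row D"
  shows "kron A B * kron C D = kron (A * C) (B * D)"
proof (rule eq_matI)
  fix i j assume "i < dim_row (kron (A * C) (B * D))" "j < dim_col (kron (A * C) (B * D))"
  then have i: "i < dim_row A * dim_row B" and j: "j < dim_col C * dim_col D" by auto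
  note ij = div_less_mult[OF i] mod_less_mult[OF i] div_less_mult[OF j] mod_less_mult[OF j]
  have "(kron A B * kron C D) $$ (i, j) = (\<Sum>k<dim_row C * dim_row D. kron A B $$ (i, k) * kron C D $$ (k, j))"
    using i j assms by (subst mult_index_sum) auto
  also have "\<dots> = (\<Sum>k<dim_row C * dim_row D. (\<lambda>k1 k2. (A $$ (i div dim_row B, k1) * C $$ (k1, j div dim_col D)) *
      (B $$ (i mod dim_row B, k2) * D $$ (k2, j mod dim_col D))) (k div dim_row D) (k mod dim_row D))"
    using i j assms by (intro sum.cong) (auto simp: ac_simps)
  also have "\<dots> = (\<Sum>k1<dim_row C. \<Sum>k2<dim_row D. (A $$ (i div dim_row B, k1) * C $$ (k1, j div dim_col D)) *
      (B $$ (i mod dim_row B, k2) * D $$ (k2, j mod dim_col D)))"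
    by (rule sum_div_mod)
  also have "\<dots> = (A * C) $$ (i div dim_row B, j div dim_col D) * (B * D) $$ (i mod dim_row B, j mod dim_col D)"
    using ij assms by (simp add: mult_index_sum sum_product del: index_mult_mat)
  also have "\<dots> = kron (A * C) (B * D) $$ (i, j)"
    using i j by simp
  finally show "(kron A B * kron C D) $$ (i, j) = kron (A * C) (B * D) $$ (i, j)" .
qed (use assms in auto)

lemma kron_assoc: "kron (kron A B) C = kron A (kron B (C :: 'a::comm_semiring_0 mat))"
proof (rule eq_matI)
  fix i j assume "i < dim_row (kron A (kron B C))" "j < dim_col (kron A (kron B C))"
  then have i: "i < dim_row A * (dim_row B * dim_row C)" and j: "j < dim_col A * (dim_col B * dim_col C)" by auto
  have i': "i < dim_row A * dim_row B * dim_row C" and j': "j < dim_col A * dim_col B * dim_col C" using i j by (auto simp: ac_simps)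
  have "dim_row C > 0" "dim_col C > 0" using i j by (auto intro: gr0I)
  then show "kron (kron A B) C $$ (i, j) = kron A (kron B C) $$ (i, j)"
    using i j i' j' div_less_mult[OF i'] div_less_mult[OF j'] mod_less_mult[OF i] mod_less_mult[OF j]
    by (simp add: div_mult2_eq mod_mult2_eq mult.assoc mult.commute[of "dim_row B"] mult.commute[of "dim_col B"])
qed (auto simp: ac_simps)

lemma kron_one_left [simp]: "kron (1\<^sub>m 1) A = (A :: 'a::semiring_1 mat)"
  by (rule eq_matI) auto
lemma kron_one_right [simp]: "kron A (1\<^sub>m 1) = (A :: 'a::semiring_1 mat)"
  by (rule eq_matI) auto
lemma kron_one_Suc0 [simp]: "kron (1\<^sub>m (Suc 0)) A = (A :: 'a::semiring_1 mat)" "kron A (1\<^sub>m (Suc 0)) = (A :: 'a::semiring_1 mat)"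
  using kron_one_left kron_one_right by simp_all

lemma div_mod_eqI: "i div n = j div n \<Longrightarrow> i mod n = j mod n \<Longrightarrow> i = (j::nat)"
  by (metis div_mult_mod_eq)

lemma kron_one_one: "kron (1\<^sub>m m) (1\<^sub>m n) = (1\<^sub>m (m * n) :: 'a::semiring_1 mat)"
proof (rule eq_matI)
  fix i j assume "i < dim_row (1\<^sub>m (m * n) :: 'a mat)" "j < dim_col (1\<^sub>m (m * n) :: 'a mat)"
  then have i: "i < m * n" and j: "j < m * n" by auto
  show "kron (1\<^sub>m m) (1\<^sub>m n) $$ (i, j) = (1\<^sub>m (m * n) :: 'a mat) $$ (i, j)"
    using i j div_less_mult[OF i] mod_less_mult[OF i] div_less_mult[OF j] mod_less_mult[OF j]
    by (auto simp: dest: div_mod_eqI)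
qed auto

lemma kron_add_left: "dim_row A = dim_row B \<Longrightarrow> dim_col A = dim_col B \<Longrightarrow>
  kron (A + B) (C :: 'a::comm_semiring_0 mat) = kron A C + kron B C"
  by (rule eq_matI) (auto simp: div_less_mult mod_less_mult distrib_left distrib_right)
lemma kron_add_right: "dim_row A = dim_row B \<Longrightarrow> dim_col A = dim_col B \<Longrightarrow>
  kron (C :: 'a::comm_semiring_0 mat) (A + B) = kron C A + kron C B"
  by (rule eq_matI) (auto simp: div_less_mult mod_less_mult distrib_left distrib_right)
lemma kron_smult_left: "kron (a \<cdot>\<^sub>m A) B = a \<cdot>\<^sub>m kron A (B :: 'a::comm_semiring_0 mat)"
  by (rule eq_matI) (auto simp: div_less_mult mod_less_mult mult.assoc)
lemma kron_smult_right: "kron A (a \<cdot>\<^sub>m B) = a \<cdot>\<^sub>m kron A (B :: 'a::comm_semiring_0 mat)"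
  by (rule eq_matI) (auto simp: div_less_mult mod_less_mult mult.left_commute)
lemma kron_zero_left [simp]: "kron (0\<^sub>m a b) B = (0\<^sub>m (a * dim_row B) (b * dim_col B) :: 'a::comm_semiring_0 mat)"
  by (rule eq_matI) (auto simp: div_less_mult mod_less_mult)
lemma kron_zero_right [simp]: "kron B (0\<^sub>m a b) = (0\<^sub>m (dim_row B * a) (dim_col B * b) :: 'a::comm_semiring_0 mat)"
  by (rule eq_matI) (auto simp: div_less_mult mod_less_mult)

subsection \<open>Traces\<close>

definition mtr :: "'a::comm_semiring_0 mat \<Rightarrow> 'a" where
  "mtr A = (\<Sum>i<dim_row A. A $$ (i, i))"

lemma mtr_comm:
  assumes "dim_col A = dim_row B" "dim_col B = dim_row A"
  shows "mtr (A * B) = mtr (B * A)"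
proof -
  have "mtr (A * B) = (\<Sum>i<dim_row A. \<Sum>k<dim_row B. A $$ (i, k) * B $$ (k, i))"
    unfolding mtr_def using assms by (auto simp del: index_mult_mat(1) simp: mult_index_sum)
  also have "\<dots> = (\<Sum>k<dim_row B. \<Sum>i<dim_row A. B $$ (k, i) * A $$ (i, k))"
    by (subst sum.swap) (simp add: mult.commute)
  also have "\<dots> = mtr (B * A)"
    unfolding mtr_def using assms by (auto simp del: index_mult_mat(1) simp: mult_index_sum)
  finally show ?thesis .
qed

lemma mtr_add: "dim_row A = dim_row B \<Longrightarrow> dim_col A = dim_row A \<Longrightarrow> dim_col B = dim_row B \<Longrightarrow> mtr (A + B) = mtr A + mtr B"
  by (auto simp: mtr_def sum.distrib)
lemma mtr_smult: "dim_col A = dim_row A \<Longrightarrow> mtr (a \<cdot>\<^sub>m A) = a * mtr A"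
  by (auto simp: mtr_def sum_distrib_left)

text \<open>Partial traces over the right and the left tensor factor, of dimension \<open>a\<close>.\<close>

definition ptrR :: "nat \<Rightarrow> nat \<Rightarrow> nat \<Rightarrow> 'a::comm_semiring_0 mat \<Rightarrow> 'a mat" where
  "ptrR x y a h = mat x y (\<lambda>(i, j). \<Sum>s<a. h $$ (i * a + s, j * a + s))"
definition ptrL :: "nat \<Rightarrow> nat \<Rightarrow> nat \<Rightarrow> 'a::comm_semiring_0 mat \<Rightarrow> 'a mat" where
  "ptrL x y a h = mat x y (\<lambda>(i, j). \<Sum>s<a. h $$ (s * x + i, s * y + j))"

lemma dim_ptr [simp]: "dim_row (ptrR x y a h) = x" "dim_col (ptrR x y a h) = y"
  "dim_row (ptrL x y a h) = x" "dim_col (ptrL x y a h) = y"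
  by (auto simp: ptrR_def ptrL_def)

lemma sum_pair: "(\<Sum>k<m * n. g k) = (\<Sum>i<m. \<Sum>j<n. g (i * n + (j::nat)))" for g :: "nat \<Rightarrow> 'a::comm_monoid_add"
proof -
  have "(\<Sum>k<m * n. g k) = (\<Sum>k<m * n. (\<lambda>i j. g (i * n + j)) (k div n) (k mod n))"
    by simp
  also note sum_div_mod
  finally show ?thesis .
qed

lemma kronR_mult_index:
  fixes P :: "'a::comm_semiring_1 mat"
  assumes h: "dim_row h = dim_col P * a" and "i < dim_row P" "s < a" "j < dim_col h"
  shows "(kron P (1\<^sub>m a) * h) $$ (i * a + s, j) = (\<Sum>k<dim_col P. P $$ (i, k) * h $$ (k * a + s, j))"
proof -
  have l: "i * a + s < dim_row P * a" using assms by (intro mult_add_less)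
  have "(kron P (1\<^sub>m a) * h) $$ (i * a + s, j) = (\<Sum>k<dim_col P * a. kron P (1\<^sub>m a) $$ (i * a + s, k) * h $$ (k, j))"
    using assms l by (subst mult_index_sum) auto
  also have "\<dots> = (\<Sum>k<dim_col P. \<Sum>t<a. kron P (1\<^sub>m a) $$ (i * a + s, k * a + t) * h $$ (k * a + t, j))"
    by (rule sum_pair)
  also have "\<dots> = (\<Sum>k<dim_col P. \<Sum>t<a. (if s = t then P $$ (i, k) * h $$ (k * a + t, j) else 0))"
    using assms l by (intro sum.cong refl) (auto simp: mult_add_less)
  also have "\<dots> = (\<Sum>k<dim_col P. P $$ (i, k) * h $$ (k * a + s, j))"
    using assms by simp
  finally show ?thesis .
qed

lemma mult_kronR_index:
  fixes P :: "'a::comm_semiring_1 mat"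
  assumes h: "dim_col h = dim_row P * a" and "j < dim_col P" "s < a" "i < dim_row h"
  shows "(h * kron P (1\<^sub>m a)) $$ (i, j * a + s) = (\<Sum>k<dim_row P. h $$ (i, k * a + s) * P $$ (k, j))"
proof -
  have l: "j * a + s < dim_col P * a" using assms by (intro mult_add_less)
  have "(h * kron P (1\<^sub>m a)) $$ (i, j * a + s) = (\<Sum>k<dim_row P * a. h $$ (i, k) * kron P (1\<^sub>m a) $$ (k, j * a + s))"
    using assms l by (subst mult_index_sum) auto
  also have "\<dots> = (\<Sum>k<dim_row P. \<Sum>t<a. h $$ (i, k * a + t) * kron P (1\<^sub>m a) $$ (k * a + t, j * a + s))"
    by (rule sum_pair)
  also have "\<dots> = (\<Sum>k<dim_row P. \<Sum>t<a. (if t = s then h $$ (i, k * a + t) * P $$ (k, j) else 0))"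
    using assms l by (intro sum.cong refl) (auto simp: mult_add_less)
  also have "\<dots> = (\<Sum>k<dim_row P. h $$ (i, k * a + s) * P $$ (k, j))"
    using assms by simp
  finally show ?thesis .
qed

lemma kronL_mult_index:
  fixes P :: "'a::comm_semiring_1 mat"
  assumes h: "dim_row h = a * dim_col P" and "i < dim_row P" "s < a" "j < dim_col h"
  shows "(kron (1\<^sub>m a) P * h) $$ (s * dim_row P + i, j) = (\<Sum>k<dim_col P. P $$ (i, k) * h $$ (s * dim_col P + k, j))"
proof -
  have l: "s * dim_row P + i < a * dim_row P" using assms by (intro mult_add_less)
  have "(kron (1\<^sub>m a) P * h) $$ (s * dim_row P + i, j) = (\<Sum>k<a * dim_col P. kron (1\<^sub>m a) P $$ (s * dim_row P + i, k) * h $$ (k, j))"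
    using assms l by (subst mult_index_sum) auto
  also have "\<dots> = (\<Sum>t<a. \<Sum>k<dim_col P. kron (1\<^sub>m a) P $$ (s * dim_row P + i, t * dim_col P + k) * h $$ (t * dim_col P + k, j))"
    by (rule sum_pair)
  also have "\<dots> = (\<Sum>t<a. (if s = t then \<Sum>k<dim_col P. P $$ (i, k) * h $$ (t * dim_col P + k, j) else 0))"
    using assms l by (intro sum.cong refl) (auto simp: mult_add_less)
  also have "\<dots> = (\<Sum>k<dim_col P. P $$ (i, k) * h $$ (s * dim_col P + k, j))"
    using assms by simp
  finally show ?thesis .
qed

lemma mult_kronL_index:
  fixes P :: "'a::comm_semiring_1 mat"
  assumes h: "dim_col h = a * dim_row P" and "j < dim_col P" "s < a" "i < dim_row h"
  shows "(h * kron (1\<^sub>m a) P) $$ (i, s * dim_col P + j) = (\<Sum>k<dim_row P. h $$ (i, s * dim_row P + k) * P $$ (k, j))"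
proof -
  have l: "s * dim_col P + j < a * dim_col P" using assms by (intro mult_add_less)
  have "(h * kron (1\<^sub>m a) P) $$ (i, s * dim_col P + j) = (\<Sum>k<a * dim_row P. h $$ (i, k) * kron (1\<^sub>m a) P $$ (k, s * dim_col P + j))"
    using assms l by (subst mult_index_sum) auto
  also have "\<dots> = (\<Sum>t<a. \<Sum>k<dim_row P. h $$ (i, t * dim_row P + k) * kron (1\<^sub>m a) P $$ (t * dim_row P + k, s * dim_col P + j))"
    by (rule sum_pair)
  also have "\<dots> = (\<Sum>t<a. (if t = s then \<Sum>k<dim_row P. h $$ (i, t * dim_row P + k) * P $$ (k, j) else 0))"
    using assms l by (intro sum.cong refl) (auto simp: mult_add_less)
  also have "\<dots> = (\<Sum>k<dim_row P. h $$ (i, s * dim_row P + k) * P $$ (k, j))"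
    using assms by simp
  finally show ?thesis .
qed

lemma ptrR_left:
  fixes P :: "'a::comm_semiring_1 mat"
  assumes h: "dim_row h = dim_col P * a" "dim_col h = y * a"
  shows "ptrR (dim_row P) y a (kron P (1\<^sub>m a) * h) = P * ptrR (dim_col P) y a h"
proof (rule eq_matI)
  fix i j assume "i < dim_row (P * ptrR (dim_col P) y a h)" "j < dim_col (P * ptrR (dim_col P) y a h)"
  then have i: "i < dim_row P" and j: "j < y" using h by auto
  have "ptrR (dim_row P) y a (kron P (1\<^sub>m a) * h) $$ (i, j) = (\<Sum>s<a. (kron P (1\<^sub>m a) * h) $$ (i * a + s, j * a + s))"
    using i j h by (simp add: ptrR_def)
  also have "\<dots> = (\<Sum>s<a. \<Sum>k<dim_col P. P $$ (i, k) * h $$ (k * a + s, j * a + s))"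
    using i j h by (intro sum.cong refl kronR_mult_index) (auto simp: mult_add_less)
  also have "\<dots> = (P * ptrR (dim_col P) y a h) $$ (i, j)"
    using i j h by (subst sum.swap) (simp add: mult_index_sum ptrR_def sum_distrib_left del: index_mult_mat(1))
  finally show "ptrR (dim_row P) y a (kron P (1\<^sub>m a) * h) $$ (i, j) = (P * ptrR (dim_col P) y a h) $$ (i, j)" .
qed (use assms in auto)

lemma ptrR_right:
  fixes P :: "'a::comm_semiring_1 mat"
  assumes h: "dim_col h = dim_row P * a" "dim_row h = x * a"
  shows "ptrR x (dim_col P) a (h * kron P (1\<^sub>m a)) = ptrR x (dim_row P) a h * P"
proof (rule eq_matI)
  fix i j assume "i < dim_row (ptrR x (dim_row P) a h * P)" "j < dim_col (ptrR x (dim_row P) a h * P)"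
  then have i: "i < x" and j: "j < dim_col P" using h by auto
  have "ptrR x (dim_col P) a (h * kron P (1\<^sub>m a)) $$ (i, j) = (\<Sum>s<a. (h * kron P (1\<^sub>m a)) $$ (i * a + s, j * a + s))"
    using i j h by (simp add: ptrR_def)
  also have "\<dots> = (\<Sum>s<a. \<Sum>k<dim_row P. h $$ (i * a + s, k * a + s) * P $$ (k, j))"
    using i j h by (intro sum.cong refl mult_kronR_index) (auto simp: mult_add_less)
  also have "\<dots> = (ptrR x (dim_row P) a h * P) $$ (i, j)"
    using i j h by (subst sum.swap) (simp add: mult_index_sum ptrR_def sum_distrib_right del: index_mult_mat(1))
  finally show "ptrR x (dim_col P) a (h * kron P (1\<^sub>m a)) $$ (i, j) = (ptrR x (dim_row P) a h * P) $$ (i, j)" .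
qed (use assms in auto)

lemma ptrR_cyclic:
  fixes B :: "'a::comm_semiring_1 mat"
  assumes B: "dim_row B = a" "dim_col B = a" and h: "dim_row h = x * a" "dim_col h = y * a"
  shows "ptrR x y a (kron (1\<^sub>m x) B * h) = ptrR x y a (h * kron (1\<^sub>m y) B)"
proof (rule eq_matI)
  fix i j assume "i < dim_row (ptrR x y a (h * kron (1\<^sub>m y) B))" "j < dim_col (ptrR x y a (h * kron (1\<^sub>m y) B))"
  then have i: "i < x" and j: "j < y" using h B by auto
  have "ptrR x y a (kron (1\<^sub>m x) B * h) $$ (i, j) = (\<Sum>s<a. (kron (1\<^sub>m x) B * h) $$ (i * a + s, j * a + s))"
    using i j h B by (simp add: ptrR_def)
  also have "\<dots> = (\<Sum>s<a. \<Sum>k<a. B $$ (s, k) * h $$ (i * a + k, j * a + s))"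
    using i j h B kronL_mult_index[of h x B] by (intro sum.cong refl) (auto simp: mult_add_less)
  also have "\<dots> = (\<Sum>k<a. \<Sum>s<a. h $$ (i * a + k, j * a + s) * B $$ (s, k))"
    by (subst sum.swap) (simp add: mult.commute)
  also have "\<dots> = (\<Sum>s<a. (h * kron (1\<^sub>m y) B) $$ (i * a + s, j * a + s))"
    using i j h B mult_kronL_index[of h y B] by (intro sum.cong refl) (auto simp: mult_add_less)
  also have "\<dots> = ptrR x y a (h * kron (1\<^sub>m y) B) $$ (i, j)"
    using i j h B by (simp add: ptrR_def)
  finally show "ptrR x y a (kron (1\<^sub>m x) B * h) $$ (i, j) = ptrR x y a (h * kron (1\<^sub>m y) B) $$ (i, j)" .
qed (use assms in auto)

lemma mtr_ptrR: "dim_row h = x * a \<Longrightarrow> dim_col h = x * a \<Longrightarrow> mtr (ptrR x x a h) = mtr h"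
  by (simp add: mtr_def ptrR_def sum_pair)

lemma ptrL_left:
  fixes P :: "'a::comm_semiring_1 mat"
  assumes h: "dim_row h = a * dim_col P" "dim_col h = a * y"
  shows "ptrL (dim_row P) y a (kron (1\<^sub>m a) P * h) = P * ptrL (dim_col P) y a h"
proof (rule eq_matI)
  fix i j assume "i < dim_row (P * ptrL (dim_col P) y a h)" "j < dim_col (P * ptrL (dim_col P) y a h)"
  then have i: "i < dim_row P" and j: "j < y" using h by auto
  have "ptrL (dim_row P) y a (kron (1\<^sub>m a) P * h) $$ (i, j) = (\<Sum>s<a. (kron (1\<^sub>m a) P * h) $$ (s * dim_row P + i, s * y + j))"
    using i j h by (simp add: ptrL_def)
  also have "\<dots> = (\<Sum>s<a. \<Sum>k<dim_col P. P $$ (i, k) * h $$ (s * dim_col P + k, s * y + j))"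
    using i j h by (intro sum.cong refl kronL_mult_index) (auto simp: mult_add_less)
  also have "\<dots> = (P * ptrL (dim_col P) y a h) $$ (i, j)"
    using i j h by (subst sum.swap) (simp add: mult_index_sum ptrL_def sum_distrib_left del: index_mult_mat(1))
  finally show "ptrL (dim_row P) y a (kron (1\<^sub>m a) P * h) $$ (i, j) = (P * ptrL (dim_col P) y a h) $$ (i, j)" .
qed (use assms in auto)

lemma ptrL_right:
  fixes P :: "'a::comm_semiring_1 mat"
  assumes h: "dim_col h = a * dim_row P" "dim_row h = a * x"
  shows "ptrL x (dim_col P) a (h * kron (1\<^sub>m a) P) = ptrL x (dim_row P) a h * P"
proof (rule eq_matI)
  fix i j assume "i < dim_row (ptrL x (dim_row P) a h * P)" "j < dim_col (ptrL x (dim_row P) a h * P)"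
  then have i: "i < x" and j: "j < dim_col P" using h by auto
  have "ptrL x (dim_col P) a (h * kron (1\<^sub>m a) P) $$ (i, j) = (\<Sum>s<a. (h * kron (1\<^sub>m a) P) $$ (s * x + i, s * dim_col P + j))"
    using i j h by (simp add: ptrL_def)
  also have "\<dots> = (\<Sum>s<a. \<Sum>k<dim_row P. h $$ (s * x + i, s * dim_row P + k) * P $$ (k, j))"
    using i j h by (intro sum.cong refl mult_kronL_index) (auto simp: mult_add_less)
  also have "\<dots> = (ptrL x (dim_row P) a h * P) $$ (i, j)"
    using i j h by (subst sum.swap) (simp add: mult_index_sum ptrL_def sum_distrib_right del: index_mult_mat(1))
  finally show "ptrL x (dim_col P) a (h * kron (1\<^sub>m a) P) $$ (i, j) = (ptrL x (dim_row P) a h * P) $$ (i, j)" .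
qed (use assms in auto)

lemma ptrL_cyclic:
  fixes B :: "'a::comm_semiring_1 mat"
  assumes B: "dim_row B = a" "dim_col B = a" and h: "dim_row h = a * x" "dim_col h = a * y"
  shows "ptrL x y a (kron B (1\<^sub>m x) * h) = ptrL x y a (h * kron B (1\<^sub>m y))"
proof (rule eq_matI)
  fix i j assume "i < dim_row (ptrL x y a (h * kron B (1\<^sub>m y)))" "j < dim_col (ptrL x y a (h * kron B (1\<^sub>m y)))"
  then have i: "i < x" and j: "j < y" using h B by auto
  have "ptrL x y a (kron B (1\<^sub>m x) * h) $$ (i, j) = (\<Sum>s<a. (kron B (1\<^sub>m x) * h) $$ (s * x + i, s * y + j))"
    using i j h B by (simp add: ptrL_def)
  also have "\<dots> = (\<Sum>s<a. \<Sum>k<a. B $$ (s, k) * h $$ (k * x + i, s * y + j))"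
    using i j h B kronR_mult_index[of h B x] by (intro sum.cong refl) (auto simp: mult_add_less)
  also have "\<dots> = (\<Sum>k<a. \<Sum>s<a. h $$ (k * x + i, s * y + j) * B $$ (s, k))"
    by (subst sum.swap) (simp add: mult.commute)
  also have "\<dots> = (\<Sum>s<a. (h * kron B (1\<^sub>m y)) $$ (s * x + i, s * y + j))"
    using i j h B mult_kronR_index[of h B y] by (intro sum.cong refl) (auto simp: mult_add_less)
  also have "\<dots> = ptrL x y a (h * kron B (1\<^sub>m y)) $$ (i, j)"
    using i j h B by (simp add: ptrL_def)
  finally show "ptrL x y a (kron B (1\<^sub>m x) * h) $$ (i, j) = ptrL x y a (h * kron B (1\<^sub>m y)) $$ (i, j)" .
qed (use assms in auto)

lemma mtr_ptrL: "dim_row h = a * x \<Longrightarrow> dim_col h = a * x \<Longrightarrow> mtr (ptrL x x a h) = mtr h"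
  by (simp add: mtr_def ptrL_def sum_pair sum.swap[of _ "{..<a}"])

section \<open>Intertwiners\<close>

text \<open>The relations of \<open>K\<close> with \<open>E\<close> and \<open>F\<close>, freed of conjugation so that they multiply out under \<open>kron\<close>.\<close>

definition wrep :: "'k::field \<Rightarrow> 'k uq_rep \<Rightarrow> bool" where
  "wrep v M \<longleftrightarrow>
     rep_E M \<in> carrier_mat (rep_dim M) (rep_dim M) \<and> rep_F M \<in> carrier_mat (rep_dim M) (rep_dim M) \<and>
     rep_K M \<in> carrier_mat (rep_dim M) (rep_dim M) \<and> rep_Kinv M \<in> carrier_mat (rep_dim M) (rep_dim M) \<and>
     rep_K M * rep_Kinv M = 1\<^sub>m (rep_dim M) \<and> rep_Kinv M * rep_K M = 1\<^sub>m (rep_dim M) \<and>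
     rep_K M * rep_E M = v\<^sup>2 \<cdot>\<^sub>m (rep_E M * rep_K M) \<and>
     rep_K M * rep_F M = inverse (v\<^sup>2) \<cdot>\<^sub>m (rep_F M * rep_K M)"

lemma wrep_dims [simp]:
  assumes "wrep v M"
  shows "dim_row (rep_E M) = rep_dim M" "dim_col (rep_E M) = rep_dim M"
    "dim_row (rep_F M) = rep_dim M" "dim_col (rep_F M) = rep_dim M"
    "dim_row (rep_K M) = rep_dim M" "dim_col (rep_K M) = rep_dim M"
    "dim_row (rep_Kinv M) = rep_dim M" "dim_col (rep_Kinv M) = rep_dim M"
  using assms by (auto simp: wrep_def)

lemma wrep_inv: "wrep v M \<Longrightarrow> rep_K M * rep_Kinv M = 1\<^sub>m (rep_dim M)"
  "wrep v M \<Longrightarrow> rep_Kinv M * rep_K M = 1\<^sub>m (rep_dim M)"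
  by (auto simp: wrep_def)

lemma wrep_inv_mult:
  "wrep v M \<Longrightarrow> dim_row A = rep_dim M \<Longrightarrow> rep_K M * (rep_Kinv M * A) = A"
  "wrep v M \<Longrightarrow> dim_row A = rep_dim M \<Longrightarrow> rep_Kinv M * (rep_K M * A) = A"
  by (simp_all add: mult_assoc_dim[symmetric] wrep_inv one_mult_dim)

lemma is_uq_rep_wrep:
  assumes "is_uq_rep v M"
  shows "wrep v M"
proof -
  note * = assms[unfolded is_uq_rep_def Let_def]
  have d: "dim_row (rep_E M) = rep_dim M" "dim_col (rep_E M) = rep_dim M"
    "dim_row (rep_F M) = rep_dim M" "dim_col (rep_F M) = rep_dim M"
    "dim_row (rep_K M) = rep_dim M" "dim_col (rep_K M) = rep_dim M"
    "dim_row (rep_Kinv M) = rep_dim M" "dim_col (rep_Kinv M) = rep_dim M"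
    using * by auto
  have "rep_K M * A = c \<cdot>\<^sub>m (A * rep_K M)" if "rep_K M * A * rep_Kinv M = c \<cdot>\<^sub>m A"
    "dim_row A = rep_dim M" "dim_col A = rep_dim M" for A c
  proof -
    have "rep_K M * A = (rep_K M * A * rep_Kinv M) * rep_K M"
      using that(2,3) d * by (simp add: mult_assoc_dim mult_one_dim)
    also have "\<dots> = c \<cdot>\<^sub>m (A * rep_K M)"
      unfolding that(1) using that(2,3) d by (simp add: smult_mult_dim)
    finally show ?thesis .
  qed
  then show ?thesis using * d unfolding wrep_def by auto
qed

lemma rep_tensor_simps [simp]:
  "rep_dim (uq_tensor M N) = rep_dim M * rep_dim N"
  "rep_K (uq_tensor M N) = kron (rep_K M) (rep_K N)"
  "rep_Kinv (uq_tensor M N) = kron (rep_Kinv M) (rep_Kinv N)"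
  "rep_E (uq_tensor M N) = kron (rep_E M) (rep_K N) + kron (1\<^sub>m (rep_dim M)) (rep_E N)"
  "rep_F (uq_tensor M N) = kron (rep_F M) (1\<^sub>m (rep_dim N)) + kron (rep_Kinv M) (rep_F N)"
  by (auto simp: uq_tensor_def)

lemma rep_trivial_simps [simp]:
  "rep_dim uq_trivial = 1" "rep_K uq_trivial = 1\<^sub>m 1" "rep_Kinv uq_trivial = 1\<^sub>m 1"
  "rep_E uq_trivial = 0\<^sub>m 1 1" "rep_F uq_trivial = 0\<^sub>m 1 1"
  by (auto simp: uq_trivial_def)

lemma wrep_trivial [simp]: "wrep v uq_trivial"
  by (auto simp: wrep_def)

lemma wrep_tensor [simp]:
  assumes M: "wrep v M" and N: "wrep v N" and v: "v \<noteq> 0"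
  shows "wrep v (uq_tensor M N)"
proof -
  note MD = M[unfolded wrep_def] and ND = N[unfolded wrep_def]
  have KE: "rep_K M * rep_E M = v\<^sup>2 \<cdot>\<^sub>m (rep_E M * rep_K M)" "rep_K N * rep_E N = v\<^sup>2 \<cdot>\<^sub>m (rep_E N * rep_K N)"
    and KF: "rep_K M * rep_F M = inverse (v\<^sup>2) \<cdot>\<^sub>m (rep_F M * rep_K M)" "rep_K N * rep_F N = inverse (v\<^sup>2) \<cdot>\<^sub>m (rep_F N * rep_K N)"
    using MD ND by auto
  have sadd: "c \<cdot>\<^sub>m A + c \<cdot>\<^sub>m B = c \<cdot>\<^sub>m (A + B)" if "dim_row A = dim_row B" "dim_col A = dim_col B" for c and A B :: "'a mat"
    using that by (intro eq_matI) (auto simp: algebra_simps)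
  have "kron (rep_K M) (rep_K N) * rep_E (uq_tensor M N) = v\<^sup>2 \<cdot>\<^sub>m (rep_E (uq_tensor M N) * kron (rep_K M) (rep_K N))"
    using M N by (simp add: mult_add_dim add_mult_dim kron_mult KE kron_smult_left kron_smult_right one_mult_dim mult_one_dim sadd)
  moreover have "kron (rep_K M) (rep_K N) * rep_F (uq_tensor M N) = inverse (v\<^sup>2) \<cdot>\<^sub>m (rep_F (uq_tensor M N) * kron (rep_K M) (rep_K N))"
    using M N by (simp add: mult_add_dim add_mult_dim kron_mult KF kron_smult_left kron_smult_right one_mult_dim mult_one_dim sadd wrep_inv)
  ultimately show ?thesis
    using M N unfolding wrep_def[of v "uq_tensor M N"]
    by (auto simp: kron_mult wrep_inv kron_one_one intro!: carrier_matI)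
qed

lemma uq_tensor_assoc:
  assumes "wrep v L" "wrep v M" "wrep v N"
  shows "uq_tensor (uq_tensor L M) N = uq_tensor L (uq_tensor M N)"
proof -
  have ass: "A + B + C = A + (B + C)" if "dim_row A = dim_row C" "dim_row B = dim_row C" "dim_col A = dim_col C" "dim_col B = dim_col C"
    for A B C :: "'a mat"
    using that by (intro assoc_add_mat[of _ "dim_row A" "dim_col A"]) auto
  show ?thesis
    using assms unfolding uq_tensor_def
    by (simp add: kron_add_left kron_add_right kron_assoc kron_one_one[symmetric] ass mult.assoc)
qed

lemma uq_tensor_unit:
  assumes "wrep v M"
  shows "uq_tensor uq_trivial M = M" "uq_tensor M uq_trivial = M"
proof -
  have z: "0\<^sub>m a b + A = A" "A + 0\<^sub>m a b = A" if "dim_row A = a" "dim_col A = b" for A :: "'a mat" and a b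
    using that by auto
  show "uq_tensor uq_trivial M = M" "uq_tensor M uq_trivial = M"
    using assms unfolding uq_tensor_def uq_trivial_def by (auto simp: z)
qed

lemma uq_tensor_unit_unit [simp]: "uq_tensor uq_trivial uq_trivial = uq_trivial"
  by (rule uq_tensor_unit[OF wrep_trivial])

lemma uq_homD:
  assumes "f \<in> uq_hom M N"
  shows "dim_row f = rep_dim N" "dim_col f = rep_dim M" "f \<in> carrier_mat (rep_dim N) (rep_dim M)"
    "f * rep_E M = rep_E N * f" "f * rep_F M = rep_F N * f" "f * rep_K M = rep_K N * f"
  using assms by (auto simp: uq_hom_def)

lemma uq_homI:
  assumes "dim_row f = rep_dim N" "dim_col f = rep_dim M"
    "f * rep_E M = rep_E N * f" "f * rep_F M = rep_F N * f" "f * rep_K M = rep_K N * f"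
  shows "f \<in> uq_hom M N"
  using assms by (auto simp: uq_hom_def)

lemma uq_hom_Kinv:
  assumes "wrep v M" "wrep v N" "f \<in> uq_hom M N"
  shows "f * rep_Kinv M = rep_Kinv N * f"
proof -
  note d = uq_homD[OF assms(3)]
  have "f * rep_Kinv M = rep_Kinv N * (rep_K N * f) * rep_Kinv M"
    using assms d by (simp add: wrep_inv_mult)
  also have "\<dots> = rep_Kinv N * (f * rep_K M) * rep_Kinv M" using d by simp
  also have "\<dots> = rep_Kinv N * f"
    using assms d(1,2) by (simp add: mult_assoc_dim wrep_inv mult_one_dim)
  finally show ?thesis .
qed

lemma hom_id [simp]: "wrep v M \<Longrightarrow> 1\<^sub>m (rep_dim M) \<in> uq_hom M M"
  by (auto intro!: uq_homI simp: one_mult_dim mult_one_dim)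

lemma hom_comp:
  assumes "wrep v M" "wrep v N" "wrep v L" "f \<in> uq_hom M N" "g \<in> uq_hom N L"
  shows "g * f \<in> uq_hom M L"
proof -
  note d = uq_homD[OF assms(4)] uq_homD[OF assms(5)]
  have 1: "(g * f) * A = C * (g * f)" if "f * A = B * f" "g * B = C * g"
    "dim_row A = rep_dim M" "dim_col B = rep_dim N" "dim_row B = rep_dim N" "dim_col C = rep_dim L" for A B C
  proof -
    have "(g * f) * A = g * (B * f)" using that d(1,2,7,8) by (simp add: mult_assoc_dim)
    also have "\<dots> = (g * B) * f" using that(3-) d(1,2,7,8) by (simp add: mult_assoc_dim)
    also have "\<dots> = C * (g * f)" using that d(1,2,7,8) by (simp add: mult_assoc_dim)
    finally show ?thesis .
  qed
  show ?thesis
    by (rule uq_homI) (use assms d in \<open>auto intro!: 1\<close>)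
qed

lemma hom_add:
  assumes "wrep v M" "wrep v N" "f \<in> uq_hom M N" "g \<in> uq_hom M N"
  shows "f + g \<in> uq_hom M N"
  using assms by (auto intro!: uq_homI simp: uq_homD[OF assms(3)] uq_homD[OF assms(4)] add_mult_dim mult_add_dim)

lemma hom_smult:
  assumes "wrep v M" "wrep v N" "f \<in> uq_hom M N"
  shows "a \<cdot>\<^sub>m f \<in> uq_hom M N"
  using assms by (auto intro!: uq_homI simp: uq_homD[OF assms(3)] smult_mult_dim mult_smult_dim)

lemma hom_zero:
  assumes "wrep v M" "wrep v N"
  shows "0\<^sub>m (rep_dim N) (rep_dim M) \<in> uq_hom M N"
  using assms unfolding wrep_def by (auto intro!: uq_homI)

lemma hom_kron:
  assumes "wrep v M" "wrep v M'" "wrep v N" "wrep v N'" "f \<in> uq_hom M M'" "g \<in> uq_hom N N'"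
  shows "kron f g \<in> uq_hom (uq_tensor M N) (uq_tensor M' N')"
proof -
  note d = uq_homD[OF assms(5)] uq_homD[OF assms(6)] uq_hom_Kinv[OF assms(1,2,5)]
  show ?thesis
    by (rule uq_homI) (use assms d in \<open>auto simp: mult_add_dim add_mult_dim kron_mult one_mult_dim mult_one_dim\<close>)
qed

subsection \<open>Partial traces of intertwiners\<close>

lemma ptrR_add:
  assumes "dim_row h = x * a" "dim_col h = y * a" "dim_row h' = x * a" "dim_col h' = y * a"
  shows "ptrR x y a (h + h') = ptrR x y a h + ptrR x y a h'"
  using assms by (intro eq_matI) (auto simp: ptrR_def mult_add_less sum.distrib)
lemma ptrL_add:
  assumes "dim_row h = a * x" "dim_col h = a * y" "dim_row h' = a * x" "dim_col h' = a * y"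
  shows "ptrL x y a (h + h') = ptrL x y a h + ptrL x y a h'"
  using assms by (intro eq_matI) (auto simp: ptrL_def mult_add_less sum.distrib)

lemma mat_add_cancel:
  assumes "A + B = C + (D :: 'a::ab_group_add mat)" "B = D" "dim_row A = dim_row B" "dim_col A = dim_col B" "dim_row C = dim_row D" "dim_col C = dim_col D"
  shows "A = C"
proof (rule eq_matI)
  fix i j assume "i < dim_row C" "j < dim_col C"
  moreover have "(A + B) $$ (i, j) = (C + D) $$ (i, j)" using assms(1) by simp
  ultimately show "A $$ (i, j) = C $$ (i, j)" using assms by simp
qed (use assms in auto)

lemma mat_add_cancel_left:
  assumes "B + A = D + (C :: 'a::ab_group_add mat)" "B = D" "dim_row A = dim_row B" "dim_col A = dim_col B" "dim_row C = dim_row D" "dim_col C = dim_col D"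
  shows "A = C"
proof (rule eq_matI)
  fix i j assume "i < dim_row C" "j < dim_col C"
  moreover have "(B + A) $$ (i, j) = (D + C) $$ (i, j)" using assms(1) by simp
  ultimately show "A $$ (i, j) = C $$ (i, j)" using assms by simp
qed (use assms in auto)

lemma kron_mult_assoc:
  assumes "dim_col A = dim_row C" "dim_col B = dim_row D" "dim_row h = dim_col C * dim_col D"
  shows "kron A B * (kron C D * h) = kron (A * C) (B * D) * (h :: 'a::comm_semiring_0 mat)"
  using assms by (simp add: mult_assoc_dim[symmetric] kron_mult)

text \<open>A partial quantum trace is the composite of \<open>g\<close> with an evaluation and a coevaluation of \<open>A\<close>, hence an
  intertwiner; with matrices this has to be checked on generators.  On the right the pivotal element
  \<open>K\<close> is inserted, on the left its inverse.\<close>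

lemma ptrR_hom:
  fixes X Y A :: "'a::field uq_rep"
  assumes X: "wrep v X" and Y: "wrep v Y" and A: "wrep v A" and g: "g \<in> uq_hom (uq_tensor Y A) (uq_tensor X A)"
  shows "ptrR (rep_dim X) (rep_dim Y) (rep_dim A) (kron (1\<^sub>m (rep_dim X)) (rep_K A) * g) \<in> uq_hom Y X"
proof -
  define x y a where xya: "x = rep_dim X" "y = rep_dim Y" "a = rep_dim A"
  define \<Phi> :: "'a mat \<Rightarrow> 'a mat" where "\<Phi> = ptrR x y a"
  note gd = uq_homD(1,2)[OF g, simplified, folded xya]
  note dims = wrep_dims[OF X, folded xya] wrep_dims[OF Y, folded xya] wrep_dims[OF A, folded xya] gd
  let ?k = "kron (1\<^sub>m x) (rep_K A)"
  have lft: "\<Phi> (kron P (1\<^sub>m a) * h) = P * \<Phi> h" if "dim_row P = x" "dim_col P = x" "dim_row h = x * a" "dim_col h = y * a" for P h :: "'a mat"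
    using ptrR_left[of h P a y] that by (simp add: \<Phi>_def)
  have rgt: "\<Phi> (h * kron P (1\<^sub>m a)) = \<Phi> h * P" if "dim_row P = y" "dim_col P = y" "dim_row h = x * a" "dim_col h = y * a" for P h :: "'a mat"
    using ptrR_right[of h P a x] that by (simp add: \<Phi>_def)
  have cyc: "\<Phi> (kron (1\<^sub>m x) B * h) = \<Phi> (h * kron (1\<^sub>m y) B)" if "dim_row B = a" "dim_col B = a" "dim_row h = x * a" "dim_col h = y * a" for B h :: "'a mat"
    using ptrR_cyclic[of B a h x y] that by (simp add: \<Phi>_def)
  have add: "\<Phi> (h + h') = \<Phi> h + \<Phi> h'" if "dim_row h = x * a" "dim_col h = y * a" "dim_row h' = x * a" "dim_col h' = y * a" for h h' :: "'a mat"
    using ptrR_add that by (simp add: \<Phi>_def)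
  have dm [simp]: "dim_row (\<Phi> h) = x" "dim_col (\<Phi> h) = y" for h :: "'a mat" by (auto simp: \<Phi>_def)
  note K = uq_homD(6)[OF g, simplified] and K' = uq_hom_Kinv[OF wrep_tensor wrep_tensor g, of v]
  have "\<Phi> (?k * g) * rep_E Y = rep_E X * \<Phi> (?k * g)"
  proof -
    have "g * kron (rep_E Y) (rep_K A) + g * kron (1\<^sub>m y) (rep_E A) = kron (rep_E X) (rep_K A) * g + kron (1\<^sub>m x) (rep_E A) * g"
      using uq_homD(4)[OF g] by (simp add: mult_add_dim add_mult_dim dims flip: xya)
    then have "\<Phi> (g * kron (rep_E Y) (rep_K A)) + \<Phi> (g * kron (1\<^sub>m y) (rep_E A)) = \<Phi> (kron (rep_E X) (rep_K A) * g) + \<Phi> (kron (1\<^sub>m x) (rep_E A) * g)"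
      by (simp add: add[symmetric] dims)
    then have 1: "\<Phi> (g * kron (rep_E Y) (rep_K A)) = \<Phi> (kron (rep_E X) (rep_K A) * g)"
      by (rule mat_add_cancel) (simp_all add: cyc dims)
    have "\<Phi> (?k * g) * rep_E Y = \<Phi> (g * kron (1\<^sub>m y) (rep_K A)) * rep_E Y" by (simp add: cyc dims)
    also have "\<dots> = \<Phi> (g * kron (1\<^sub>m y) (rep_K A) * kron (rep_E Y) (1\<^sub>m a))" by (simp add: rgt dims)
    also have "\<dots> = \<Phi> (g * kron (rep_E Y) (rep_K A))" by (simp add: mult_assoc_dim kron_mult one_mult_dim mult_one_dim dims)
    also note 1
    also have "kron (rep_E X) (rep_K A) * g = kron (rep_E X) (1\<^sub>m a) * (?k * g)" by (simp add: kron_mult_assoc one_mult_dim mult_one_dim dims)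
    also have "\<Phi> \<dots> = rep_E X * \<Phi> (?k * g)" by (simp add: lft dims)
    finally show ?thesis .
  qed
  moreover have "\<Phi> (?k * g) * rep_K Y = rep_K X * \<Phi> (?k * g)"
  proof -
    have "\<Phi> (?k * g) * rep_K Y = \<Phi> (g * kron (1\<^sub>m y) (rep_K A)) * rep_K Y" by (simp add: cyc dims)
    also have "\<dots> = \<Phi> (g * kron (1\<^sub>m y) (rep_K A) * kron (rep_K Y) (1\<^sub>m a))" by (simp add: rgt dims)
    also have "\<dots> = \<Phi> (g * kron (rep_K Y) (rep_K A))" by (simp add: mult_assoc_dim kron_mult one_mult_dim mult_one_dim dims)
    also note K
    also have "kron (rep_K X) (rep_K A) * g = kron (rep_K X) (1\<^sub>m a) * (?k * g)" by (simp add: kron_mult_assoc one_mult_dim mult_one_dim dims)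
    also have "\<Phi> \<dots> = rep_K X * \<Phi> (?k * g)" by (simp add: lft dims)
    finally show ?thesis .
  qed
  moreover have "\<Phi> (?k * g) * rep_F Y = rep_F X * \<Phi> (?k * g)"
  proof -
    have K': "g * kron (rep_Kinv Y) (rep_Kinv A) = kron (rep_Kinv X) (rep_Kinv A) * g"
    proof -
      have "g * kron (rep_Kinv Y) (rep_Kinv A) = kron (rep_Kinv X) (rep_Kinv A) * (kron (rep_K X) (rep_K A) * g) * kron (rep_Kinv Y) (rep_Kinv A)"
        using X A by (simp add: kron_mult_assoc wrep_inv kron_one_one one_mult_dim dims flip: xya)
      also have "\<dots> = kron (rep_Kinv X) (rep_Kinv A) * (g * kron (rep_K Y) (rep_K A)) * kron (rep_Kinv Y) (rep_Kinv A)" by (simp add: K)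
      also have "\<dots> = kron (rep_Kinv X) (rep_Kinv A) * g"
        using Y A by (simp add: mult_assoc_dim kron_mult wrep_inv kron_one_one mult_one_dim dims flip: xya)
      finally show ?thesis .
    qed
    have "g * kron (rep_F Y) (1\<^sub>m a) + g * kron (rep_Kinv Y) (rep_F A) = kron (rep_F X) (1\<^sub>m a) * g + kron (rep_Kinv X) (rep_F A) * g"
      using uq_homD(5)[OF g] by (simp add: mult_add_dim add_mult_dim dims flip: xya)
    then have "?k * (g * kron (rep_F Y) (1\<^sub>m a) + g * kron (rep_Kinv Y) (rep_F A)) = ?k * (kron (rep_F X) (1\<^sub>m a) * g + kron (rep_Kinv X) (rep_F A) * g)"
      by simp
    then have "?k * (g * kron (rep_F Y) (1\<^sub>m a)) + ?k * (g * kron (rep_Kinv Y) (rep_F A)) = ?k * (kron (rep_F X) (1\<^sub>m a) * g) + ?k * (kron (rep_Kinv X) (rep_F A) * g)"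
      by (simp add: mult_add_dim dims)
    then have "\<Phi> (?k * (g * kron (rep_F Y) (1\<^sub>m a))) + \<Phi> (?k * (g * kron (rep_Kinv Y) (rep_F A))) = \<Phi> (?k * (kron (rep_F X) (1\<^sub>m a) * g)) + \<Phi> (?k * (kron (rep_Kinv X) (rep_F A) * g))"
      by (simp add: add[symmetric] dims)
    then have 1: "\<Phi> (?k * (g * kron (rep_F Y) (1\<^sub>m a))) = \<Phi> (?k * (kron (rep_F X) (1\<^sub>m a) * g))"
    proof (rule mat_add_cancel)
      have "?k * (g * kron (rep_Kinv Y) (rep_F A)) = (?k * g * kron (rep_Kinv Y) (1\<^sub>m a)) * kron (1\<^sub>m y) (rep_F A)"
        by (simp add: mult_assoc_dim kron_mult one_mult_dim mult_one_dim dims)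
      then have "\<Phi> (?k * (g * kron (rep_Kinv Y) (rep_F A))) = \<Phi> (kron (1\<^sub>m x) (rep_F A) * (?k * g * kron (rep_Kinv Y) (1\<^sub>m a)))"
        by (simp add: cyc dims)
      also have "kron (1\<^sub>m x) (rep_F A) * (?k * g * kron (rep_Kinv Y) (1\<^sub>m a)) = (kron (1\<^sub>m x) (rep_F A * rep_K A) * g) * kron (rep_Kinv Y) (1\<^sub>m a)"
        by (simp add: mult_assoc_dim kron_mult_assoc one_mult_dim mult_one_dim dims)
      also have "\<Phi> \<dots> = \<Phi> (kron (1\<^sub>m x) (rep_F A * rep_K A) * g) * rep_Kinv Y" by (simp add: rgt dims)
      also have "kron (1\<^sub>m x) (rep_F A * rep_K A) * g = kron (1\<^sub>m x) (rep_Kinv A) * (kron (1\<^sub>m x) (rep_K A * (rep_F A * rep_K A)) * g)"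
        using A by (simp add: kron_mult_assoc wrep_inv_mult one_mult_dim dims flip: xya)
      also have "\<Phi> \<dots> = \<Phi> (kron (1\<^sub>m x) (rep_K A * (rep_F A * rep_K A)) * g * kron (1\<^sub>m y) (rep_Kinv A))" by (simp add: cyc dims)
      also have "\<dots> * rep_Kinv Y = \<Phi> (kron (1\<^sub>m x) (rep_K A * (rep_F A * rep_K A)) * g * kron (1\<^sub>m y) (rep_Kinv A) * kron (rep_Kinv Y) (1\<^sub>m a))"
        by (simp add: rgt dims)
      also have "kron (1\<^sub>m x) (rep_K A * (rep_F A * rep_K A)) * g * kron (1\<^sub>m y) (rep_Kinv A) * kron (rep_Kinv Y) (1\<^sub>m a)
         = kron (1\<^sub>m x) (rep_K A * (rep_F A * rep_K A)) * (g * kron (rep_Kinv Y) (rep_Kinv A))"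
        by (simp add: mult_assoc_dim kron_mult one_mult_dim mult_one_dim dims)
      also have "\<dots> = ?k * (kron (rep_Kinv X) (rep_F A) * g)"
        using A by (simp add: K' kron_mult_assoc mult_assoc_dim wrep_inv mult_one_dim one_mult_dim dims flip: xya)
      finally show "\<Phi> (?k * (g * kron (rep_Kinv Y) (rep_F A))) = \<Phi> (?k * (kron (rep_Kinv X) (rep_F A) * g))" .
    qed simp_all
    have "\<Phi> (?k * g) * rep_F Y = \<Phi> (?k * g * kron (rep_F Y) (1\<^sub>m a))" by (simp add: rgt dims)
    also have "?k * g * kron (rep_F Y) (1\<^sub>m a) = ?k * (g * kron (rep_F Y) (1\<^sub>m a))" by (simp add: mult_assoc_dim dims)
    also note 1
    also have "?k * (kron (rep_F X) (1\<^sub>m a) * g) = kron (rep_F X) (1\<^sub>m a) * (?k * g)" by (simp add: kron_mult_assoc one_mult_dim mult_one_dim dims)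
    also have "\<Phi> \<dots> = rep_F X * \<Phi> (?k * g)" by (simp add: lft dims)
    finally show ?thesis .
  qed
  ultimately show ?thesis by (intro uq_homI) (simp_all add: \<Phi>_def xya)
qed

lemma ptrL_hom:
  fixes X Y A :: "'a::field uq_rep"
  assumes X: "wrep v X" and Y: "wrep v Y" and A: "wrep v A" and g: "g \<in> uq_hom (uq_tensor A Y) (uq_tensor A X)"
  shows "ptrL (rep_dim X) (rep_dim Y) (rep_dim A) (kron (rep_Kinv A) (1\<^sub>m (rep_dim X)) * g) \<in> uq_hom Y X"
proof -
  define x y a where xya: "x = rep_dim X" "y = rep_dim Y" "a = rep_dim A"
  define \<Phi> :: "'a mat \<Rightarrow> 'a mat" where "\<Phi> = ptrL x y a"
  note gd = uq_homD(1,2)[OF g, simplified, folded xya]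
  note dims = wrep_dims[OF X, folded xya] wrep_dims[OF Y, folded xya] wrep_dims[OF A, folded xya] gd
  let ?k = "kron (rep_Kinv A) (1\<^sub>m x)"
  have lft: "\<Phi> (kron (1\<^sub>m a) P * h) = P * \<Phi> h" if "dim_row P = x" "dim_col P = x" "dim_row h = a * x" "dim_col h = a * y" for P h :: "'a mat"
    using ptrL_left[of h a P y] that by (simp add: \<Phi>_def)
  have rgt: "\<Phi> (h * kron (1\<^sub>m a) P) = \<Phi> h * P" if "dim_row P = y" "dim_col P = y" "dim_row h = a * x" "dim_col h = a * y" for P h :: "'a mat"
    using ptrL_right[of h a P x] that by (simp add: \<Phi>_def)
  have cyc: "\<Phi> (kron B (1\<^sub>m x) * h) = \<Phi> (h * kron B (1\<^sub>m y))" if "dim_row B = a" "dim_col B = a" "dim_row h = a * x" "dim_col h = a * y" for B h :: "'a mat"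
    using ptrL_cyclic[of B a h x y] that by (simp add: \<Phi>_def)
  have add: "\<Phi> (h + h') = \<Phi> h + \<Phi> h'" if "dim_row h = a * x" "dim_col h = a * y" "dim_row h' = a * x" "dim_col h' = a * y" for h h' :: "'a mat"
    using ptrL_add that by (simp add: \<Phi>_def)
  have dm [simp]: "dim_row (\<Phi> h) = x" "dim_col (\<Phi> h) = y" for h :: "'a mat" by (auto simp: \<Phi>_def)
  note K = uq_homD(6)[OF g, simplified]
  have KY: "\<Phi> (kron B (rep_K X) * g) = \<Phi> (kron (rep_K A * (B * rep_Kinv A)) (1\<^sub>m x) * g) * rep_K Y" if B: "dim_row B = a" "dim_col B = a" for B :: "'a mat"
  proof -
    have "kron B (rep_K X) * g = kron (B * rep_Kinv A) (1\<^sub>m x) * (kron (rep_K A) (rep_K X) * g)"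
      using A B by (simp add: kron_mult_assoc mult_assoc_dim wrep_inv mult_one_dim one_mult_dim dims flip: xya)
    also have "\<dots> = kron (B * rep_Kinv A) (1\<^sub>m x) * (g * kron (rep_K A) (rep_K Y))" using K by simp
    also have "\<dots> = (kron (B * rep_Kinv A) (1\<^sub>m x) * g * kron (1\<^sub>m a) (rep_K Y)) * kron (rep_K A) (1\<^sub>m y)"
      by (simp add: mult_assoc_dim kron_mult one_mult_dim mult_one_dim dims B)
    also have "\<Phi> \<dots> = \<Phi> (kron (rep_K A) (1\<^sub>m x) * (kron (B * rep_Kinv A) (1\<^sub>m x) * g * kron (1\<^sub>m a) (rep_K Y)))"
      by (simp add: cyc dims B)
    also have "kron (rep_K A) (1\<^sub>m x) * (kron (B * rep_Kinv A) (1\<^sub>m x) * g * kron (1\<^sub>m a) (rep_K Y))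
      = (kron (rep_K A * (B * rep_Kinv A)) (1\<^sub>m x) * g) * kron (1\<^sub>m a) (rep_K Y)"
      by (simp add: mult_assoc_dim kron_mult_assoc one_mult_dim mult_one_dim dims B)
    also have "\<Phi> \<dots> = \<Phi> (kron (rep_K A * (B * rep_Kinv A)) (1\<^sub>m x) * g) * rep_K Y" by (simp add: rgt dims B)
    finally show ?thesis .
  qed
  have "\<Phi> (?k * g) * rep_E Y = rep_E X * \<Phi> (?k * g)"
  proof -
    have "g * kron (rep_E A) (rep_K Y) + g * kron (1\<^sub>m a) (rep_E Y) = kron (rep_E A) (rep_K X) * g + kron (1\<^sub>m a) (rep_E X) * g"
      using uq_homD(4)[OF g] by (simp add: mult_add_dim add_mult_dim dims flip: xya)
    then have "?k * (g * kron (rep_E A) (rep_K Y) + g * kron (1\<^sub>m a) (rep_E Y)) = ?k * (kron (rep_E A) (rep_K X) * g + kron (1\<^sub>m a) (rep_E X) * g)"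
      by simp
    then have "\<Phi> (?k * (g * kron (rep_E A) (rep_K Y))) + \<Phi> (?k * (g * kron (1\<^sub>m a) (rep_E Y))) = \<Phi> (?k * (kron (rep_E A) (rep_K X) * g)) + \<Phi> (?k * (kron (1\<^sub>m a) (rep_E X) * g))"
      by (simp add: add[symmetric] dims mult_add_dim)
    then have 1: "\<Phi> (?k * (g * kron (1\<^sub>m a) (rep_E Y))) = \<Phi> (?k * (kron (1\<^sub>m a) (rep_E X) * g))"
    proof (rule mat_add_cancel_left)
      have "?k * (kron (rep_E A) (rep_K X) * g) = kron (rep_Kinv A * rep_E A) (rep_K X) * g"
        by (simp add: kron_mult_assoc one_mult_dim dims)
      then have "\<Phi> (?k * (kron (rep_E A) (rep_K X) * g)) = \<Phi> (kron (rep_K A * ((rep_Kinv A * rep_E A) * rep_Kinv A)) (1\<^sub>m x) * g) * rep_K Y"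
        by (simp add: KY dims)
      also have "rep_K A * ((rep_Kinv A * rep_E A) * rep_Kinv A) = rep_E A * rep_Kinv A"
        using A by (simp add: mult_assoc_dim wrep_inv_mult)
      also have "kron (rep_E A * rep_Kinv A) (1\<^sub>m x) * g = kron (rep_E A) (1\<^sub>m x) * (?k * g)"
        by (simp add: kron_mult_assoc one_mult_dim dims)
      also have "\<Phi> \<dots> = \<Phi> (?k * g * kron (rep_E A) (1\<^sub>m y))" by (simp add: cyc dims)
      also have "\<dots> * rep_K Y = \<Phi> (?k * g * kron (rep_E A) (1\<^sub>m y) * kron (1\<^sub>m a) (rep_K Y))" by (simp add: rgt dims)
      also have "?k * g * kron (rep_E A) (1\<^sub>m y) * kron (1\<^sub>m a) (rep_K Y) = ?k * (g * kron (rep_E A) (rep_K Y))"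
        by (simp add: mult_assoc_dim kron_mult one_mult_dim mult_one_dim dims)
      finally show "\<Phi> (?k * (g * kron (rep_E A) (rep_K Y))) = \<Phi> (?k * (kron (rep_E A) (rep_K X) * g))" by simp
    qed simp_all
    have "\<Phi> (?k * g) * rep_E Y = \<Phi> (?k * g * kron (1\<^sub>m a) (rep_E Y))" by (simp add: rgt dims)
    also have "?k * g * kron (1\<^sub>m a) (rep_E Y) = ?k * (g * kron (1\<^sub>m a) (rep_E Y))" by (simp add: mult_assoc_dim dims)
    also note 1
    also have "?k * (kron (1\<^sub>m a) (rep_E X) * g) = kron (1\<^sub>m a) (rep_E X) * (?k * g)" by (simp add: kron_mult_assoc one_mult_dim mult_one_dim dims)
    also have "\<Phi> \<dots> = rep_E X * \<Phi> (?k * g)" by (simp add: lft dims)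
    finally show ?thesis .
  qed
  moreover have "\<Phi> (?k * g) * rep_K Y = rep_K X * \<Phi> (?k * g)"
  proof -
    have "\<Phi> (kron (rep_Kinv A) (rep_K X) * g) = \<Phi> (?k * g) * rep_K Y"
      using KY[of "rep_Kinv A"] A by (simp add: wrep_inv_mult dims flip: xya)
    also have "kron (rep_Kinv A) (rep_K X) * g = kron (1\<^sub>m a) (rep_K X) * (?k * g)"
      by (simp add: kron_mult_assoc one_mult_dim mult_one_dim dims)
    also have "\<Phi> \<dots> = rep_K X * \<Phi> (?k * g)" by (simp add: lft dims)
    finally show ?thesis by simp
  qed
  moreover have "\<Phi> (?k * g) * rep_F Y = rep_F X * \<Phi> (?k * g)"
  proof -
    have "g * kron (rep_F A) (1\<^sub>m y) + g * kron (rep_Kinv A) (rep_F Y) = kron (rep_F A) (1\<^sub>m x) * g + kron (rep_Kinv A) (rep_F X) * g"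
      using uq_homD(5)[OF g] by (simp add: mult_add_dim add_mult_dim dims flip: xya)
    then have "\<Phi> (g * kron (rep_F A) (1\<^sub>m y)) + \<Phi> (g * kron (rep_Kinv A) (rep_F Y)) = \<Phi> (kron (rep_F A) (1\<^sub>m x) * g) + \<Phi> (kron (rep_Kinv A) (rep_F X) * g)"
      by (simp add: add[symmetric] dims)
    then have 1: "\<Phi> (g * kron (rep_Kinv A) (rep_F Y)) = \<Phi> (kron (rep_Kinv A) (rep_F X) * g)"
      by (rule mat_add_cancel_left) (simp_all add: cyc dims)
    have "\<Phi> (?k * g) * rep_F Y = \<Phi> (g * kron (rep_Kinv A) (1\<^sub>m y)) * rep_F Y" by (simp add: cyc dims)
    also have "\<dots> = \<Phi> (g * kron (rep_Kinv A) (1\<^sub>m y) * kron (1\<^sub>m a) (rep_F Y))" by (simp add: rgt dims)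
    also have "\<dots> = \<Phi> (g * kron (rep_Kinv A) (rep_F Y))" by (simp add: mult_assoc_dim kron_mult one_mult_dim mult_one_dim dims)
    also note 1
    also have "kron (rep_Kinv A) (rep_F X) * g = kron (1\<^sub>m a) (rep_F X) * (?k * g)" by (simp add: kron_mult_assoc one_mult_dim mult_one_dim dims)
    also have "\<Phi> \<dots> = rep_F X * \<Phi> (?k * g)" by (simp add: lft dims)
    finally show ?thesis .
  qed
  ultimately show ?thesis by (intro uq_homI) (simp_all add: \<Phi>_def xya)
qed

subsection \<open>Mates\<close>

text \<open>A form on \<open>k^b \<otimes> k^w\<close> and a vector of \<open>k^w \<otimes> k^c\<close>, reshaped into matrices.  In these terms a zigzag is an
  ordinary matrix product, which makes morphisms insertable in its middle strand.\<close>

definition rsh :: "nat \<Rightarrow> nat \<Rightarrow> 'a mat \<Rightarrow> 'a mat" where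
  "rsh b w \<alpha> = mat b w (\<lambda>(i, k). \<alpha> $$ (0, i * w + k))"
definition csh :: "nat \<Rightarrow> nat \<Rightarrow> 'a mat \<Rightarrow> 'a mat" where
  "csh w c \<beta> = mat w c (\<lambda>(i, k). \<beta> $$ (i * c + k, 0))"

lemma dim_sh [simp]: "dim_row (rsh b w \<alpha>) = b" "dim_col (rsh b w \<alpha>) = w" "dim_row (csh b w \<alpha>) = b" "dim_col (csh b w \<alpha>) = w"
  by (auto simp: rsh_def csh_def)

lemma mateA:
  fixes \<alpha> \<beta> :: "'a::comm_semiring_1 mat"
  assumes "dim_row \<alpha> = 1" "dim_col \<alpha> = b * w" "dim_row \<beta> = w * c" "dim_col \<beta> = 1"
  shows "kron \<alpha> (1\<^sub>m c) * kron (1\<^sub>m b) \<beta> = transpose_mat (rsh b w \<alpha> * csh w c \<beta>)"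
proof (rule eq_matI)
  fix i j assume "i < dim_row (transpose_mat (rsh b w \<alpha> * csh w c \<beta>))" "j < dim_col (transpose_mat (rsh b w \<alpha> * csh w c \<beta>))"
  then have i: "i < c" and j: "j < b" by auto
  have r: "k * w * c + (k' * c + i) < b * (w * c)" if "k < b" "k' < w" for k k'
    using mult_add_less[OF that(1) mult_add_less[OF that(2) i]] by (simp add: ac_simps)
  have r2: "k' * c + i < w * c" if "k' < w" for k' using mult_add_less[OF that i] .
  have dm: "(k * w * c + (k' * c + i)) div (w * c) = k \<and> (k * w * c + (k' * c + i)) mod (w * c) = k' * c + i" if "k' < w" for k k'
  proof -
    have "w * c \<noteq> 0" using r2[OF that] by linarith
    then show ?thesis using r2[OF that] by (simp add: mult.assoc)
  qed
  have "(kron \<alpha> (1\<^sub>m c) * kron (1\<^sub>m b) \<beta>) $$ (0 * c + i, j) = (\<Sum>k<b * w. \<alpha> $$ (0, k) * kron (1\<^sub>m b) \<beta> $$ (k * c + i, j))"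
    using assms i j by (subst kronR_mult_index) (auto simp: ac_simps)
  also have "\<dots> = (\<Sum>k<b. \<Sum>k'<w. \<alpha> $$ (0, k * w + k') * kron (1\<^sub>m b) \<beta> $$ ((k * w + k') * c + i, j))"
    by (rule sum_pair)
  also have "\<dots> = (\<Sum>k<b. if k = j then \<Sum>k'<w. \<alpha> $$ (0, k * w + k') * \<beta> $$ (k' * c + i, 0) else 0)"
    using assms i j r r2 dm by (intro sum.cong refl) (auto simp: algebra_simps)
  also have "\<dots> = (\<Sum>k'<w. \<alpha> $$ (0, j * w + k') * \<beta> $$ (k' * c + i, 0))"
    using j by simp
  also have "\<dots> = transpose_mat (rsh b w \<alpha> * csh w c \<beta>) $$ (i, j)"
    using i j by (simp add: mult_index_sum rsh_def csh_def del: index_mult_mat(1))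
  finally show "(kron \<alpha> (1\<^sub>m c) * kron (1\<^sub>m b) \<beta>) $$ (i, j) = transpose_mat (rsh b w \<alpha> * csh w c \<beta>) $$ (i, j)" by simp
qed (use assms in auto)

lemma mateB:
  fixes \<alpha> \<beta> :: "'a::comm_semiring_1 mat"
  assumes "dim_row \<alpha> = 1" "dim_col \<alpha> = w * c" "dim_row \<beta> = b * w" "dim_col \<beta> = 1"
  shows "kron (1\<^sub>m b) \<alpha> * kron \<beta> (1\<^sub>m c) = csh b w \<beta> * rsh w c \<alpha>"
proof (rule eq_matI)
  fix i j assume "i < dim_row (csh b w \<beta> * rsh w c \<alpha>)" "j < dim_col (csh b w \<beta> * rsh w c \<alpha>)"
  then have i: "i < b" and j: "j < c" by auto
  have r: "i * w * c + (k * c + k') < b * w * c" if "k < w" "k' < c" for k k'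
    using mult_add_less[OF i mult_add_less[OF that]] by (simp add: ac_simps)
  have dm: "(i * w * c + (k * c + k')) div c = i * w + k \<and> (i * w * c + (k * c + k')) mod c = k'" if "k' < c" for k k'
  proof -
    have "i * w * c + (k * c + k') = (i * w + k) * c + k'" by (simp add: algebra_simps)
    then show ?thesis using that by simp
  qed
  have "(kron (1\<^sub>m b) \<alpha> * kron \<beta> (1\<^sub>m c)) $$ (i * 1 + 0, j) = (\<Sum>k<w * c. \<alpha> $$ (0, k) * kron \<beta> (1\<^sub>m c) $$ (i * (w * c) + k, j))"
    using assms i j kronL_mult_index[of "kron \<beta> (1\<^sub>m c)" b \<alpha> 0 i j] by (auto simp: ac_simps)
  also have "\<dots> = (\<Sum>k<w. \<Sum>k'<c. \<alpha> $$ (0, k * c + k') * kron \<beta> (1\<^sub>m c) $$ (i * (w * c) + (k * c + k'), j))"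
    by (rule sum_pair)
  also have "\<dots> = (\<Sum>k<w. \<Sum>k'<c. if k' = j then \<beta> $$ (i * w + k, 0) * \<alpha> $$ (0, k * c + k') else 0)"
    using assms i j r dm by (intro sum.cong refl) (auto simp: mult.assoc[symmetric] mult.commute[of "\<alpha> $$ _"])
  also have "\<dots> = (\<Sum>k<w. \<beta> $$ (i * w + k, 0) * \<alpha> $$ (0, k * c + j))"
    using j by simp
  also have "\<dots> = (csh b w \<beta> * rsh w c \<alpha>) $$ (i, j)"
    using i j by (simp add: mult_index_sum rsh_def csh_def del: index_mult_mat(1))
  finally show "(kron (1\<^sub>m b) \<alpha> * kron \<beta> (1\<^sub>m c)) $$ (i, j) = (csh b w \<beta> * rsh w c \<alpha>) $$ (i, j)" by simp
qed (use assms in auto)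

lemma rsh_right:
  fixes f :: "'a::comm_semiring_1 mat"
  assumes "dim_row \<alpha> = 1" "dim_col \<alpha> = b * dim_row f"
  shows "rsh b (dim_col f) (\<alpha> * kron (1\<^sub>m b) f) = rsh b (dim_row f) \<alpha> * f"
  using assms by (intro eq_matI) (auto simp: rsh_def mult_index_sum mult_kronL_index simp del: index_mult_mat(1))
lemma rsh_left:
  fixes f :: "'a::comm_semiring_1 mat"
  assumes "dim_row \<alpha> = 1" "dim_col \<alpha> = dim_row f * c"
  shows "rsh (dim_col f) c (\<alpha> * kron f (1\<^sub>m c)) = transpose_mat f * rsh (dim_row f) c \<alpha>"
  using assms by (intro eq_matI) (auto simp: rsh_def mult_index_sum mult_kronR_index mult.commute simp del: index_mult_mat(1))
lemma csh_left:
  fixes f :: "'a::comm_semiring_1 mat"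
  assumes "dim_col \<beta> = 1" "dim_row \<beta> = dim_col f * c"
  shows "csh (dim_row f) c (kron f (1\<^sub>m c) * \<beta>) = f * csh (dim_col f) c \<beta>"
  using assms by (intro eq_matI) (auto simp: csh_def mult_index_sum kronR_mult_index simp del: index_mult_mat(1))
lemma csh_right:
  fixes f :: "'a::comm_semiring_1 mat"
  assumes "dim_col \<beta> = 1" "dim_row \<beta> = b * dim_col f"
  shows "csh b (dim_row f) (kron (1\<^sub>m b) f * \<beta>) = csh b (dim_col f) \<beta> * transpose_mat f"
  using assms by (intro eq_matI) (auto simp: csh_def mult_index_sum kronL_mult_index mult.commute simp del: index_mult_mat(1))

section \<open>Small representations at an eighth root of unity\<close>

lemma sum2: "(\<Sum>k<(2::nat). g k) = g 0 + (g 1 :: 'a::comm_monoid_add)"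
  by (simp add: eval_nat_numeral)
lemma sum3: "(\<Sum>k<(3::nat). g k) = g 0 + g 1 + (g 2 :: 'a::comm_monoid_add)"
  by (simp add: eval_nat_numeral)
lemma sum4: "(\<Sum>k<(4::nat). g k) = g 0 + g 1 + g 2 + (g 3 :: 'a::comm_monoid_add)"
  by (simp add: eval_nat_numeral)
lemma sum8: "(\<Sum>k<(8::nat). g k) = g 0 + g 1 + g 2 + g 3 + g 4 + g 5 + g 6 + (g 7 :: 'a::comm_monoid_add)"
  by (simp add: eval_nat_numeral)

lemma all1: "(\<forall>i<(1::nat). P i) \<longleftrightarrow> P 0" by auto
lemma all2: "(\<forall>i<(2::nat). P i) \<longleftrightarrow> P 0 \<and> P 1" by (auto simp add: eval_nat_numeral All_less_Suc)
lemma all3: "(\<forall>i<(3::nat). P i) \<longleftrightarrow> P 0 \<and> P 1 \<and> P 2" by (auto simp add: eval_nat_numeral All_less_Suc)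
lemma all4: "(\<forall>i<(4::nat). P i) \<longleftrightarrow> P 0 \<and> P 1 \<and> P 2 \<and> P 3" by (auto simp add: eval_nat_numeral All_less_Suc)
lemma all8: "(\<forall>i<(8::nat). P i) \<longleftrightarrow> P 0 \<and> P 1 \<and> P 2 \<and> P 3 \<and> P 4 \<and> P 5 \<and> P 6 \<and> P 7"
  by (auto simp add: eval_nat_numeral All_less_Suc)
lemmas alls = all1 all2 all3 all4 all8
lemmas sums = sum2 sum3 sum4 sum8

lemma mat_eq_all: "A = B \<longleftrightarrow> dim_row A = dim_row B \<and> dim_col A = dim_col B \<and>
   (\<forall>i<dim_row B. \<forall>j<dim_col B. A $$ (i, j) = B $$ (i, j))"
  by (auto intro: eq_matI)

definition mk :: "nat \<Rightarrow> nat \<Rightarrow> 'a list list \<Rightarrow> 'a mat" where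
  "mk nr nc rs = mat nr nc (\<lambda>(i, j). rs ! i ! j)"

lemma mk_index: "i < nr \<Longrightarrow> j < nc \<Longrightarrow> mk nr nc rs $$ (i, j) = rs ! i ! j"
  by (simp add: mk_def)
lemma mk_dim [simp]: "dim_row (mk nr nc rs) = nr" "dim_col (mk nr nc rs) = nc"
  by (simp_all add: mk_def)

lemmas ent = mat_eq_all alls sums mk_index mult_index_sum

lemma diagonal_comm:
  fixes f :: "'a::comm_semiring_0 mat"
  assumes "diagonal_mat A" "diagonal_mat B" "f * A = B * f"
    "dim_row A = dim_col f" "dim_col A = dim_col f" "dim_row B = dim_row f" "dim_col B = dim_row f"
    "i < dim_row f" "j < dim_col f"
  shows "f $$ (i, j) * A $$ (j, j) = B $$ (i, i) * f $$ (i, j)"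
proof -
  have "(f * A) $$ (i, j) = (\<Sum>k<dim_col f. f $$ (i, k) * A $$ (k, j))"
    using assms(4-) by (simp add: mult_index_sum del: index_mult_mat(1))
  also have "\<dots> = (\<Sum>k<dim_col f. if k = j then f $$ (i, j) * A $$ (j, j) else 0)"
    using assms(1,4-) by (intro sum.cong) (auto simp: diagonal_mat_def)
  finally have 1: "(f * A) $$ (i, j) = f $$ (i, j) * A $$ (j, j)" using assms(9) by simp
  have "(B * f) $$ (i, j) = (\<Sum>k<dim_row f. B $$ (i, k) * f $$ (k, j))"
    using assms(4-) by (simp add: mult_index_sum del: index_mult_mat(1))
  also have "\<dots> = (\<Sum>k<dim_row f. if k = i then B $$ (i, i) * f $$ (i, j) else 0)"
    using assms(2,4-) by (intro sum.cong) (auto simp: diagonal_mat_def)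
  finally show ?thesis using 1 assms(3,8) by simp
qed

locale ising_parameter =
  fixes v :: "'k::field_char_0"
  assumes v4: "v ^ 4 = -1"
begin

abbreviation V where "V \<equiv> uq_fundamental v"

lemma v_nz: "v \<noteq> 0" using v4 by auto
lemma iv: "inverse v = - (v ^ 3)"
  by (rule inverse_unique) (use v4 in \<open>simp add: eval_nat_numeral\<close>)
lemma v_pows: "v * (v * (v * v)) = -1" "v * (v * (v * (v * a))) = - a"
proof -
  show 1: "v * (v * (v * v)) = -1" using v4 by (simp add: eval_nat_numeral)
  have "v * (v * (v * (v * a))) = v * (v * (v * v)) * a" by (simp only: mult.assoc)
  then show "v * (v * (v * (v * a))) = - a" by (simp add: 1)
qed

lemmas vs = iv power3_eq_cube power2_eq_square mult.assoc v_pows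

lemma v2_ne: "v\<^sup>2 \<noteq> 1" "v\<^sup>2 \<noteq> -1" "v\<^sup>2 \<noteq> 0"
  using v4 v_nz by (auto simp: power2_eq_square power4_eq_xxxx)

text \<open>The value of a circle, \<open>cap * cup\<close>; the trace of \<open>K\<close> on \<open>V\<close> is \<open>- d\<close>.\<close>

definition d :: 'k where "d = - v - inverse v"
lemma d2: "d * d = 2"
  by (simp add: d_def vs algebra_simps)
lemma d_nz: "d \<noteq> 0" using d2 by auto

lemma V_simps [simp]: "rep_dim V = 2" "rep_E V = mk 2 2 [[0, 1], [0, 0]]" "rep_F V = mk 2 2 [[0, 0], [1, 0]]"
    "rep_K V = mk 2 2 [[v, 0], [0, inverse v]]" "rep_Kinv V = mk 2 2 [[inverse v, 0], [0, v]]"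
  by (simp_all add: uq_fundamental_def mat_of_rows_list_def mk_def eval_nat_numeral)

lemma v_diff: "v - inverse v \<noteq> 0"
proof
  assume "v - inverse v = 0"
  then have "v * v = 1" using v_nz by (simp add: field_simps)
  then show False using v2_ne by (simp add: power2_eq_square)
qed

lemma V_rep: "is_uq_rep v V"
  unfolding is_uq_rep_def Let_def
  using v_nz v_diff by (auto simp: ent intro!: carrier_matI simp del: index_mult_mat(1)) (simp_all add: field_simps power2_eq_square)

lemma V_wrep [simp]: "wrep v V" by (rule is_uq_rep_wrep[OF V_rep])

definition V2 where "V2 = uq_tensor V V"
definition V3 where "V3 = uq_tensor V V2"

lemma V2_simps: "rep_dim V2 = 4"
  "rep_K V2 = mk 4 4 [[v\<^sup>2, 0, 0, 0], [0, 1, 0, 0], [0, 0, 1, 0], [0, 0, 0, inverse v ^ 2]]"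
  "rep_Kinv V2 = mk 4 4 [[inverse v ^ 2, 0, 0, 0], [0, 1, 0, 0], [0, 0, 1, 0], [0, 0, 0, v ^ 2]]"
  "rep_E V2 = mk 4 4 [[0, 1, v, 0], [0, 0, 0, inverse v], [0, 0, 0, 1], [0, 0, 0, 0]]"
  "rep_F V2 = mk 4 4 [[0, 0, 0, 0], [inverse v, 0, 0, 0], [1, 0, 0, 0], [0, 1, v, 0]]"
  unfolding V2_def using v_nz
  by (auto simp: ent index_kron simp del: index_mult_mat(1)) (simp_all add: power2_eq_square)

lemma V2_wrep [simp]: "wrep v V2" unfolding V2_def using v_nz by simp
lemma V3_wrep [simp]: "wrep v V3" unfolding V3_def using v_nz by simp

definition cup :: "'k mat" where "cup = mk 4 1 [[0], [- v], [1], [0]]"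
definition cap :: "'k mat" where "cap = mk 1 4 [[0, 1, - inverse v, 0]]"

lemma cup_dim [simp]: "dim_row cup = 4" "dim_col cup = 1" "dim_row cap = 1" "dim_col cap = 4"
  by (simp_all add: cup_def cap_def)

lemma cup_hom: "cup \<in> uq_hom uq_trivial V2"
  using v_nz by (intro uq_homI) (auto simp: V2_simps cup_def ent simp del: index_mult_mat(1))
lemma cap_hom: "cap \<in> uq_hom V2 uq_trivial"
  using v_nz by (intro uq_homI) (auto simp: V2_simps cap_def ent simp del: index_mult_mat(1))
lemma cap_cup: "cap * cup = d \<cdot>\<^sub>m 1\<^sub>m 1"
  using v_nz by (auto simp: cup_def cap_def d_def ent simp del: index_mult_mat(1))

lemma PQ: "rsh 2 2 cap * csh 2 2 cup = 1\<^sub>m 2" "csh 2 2 cup * rsh 2 2 cap = 1\<^sub>m 2"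
  using v_nz by (auto simp: cup_def cap_def rsh_def csh_def ent simp del: index_mult_mat(1))

lemma zz1: "kron cap (1\<^sub>m 2) * kron (1\<^sub>m 2) cup = 1\<^sub>m 2"
  by (subst mateA[where w = 2]) (auto simp: PQ)
lemma zz2: "kron (1\<^sub>m 2) cap * kron cup (1\<^sub>m 2) = 1\<^sub>m 2"
  by (subst mateB[where w = 2]) (auto simp: PQ)

lemma iv_ne: "inverse v \<noteq> v" using v_diff by auto

lemma End_V:
  assumes "f \<in> uq_hom V V"
  shows "f = f $$ (0, 0) \<cdot>\<^sub>m 1\<^sub>m 2"
proof -
  note h = uq_homD[OF assms]
  have dm [simp]: "dim_row f = 2" "dim_col f = 2" using h by auto
  from h(4,6) show ?thesis
    using iv_ne v_nz by (auto simp: ent simp del: index_mult_mat(1))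
qed

text \<open>\<open>K\<close> confines \<open>f\<close> to weight spaces; commuting with \<open>E\<close> and \<open>F\<close> relates the remaining entries.\<close>

lemma End_V2:
  assumes "f \<in> uq_hom V2 V2"
  shows "f = f $$ (0, 0) \<cdot>\<^sub>m 1\<^sub>m 4 + f $$ (1, 2) \<cdot>\<^sub>m (cup * cap)"
proof -
  note h = uq_homD[OF assms]
  have dm [simp]: "dim_row f = 4" "dim_col f = 4" using h by (auto simp: V2_simps)
  have ne: "inverse v * inverse v \<noteq> 1" "v * v \<noteq> 1" "inverse v * inverse v \<noteq> v * v"
    using v2_ne v4 v_nz by (auto simp: power2_eq_square field_simps power4_eq_xxxx)
  have K: "f $$ (i, j) * rep_K V2 $$ (j, j) = rep_K V2 $$ (i, i) * f $$ (i, j)" if "i < 4" "j < 4" for i j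
    by (rule diagonal_comm[OF _ _ h(6)]) (use that in \<open>auto simp: diagonal_mat_def V2_simps mk_index all4\<close>)
  have z: "f $$ (0, 1) = 0" "f $$ (0, 2) = 0" "f $$ (0, 3) = 0" "f $$ (1, 0) = 0" "f $$ (1, 3) = 0"
    "f $$ (2, 0) = 0" "f $$ (2, 3) = 0" "f $$ (3, 0) = 0" "f $$ (3, 1) = 0" "f $$ (3, 2) = 0"
    using K[of 0 1] K[of 0 2] K[of 0 3] K[of 1 0] K[of 1 3] K[of 2 0] K[of 2 3] K[of 3 0] K[of 3 1] K[of 3 2] ne
    by (auto simp: V2_simps mk_index power2_eq_square)
  have E: "(f * rep_E V2) $$ (i, j) = (rep_E V2 * f) $$ (i, j)" for i j using h(4) by simp
  have F: "(f * rep_F V2) $$ (i, j) = (rep_F V2 * f) $$ (i, j)" for i j using h(5) by simp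
  have e1: "f $$ (0, 0) = f $$ (1, 1) + v * f $$ (2, 1)" and e2: "f $$ (0, 0) * v = f $$ (1, 2) + v * f $$ (2, 2)"
    and e3: "inverse v * f $$ (3, 3) = inverse v * f $$ (1, 1) + f $$ (1, 2)"
    using E[of 0 1] E[of 0 2] E[of 1 3] by (simp_all add: V2_simps sums mult_index_sum mk_index mult.commute del: index_mult_mat(1))
  have e4: "f $$ (2, 1) * inverse v + f $$ (2, 2) = f $$ (0, 0)"
    using F[of 2 0] by (simp add: V2_simps sums mult_index_sum mk_index del: index_mult_mat(1))
  have r1: "f $$ (2, 2) = f $$ (0, 0) - f $$ (1, 2) * inverse v"
    using e2 v_nz by (simp add: field_simps)
  have r2: "f $$ (2, 1) = f $$ (1, 2)" using e4 v_nz unfolding r1 by (simp add: field_simps)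
  have r3: "f $$ (1, 1) = f $$ (0, 0) - v * f $$ (1, 2)" using e1 unfolding r2 by (simp add: algebra_simps)
  have r4: "f $$ (3, 3) = f $$ (0, 0)" using e3 v_nz unfolding r3 by (simp add: field_simps)
  show ?thesis
    by (simp add: mat_eq_all all4 sums mult_index_sum cup_def cap_def mk_index z[simplified] r1[simplified] r2[simplified] r3[simplified] r4[simplified] v_nz algebra_simps del: index_mult_mat(1))
qed

subsection \<open>The three-dimensional representation\<close>

definition t2 :: 'k where "t2 = v + inverse v"
lemma t2: "t2 = - d" "t2 * t2 = 2" "t2 \<noteq> 0"
proof -
  show 1: "t2 = - d" by (simp add: t2_def d_def)
  show "t2 * t2 = 2" "t2 \<noteq> 0" using d2 d_nz by (simp_all add: 1)
qed

text \<open>The representation of highest weight \<open>v^2\<close>, which becomes \<open>\<delta>\<close> after semisimplification.\<close>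

definition D :: "'k uq_rep" where
  "D = \<lparr>rep_dim = 3, rep_E = mk 3 3 [[0, t2, 0], [0, 0, 1], [0, 0, 0]],
        rep_F = mk 3 3 [[0, 0, 0], [1, 0, 0], [0, t2, 0]],
        rep_K = mk 3 3 [[v\<^sup>2, 0, 0], [0, 1, 0], [0, 0, inverse v ^ 2]],
        rep_Kinv = mk 3 3 [[inverse v ^ 2, 0, 0], [0, 1, 0], [0, 0, v\<^sup>2]]\<rparr>"

lemma D_simps [simp]: "rep_dim D = 3" "rep_E D = mk 3 3 [[0, t2, 0], [0, 0, 1], [0, 0, 0]]"
        "rep_F D = mk 3 3 [[0, 0, 0], [1, 0, 0], [0, t2, 0]]"
        "rep_K D = mk 3 3 [[v\<^sup>2, 0, 0], [0, 1, 0], [0, 0, inverse v ^ 2]]"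
        "rep_Kinv D = mk 3 3 [[inverse v ^ 2, 0, 0], [0, 1, 0], [0, 0, v\<^sup>2]]"
  by (simp_all add: D_def)

lemma t2_comm: "t2 = inverse (v - inverse v) * (v\<^sup>2 - inverse v ^ 2)"
proof -
  have "v\<^sup>2 - inverse v ^ 2 = (v - inverse v) * t2" by (simp add: t2_def algebra_simps power2_eq_square)
  then show ?thesis using v_diff by simp
qed

lemma t2_comm': "- t2 = inverse (v - inverse v) * (inverse v ^ 2 - v\<^sup>2)"
  unfolding t2_comm by (simp only: mult_minus_right[symmetric] minus_diff_eq)

lemma D_rep: "is_uq_rep v D"
proof -
  have 1: "rep_E D * rep_F D - rep_F D * rep_E D = inverse (v - inverse v) \<cdot>\<^sub>m (rep_K D - rep_Kinv D)"
    by (simp add: ent t2_comm[symmetric] t2_comm'[symmetric] del: index_mult_mat(1))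
  show ?thesis
    unfolding is_uq_rep_def Let_def 1[symmetric]
    using v_nz by (auto simp: ent intro!: carrier_matI simp del: index_mult_mat(1)) (simp_all add: power2_eq_square field_simps)
qed

lemma D_wrep [simp]: "wrep v D" by (rule is_uq_rep_wrep[OF D_rep])

definition iD where "iD = mk 4 3 [[1, 0, 0], [0, inverse v, 0], [0, 1, 0], [0, 0, 1]]"
definition rD where "rD = mk 3 4 [[1, 0, 0, 0], [0, (v - v * v * v) / 2, (1 + v * v) / 2, 0], [0, 0, 0, 1]]"

lemma iD_dim [simp]: "dim_row iD = 4" "dim_col iD = 3" "dim_row rD = 3" "dim_col rD = 4"
  by (simp_all add: iD_def rD_def)

lemma iD_hom: "iD \<in> uq_hom D V2"
  using v_nz by (intro uq_homI) (auto simp: V2_simps iD_def t2_def ent simp del: index_mult_mat(1))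

lemma t2_poly: "t2 = v - v * v * v"
  by (simp add: t2_def vs)

lemma rD_hom: "rD \<in> uq_hom V2 D"
  by (intro uq_homI) (simp_all add: V2_simps rD_def t2_poly ent vs del: index_mult_mat(1), (simp_all add: algebra_simps v_pows add_divide_distrib diff_divide_distrib)?)

lemma rD_iD: "rD * iD = 1\<^sub>m 3"
  by (simp add: iD_def rD_def ent vs algebra_simps add_divide_distrib diff_divide_distrib del: index_mult_mat(1), (simp_all add: algebra_simps v_pows add_divide_distrib diff_divide_distrib)?)
lemma cap_iD: "cap * iD = 0\<^sub>m 1 3"
  using v_nz by (auto simp: iD_def cap_def ent simp del: index_mult_mat(1))
lemma V2_split: "1\<^sub>m 4 = inverse d \<cdot>\<^sub>m (cup * cap) + iD * rD"
proof -
  have "inverse d = (v * v * v - v) / 2"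
    by (rule inverse_unique) (simp add: d_def vs algebra_simps add_divide_distrib diff_divide_distrib, (simp add: algebra_simps v_pows)?)
  show ?thesis unfolding \<open>inverse d = _\<close>
    by (simp add: iD_def rD_def cup_def cap_def ent vs algebra_simps del: index_mult_mat(1), (simp_all add: algebra_simps v_pows add_divide_distrib diff_divide_distrib)?)
qed

lemma End_D:
  assumes "f \<in> uq_hom D D"
  shows "f = f $$ (0, 0) \<cdot>\<^sub>m 1\<^sub>m 3"
proof -
  note h = uq_homD[OF assms]
  have dm [simp]: "dim_row f = 3" "dim_col f = 3" using h by auto
  have ne: "inverse v * inverse v \<noteq> 1" "v * v \<noteq> 1" "inverse v * inverse v \<noteq> v * v"
    using v2_ne v4 v_nz by (auto simp: power2_eq_square field_simps power4_eq_xxxx)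
  from h(4,6) show ?thesis
    using ne v_nz t2(3) by (auto simp: ent power2_eq_square simp del: index_mult_mat(1))
qed

subsection \<open>The Jones-Wenzl projector on three strands\<close>

abbreviation u1 where "u1 \<equiv> kron cup (1\<^sub>m 2)"
abbreviation u2 where "u2 \<equiv> kron (1\<^sub>m 2) cup"
abbreviation c1 where "c1 \<equiv> kron cap (1\<^sub>m 2)"
abbreviation c2 where "c2 \<equiv> kron (1\<^sub>m 2) cap"

lemma cu: "c1 * u1 = d \<cdot>\<^sub>m 1\<^sub>m 2" "c2 * u2 = d \<cdot>\<^sub>m 1\<^sub>m 2" "c1 * u2 = 1\<^sub>m 2" "c2 * u1 = 1\<^sub>m 2"
  by (simp_all add: kron_mult cap_cup kron_smult_left kron_smult_right zz1 zz2 one_mult_dim kron_one_one)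

lemma u_explicit:
  "u1 = mk 8 2 [[0,0],[0,0],[-v,0],[0,-v],[1,0],[0,1],[0,0],[0,0]]"
  "u2 = mk 8 2 [[0,0],[-v,0],[1,0],[0,0],[0,0],[0,-v],[0,1],[0,0]]"
  "c1 = mk 2 8 [[0,0,1,0,-inverse v,0,0,0],[0,0,0,1,0,-inverse v,0,0]]"
  "c2 = mk 2 8 [[0,1,-inverse v,0,0,0,0,0],[0,0,0,0,0,1,-inverse v,0]]"
  by (auto simp: ent cup_def cap_def)

text \<open>Inclusion and retraction that factor the Jones-Wenzl projector through the four-dimensional
  representation of highest weight \<open>v^3\<close>.\<close>

definition iSt :: "'k mat" where
  "iSt = mk 8 4 [[1,0,0,0],[0,inverse v ^ 2,0,0],[0,inverse v,0,0],[0,0,inverse v ^ 2,0],[0,1,0,0],[0,0,inverse v,0],[0,0,1,0],[0,0,0,1]]"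
definition rSt :: "'k mat" where
  "rSt = mk 4 8 [[1,0,0,0,0,0,0,0],[0,1,v,0,v^2,0,0,0],[0,0,0,1,0,v,v^2,0],[0,0,0,0,0,0,0,1]]"

definition JW :: "'k mat" where
  "JW = 1\<^sub>m 8 + u1 * (c2 + (- d) \<cdot>\<^sub>m c1) + u2 * (c1 + (- d) \<cdot>\<^sub>m c2)"

lemma JW_factor: "JW = iSt * rSt"
  unfolding JW_def u_explicit iSt_def rSt_def d_def
  by (simp add: ent vs algebra_simps v_pows del: index_mult_mat(1))

lemma V3_simps: "rep_dim V3 = 8"
  "rep_K V3 = mat 8 8 (\<lambda>(i, j). if i = j then [v^3, v, v, inverse v, v, inverse v, inverse v, inverse v ^ 3] ! i else 0)"
  "rep_F V3 = mk 8 8 [[0,0,0,0,0,0,0,0],[inverse v ^ 2,0,0,0,0,0,0,0],[inverse v,0,0,0,0,0,0,0],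
     [0,inverse v,1,0,0,0,0,0],[1,0,0,0,0,0,0,0],[0,1,0,0,1,0,0,0],[0,0,1,0,v,0,0,0],[0,0,0,1,0,v,v^2,0]]"
  unfolding V3_def using v_nz
  by (simp_all add: ent V2_simps power2_eq_square power3_eq_cube del: index_mult_mat(1))

text \<open>The image of \<open>JW\<close> is generated under \<open>F\<close> by the vector of weight \<open>v^3\<close>, which \<open>g\<close> preserves up to a scalar \<open>l\<close>;
  hence \<open>g * JW = l JW\<close>, and the trace \<open>v^3 + v + v^-1 + v^-3\<close> of \<open>K\<close> on the image is zero.\<close>

lemma JW_trace_zero:
  assumes g: "g \<in> uq_hom V3 V3"
  shows "mtr (rep_K V3 * (g * JW)) = 0"
proof -
  note h = uq_homD[OF g]
  have dm [simp]: "dim_row g = 8" "dim_col g = 8" using h by (auto simp: V3_simps)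
  have dS [simp]: "dim_row iSt = 8" "dim_col iSt = 4" "dim_row rSt = 4" "dim_col rSt = 8" by (auto simp: iSt_def rSt_def)
  have dF [simp]: "dim_row (rep_F V3) = 8" "dim_col (rep_F V3) = 8" by (auto simp: V3_simps)
  have ne: "v \<noteq> v * (v * v)" "inverse v \<noteq> v * (v * v)" "inverse v * (inverse v * inverse v) \<noteq> v * (v * v)"
  proof -
    show "v \<noteq> v * (v * v)" using v2_ne v_nz by (auto simp: power2_eq_square)
    show "inverse v \<noteq> v * (v * v)" unfolding iv using v_nz by (auto simp: power3_eq_cube eq_neg_iff_add_eq_0 mult.assoc)
    show "inverse v * (inverse v * inverse v) \<noteq> v * (v * v)"
    proof
      assume "inverse v * (inverse v * inverse v) = v * (v * v)"
      then have "inverse v * (inverse v * inverse v) * v = v * (v * v) * v" by simp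
      then have "inverse v * inverse v = - 1" using v_nz by (simp add: mult.assoc v_pows)
      then have "- (v * v) = 1" using v_nz by (simp add: field_simps)
      then have "v\<^sup>2 = -1" by (metis minus_minus power2_eq_square)
      then show False using v2_ne by simp
    qed
  qed
  have K: "g $$ (i, j) * rep_K V3 $$ (j, j) = rep_K V3 $$ (i, i) * g $$ (i, j)" if "i < 8" "j < 8" for i j
    by (rule diagonal_comm[OF _ _ h(6)]) (use that in \<open>auto simp: diagonal_mat_def V3_simps\<close>)
  define l where "l = g $$ (0, 0)"
  define G where "G = g * iSt"
  define S where "S = mk 4 4 [[0,0,0,0],[1,0,0,0],[0,t2,0,0],[0,0,1,0]]"
  have dG [simp]: "dim_row G = 8" "dim_col G = 4" "dim_row S = 4" "dim_col S = 4" by (auto simp: G_def S_def)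
  have zz: "g $$ (i, 0) = 0" if "i < 8" "rep_K V3 $$ (i, i) \<noteq> v * (v * v)" for i
  proof -
    have "rep_K V3 $$ (0, 0) = v * (v * v)" by (simp add: V3_simps power3_eq_cube mult.assoc)
    then have "(rep_K V3 $$ (i, i) - v * (v * v)) * g $$ (i, 0) = 0"
      using K[OF that(1), of 0] by (auto simp: algebra_simps)
    then show ?thesis using that(2) by simp
  qed
  have z: "g $$ (1, 0) = 0" "g $$ (2, 0) = 0" "g $$ (3, 0) = 0" "g $$ (4, 0) = 0" "g $$ (5, 0) = 0"
    "g $$ (6, 0) = 0" "g $$ (7, 0) = 0"
    by (rule zz; use ne in \<open>simp add: V3_simps power3_eq_cube mult.assoc\<close>)+
  have FS: "rep_F V3 * iSt = iSt * S"
    unfolding V3_simps iSt_def S_def t2_poly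
    by (simp add: ent vs algebra_simps v_pows del: index_mult_mat(1))
  have "G * S = g * (rep_F V3 * iSt)" by (simp add: G_def mult_assoc_dim FS)
  also have "\<dots> = (rep_F V3 * g) * iSt" unfolding h(5)[symmetric] by (simp add: mult_assoc_dim)
  finally have GS: "G * S = rep_F V3 * G" by (simp add: G_def mult_assoc_dim)
  have step: "(G * S) $$ (i, k) = l * (iSt * S) $$ (i, k)" if c: "\<And>i. i < 8 \<Longrightarrow> G $$ (i, k) = l * iSt $$ (i, k)" and i: "i < 8" and k: "k < 4" for i k
  proof -
    have "(G * S) $$ (i, k) = (\<Sum>j<8. rep_F V3 $$ (i, j) * G $$ (j, k))"
      unfolding GS using i k by (simp add: mult_index_sum del: index_mult_mat(1))
    also have "\<dots> = l * (\<Sum>j<8. rep_F V3 $$ (i, j) * iSt $$ (j, k))"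
      unfolding sum_distrib_left by (intro sum.cong) (auto simp: c)
    also have "(\<Sum>j<8. rep_F V3 $$ (i, j) * iSt $$ (j, k)) = (rep_F V3 * iSt) $$ (i, k)"
      using i k by (simp add: mult_index_sum del: index_mult_mat(1))
    finally show ?thesis by (simp add: FS)
  qed
  have Sx: "(A * S) $$ (i, 0) = A $$ (i, 1)" "(A * S) $$ (i, 1) = t2 * A $$ (i, 2)" "(A * S) $$ (i, 2) = A $$ (i, 3)"
    if "i < dim_row A" "dim_col A = 4" for A :: "'k mat" and i
    using that by (simp_all add: mult_index_sum sums S_def mk_index del: index_mult_mat(1))
  have c0: "G $$ (i, 0) = l * iSt $$ (i, 0)" if "i < 8" for i
  proof -
    have "\<forall>i<8. G $$ (i, 0) = l * iSt $$ (i, 0)"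
      unfolding G_def by (simp add: all8 mult_index_sum sums iSt_def mk_index z[simplified] l_def del: index_mult_mat(1))
    then show ?thesis using that by simp
  qed
  have c1: "G $$ (i, 1) = l * iSt $$ (i, 1)" if "i < 8" for i
    using step[OF c0 that] Sx(1)[where A = G and i = i] Sx(1)[where A = iSt and i = i] that by simp
  have c2: "G $$ (i, 2) = l * iSt $$ (i, 2)" if "i < 8" for i
    using step[OF c1 that] Sx(2)[where A = G and i = i] Sx(2)[where A = iSt and i = i] that t2(3) by simp
  have c3: "G $$ (i, 3) = l * iSt $$ (i, 3)" if "i < 8" for i
    using step[OF c2 that] Sx(3)[where A = G and i = i] Sx(3)[where A = iSt and i = i] that by simp
  have "G = l \<cdot>\<^sub>m iSt"
  proof (rule eq_matI)
    fix i j assume "i < dim_row (l \<cdot>\<^sub>m iSt)" "j < dim_col (l \<cdot>\<^sub>m iSt)"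
    then have "i < 8" "j = 0 \<or> j = 1 \<or> j = 2 \<or> j = 3" by auto
    then show "G $$ (i, j) = (l \<cdot>\<^sub>m iSt) $$ (i, j)" using c0 c1 c2 c3 by auto
  qed simp_all
  then have "g * JW = l \<cdot>\<^sub>m (iSt * rSt)"
    by (simp add: JW_factor G_def mult_assoc_dim[symmetric] smult_mult_dim)
  then have "mtr (rep_K V3 * (g * JW)) = l * mtr (rep_K V3 * (iSt * rSt))"
    by (simp add: mult_smult_dim mtr_smult V3_simps)
  also have "mtr (rep_K V3 * (iSt * rSt)) = (\<Sum>i<8. rep_K V3 $$ (i, i) * (\<Sum>k<4. iSt $$ (i, k) * rSt $$ (k, i)))"
  proof -
    have "(rep_K V3 * (iSt * rSt)) $$ (i, i) = rep_K V3 $$ (i, i) * (\<Sum>k<4. iSt $$ (i, k) * rSt $$ (k, i))" if "i < 8" for i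
    proof -
      have "(rep_K V3 * (iSt * rSt)) $$ (i, i) = (\<Sum>j<8. rep_K V3 $$ (i, j) * (iSt * rSt) $$ (j, i))"
        using that by (simp add: mult_index_sum V3_simps del: index_mult_mat(1))
      also have "\<dots> = (\<Sum>j<8. if j = i then rep_K V3 $$ (i, i) * (iSt * rSt) $$ (i, i) else 0)"
        using that by (intro sum.cong) (auto simp: V3_simps)
      finally show ?thesis using that by (simp add: mult_index_sum del: index_mult_mat(1))
    qed
    then show ?thesis by (simp add: mtr_def V3_simps)
  qed
  also have "\<dots> = 0"
    by (simp add: V3_simps sums iSt_def rSt_def mk_index vs algebra_simps v_pows)
  finally show ?thesis by simp
qed

lemma traces: "mtr (rep_K V) = - d" "mtr (rep_Kinv V) = - d" "mtr (rep_K D) = 1"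
  by (simp_all add: mtr_def sums mk_index d_def vs)

section \<open>Tilting objects\<close>

definition T :: "'k uq_rep set" where "T = generated_objs (Rep_Uq v) V"

lemma Rep_simps [simp]:
  "cat_obj (Rep_Uq v) = {M. is_uq_rep v M}" "cat_hom (Rep_Uq v) = uq_hom"
  "cat_id (Rep_Uq v) M = 1\<^sub>m (rep_dim M)" "cat_comp (Rep_Uq v) X Y Z g f = g * f"
  "cat_zero (Rep_Uq v) M N = 0\<^sub>m (rep_dim N) (rep_dim M)" "cat_add (Rep_Uq v) X Y f g = f + g"
  "cat_scale (Rep_Uq v) X Y a f = a \<cdot>\<^sub>m f" "ten_unit (Rep_Uq v) = uq_trivial" "ten_obj (Rep_Uq v) = uq_tensor"
  "ten_mor (Rep_Uq v) X X' Y Y' f g = kron f g"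
  "ten_assoc (Rep_Uq v) L M N = 1\<^sub>m (rep_dim L * rep_dim M * rep_dim N)"
  "ten_lunit (Rep_Uq v) M = 1\<^sub>m (rep_dim M)" "ten_runit (Rep_Uq v) M = 1\<^sub>m (rep_dim M)"
  by (simp_all add: Rep_Uq_def)

lemma wrep_ten [simp]: "wrep v M \<Longrightarrow> wrep v N \<Longrightarrow> wrep v (uq_tensor M N)"
  using v_nz by simp

lemma T_wrep [simp]: "X \<in> T \<Longrightarrow> wrep v X"
  unfolding T_def
  by (induction rule: generated_objs.induct) (auto intro: is_uq_rep_wrep)

lemma T_unit [simp]: "uq_trivial \<in> T"
  using gen_unit[of "Rep_Uq v" V] by (simp add: T_def)
lemma T_V [simp]: "V \<in> T"
  unfolding T_def by (rule gen_base) (simp add: V_rep)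
lemma T_tensor [simp]: "X \<in> T \<Longrightarrow> Y \<in> T \<Longrightarrow> uq_tensor X Y \<in> T"
  unfolding T_def using gen_tensor[of X "Rep_Uq v" V Y] by simp
lemma T_V2 [simp]: "V2 \<in> T" by (simp add: V2_def)
lemma T_D [simp]: "D \<in> T"
  unfolding T_def
proof (rule gen_summand)
  show "V2 \<in> generated_objs (Rep_Uq v) V" using T_V2 by (simp add: T_def)
  show "retract_of (Rep_Uq v) D V2"
    unfolding retract_of_def Rep_simps D_simps(1) using iD_hom rD_hom rD_iD by blast
qed (simp add: D_rep)

primrec Vp :: "nat \<Rightarrow> 'k uq_rep" where
  "Vp 0 = uq_trivial"
| "Vp (Suc n) = uq_tensor V (Vp n)"

lemma Vp_T [simp]: "Vp n \<in> T"
  by (induction n) auto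
lemma Vp_wrep [simp]: "wrep v (Vp n)" by simp
lemma Vp_dim: "rep_dim (Vp n) = 2 ^ n"
  by (induction n) auto
lemma Vp_add: "uq_tensor (Vp m) (Vp n) = Vp (m + n)"
  by (induction m) (auto simp: uq_tensor_unit[of v] uq_tensor_assoc[of v])
lemma Vp_1: "Vp (Suc 0) = V" "Vp 1 = V"
  by (simp_all add: uq_tensor_unit[of v])
lemma Vp_2: "Vp 2 = V2" "Vp (Suc (Suc 0)) = V2"
  by (simp_all add: V2_def uq_tensor_unit[of v] eval_nat_numeral)
lemma Vp_3: "Vp 3 = V3"
  by (simp add: V2_def V3_def uq_tensor_unit[of v] eval_nat_numeral)
lemma Vp_Suc': "Vp (Suc n) = uq_tensor (Vp n) V"
  using Vp_add[of n 1] by (simp add: uq_tensor_unit[of v])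

subsection \<open>Morphisms that factor through given objects\<close>

text \<open>Sums of composites \<open>X \<rightarrow> W \<rightarrow> Y\<close> with \<open>W\<close> in \<open>S\<close>.  That the identity of \<open>X\<close> is of this form says that
  \<open>X\<close> is a summand of a sum of objects of \<open>S\<close>, without mentioning direct sums.\<close>

inductive thru :: "'k uq_rep set \<Rightarrow> 'k uq_rep \<Rightarrow> 'k uq_rep \<Rightarrow> 'k mat \<Rightarrow> bool" for S X Y where
  thru_zero: "thru S X Y (0\<^sub>m (rep_dim Y) (rep_dim X))"
| thru_add: "W \<in> S \<Longrightarrow> wrep v W \<Longrightarrow> g \<in> uq_hom X W \<Longrightarrow> f \<in> uq_hom W Y \<Longrightarrow> thru S X Y h \<Longrightarrow> thru S X Y (f * g + h)"

lemma thru_hom: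
  assumes "thru S X Y h" "wrep v X" "wrep v Y"
  shows "h \<in> uq_hom X Y"
  using assms by (induction) (auto intro: hom_zero hom_add hom_comp)

lemma thru_base:
  assumes "W \<in> S" "wrep v W" "wrep v X" "wrep v Y" "g \<in> uq_hom X W" "f \<in> uq_hom W Y"
  shows "thru S X Y (f * g)"
proof -
  have "f * g + 0\<^sub>m (rep_dim Y) (rep_dim X) = f * g"
    using uq_homD(1,2)[OF assms(5)] uq_homD(1,2)[OF assms(6)] by (intro right_add_zero_mat) auto
  then show ?thesis using thru_add[OF assms(1,2,5,6) thru_zero] by simp
qed

lemma thru_plus:
  assumes "thru S X Y h" "thru S X Y h'" "wrep v X" "wrep v Y"
  shows "thru S X Y (h + h')"
  using assms
proof (induction)
  case thru_zero
  then show ?case using uq_homD(3)[OF thru_hom[OF thru_zero(1-3)]] by simp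
next
  case (thru_add W g f h)
  note m = hom_comp[OF \<open>wrep v X\<close> \<open>wrep v W\<close> \<open>wrep v Y\<close> thru_add(3,4)]
  have "f * g + h + h' = f * g + (h + h')"
    by (rule assoc_add_mat[OF uq_homD(3)[OF m] uq_homD(3)[OF thru_hom[OF thru_add(5,8,9)]] uq_homD(3)[OF thru_hom[OF thru_add(7,8,9)]]])
  then show ?case using thru_add by (auto intro: thru.thru_add)
qed

lemma thru_comp:
  assumes "thru S X Y h" "wrep v X" "wrep v Y" "wrep v X'" "wrep v Y'" "a \<in> uq_hom Y Y'" "b \<in> uq_hom X' X"
  shows "thru S X' Y' (a * h * b)"
  using assms
proof (induction)
  case thru_zero
  have "a * 0\<^sub>m (rep_dim Y) (rep_dim X) * b = 0\<^sub>m (rep_dim Y') (rep_dim X')"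
    using uq_homD(3)[OF thru_zero(5)] uq_homD(3)[OF thru_zero(6)] by simp
  then show ?case using thru.thru_zero by metis
next
  case (thru_add W g f h)
  note d = uq_homD(1,2)[OF thru_add(3)] uq_homD(1,2)[OF thru_add(4)] uq_homD(1,2)[OF thru_add(11)] uq_homD(1,2)[OF thru_add(12)]
     uq_homD(1,2)[OF thru_hom[OF thru_add(5,7,8)]]
  have "a * (f * g + h) * b = (a * f) * (g * b) + a * h * b"
    using d by (simp add: mult_add_dim add_mult_dim mult_assoc_dim)
  moreover have "thru S X' Y' ((a * f) * (g * b) + a * h * b)"
    using thru_add by (intro thru.thru_add) (auto intro: hom_comp)
  ultimately show ?case by simp
qed

lemma thru_refine:
  assumes "thru S X Y h" "wrep v X" "wrep v Y" "\<And>W. W \<in> S \<Longrightarrow> thru S' W W (1\<^sub>m (rep_dim W))"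
  shows "thru S' X Y h"
  using assms
proof (induction)
  case thru_zero
  then show ?case by (intro thru.thru_zero)
next
  case (thru_add W g f h)
  have "thru S' X Y (f * 1\<^sub>m (rep_dim W) * g)"
    using thru_add by (intro thru_comp[of S' W W]) auto
  also have "f * 1\<^sub>m (rep_dim W) * g = f * g" using uq_homD(2)[OF thru_add(4)] by (simp add: mult_one_dim)
  finally show ?case using thru_add by (intro thru_plus) auto
qed

lemma thru_tensor:
  assumes "thru S X Y h" "thru S' X' Y' h'" "wrep v X" "wrep v Y" "wrep v X'" "wrep v Y'"
    and "\<And>W W'. W \<in> S \<Longrightarrow> W' \<in> S' \<Longrightarrow> uq_tensor W W' \<in> S''"
  shows "thru S'' (uq_tensor X X') (uq_tensor Y Y') (kron h h')"
  using assms
proof (induction)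
  case thru_zero
  have "kron (0\<^sub>m (rep_dim Y) (rep_dim X)) h' = 0\<^sub>m (rep_dim (uq_tensor Y Y')) (rep_dim (uq_tensor X X'))"
    using uq_homD(1,2)[OF thru_hom[OF thru_zero(1,4,5)]] by simp
  then show ?case by (metis thru.thru_zero)
next
  case (thru_add W g f h)
  note h' = thru_hom[OF thru_add(7,10,11)]
  note d = uq_homD(1,2)[OF thru_add(3)] uq_homD(1,2)[OF thru_add(4)] uq_homD(1,2)[OF h']
     uq_homD(1,2)[OF thru_hom[OF thru_add(5,8,9)]]
  have 1: "thru S'' (uq_tensor X X') (uq_tensor Y Y') (kron (f * g) h')"
    using thru_add(7,10,11)
  proof (induction)
    case thru_zero
    have "kron (f * g) (0\<^sub>m (rep_dim Y') (rep_dim X')) = 0\<^sub>m (rep_dim (uq_tensor Y Y')) (rep_dim (uq_tensor X X'))"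
      using d by simp
    then show ?case by (metis thru.thru_zero)
  next
    case (thru_add W' g' f' h')
    note d' = d uq_homD(1,2)[OF thru_add(3)] uq_homD(1,2)[OF thru_add(4)] uq_homD(1,2)[OF thru_hom[OF thru_add(5,7,8)]]
    have "kron (f * g) (f' * g' + h') = kron f f' * kron g g' + kron (f * g) h'"
      using d' by (simp add: kron_add_right kron_mult)
    moreover have "thru S'' (uq_tensor X X') (uq_tensor Y Y') (kron f f' * kron g g' + kron (f * g) h')"
      using thru_add \<open>W \<in> S\<close> \<open>wrep v W\<close> \<open>g \<in> uq_hom X W\<close> \<open>f \<in> uq_hom W Y\<close> \<open>wrep v X\<close> \<open>wrep v Y\<close> assms(7)
      by (intro thru.thru_add[of "uq_tensor W W'"]) (auto intro: hom_kron)
    ultimately show ?case by simp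
  qed
  have "kron (f * g + h) h' = kron (f * g) h' + kron h h'"
    using d by (simp add: kron_add_left)
  then show ?case using 1 thru_add by (auto intro!: thru_plus)
qed

subsection \<open>Duals\<close>

text \<open>The duality of \<open>V^{\<otimes>(n+1)}\<close> is obtained by nesting that of \<open>V^{\<otimes>n}\<close> into \<open>cup\<close> and \<open>cap\<close>.\<close>

lemma zig_Vp:
  "\<exists>ev coev. ev \<in> uq_hom (uq_tensor (Vp n) (Vp n)) uq_trivial \<and> coev \<in> uq_hom uq_trivial (uq_tensor (Vp n) (Vp n)) \<and>
     kron (1\<^sub>m (2 ^ n)) ev * kron coev (1\<^sub>m (2 ^ n)) = 1\<^sub>m (2 ^ n)"
proof (induction n)
  case 0
  have "(1\<^sub>m 1 :: 'k mat) \<in> uq_hom uq_trivial uq_trivial" using hom_id[of v uq_trivial] by simp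
  then show ?case by (intro exI[of _ "1\<^sub>m 1"]) (simp add: kron_mult one_mult_dim)
next
  case (Suc n)
  define N :: nat where "N = 2 ^ n"
  obtain ev coev where ev: "ev \<in> uq_hom (uq_tensor (Vp n) (Vp n)) uq_trivial" and coev: "coev \<in> uq_hom uq_trivial (uq_tensor (Vp n) (Vp n))"
    and zig: "kron (1\<^sub>m N) ev * kron coev (1\<^sub>m N) = 1\<^sub>m N"
    using Suc by (auto simp: N_def)
  have d: "dim_row ev = 1" "dim_col ev = N * N" "dim_row coev = N * N" "dim_col coev = 1"
    using uq_homD(1,2)[OF ev] uq_homD(1,2)[OF coev] by (auto simp: Vp_dim N_def)
  define B where "B = kron (1\<^sub>m N) (kron cap (1\<^sub>m N))"
  define C where "C = kron (1\<^sub>m 2) (kron coev (1\<^sub>m 2))"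
  have dB: "dim_row B = N * N" "dim_col B = N * (4 * N)" "dim_row C = 2 * (N * N * 2)" "dim_col C = 4"
    using d by (auto simp: B_def C_def)
  have Vn1: "uq_tensor (Vp (Suc n)) (Vp (Suc n)) = uq_tensor (Vp n) (uq_tensor V2 (Vp n))"
    unfolding V2_def using Vp_add[of n "Suc (Suc n)"] Vp_add[of "Suc n" "Suc n"]
    by (simp add: uq_tensor_assoc[of v])
  have Vn2: "uq_tensor (Vp (Suc n)) (Vp (Suc n)) = uq_tensor V (uq_tensor (uq_tensor (Vp n) (Vp n)) V)"
  proof -
    have "uq_tensor (Vp (Suc n)) (Vp (Suc n)) = uq_tensor (uq_tensor V (Vp n)) (uq_tensor (Vp n) V)"
      by (simp only: Vp_Suc'[symmetric] Vp.simps(2))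
    then show ?thesis by (simp add: uq_tensor_assoc[of v])
  qed
  have i1: "1\<^sub>m N \<in> uq_hom (Vp n) (Vp n)" using hom_id[of v "Vp n"] by (simp add: Vp_dim N_def)
  have i2: "1\<^sub>m 2 \<in> uq_hom V V" using hom_id[of v V] by simp
  have "kron (1\<^sub>m N) (kron cap (1\<^sub>m N)) \<in> uq_hom (uq_tensor (Vp n) (uq_tensor V2 (Vp n))) (uq_tensor (Vp n) (uq_tensor uq_trivial (Vp n)))"
    by (intro hom_kron[of v]) (auto simp: i1 cap_hom)
  then have B: "B \<in> uq_hom (uq_tensor (Vp (Suc n)) (Vp (Suc n))) (uq_tensor (Vp n) (Vp n))"
    by (simp only: Vn1 B_def uq_tensor_unit[OF Vp_wrep])
  have "kron (1\<^sub>m 2) (kron coev (1\<^sub>m 2)) \<in> uq_hom (uq_tensor V (uq_tensor uq_trivial V)) (uq_tensor V (uq_tensor (uq_tensor (Vp n) (Vp n)) V))"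
    by (intro hom_kron[of v]) (auto simp: i2 coev)
  then have C: "C \<in> uq_hom V2 (uq_tensor (Vp (Suc n)) (Vp (Suc n)))"
    by (simp only: Vn2 C_def uq_tensor_unit[OF V_wrep] V2_def)
  have "kron (1\<^sub>m (2 * N)) (ev * B) * kron (C * cup) (1\<^sub>m (2 * N)) = 1\<^sub>m (2 * N)"
  proof -
    have a: "kron (1\<^sub>m (2 * N)) (ev * B) = kron (1\<^sub>m (2 * N)) ev * kron (1\<^sub>m (2 * N)) B"
      using d dB by (simp add: kron_mult one_mult_dim)
    have b: "kron (C * cup) (1\<^sub>m (2 * N)) = kron C (1\<^sub>m (2 * N)) * kron cup (1\<^sub>m (2 * N))"
      using d dB by (simp add: kron_mult one_mult_dim)
    have B2: "kron (1\<^sub>m (2 * N)) B = kron (1\<^sub>m 2) (kron (1\<^sub>m (N * N)) (kron cap (1\<^sub>m N)))"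
      by (simp add: B_def kron_one_one[symmetric] kron_assoc)
    have C2: "kron C (1\<^sub>m (2 * N)) = kron (1\<^sub>m 2) (kron coev (kron (1\<^sub>m 4) (1\<^sub>m N)))"
    proof -
      have "(1\<^sub>m 4 :: 'k mat) = kron (1\<^sub>m 2) (1\<^sub>m 2)" by (simp add: kron_one_one)
      then show ?thesis by (simp add: C_def kron_one_one[symmetric] kron_assoc)
    qed
    have "kron (1\<^sub>m (2 * N)) B * kron C (1\<^sub>m (2 * N)) = kron (1\<^sub>m 2) (kron coev (kron cap (1\<^sub>m N)))"
      unfolding B2 C2 using d by (simp add: kron_mult one_mult_dim mult_one_dim)
    also have "\<dots> = kron (1\<^sub>m 2) (kron coev (1\<^sub>m N)) * kron (1\<^sub>m 2) (kron cap (1\<^sub>m N))"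
    proof -
      have "kron coev (1\<^sub>m N) * kron cap (1\<^sub>m N) = kron coev (1\<^sub>m N) * kron (1\<^sub>m 1) (kron cap (1\<^sub>m N))" by simp
      also have "\<dots> = kron coev (kron cap (1\<^sub>m N))"
        using d by (subst kron_mult) (auto simp: one_mult_dim mult_one_dim)
      finally show ?thesis using d by (simp add: kron_mult one_mult_dim)
    qed
    finally have mid: "kron (1\<^sub>m (2 * N)) B * kron C (1\<^sub>m (2 * N)) = kron (1\<^sub>m 2) (kron coev (1\<^sub>m N)) * kron (1\<^sub>m 2) (kron cap (1\<^sub>m N))" .
    have last: "kron (1\<^sub>m 2) (kron cap (1\<^sub>m N)) * kron cup (1\<^sub>m (2 * N)) = 1\<^sub>m (2 * N)"
    proof -
      have "kron (1\<^sub>m 2) (kron cap (1\<^sub>m N)) * kron cup (1\<^sub>m (2 * N)) = kron (kron (1\<^sub>m 2) cap) (1\<^sub>m N) * kron (kron cup (1\<^sub>m 2)) (1\<^sub>m N)"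
        by (simp add: kron_one_one[symmetric] kron_assoc)
      also have "\<dots> = 1\<^sub>m (2 * N)" by (simp add: kron_mult zz2 one_mult_dim kron_one_one)
      finally show ?thesis .
    qed
    have first: "kron (1\<^sub>m (2 * N)) ev * kron (1\<^sub>m 2) (kron coev (1\<^sub>m N)) = 1\<^sub>m (2 * N)"
    proof -
      have "kron (1\<^sub>m (2 * N)) ev = kron (1\<^sub>m 2) (kron (1\<^sub>m N) ev)" by (simp add: kron_one_one[symmetric] kron_assoc)
      then show ?thesis using d by (simp add: kron_mult zig one_mult_dim kron_one_one)
    qed
    have "kron (1\<^sub>m (2 * N)) (ev * B) * kron (C * cup) (1\<^sub>m (2 * N))
      = kron (1\<^sub>m (2 * N)) ev * ((kron (1\<^sub>m (2 * N)) B * kron C (1\<^sub>m (2 * N))) * kron cup (1\<^sub>m (2 * N)))"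
      unfolding a b using d dB by (simp add: mult_assoc_dim)
    also have "\<dots> = (kron (1\<^sub>m (2 * N)) ev * kron (1\<^sub>m 2) (kron coev (1\<^sub>m N))) * (kron (1\<^sub>m 2) (kron cap (1\<^sub>m N)) * kron cup (1\<^sub>m (2 * N)))"
      unfolding mid using d dB by (simp add: mult_assoc_dim)
    also have "\<dots> = 1\<^sub>m (2 * N)" unfolding first last by simp
    finally show ?thesis .
  qed
  moreover have "ev * B \<in> uq_hom (uq_tensor (Vp (Suc n)) (Vp (Suc n))) uq_trivial"
    using B ev by (intro hom_comp[of v _ "uq_tensor (Vp n) (Vp n)"]) auto
  moreover have "C * cup \<in> uq_hom uq_trivial (uq_tensor (Vp (Suc n)) (Vp (Suc n)))"
    using C cup_hom by (intro hom_comp[of v _ V2]) auto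
  ultimately show ?case by (intro exI[of _ "ev * B"] exI[of _ "C * cup"]) (simp add: N_def)
qed

lemma selfdual_Vp:
  obtains ev coev where "ev \<in> uq_hom (uq_tensor (Vp n) (Vp n)) uq_trivial" "coev \<in> uq_hom uq_trivial (uq_tensor (Vp n) (Vp n))"
    "csh (2 ^ n) (2 ^ n) coev * rsh (2 ^ n) (2 ^ n) ev = 1\<^sub>m (2 ^ n)" "rsh (2 ^ n) (2 ^ n) ev * csh (2 ^ n) (2 ^ n) coev = 1\<^sub>m (2 ^ n)"
proof -
  obtain ev coev where ev: "ev \<in> uq_hom (uq_tensor (Vp n) (Vp n)) uq_trivial" and coev: "coev \<in> uq_hom uq_trivial (uq_tensor (Vp n) (Vp n))"
    and zig: "kron (1\<^sub>m (2 ^ n)) ev * kron coev (1\<^sub>m (2 ^ n)) = 1\<^sub>m (2 ^ n)"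
    using zig_Vp by blast
  have "csh (2 ^ n) (2 ^ n) coev * rsh (2 ^ n) (2 ^ n) ev = 1\<^sub>m (2 ^ n)"
    using zig uq_homD(1,2)[OF ev] uq_homD(1,2)[OF coev] by (subst mateB[symmetric]) (auto simp: Vp_dim)
  moreover from this have "rsh (2 ^ n) (2 ^ n) ev * csh (2 ^ n) (2 ^ n) coev = 1\<^sub>m (2 ^ n)"
    by (rule mat_mult_left_right_inverse[rotated 2]) (auto intro: carrier_matI)
  ultimately show ?thesis using that ev coev by blast
qed

lemma mateA_hom:
  assumes "wrep v B" "wrep v W" "wrep v C" "\<alpha> \<in> uq_hom (uq_tensor B W) uq_trivial" "\<beta> \<in> uq_hom uq_trivial (uq_tensor W C)"
  shows "transpose_mat (rsh (rep_dim B) (rep_dim W) \<alpha> * csh (rep_dim W) (rep_dim C) \<beta>) \<in> uq_hom B C"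
proof -
  note d = uq_homD(1,2)[OF assms(4)] uq_homD(1,2)[OF assms(5)]
  have "kron (1\<^sub>m (rep_dim B)) \<beta> \<in> uq_hom (uq_tensor B uq_trivial) (uq_tensor B (uq_tensor W C))"
    using assms by (intro hom_kron[of v]) auto
  moreover have "kron \<alpha> (1\<^sub>m (rep_dim C)) \<in> uq_hom (uq_tensor (uq_tensor B W) C) (uq_tensor uq_trivial C)"
    using assms by (intro hom_kron[of v]) auto
  ultimately have "kron \<alpha> (1\<^sub>m (rep_dim C)) * kron (1\<^sub>m (rep_dim B)) \<beta> \<in> uq_hom B C"
    using assms by (intro hom_comp[of v B "uq_tensor B (uq_tensor W C)"]) (auto simp: uq_tensor_unit[of v] uq_tensor_assoc[of v])
  then show ?thesis using d by (simp add: mateA[where b = "rep_dim B" and w = "rep_dim W" and c = "rep_dim C"])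
qed

lemma mateB_hom:
  assumes "wrep v B" "wrep v W" "wrep v C" "\<alpha> \<in> uq_hom (uq_tensor W C) uq_trivial" "\<beta> \<in> uq_hom uq_trivial (uq_tensor B W)"
  shows "csh (rep_dim B) (rep_dim W) \<beta> * rsh (rep_dim W) (rep_dim C) \<alpha> \<in> uq_hom C B"
proof -
  note d = uq_homD(1,2)[OF assms(4)] uq_homD(1,2)[OF assms(5)]
  have "kron \<beta> (1\<^sub>m (rep_dim C)) \<in> uq_hom (uq_tensor uq_trivial C) (uq_tensor (uq_tensor B W) C)"
    using assms by (intro hom_kron[of v]) auto
  moreover have "kron (1\<^sub>m (rep_dim B)) \<alpha> \<in> uq_hom (uq_tensor B (uq_tensor W C)) (uq_tensor B uq_trivial)"
    using assms by (intro hom_kron[of v]) auto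
  ultimately have "kron (1\<^sub>m (rep_dim B)) \<alpha> * kron \<beta> (1\<^sub>m (rep_dim C)) \<in> uq_hom C B"
    using assms by (intro hom_comp[of v C "uq_tensor B (uq_tensor W C)"]) (auto simp: uq_tensor_unit[of v] uq_tensor_assoc[of v])
  then show ?thesis using d by (simp add: mateB[where b = "rep_dim B" and w = "rep_dim W" and c = "rep_dim C"])
qed

text \<open>The mate of a factorisation through \<open>V^{\<otimes>m}\<close> is a factorisation through its dual, which is \<open>V^{\<otimes>m}\<close> again.\<close>

lemma thru_dualA:
  assumes A: "wrep v A" and B: "wrep v B"
    and ev: "ev \<in> uq_hom (uq_tensor B A) uq_trivial" and coev: "coev \<in> uq_hom uq_trivial (uq_tensor A B)"
    and h: "thru (range Vp) A A h"
  shows "thru (range Vp) B B (transpose_mat (rsh (rep_dim B) (rep_dim A) ev * h * csh (rep_dim A) (rep_dim B) coev))"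
  using h
proof (induction)
  define a b where "a = rep_dim A" and "b = rep_dim B"
  define P Q where "P = rsh b a ev" and "Q = csh a b coev"
  have dPQ [simp]: "dim_row P = b" "dim_col P = a" "dim_row Q = a" "dim_col Q = b" by (auto simp: P_def Q_def)
  note dev = uq_homD(1,2)[OF ev] uq_homD(1,2)[OF coev]
  {
    case thru_zero
    have "transpose_mat (P * 0\<^sub>m a a * Q) = 0\<^sub>m b b" by (intro eq_matI) (auto simp: mult_index_sum simp del: index_mult_mat(1))
    then show ?case using thru.thru_zero[of "range Vp" B B] by (simp add: P_def Q_def a_def b_def)
  next
    case (thru_add W g f h)
    then obtain n where W: "W = Vp n" by auto
    define w :: nat where "w = 2 ^ n"
    have wW: "rep_dim W = w" by (simp add: W Vp_dim w_def)
    obtain evw coevw where sd: "evw \<in> uq_hom (uq_tensor (Vp n) (Vp n)) uq_trivial" "coevw \<in> uq_hom uq_trivial (uq_tensor (Vp n) (Vp n))"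
      "csh (2 ^ n) (2 ^ n) coevw * rsh (2 ^ n) (2 ^ n) evw = 1\<^sub>m (2 ^ n)" "rsh (2 ^ n) (2 ^ n) evw * csh (2 ^ n) (2 ^ n) coevw = 1\<^sub>m (2 ^ n)"
      by (rule selfdual_Vp)
    note evw = sd(1)[folded W] and coevw = sd(2)[folded W] and QP = sd(3)[folded w_def]
    note df = uq_homD(1,2)[OF thru_add(3)] uq_homD(1,2)[OF thru_add(4)] uq_homD(1,2)[OF thru_hom[OF thru_add(5) A A]]
    have \<alpha>: "ev * kron (1\<^sub>m b) f \<in> uq_hom (uq_tensor B W) uq_trivial"
      unfolding b_def using A B ev thru_add(2,4)
      by (intro hom_comp[of v _ "uq_tensor B A"] hom_kron[of v]) auto
    have r1: "rsh b w (ev * kron (1\<^sub>m b) f) = P * f"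
      using rsh_right[of ev b f] df dev by (simp add: P_def a_def b_def wW)
    have \<beta>: "kron g (1\<^sub>m b) * coev \<in> uq_hom uq_trivial (uq_tensor W B)"
      unfolding b_def using A B coev thru_add(2,3)
      by (intro hom_comp[of v _ "uq_tensor A B"] hom_kron[of v]) auto
    have r2: "csh w b (kron g (1\<^sub>m b) * coev) = g * Q"
      using csh_left[of coev g b] df dev by (simp add: Q_def a_def b_def wW)
    have g': "transpose_mat (P * f * csh w w coevw) \<in> uq_hom B W"
      using mateA_hom[OF B thru_add(2) thru_add(2) \<alpha> coevw] r1 by (simp add: b_def wW)
    have f': "transpose_mat (rsh w w evw * (g * Q)) \<in> uq_hom W B"
      using mateA_hom[OF thru_add(2) thru_add(2) B evw \<beta>] r2 by (simp add: b_def wW)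
    have "P * (f * g) * Q = P * f * (1\<^sub>m w * (g * Q))"
      using df by (simp add: mult_assoc_dim one_mult_dim a_def wW)
    also have "\<dots> = (P * f * csh w w coevw) * (rsh w w evw * (g * Q))"
      unfolding QP[symmetric] using df by (simp add: mult_assoc_dim a_def wW)
    finally have e: "P * (f * g) * Q = (P * f * csh w w coevw) * (rsh w w evw * (g * Q))" .
    have "transpose_mat (P * (f * g) * Q) = transpose_mat (rsh w w evw * (g * Q)) * transpose_mat (P * f * csh w w coevw)"
      unfolding e by (rule transpose_mult[of _ b w _ b]) (use df in \<open>auto intro!: carrier_matI simp: a_def wW\<close>)
    moreover have "P * (f * g + h) * Q = P * (f * g) * Q + P * h * Q"
      using df by (simp add: mult_add_dim add_mult_dim a_def)
    moreover have "transpose_mat (P * (f * g) * Q + P * h * Q) = transpose_mat (P * (f * g) * Q) + transpose_mat (P * h * Q)"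
      by (rule transpose_add[of _ b b]) (auto intro: carrier_matI)
    ultimately have "transpose_mat (P * (f * g + h) * Q) = transpose_mat (rsh w w evw * (g * Q)) * transpose_mat (P * f * csh w w coevw) + transpose_mat (P * h * Q)"
      by simp
    then show ?case
      using thru.thru_add[OF thru_add(1,2) g' f' thru_add(6)[folded a_def b_def P_def Q_def]] by (simp add: P_def Q_def a_def b_def)
  }
qed

lemma thru_dualB:
  assumes A: "wrep v A" and B: "wrep v B"
    and ev: "ev \<in> uq_hom (uq_tensor A B) uq_trivial" and coev: "coev \<in> uq_hom uq_trivial (uq_tensor B A)"
    and h: "thru (range Vp) A A h"
  shows "thru (range Vp) B B (csh (rep_dim B) (rep_dim A) coev * transpose_mat h * rsh (rep_dim A) (rep_dim B) ev)"
  using h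
proof (induction)
  define a b where "a = rep_dim A" and "b = rep_dim B"
  define P Q where "P = rsh a b ev" and "Q = csh b a coev"
  have dPQ [simp]: "dim_row P = a" "dim_col P = b" "dim_row Q = b" "dim_col Q = a" by (auto simp: P_def Q_def)
  note dev = uq_homD(1,2)[OF ev] uq_homD(1,2)[OF coev]
  {
    case thru_zero
    have "Q * transpose_mat (0\<^sub>m a a) * P = 0\<^sub>m b b" by (intro eq_matI) (auto simp: mult_index_sum simp del: index_mult_mat(1))
    then show ?case using thru.thru_zero[of "range Vp" B B] by (simp add: P_def Q_def a_def b_def)
  next
    case (thru_add W g f h)
    then obtain n where W: "W = Vp n" by auto
    define w :: nat where "w = 2 ^ n"
    have wW: "rep_dim W = w" by (simp add: W Vp_dim w_def)
    obtain evw coevw where sd: "evw \<in> uq_hom (uq_tensor (Vp n) (Vp n)) uq_trivial" "coevw \<in> uq_hom uq_trivial (uq_tensor (Vp n) (Vp n))"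
      "csh (2 ^ n) (2 ^ n) coevw * rsh (2 ^ n) (2 ^ n) evw = 1\<^sub>m (2 ^ n)" "rsh (2 ^ n) (2 ^ n) evw * csh (2 ^ n) (2 ^ n) coevw = 1\<^sub>m (2 ^ n)"
      by (rule selfdual_Vp)
    note evw = sd(1)[folded W] and coevw = sd(2)[folded W] and PQ = sd(4)[folded w_def]
    note df = uq_homD(1,2)[OF thru_add(3)] uq_homD(1,2)[OF thru_add(4)] uq_homD(1,2)[OF thru_hom[OF thru_add(5) A A]]
    have \<alpha>: "ev * kron f (1\<^sub>m b) \<in> uq_hom (uq_tensor W B) uq_trivial"
      unfolding b_def using A B ev thru_add(2,4)
      by (intro hom_comp[of v _ "uq_tensor A B"] hom_kron[of v]) auto
    have r1: "rsh w b (ev * kron f (1\<^sub>m b)) = transpose_mat f * P"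
      using rsh_left[of ev f b] df dev by (simp add: P_def a_def b_def wW)
    have \<beta>: "kron (1\<^sub>m b) g * coev \<in> uq_hom uq_trivial (uq_tensor B W)"
      unfolding b_def using A B coev thru_add(2,3)
      by (intro hom_comp[of v _ "uq_tensor B A"] hom_kron[of v]) auto
    have r2: "csh b w (kron (1\<^sub>m b) g * coev) = Q * transpose_mat g"
      using csh_right[of coev b g] df dev by (simp add: Q_def a_def b_def wW)
    have g': "csh w w coevw * (transpose_mat f * P) \<in> uq_hom B W"
      using mateB_hom[OF thru_add(2) thru_add(2) B \<alpha> coevw] r1 by (simp add: b_def wW)
    have f': "Q * transpose_mat g * rsh w w evw \<in> uq_hom W B"
      using mateB_hom[OF B thru_add(2) thru_add(2) evw \<beta>] r2 by (simp add: b_def wW)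
    have e: "transpose_mat (f * g) = transpose_mat g * transpose_mat f"
      by (rule transpose_mult[of f a w g a]) (use df in \<open>auto intro!: carrier_matI simp: a_def wW\<close>)
    have "Q * transpose_mat (f * g) * P = Q * transpose_mat g * (1\<^sub>m w * (transpose_mat f * P))"
      unfolding e using df by (simp add: mult_assoc_dim one_mult_dim a_def wW)
    also have "\<dots> = (Q * transpose_mat g * rsh w w evw) * (csh w w coevw * (transpose_mat f * P))"
      unfolding PQ[symmetric] using df by (simp add: mult_assoc_dim a_def wW)
    finally have 1: "Q * transpose_mat (f * g) * P = (Q * transpose_mat g * rsh w w evw) * (csh w w coevw * (transpose_mat f * P))" .
    have "transpose_mat (f * g + h) = transpose_mat (f * g) + transpose_mat h"
      using df by (intro transpose_add[of _ a a]) (auto intro: carrier_matI simp: a_def)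
    then have "Q * transpose_mat (f * g + h) * P = (Q * transpose_mat g * rsh w w evw) * (csh w w coevw * (transpose_mat f * P)) + Q * transpose_mat h * P"
      using df 1 by (simp add: mult_add_dim add_mult_dim a_def)
    then show ?case
      using thru.thru_add[OF thru_add(1,2) g' f' thru_add(6)[folded a_def b_def P_def Q_def]] by (simp add: P_def Q_def a_def b_def)
  }
qed

lemma inv_assoc_Rep:
  "inv_mor (Rep_Uq v) (uq_tensor (uq_tensor X Y) Z) (uq_tensor X (uq_tensor Y Z)) (1\<^sub>m (rep_dim X * rep_dim Y * rep_dim Z))
     = 1\<^sub>m (rep_dim X * rep_dim Y * rep_dim Z)"
  if "wrep v X" "wrep v Y" "wrep v Z"
proof -
  have e: "uq_tensor (uq_tensor X Y) Z = uq_tensor X (uq_tensor Y Z)" using that by (simp add: uq_tensor_assoc[of v])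
  have w: "wrep v (uq_tensor X (uq_tensor Y Z))" using that by simp
  have i: "1\<^sub>m (rep_dim X * rep_dim Y * rep_dim Z) \<in> uq_hom (uq_tensor X (uq_tensor Y Z)) (uq_tensor X (uq_tensor Y Z))"
    using hom_id[OF w] by (simp add: mult.assoc)
  show ?thesis
    unfolding inv_mor_def inverse_mors_def e using i
    by (intro the_equality) (auto simp: mult.assoc one_mult_dim mult_one_dim uq_homD(1,2))
qed

text \<open>The objects obtained from \<open>V\<close> are the summands of sums of its tensor powers.  All closure operations are
  immediate for \<open>thru\<close> except the duals, where the zigzag identity exhibits the identity of the dual
  object as a mate.\<close>

lemma thru_T: "X \<in> T \<Longrightarrow> thru (range Vp) X X (1\<^sub>m (rep_dim X))"
  unfolding T_def
proof (induction rule: generated_objs.induct)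
  case gen_base
  show ?case using thru_base[of V "range Vp" V V "1\<^sub>m 2" "1\<^sub>m 2"] hom_id[of v V] range_eqI[of V Vp 1]
    by (simp add: Vp_1 one_mult_dim uq_tensor_unit[of v])
next
  case gen_unit
  show ?case using thru_base[of uq_trivial "range Vp" uq_trivial uq_trivial "1\<^sub>m 1" "1\<^sub>m 1"] hom_id[of v uq_trivial] range_eqI[of uq_trivial Vp 0]
    by (simp add: one_mult_dim)
next
  case (gen_tensor A B)
  then show ?case
    using thru_tensor[of "range Vp" A A "1\<^sub>m (rep_dim A)" "range Vp" B B "1\<^sub>m (rep_dim B)" "range Vp", OF gen_tensor(3,4)]
    by (fastforce simp: T_def[symmetric] kron_one_one Vp_add)
next
  case (gen_sum A B S)
  have w: "wrep v A" "wrep v B" "wrep v S" using gen_sum is_uq_rep_wrep by (auto simp: T_def[symmetric])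
  from gen_sum.hyps(4) obtain i j p r where h: "i \<in> uq_hom A S" "j \<in> uq_hom B S" "p \<in> uq_hom S A" "r \<in> uq_hom S B"
    and e: "i * p + j * r = 1\<^sub>m (rep_dim S)"
    unfolding biproduct_of_def by auto
  have "thru (range Vp) S S (i * 1\<^sub>m (rep_dim A) * p + j * 1\<^sub>m (rep_dim B) * r)"
    using w h gen_sum by (intro thru_plus thru_comp[of _ A A] thru_comp[of _ B B]) auto
  then show ?case using e uq_homD(1,2)[OF h(1)] uq_homD(1,2)[OF h(2)] by (simp add: mult_one_dim)
next
  case (gen_summand A B)
  have w: "wrep v A" "wrep v B" using gen_summand is_uq_rep_wrep by (auto simp: T_def[symmetric])
  from gen_summand.hyps(3) obtain i p where h: "i \<in> uq_hom B A" "p \<in> uq_hom A B" and e: "p * i = 1\<^sub>m (rep_dim B)"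
    unfolding retract_of_def by auto
  have "thru (range Vp) B B (p * 1\<^sub>m (rep_dim A) * i)"
    using w h gen_summand by (intro thru_comp[of _ A A]) auto
  then show ?case using e uq_homD(1,2)[OF h(2)] by (simp add: mult_one_dim)
next
  case (gen_dual A B)
  have w: "wrep v A" "wrep v B" using gen_dual is_uq_rep_wrep by (auto simp: T_def[symmetric])
  define a b where "a = rep_dim A" and "b = rep_dim B"
  note ia = inv_assoc_Rep[OF w(2) w(1) w(2)]
  from gen_dual.hyps(3) show ?case
  proof
    assume "left_dual_of (Rep_Uq v) A B"
    then obtain ev coev where ev: "ev \<in> uq_hom (uq_tensor B A) uq_trivial" and coev: "coev \<in> uq_hom uq_trivial (uq_tensor A B)"
      and z: "1\<^sub>m b * (kron ev (1\<^sub>m b) * (1\<^sub>m (b * a * b) * kron (1\<^sub>m b) coev)) = 1\<^sub>m b"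
      unfolding left_dual_of_def Let_def using w ia by (auto simp: a_def b_def)
    note d = uq_homD(1,2)[OF ev] uq_homD(1,2)[OF coev]
    have "kron ev (1\<^sub>m b) * kron (1\<^sub>m b) coev = 1\<^sub>m b"
      using z d by (simp add: one_mult_dim a_def b_def mult.assoc)
    then have "transpose_mat (rsh b a ev * csh a b coev) = 1\<^sub>m b"
      using d by (subst mateA[symmetric]) (auto simp: a_def b_def)
    moreover have "thru (range Vp) B B (transpose_mat (rsh b a ev * 1\<^sub>m a * csh a b coev))"
      unfolding a_def b_def using w ev coev gen_dual by (intro thru_dualA) auto
    ultimately show ?thesis by (simp add: mult_one_dim b_def)
  next
    assume "left_dual_of (Rep_Uq v) B A"
    then obtain ev coev where ev: "ev \<in> uq_hom (uq_tensor A B) uq_trivial" and coev: "coev \<in> uq_hom uq_trivial (uq_tensor B A)"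
      and z: "1\<^sub>m b * (kron (1\<^sub>m b) ev * (1\<^sub>m (b * a * b) * kron coev (1\<^sub>m b))) = 1\<^sub>m b"
      unfolding left_dual_of_def Let_def using w ia by (auto simp: a_def b_def)
    note d = uq_homD(1,2)[OF ev] uq_homD(1,2)[OF coev]
    have "kron (1\<^sub>m b) ev * kron coev (1\<^sub>m b) = 1\<^sub>m b"
      using z d by (simp add: one_mult_dim a_def b_def mult.assoc)
    then have "csh b a coev * rsh a b ev = 1\<^sub>m b"
      using d by (subst mateB[symmetric]) (auto simp: a_def b_def)
    moreover have "thru (range Vp) B B (csh b a coev * transpose_mat (1\<^sub>m a) * rsh a b ev)"
      unfolding a_def b_def using w ev coev gen_dual by (intro thru_dualB) auto
    ultimately show ?thesis by (simp add: mult_one_dim b_def)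
  qed
qed

subsection \<open>Sphericality\<close>

lemma spherical_Vp: "f \<in> uq_hom (Vp n) (Vp n) \<Longrightarrow> mtr (rep_K (Vp n) * f) = mtr (rep_Kinv (Vp n) * f)"
proof (induction n arbitrary: f)
  case 0
  then show ?case by simp
next
  case (Suc n)
  define x :: nat where "x = 2 ^ n"
  let ?X = "Vp n"
  have f: "f \<in> uq_hom (uq_tensor ?X V) (uq_tensor ?X V)" using Suc(2) by (simp only: Vp_Suc')
  have df: "dim_row f = x * 2" "dim_col f = x * 2" using uq_homD(1,2)[OF f] by (auto simp: Vp_dim x_def)
  have dK [simp]: "dim_row (rep_K ?X) = x" "dim_col (rep_K ?X) = x" "dim_row (rep_Kinv ?X) = x" "dim_col (rep_Kinv ?X) = x" "rep_dim ?X = x"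
    using wrep_dims[of v ?X] by (auto simp: Vp_dim x_def)
  let ?KV = "rep_K V" and ?KV' = "rep_Kinv V"
  have dV [simp]: "dim_row ?KV = 2" "dim_col ?KV = 2" "dim_row ?KV' = 2" "dim_col ?KV' = 2" by auto
  note V_simps [simp del]
  have V2: "rep_dim V = 2" by (simp add: V_simps)
  define R where "R = ptrR x x 2 (kron (1\<^sub>m x) ?KV * f)"
  define L where "L = ptrL 2 2 x (kron (rep_Kinv ?X) (1\<^sub>m 2) * f)"
  have R: "R \<in> uq_hom ?X ?X" using ptrR_hom[of v ?X ?X V f] f by (simp add: R_def V2)
  have L: "L \<in> uq_hom V V" using ptrL_hom[of v V V ?X f] f by (simp add: L_def V2)
  have PR: "mtr (kron P ?KV * f) = mtr (P * R)" if "dim_row P = x" "dim_col P = x" for P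
  proof -
    have "kron P ?KV * f = kron P (1\<^sub>m 2) * (kron (1\<^sub>m x) ?KV * f)"
      using that df by (simp add: kron_mult_assoc one_mult_dim mult_one_dim)
    then have "mtr (kron P ?KV * f) = mtr (ptrR x x 2 (kron P (1\<^sub>m 2) * (kron (1\<^sub>m x) ?KV * f)))"
      using that df by (simp add: mtr_ptrR)
    also have "\<dots> = mtr (P * R)" using ptrR_left[of "kron (1\<^sub>m x) ?KV * f" P 2 x] that df by (simp add: R_def)
    finally show ?thesis .
  qed
  have PL: "mtr (kron (rep_Kinv ?X) P * f) = mtr (P * L)" if "dim_row P = 2" "dim_col P = 2" for P
  proof -
    have "kron (rep_Kinv ?X) P * f = kron (1\<^sub>m x) P * (kron (rep_Kinv ?X) (1\<^sub>m 2) * f)"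
      using that df by (simp add: kron_mult_assoc one_mult_dim mult_one_dim)
    then have "mtr (kron (rep_Kinv ?X) P * f) = mtr (ptrL 2 2 x (kron (1\<^sub>m x) P * (kron (rep_Kinv ?X) (1\<^sub>m 2) * f)))"
      using that df by (simp add: mtr_ptrL)
    also have "\<dots> = mtr (P * L)" using ptrL_left[of "kron (rep_Kinv ?X) (1\<^sub>m 2) * f" x P 2] that df by (simp add: L_def)
    finally show ?thesis .
  qed
  obtain s where s: "L = s \<cdot>\<^sub>m 1\<^sub>m 2" using End_V[OF L] by blast
  have "mtr (kron (rep_K ?X) ?KV * f) = mtr (rep_Kinv ?X * R)" using Suc(1)[OF R] by (simp add: PR)
  also have "\<dots> = mtr (?KV * L)" by (simp add: PR[symmetric] PL)
  also have "\<dots> = mtr (?KV' * L)" using traces(1,2) by (simp add: s mult_smult_dim mult_one_dim mtr_smult)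
  also have "\<dots> = mtr (kron (rep_Kinv ?X) ?KV' * f)" by (simp add: PL)
  finally show ?case by (simp only: Vp_Suc' rep_tensor_simps)
qed

text \<open>Left and right quantum traces agree on tensor powers of \<open>V\<close>, by removing one strand at a time with a
  partial trace, and then on all objects by cyclicity of the trace.\<close>

lemma spherical:
  assumes X: "X \<in> T" and f: "f \<in> uq_hom X X"
  shows "mtr (rep_K X * f) = mtr (rep_Kinv X * f)"
proof -
  have w: "wrep v X" using X by simp
  have "mtr (rep_K X * (h * f)) = mtr (rep_Kinv X * (h * f))" if "thru (range Vp) X X h" for h
    using that
  proof (induction)
    case thru_zero
    have "0\<^sub>m (rep_dim X) (rep_dim X) * f = 0\<^sub>m (rep_dim X) (rep_dim X)"
      using uq_homD(3)[OF f] by simp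
    then show ?case using w by (simp add: mtr_def del: index_mult_mat(1))
  next
    case (thru_add W b a h)
    then obtain n where W: "W = Vp n" by auto
    note d = uq_homD(1,2)[OF f] uq_homD(1,2)[OF thru_add(3)] uq_homD(1,2)[OF thru_add(4)] uq_homD(1,2)[OF thru_hom[OF thru_add(5) w w]]
    have bfa: "b * f * a \<in> uq_hom W W"
      using hom_comp[OF thru_add(2) w w thru_add(4) f] hom_comp[OF w w thru_add(2) f thru_add(3)]
        hom_comp[OF thru_add(2) w thru_add(2) thru_add(4), of "b * f"] by simp
    have "mtr (K * (a * b * f)) = mtr (K' * (b * f * a))" if "a * K' = K * a" "dim_row K = rep_dim X" "dim_col K = rep_dim X" "dim_row K' = rep_dim W" "dim_col K' = rep_dim W" for K K'
    proof -
      have "mtr (K * (a * b * f)) = mtr ((a * K') * (b * f))" unfolding that(1) using d that(2-) by (simp add: mult_assoc_dim)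
      also have "\<dots> = mtr ((K' * (b * f)) * a)" using d that(2-) by (simp add: mult_assoc_dim mtr_comm[of a])
      finally show ?thesis using d that(2-) by (simp add: mult_assoc_dim)
    qed
    from this[OF uq_homD(6)[OF thru_add(4)]] this[OF uq_hom_Kinv[OF thru_add(2) w thru_add(4)]]
    have "mtr (rep_K X * (a * b * f)) = mtr (rep_Kinv X * (a * b * f))"
      using spherical_Vp[of "b * f * a" n] bfa wrep_dims[OF w] wrep_dims[OF Vp_wrep, of n] by (simp add: W)
    moreover have "mtr (K * ((a * b + h) * f)) = mtr (K * (a * b * f)) + mtr (K * (h * f))" if "dim_row K = rep_dim X" "dim_col K = rep_dim X" for K
      using d that by (simp add: add_mult_dim mult_add_dim mtr_add)
    ultimately show ?case using thru_add(6) w by simp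
  qed
  from this[OF thru_T[OF X]] show ?thesis using uq_homD(1)[OF f] by (simp add: one_mult_dim)
qed

section \<open>Negligible morphisms\<close>

lemmas hadd = hom_add[of v] and hsm = hom_smult[of v] and hcomp = hom_comp[of v] and hkron = hom_kron[of v]

definition Neg :: "'k uq_rep \<Rightarrow> 'k uq_rep \<Rightarrow> 'k mat set" where
  "Neg X Y = {f \<in> uq_hom X Y. \<forall>g\<in>uq_hom Y X. mtr (rep_K X * (g * f)) = 0}"

lemma Neg_hom: "f \<in> Neg X Y \<Longrightarrow> f \<in> uq_hom X Y" by (simp add: Neg_def)

lemma Neg_zero: "wrep v X \<Longrightarrow> wrep v Y \<Longrightarrow> 0\<^sub>m (rep_dim Y) (rep_dim X) \<in> Neg X Y"
  unfolding Neg_def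
proof (intro CollectI conjI ballI)
  fix g assume w: "wrep v X" "wrep v Y" and g: "g \<in> uq_hom Y X"
  have "g * 0\<^sub>m (rep_dim Y) (rep_dim X) = 0\<^sub>m (rep_dim X) (rep_dim X)" using uq_homD(3)[OF g] by simp
  moreover have "rep_K X * 0\<^sub>m (rep_dim X) (rep_dim X) = 0\<^sub>m (rep_dim X) (rep_dim X)"
    using w by (intro right_mult_zero_mat) (auto simp: wrep_def)
  ultimately show "mtr (rep_K X * (g * 0\<^sub>m (rep_dim Y) (rep_dim X))) = 0"
    by (simp add: mtr_def)
qed (rule hom_zero)

lemma Neg_add:
  assumes "wrep v X" "wrep v Y" "f \<in> Neg X Y" "g \<in> Neg X Y"
  shows "f + g \<in> Neg X Y"
proof -
  note d = uq_homD(1,2)[OF Neg_hom[OF assms(3)]] uq_homD(1,2)[OF Neg_hom[OF assms(4)]]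
  have "mtr (rep_K X * (h * (f + g))) = 0" if h: "h \<in> uq_hom Y X" for h
  proof -
    have "rep_K X * (h * (f + g)) = rep_K X * (h * f) + rep_K X * (h * g)"
      using d uq_homD(1,2)[OF h] assms(1) by (simp add: mult_add_dim)
    then show ?thesis
      using assms d uq_homD(1,2)[OF h] h by (simp add: mtr_add Neg_def)
  qed
  then show ?thesis using assms hom_add by (auto simp: Neg_def)
qed

lemma Neg_smult:
  assumes "wrep v X" "wrep v Y" "f \<in> Neg X Y"
  shows "a \<cdot>\<^sub>m f \<in> Neg X Y"
proof -
  note d = uq_homD(1,2)[OF Neg_hom[OF assms(3)]]
  have "mtr (rep_K X * (h * (a \<cdot>\<^sub>m f))) = 0" if h: "h \<in> uq_hom Y X" for h
    using assms d uq_homD(1,2)[OF h] h by (simp add: mult_smult_dim mtr_smult Neg_def)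
  then show ?thesis using assms hom_smult by (auto simp: Neg_def)
qed

lemma Neg_compL:
  assumes w: "wrep v X" "wrep v Y" "wrep v Z" and f: "f \<in> Neg X Y" and g: "g \<in> uq_hom Y Z"
  shows "g * f \<in> Neg X Z"
proof -
  note d = uq_homD(1,2)[OF Neg_hom[OF f]] uq_homD(1,2)[OF g]
  have "mtr (rep_K X * (h * (g * f))) = 0" if h: "h \<in> uq_hom Z X" for h
  proof -
    have "h * g \<in> uq_hom Y X" using hom_comp[OF w(2,3,1) g h] .
    then have "mtr (rep_K X * (h * g * f)) = 0" using f by (auto simp: Neg_def)
    then show ?thesis using d uq_homD(1,2)[OF h] w by (simp add: mult_assoc_dim)
  qed
  then show ?thesis using hom_comp[OF w(1,2,3) Neg_hom[OF f] g] by (auto simp: Neg_def)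
qed

lemma trace_cyclic:
  assumes w: "wrep v X" "wrep v Y" and f: "f \<in> uq_hom X Y" and g: "g \<in> uq_hom Y X"
  shows "mtr (rep_K X * (g * f)) = mtr (rep_K Y * (f * g))"
proof -
  note d = uq_homD(1,2)[OF f] uq_homD(1,2)[OF g] wrep_dims[OF w(1)] wrep_dims[OF w(2)]
  have "mtr (rep_K X * (g * f)) = mtr ((rep_K X * g) * f)" using d by (simp add: mult_assoc_dim)
  also have "\<dots> = mtr ((g * rep_K Y) * f)" using uq_homD(6)[OF g] by simp
  also have "\<dots> = mtr (g * (rep_K Y * f))" using d by (simp add: mult_assoc_dim)
  also have "\<dots> = mtr ((rep_K Y * f) * g)" using d by (intro mtr_comm) auto
  also have "\<dots> = mtr (rep_K Y * (f * g))" using d by (simp add: mult_assoc_dim)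
  finally show ?thesis .
qed

lemma Neg_compR:
  assumes w: "wrep v X" "wrep v Y" "wrep v Z" and g: "g \<in> Neg Y Z" and f: "f \<in> uq_hom X Y"
  shows "g * f \<in> Neg X Z"
proof -
  note d = uq_homD(1,2)[OF Neg_hom[OF g]] uq_homD(1,2)[OF f]
  have "mtr (rep_K X * (h * (g * f))) = 0" if h: "h \<in> uq_hom Z X" for h
  proof -
    have hg: "h * g \<in> uq_hom Y X" using hom_comp[OF w(2,3,1) Neg_hom[OF g] h] .
    have fh: "f * h \<in> uq_hom Z Y" using hom_comp[OF w(3,1,2) h f] .
    have "mtr (rep_K X * (h * (g * f))) = mtr (rep_K X * ((h * g) * f))" using d uq_homD(1,2)[OF h] by (simp add: mult_assoc_dim)
    also have "\<dots> = mtr (rep_K Y * (f * (h * g)))" by (rule trace_cyclic[OF w(1,2) f hg])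
    also have "\<dots> = mtr (rep_K Y * ((f * h) * g))" using d uq_homD(1,2)[OF h] by (simp add: mult_assoc_dim)
    also have "\<dots> = 0" using g fh by (auto simp: Neg_def)
    finally show ?thesis .
  qed
  then show ?thesis using hom_comp[OF w(1,2,3) f Neg_hom[OF g]] by (auto simp: Neg_def)
qed

text \<open>The trace over the second factor turns a pairing with \<open>f \<otimes> a\<close> into a pairing with \<open>f\<close>.\<close>

lemma Neg_kronR:
  assumes T: "X \<in> T" "Y \<in> T" "A \<in> T" "A' \<in> T" and f: "f \<in> Neg X Y" and a: "a \<in> uq_hom A A'"
  shows "kron f a \<in> Neg (uq_tensor X A) (uq_tensor Y A')"
proof -
  have w: "wrep v X" "wrep v Y" "wrep v A" "wrep v A'" using T by auto
  note d = uq_homD(1,2)[OF Neg_hom[OF f]] uq_homD(1,2)[OF a] wrep_dims[OF w(1)] wrep_dims[OF w(3)]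
  let ?i = "1\<^sub>m (rep_dim A)"
  have "kron f ?i \<in> Neg (uq_tensor X A) (uq_tensor Y A)"
    unfolding Neg_def
  proof (intro CollectI conjI ballI)
    show "kron f ?i \<in> uq_hom (uq_tensor X A) (uq_tensor Y A)" using w Neg_hom[OF f] by (intro hom_kron[of v]) auto
    fix g assume g: "g \<in> uq_hom (uq_tensor Y A) (uq_tensor X A)"
    note dg = uq_homD(1,2)[OF g, simplified]
    define k where "k = kron (1\<^sub>m (rep_dim X)) (rep_K A) * g"
    have dk: "dim_row k = rep_dim X * rep_dim A" "dim_col k = rep_dim Y * rep_dim A" using dg d by (auto simp: k_def)
    have P: "ptrR (rep_dim X) (rep_dim Y) (rep_dim A) k \<in> uq_hom Y X"
      unfolding k_def using w g by (intro ptrR_hom[of v]) auto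
    have "rep_K (uq_tensor X A) * (g * kron f ?i) = kron (rep_K X) ?i * (k * kron f ?i)"
      using d dg by (simp add: k_def mult_assoc_dim kron_mult_assoc one_mult_dim mult_one_dim)
    then have "mtr (rep_K (uq_tensor X A) * (g * kron f ?i)) = mtr (kron (rep_K X) ?i * (k * kron f ?i))" by simp
    also have "\<dots> = mtr (ptrR (rep_dim X) (rep_dim X) (rep_dim A) (kron (rep_K X) ?i * (k * kron f ?i)))"
      using d dk by (simp add: mtr_ptrR)
    also have "\<dots> = mtr (rep_K X * ptrR (rep_dim X) (rep_dim X) (rep_dim A) (k * kron f ?i))"
      using ptrR_left[of "k * kron f ?i" "rep_K X" "rep_dim A" "rep_dim X"] d dk by simp
    also have "\<dots> = mtr (rep_K X * (ptrR (rep_dim X) (rep_dim Y) (rep_dim A) k * f))"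
      using ptrR_right[of k f "rep_dim A" "rep_dim X"] d dk by simp
    also have "\<dots> = 0" using f P by (auto simp: Neg_def)
    finally show "mtr (rep_K (uq_tensor X A) * (g * kron f ?i)) = 0" .
  qed
  moreover have "kron (1\<^sub>m (rep_dim Y)) a \<in> uq_hom (uq_tensor Y A) (uq_tensor Y A')"
    using w a by (intro hom_kron[of v]) auto
  ultimately have "kron (1\<^sub>m (rep_dim Y)) a * kron f ?i \<in> Neg (uq_tensor X A) (uq_tensor Y A')"
    using w by (intro Neg_compL[of _ "uq_tensor Y A"]) auto
  then show ?thesis using d by (simp add: kron_mult one_mult_dim mult_one_dim)
qed

text \<open>The trace over the left tensor factor needs the inverse of \<open>K\<close>; sphericality turns it into \<open>K\<close>.\<close>

lemma Neg_kronL: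
  assumes T: "X \<in> T" "Y \<in> T" "A \<in> T" "A' \<in> T" and f: "f \<in> Neg X Y" and a: "a \<in> uq_hom A A'"
  shows "kron a f \<in> Neg (uq_tensor A X) (uq_tensor A' Y)"
proof -
  have w: "wrep v X" "wrep v Y" "wrep v A" "wrep v A'" using T by auto
  note d = uq_homD(1,2)[OF Neg_hom[OF f]] uq_homD(1,2)[OF a] wrep_dims[OF w(1)] wrep_dims[OF w(3)]
  let ?i = "1\<^sub>m (rep_dim A)"
  have "kron ?i f \<in> Neg (uq_tensor A X) (uq_tensor A Y)"
    unfolding Neg_def
  proof (intro CollectI conjI ballI)
    show h: "kron ?i f \<in> uq_hom (uq_tensor A X) (uq_tensor A Y)" using w Neg_hom[OF f] by (intro hom_kron[of v]) auto
    fix g assume g: "g \<in> uq_hom (uq_tensor A Y) (uq_tensor A X)"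
    note dg = uq_homD(1,2)[OF g, simplified]
    define k where "k = kron (rep_Kinv A) (1\<^sub>m (rep_dim X)) * g"
    have dk: "dim_row k = rep_dim A * rep_dim X" "dim_col k = rep_dim A * rep_dim Y" using dg d by (auto simp: k_def)
    have P: "ptrL (rep_dim X) (rep_dim Y) (rep_dim A) k \<in> uq_hom Y X"
      unfolding k_def using w g by (intro ptrL_hom[of v]) auto
    have "g * kron ?i f \<in> uq_hom (uq_tensor A X) (uq_tensor A X)"
      using w g h by (intro hom_comp[of v _ "uq_tensor A Y"]) auto
    then have "mtr (rep_K (uq_tensor A X) * (g * kron ?i f)) = mtr (rep_Kinv (uq_tensor A X) * (g * kron ?i f))"
      using T by (intro spherical) auto
    also have "rep_Kinv (uq_tensor A X) * (g * kron ?i f) = kron ?i (rep_Kinv X) * (k * kron ?i f)"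
      using d dg by (simp add: k_def mult_assoc_dim kron_mult_assoc one_mult_dim mult_one_dim)
    also have "mtr \<dots> = mtr (ptrL (rep_dim X) (rep_dim X) (rep_dim A) (kron ?i (rep_Kinv X) * (k * kron ?i f)))"
      using d dk by (simp add: mtr_ptrL)
    also have "\<dots> = mtr (rep_Kinv X * ptrL (rep_dim X) (rep_dim X) (rep_dim A) (k * kron ?i f))"
      using ptrL_left[of "k * kron ?i f" "rep_dim A" "rep_Kinv X" "rep_dim X"] d dk by simp
    also have "\<dots> = mtr (rep_Kinv X * (ptrL (rep_dim X) (rep_dim Y) (rep_dim A) k * f))"
      using ptrL_right[of k "rep_dim A" f "rep_dim X"] d dk by simp
    also have "\<dots> = mtr (rep_K X * (ptrL (rep_dim X) (rep_dim Y) (rep_dim A) k * f))"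
      using hom_comp[OF w(1,2,1) Neg_hom[OF f] P] T by (simp add: spherical)
    also have "\<dots> = 0" using f P by (auto simp: Neg_def)
    finally show "mtr (rep_K (uq_tensor A X) * (g * kron ?i f)) = 0" .
  qed
  moreover have "kron a (1\<^sub>m (rep_dim Y)) \<in> uq_hom (uq_tensor A Y) (uq_tensor A' Y)"
    using w a by (intro hom_kron[of v]) auto
  ultimately have "kron a (1\<^sub>m (rep_dim Y)) * kron ?i f \<in> Neg (uq_tensor A X) (uq_tensor A' Y)"
    using w by (intro Neg_compL[of _ "uq_tensor A Y"]) auto
  then show ?thesis using d by (simp add: kron_mult one_mult_dim mult_one_dim)
qed

definition eqv :: "'k uq_rep \<Rightarrow> 'k uq_rep \<Rightarrow> 'k mat \<Rightarrow> 'k mat \<Rightarrow> bool" where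
  "eqv X Y f g \<longleftrightarrow> f \<in> uq_hom X Y \<and> g \<in> uq_hom X Y \<and> (\<exists>n\<in>Neg X Y. f = g + n)"

lemma eqv_hom: "eqv X Y f g \<Longrightarrow> f \<in> uq_hom X Y" "eqv X Y f g \<Longrightarrow> g \<in> uq_hom X Y"
  by (auto simp: eqv_def)

lemma eqv_refl [intro]: "wrep v X \<Longrightarrow> wrep v Y \<Longrightarrow> f \<in> uq_hom X Y \<Longrightarrow> eqv X Y f f"
  unfolding eqv_def using Neg_zero[of X Y] uq_homD(3)[of f X Y] by (metis right_add_zero_mat)

lemma eqv_sym:
  assumes "wrep v X" "wrep v Y" "eqv X Y f g"
  shows "eqv X Y g f"
proof -
  obtain n where n: "n \<in> Neg X Y" "f = g + n" and h: "f \<in> uq_hom X Y" "g \<in> uq_hom X Y" using assms by (auto simp: eqv_def)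
  have "g = f + (-1) \<cdot>\<^sub>m n"
    using n uq_homD(1,2)[OF h(2)] uq_homD(1,2)[OF Neg_hom[OF n(1)]] by (intro eq_matI) auto
  then show ?thesis using h Neg_smult[OF assms(1,2) n(1)] by (auto simp: eqv_def)
qed

lemma eqv_trans:
  assumes "wrep v X" "wrep v Y" "eqv X Y f g" "eqv X Y g h"
  shows "eqv X Y f h"
proof -
  obtain n m where n: "n \<in> Neg X Y" "f = g + n" "m \<in> Neg X Y" "g = h + m" and h: "f \<in> uq_hom X Y" "g \<in> uq_hom X Y" "h \<in> uq_hom X Y"
    using assms by (auto simp: eqv_def)
  have "f = h + (m + n)"
    using n uq_homD(1,2)[OF h(3)] uq_homD(1,2)[OF Neg_hom[OF n(1)]] uq_homD(1,2)[OF Neg_hom[OF n(3)]] by (intro eq_matI) auto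
  then show ?thesis using h Neg_add[OF assms(1,2) n(3,1)] by (auto simp: eqv_def)
qed

lemma eqv_add:
  assumes "wrep v X" "wrep v Y" "eqv X Y f f'" "eqv X Y g g'"
  shows "eqv X Y (f + g) (f' + g')"
proof -
  obtain n m where n: "n \<in> Neg X Y" "f = f' + n" "m \<in> Neg X Y" "g = g' + m" and h: "f' \<in> uq_hom X Y" "g' \<in> uq_hom X Y" "f \<in> uq_hom X Y" "g \<in> uq_hom X Y"
    using assms by (auto simp: eqv_def)
  have "f + g = f' + g' + (n + m)"
    using n uq_homD(1,2)[OF h(1)] uq_homD(1,2)[OF h(2)] uq_homD(1,2)[OF Neg_hom[OF n(1)]] uq_homD(1,2)[OF Neg_hom[OF n(3)]] by (intro eq_matI) auto
  then show ?thesis using h Neg_add[OF assms(1,2) n(1,3)] hom_add[OF assms(1,2)] unfolding eqv_def by blast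
qed

lemma eqv_smult:
  assumes "wrep v X" "wrep v Y" "eqv X Y f f'"
  shows "eqv X Y (a \<cdot>\<^sub>m f) (a \<cdot>\<^sub>m f')"
proof -
  obtain n where n: "n \<in> Neg X Y" "f = f' + n" and h: "f' \<in> uq_hom X Y" "f \<in> uq_hom X Y"
    using assms by (auto simp: eqv_def)
  have "a \<cdot>\<^sub>m f = a \<cdot>\<^sub>m f' + a \<cdot>\<^sub>m n"
    using n uq_homD(1,2)[OF h(1)] uq_homD(1,2)[OF Neg_hom[OF n(1)]] by (intro eq_matI) (auto simp: algebra_simps)
  then show ?thesis using h Neg_smult[OF assms(1,2) n(1)] hom_smult[OF assms(1,2)] unfolding eqv_def by blast
qed

lemma eqv_comp:
  assumes w: "wrep v X" "wrep v Y" "wrep v Z" and "eqv X Y f f'" "eqv Y Z g g'"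
  shows "eqv X Z (g * f) (g' * f')"
proof -
  obtain n m where n: "n \<in> Neg X Y" "f = f' + n" "m \<in> Neg Y Z" "g = g' + m" and h: "f' \<in> uq_hom X Y" "g' \<in> uq_hom Y Z" "f \<in> uq_hom X Y" "g \<in> uq_hom Y Z"
    using assms by (auto simp: eqv_def)
  note d = uq_homD(1,2)[OF h(1)] uq_homD(1,2)[OF h(2)] uq_homD(1,2)[OF Neg_hom[OF n(1)]] uq_homD(1,2)[OF Neg_hom[OF n(3)]]
  have "g * f = g' * f' + (g' * n + m * f)"
    unfolding n(2,4) using d by (intro eq_matI) (auto simp: add_mult_dim mult_add_dim simp del: index_mult_mat(1))
  then show ?thesis
    using hom_comp[OF w] h Neg_add[OF w(1,3) Neg_compL[OF w n(1) h(2)] Neg_compR[OF w n(3) h(3)]]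
    unfolding eqv_def by blast
qed

lemma eqv_kron:
  assumes T: "X \<in> T" "X' \<in> T" "Y \<in> T" "Y' \<in> T" and "eqv X X' f f'" "eqv Y Y' g g'"
  shows "eqv (uq_tensor X Y) (uq_tensor X' Y') (kron f g) (kron f' g')"
proof -
  obtain n m where n: "n \<in> Neg X X'" "f = f' + n" "m \<in> Neg Y Y'" "g = g' + m" and h: "f' \<in> uq_hom X X'" "g' \<in> uq_hom Y Y'" "f \<in> uq_hom X X'" "g \<in> uq_hom Y Y'"
    using assms by (auto simp: eqv_def)
  have w: "wrep v X" "wrep v X'" "wrep v Y" "wrep v Y'" using T by auto
  note d = uq_homD(1,2)[OF h(1)] uq_homD(1,2)[OF h(2)] uq_homD(1,2)[OF Neg_hom[OF n(1)]] uq_homD(1,2)[OF Neg_hom[OF n(3)]]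
  have "kron f g = kron f' g' + (kron f' m + kron n g)"
    unfolding n(2,4) using d by (intro eq_matI) (auto simp: kron_add_left kron_add_right simp del: index_kron)
  then show ?thesis
    using hom_kron[OF w] h Neg_add[OF wrep_ten[OF w(1,3)] wrep_ten[OF w(2,4)] Neg_kronL[OF T(3,4,1,2) n(3) h(1)] Neg_kronR[OF T n(1) h(4)]]
    unfolding eqv_def by blast
qed

lemma eqv_zero_iff:
  assumes "wrep v X" "wrep v Y"
  shows "eqv X Y f (0\<^sub>m (rep_dim Y) (rep_dim X)) \<longleftrightarrow> f \<in> Neg X Y"
proof
  assume "eqv X Y f (0\<^sub>m (rep_dim Y) (rep_dim X))"
  then obtain n where n: "n \<in> Neg X Y" "f = 0\<^sub>m (rep_dim Y) (rep_dim X) + n" by (auto simp: eqv_def)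
  then show "f \<in> Neg X Y" using uq_homD(3)[OF Neg_hom[OF n(1)]] by simp
next
  assume f: "f \<in> Neg X Y"
  have "f = 0\<^sub>m (rep_dim Y) (rep_dim X) + f" using uq_homD(3)[OF Neg_hom[OF f]] by simp
  then show "eqv X Y f (0\<^sub>m (rep_dim Y) (rep_dim X))" using f Neg_hom hom_zero[OF assms] by (auto simp: eqv_def)
qed

lemma eqv_trace:
  assumes w: "wrep v X" and "eqv X X f g"
  shows "mtr (rep_K X * f) = mtr (rep_K X * g)"
proof -
  obtain n where n: "n \<in> Neg X X" "f = g + n" and h: "g \<in> uq_hom X X" using assms by (auto simp: eqv_def)
  note d = uq_homD(1,2)[OF h] uq_homD(1,2)[OF Neg_hom[OF n(1)]]
  have "mtr (rep_K X * (1\<^sub>m (rep_dim X) * n)) = 0" using n(1) hom_id[OF w] by (auto simp: Neg_def)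
  then show ?thesis unfolding n(2) using d w by (simp add: mult_add_dim mtr_add one_mult_dim)
qed

text \<open>If \<open>g\<close> is not negligible, some \<open>g h\<close> has non-zero trace; it is a scalar, so \<open>W\<close> splits off from \<open>X\<close>.\<close>

lemma schur:
  assumes w: "wrep v X" "wrep v W" and End: "\<And>f. f \<in> uq_hom W W \<Longrightarrow> \<exists>s. f = s \<cdot>\<^sub>m 1\<^sub>m (rep_dim W)"
    and g: "g \<in> uq_hom X W" "g \<notin> Neg X W"
  obtains h where "h \<in> uq_hom W X" "g * h = 1\<^sub>m (rep_dim W)"
proof -
  obtain h where h: "h \<in> uq_hom W X" and t: "mtr (rep_K X * (h * g)) \<noteq> 0" using g by (auto simp: Neg_def)
  note d = uq_homD(1,2)[OF g(1)] uq_homD(1,2)[OF h]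
  obtain s where s: "g * h = s \<cdot>\<^sub>m 1\<^sub>m (rep_dim W)" using End hom_comp[OF w(2,1,2) h g(1)] by blast
  have "mtr (rep_K W * (g * h)) \<noteq> 0" using t trace_cyclic[OF w g(1) h] by simp
  then have "s \<noteq> 0" using w unfolding s by (auto simp: mult_smult_dim mult_one_dim mtr_smult)
  then have "g * (inverse s \<cdot>\<^sub>m h) = 1\<^sub>m (rep_dim W)"
    using d s by (simp add: mult_smult_dim) (auto intro!: eq_matI)
  then show ?thesis using that hom_smult[OF w(2,1) h] by blast
qed

lemma End_triv: "f \<in> uq_hom uq_trivial uq_trivial \<Longrightarrow> f = f $$ (0, 0) \<cdot>\<^sub>m 1\<^sub>m 1"
  by (rule eq_matI) (auto dest: uq_homD(1,2))

subsection \<open>Reduction to the simple objects\<close>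

definition ethru :: "'k uq_rep set \<Rightarrow> 'k uq_rep \<Rightarrow> 'k uq_rep \<Rightarrow> 'k mat \<Rightarrow> bool" where
  "ethru S X Y f \<longleftrightarrow> (\<exists>h. thru S X Y h \<and> eqv X Y f h)"

lemma ethru_eqv: "ethru S X Y f \<Longrightarrow> eqv X Y g f \<Longrightarrow> wrep v X \<Longrightarrow> wrep v Y \<Longrightarrow> ethru S X Y g"
  unfolding ethru_def using eqv_trans by blast
lemma thru_ethru: "thru S X Y f \<Longrightarrow> wrep v X \<Longrightarrow> wrep v Y \<Longrightarrow> ethru S X Y f"
  unfolding ethru_def using eqv_refl thru_hom by blast

lemma ethru_plus:
  assumes "wrep v X" "wrep v Y" "ethru S X Y f" "ethru S X Y g"
  shows "ethru S X Y (f + g)"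
  using assms unfolding ethru_def by (metis eqv_add thru_plus)

lemma ethru_comp:
  assumes "ethru S X Y h" "wrep v X" "wrep v Y" "wrep v X'" "wrep v Y'" "a \<in> uq_hom Y Y'" "b \<in> uq_hom X' X"
  shows "ethru S X' Y' (a * h * b)"
proof -
  obtain k where k: "thru S X Y k" "eqv X Y h k" using assms by (auto simp: ethru_def)
  have "eqv X' Y' (a * h * b) (a * k * b)"
    using assms k by (intro eqv_comp[of X' X Y'] eqv_comp[of X Y Y'] eqv_refl) auto
  then show ?thesis using thru_comp[OF k(1) assms(2-)] by (auto simp: ethru_def)
qed

lemma thru_erefine:
  assumes "thru S X Y h" "wrep v X" "wrep v Y" "\<And>W. W \<in> S \<Longrightarrow> ethru S' W W (1\<^sub>m (rep_dim W))"
  shows "ethru S' X Y h"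
  using assms
proof (induction)
  case thru_zero
  then show ?case by (intro thru_ethru thru.thru_zero)
next
  case (thru_add W g f h)
  have "ethru S' X Y (f * 1\<^sub>m (rep_dim W) * g)"
    using thru_add by (intro ethru_comp[of S' W W]) auto
  also have "f * 1\<^sub>m (rep_dim W) * g = f * g" using uq_homD(2)[OF thru_add(4)] by (simp add: mult_one_dim)
  finally show ?case using thru_add by (intro ethru_plus) auto
qed

lemma ethru_refine:
  assumes "ethru S X Y h" "wrep v X" "wrep v Y" "\<And>W. W \<in> S \<Longrightarrow> ethru S' W W (1\<^sub>m (rep_dim W))"
  shows "ethru S' X Y h"
  using assms thru_erefine[of S X Y _ S'] ethru_eqv unfolding ethru_def[of S] by metis

lemma u_homs: "u1 \<in> uq_hom V V3" "u2 \<in> uq_hom V V3" "c1 \<in> uq_hom V3 V" "c2 \<in> uq_hom V3 V"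
proof -
  have i: "1\<^sub>m 2 \<in> uq_hom V V" using hom_id[of v V] by simp
  have V3': "V3 = uq_tensor V2 V" unfolding V3_def V2_def by (simp add: uq_tensor_assoc[of v])
  have "u1 \<in> uq_hom (uq_tensor uq_trivial V) (uq_tensor V2 V)" "c1 \<in> uq_hom (uq_tensor V2 V) (uq_tensor uq_trivial V)"
    using i cup_hom cap_hom by (auto intro!: hom_kron[of v])
  then show "u1 \<in> uq_hom V V3" "c1 \<in> uq_hom V3 V" by (simp_all only: uq_tensor_unit[OF V_wrep] V3')
  have "u2 \<in> uq_hom (uq_tensor V uq_trivial) (uq_tensor V V2)" "c2 \<in> uq_hom (uq_tensor V V2) (uq_tensor V uq_trivial)"
    using i cup_hom cap_hom by (auto intro!: hom_kron[of v])
  then show "u2 \<in> uq_hom V V3" "c2 \<in> uq_hom V3 V" by (simp_all only: uq_tensor_unit[OF V_wrep] V3_def)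
qed

text \<open>\<open>a1\<close>, \<open>a2\<close> form the basis dual to \<open>u1\<close>, \<open>u2\<close>; since \<open>d^2 - 1 = 1\<close>, no denominators occur.\<close>

definition a1 where "a1 = d \<cdot>\<^sub>m c1 + (-1) \<cdot>\<^sub>m c2"
definition a2 where "a2 = d \<cdot>\<^sub>m c2 + (-1) \<cdot>\<^sub>m c1"

lemma a_homs: "a1 \<in> uq_hom V3 V" "a2 \<in> uq_hom V3 V"
  unfolding a1_def a2_def by (auto intro!: hadd hsm u_homs)

lemma u_dims [simp]: "dim_row u1 = 8" "dim_col u1 = 2" "dim_row u2 = 8" "dim_col u2 = 2"
  "dim_row c1 = 2" "dim_col c1 = 8" "dim_row c2 = 2" "dim_col c2 = 8" "dim_row a1 = 2" "dim_col a1 = 8" "dim_row a2 = 2" "dim_col a2 = 8"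
  by (simp_all add: a1_def a2_def)

lemma JW_hom: "JW \<in> uq_hom V3 V3"
  unfolding JW_def using hom_id[OF V3_wrep]
  by (auto intro!: hadd hsm hcomp[of V3 V V3] u_homs simp: V3_simps)

lemma JW_Neg: "JW \<in> Neg V3 V3"
  using JW_hom JW_trace_zero by (auto simp: Neg_def)

lemma JW_split: "1\<^sub>m 8 = u1 * a1 + u2 * a2 + JW"
proof -
  have "(u1 * a1 + u2 * a2 + JW) $$ (i, j) = 1\<^sub>m 8 $$ (i, j)" if "i < 8" "j < 8" for i j
    using that unfolding JW_def a1_def a2_def
    by (simp add: mult_add_dim mult_smult_dim del: index_mult_mat(1) index_kron)
  then show ?thesis by (intro eq_matI) (auto simp: JW_def)
qed

text \<open>With the Jones-Wenzl projector gone, \<open>V \<otimes> V \<otimes> V\<close> is the sum of two copies of \<open>V\<close>.\<close>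

lemma V3_eqv: "eqv V3 V3 (1\<^sub>m 8) (u1 * a1 + u2 * a2)"
  unfolding eqv_def
proof (intro conjI bexI)
  show "1\<^sub>m 8 \<in> uq_hom V3 V3" using hom_id[OF V3_wrep] by (simp add: V3_simps)
  show "u1 * a1 + u2 * a2 \<in> uq_hom V3 V3" by (intro hadd hcomp[of V3 V V3] u_homs a_homs V3_wrep V_wrep)
qed (use JW_split JW_Neg in auto)

lemma Vp_simple: "ethru {uq_trivial, V, D} (Vp n) (Vp n) (1\<^sub>m (rep_dim (Vp n)))"
proof (induction n rule: less_induct)
  case (less n)
  consider "n = 0" | "n = 1" | "n = 2" | m where "n = Suc (Suc (Suc m))"
    by (metis One_nat_def numeral_2_eq_2 old.nat.exhaust)
  then show ?case
  proof cases
    case 1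
    have "thru {uq_trivial, V, D} uq_trivial uq_trivial (1\<^sub>m 1 * 1\<^sub>m 1)"
      using hom_id[of v uq_trivial] by (intro thru_base) auto
    then show ?thesis using 1 by (auto intro: thru_ethru)
  next
    case 2
    have "thru {uq_trivial, V, D} V V (1\<^sub>m 2 * 1\<^sub>m 2)"
      using hom_id[of v V] by (intro thru_base) auto
    then show ?thesis using 2 by (auto intro: thru_ethru simp: Vp_1 uq_tensor_unit[of v])
  next
    case 3
    have "thru {uq_trivial, V, D} V2 V2 ((inverse d \<cdot>\<^sub>m cup) * cap + iD * rD)"
    proof (rule thru_plus)
      show "thru {uq_trivial, V, D} V2 V2 ((inverse d \<cdot>\<^sub>m cup) * cap)"
        by (rule thru_base[of uq_trivial]) (auto intro!: hsm cup_hom cap_hom)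
      show "thru {uq_trivial, V, D} V2 V2 (iD * rD)"
        by (rule thru_base[of D]) (auto intro!: iD_hom rD_hom)
    qed auto
    also have "(inverse d \<cdot>\<^sub>m cup) * cap + iD * rD = 1\<^sub>m (rep_dim V2)"
      using V2_split by (simp add: smult_mult_dim V2_simps)
    finally show ?thesis using 3 thru_ethru by (simp add: Vp_2 del: Vp.simps)
  next
    case 4
    let ?m = "Vp m" and ?i = "1\<^sub>m (rep_dim (Vp m))"
    have e: "Vp n = uq_tensor V3 ?m"
      using Vp_add[of 3 m] 4 by (simp add: Vp_3[symmetric] numeral_3_eq_3 del: Vp.simps)
    have i: "?i \<in> uq_hom ?m ?m" by (rule hom_id[OF Vp_wrep])
    have W: "uq_tensor V ?m = Vp (Suc m)" by simp
    have "eqv (uq_tensor V3 ?m) (uq_tensor V3 ?m) (kron (1\<^sub>m 8) ?i) (kron (u1 * a1 + u2 * a2) ?i)"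
      by (intro eqv_kron V3_eqv eqv_refl i Vp_T Vp_wrep) (use Vp_T[of 3] in \<open>auto simp: Vp_3\<close>)
    moreover have "kron (u1 * a1 + u2 * a2) ?i = kron u1 ?i * kron a1 ?i + kron u2 ?i * kron a2 ?i"
      by (simp add: kron_add_left kron_mult one_mult_dim)
    moreover have "thru {Vp (Suc m)} (uq_tensor V3 ?m) (uq_tensor V3 ?m) (kron u1 ?i * kron a1 ?i + kron u2 ?i * kron a2 ?i)"
      unfolding W[symmetric]
      by (intro thru_plus thru_base[of "uq_tensor V ?m"] hom_kron[of v] u_homs a_homs i) auto
    ultimately have e1: "ethru {Vp (Suc m)} (Vp n) (Vp n) (1\<^sub>m (rep_dim (Vp n)))"
      unfolding ethru_def e by (auto simp: kron_one_one V3_simps)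
    have IH: "ethru {uq_trivial, V, D} (Vp (Suc m)) (Vp (Suc m)) (1\<^sub>m (rep_dim (Vp (Suc m))))"
      by (rule less) (simp add: 4)
    show ?thesis
      by (rule ethru_refine[OF e1 Vp_wrep Vp_wrep]) (simp only: singleton_iff IH)
  qed
qed

text \<open>Since \<open>V \<otimes> V = \<one> + D\<close> and \<open>V \<otimes> V \<otimes> V = 2 V\<close>, tensor powers reduce to these three objects.\<close>

lemma T_simple: "X \<in> T \<Longrightarrow> ethru {uq_trivial, V, D} X X (1\<^sub>m (rep_dim X))"
proof -
  assume X: "X \<in> T"
  show ?thesis
    by (rule thru_erefine[OF thru_T[OF X] T_wrep[OF X] T_wrep[OF X]]) (use Vp_simple in blast)
qed

section \<open>The Ising category\<close>

abbreviation cls :: "'k uq_rep \<Rightarrow> 'k uq_rep \<Rightarrow> 'k mat \<Rightarrow> 'k mat set" where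
  "cls \<equiv> neg_class (Tilt_Uq v) quantum_trace"

definition I :: "('k uq_rep, 'k mat set, 'k) lin_mon_cat" where
  "I = semisimplification (Tilt_Uq v) quantum_trace"

lemma Tilt_simps [simp]:
  "cat_obj (Tilt_Uq v) = T" "cat_hom (Tilt_Uq v) = uq_hom"
  "cat_id (Tilt_Uq v) M = 1\<^sub>m (rep_dim M)" "cat_comp (Tilt_Uq v) X Y Z g f = g * f"
  "cat_zero (Tilt_Uq v) M N = 0\<^sub>m (rep_dim N) (rep_dim M)" "cat_add (Tilt_Uq v) X Y f g = f + g"
  "cat_scale (Tilt_Uq v) X Y a f = a \<cdot>\<^sub>m f" "ten_unit (Tilt_Uq v) = uq_trivial" "ten_obj (Tilt_Uq v) = uq_tensor"
  "ten_mor (Tilt_Uq v) X X' Y Y' f g = kron f g"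
  "ten_assoc (Tilt_Uq v) L M N = 1\<^sub>m (rep_dim L * rep_dim M * rep_dim N)"
  "ten_lunit (Tilt_Uq v) M = 1\<^sub>m (rep_dim M)" "ten_runit (Tilt_Uq v) M = 1\<^sub>m (rep_dim M)"
  by (simp_all add: Tilt_Uq_def generated_subcat_def full_subcat_def T_def)

lemma negligible_Neg:
  assumes "wrep v X"
  shows "negligible_mors (Tilt_Uq v) quantum_trace X Y = Neg X Y"
  using assms by (simp add: negligible_mors_def Neg_def quantum_trace_def mtr_def)

lemma cls_def': "wrep v X \<Longrightarrow> cls X Y f = (\<lambda>h. f + h) ` Neg X Y"
  by (simp add: neg_class_def negligible_Neg)

lemma in_cls: "wrep v X \<Longrightarrow> wrep v Y \<Longrightarrow> f \<in> uq_hom X Y \<Longrightarrow> g \<in> cls X Y f \<longleftrightarrow> eqv X Y g f"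
  unfolding cls_def' eqv_def using hadd Neg_hom by blast

lemma cls_eq_iff:
  assumes "wrep v X" "wrep v Y" "f \<in> uq_hom X Y" "g \<in> uq_hom X Y"
  shows "cls X Y f = cls X Y g \<longleftrightarrow> eqv X Y f g"
proof
  assume "cls X Y f = cls X Y g"
  then show "eqv X Y f g" using in_cls[OF assms(1-3), of f] in_cls[OF assms(1,2,4), of f] eqv_refl[OF assms(1-3)] by simp
next
  assume "eqv X Y f g"
  then show "cls X Y f = cls X Y g"
    using in_cls[OF assms(1-3)] in_cls[OF assms(1,2,4)] eqv_trans[OF assms(1,2)] eqv_sym[OF assms(1,2)] by blast
qed

lemma cls_nonempty: "wrep v X \<Longrightarrow> wrep v Y \<Longrightarrow> f \<in> uq_hom X Y \<Longrightarrow> cls X Y f \<noteq> {}"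
  using in_cls eqv_refl by blast

lemma I_simps [simp]: "cat_obj I = T" "ten_unit I = uq_trivial" "ten_obj I = uq_tensor"
  "cat_id I X = cls X X (1\<^sub>m (rep_dim X))" "cat_zero I X Y = cls X Y (0\<^sub>m (rep_dim Y) (rep_dim X))"
  "cat_hom I X Y = cls X Y ` uq_hom X Y"
  "ten_assoc I X Y Z = cls (uq_tensor (uq_tensor X Y) Z) (uq_tensor X (uq_tensor Y Z)) (1\<^sub>m (rep_dim X * rep_dim Y * rep_dim Z))"
  "ten_lunit I X = cls (uq_tensor uq_trivial X) X (1\<^sub>m (rep_dim X))"
  "ten_runit I X = cls (uq_tensor X uq_trivial) X (1\<^sub>m (rep_dim X))"
  by (simp_all add: I_def semisimplification_def)

lemma I_comp:
  assumes w: "wrep v X" "wrep v Y" "wrep v Z" and f: "f \<in> uq_hom X Y" and g: "g \<in> uq_hom Y Z"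
  shows "cat_comp I X Y Z (cls Y Z g) (cls X Y f) = cls X Z (g * f)"
proof -
  have "cls X Z (g' * f') = cls X Z (g * f)" if "g' \<in> cls Y Z g" "f' \<in> cls X Y f" for f' g'
    using that eqv_comp[OF w, of f' f g' g] hom_comp[OF w] f g w
    by (subst cls_eq_iff) (auto simp: in_cls dest: eqv_hom)
  then show ?thesis
    unfolding I_def semisimplification_def using w f g by (simp add: cls_nonempty)
qed

lemma I_add:
  assumes w: "wrep v X" "wrep v Y" and f: "f \<in> uq_hom X Y" and g: "g \<in> uq_hom X Y"
  shows "cat_add I X Y (cls X Y f) (cls X Y g) = cls X Y (f + g)"
proof -
  have "cls X Y (f' + g') = cls X Y (f + g)" if "g' \<in> cls X Y g" "f' \<in> cls X Y f" for f' g'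
    using that eqv_add[OF w, of f' f g' g] hom_add[OF w] f g w
    by (subst cls_eq_iff) (auto simp: in_cls dest: eqv_hom)
  then show ?thesis
    unfolding I_def semisimplification_def using w f g by (simp add: cls_nonempty)
qed

lemma I_scale:
  assumes w: "wrep v X" "wrep v Y" and f: "f \<in> uq_hom X Y"
  shows "cat_scale I X Y a (cls X Y f) = cls X Y (a \<cdot>\<^sub>m f)"
proof -
  have "cls X Y (a \<cdot>\<^sub>m f') = cls X Y (a \<cdot>\<^sub>m f)" if "f' \<in> cls X Y f" for f'
    using that eqv_smult[OF w, of f' f] hom_smult[OF w] f w
    by (subst cls_eq_iff) (auto simp: in_cls dest: eqv_hom)
  then show ?thesis
    unfolding I_def semisimplification_def using w f by (simp add: cls_nonempty)
qed

lemma I_ten: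
  assumes T: "X \<in> T" "X' \<in> T" "Y \<in> T" "Y' \<in> T" and f: "f \<in> uq_hom X X'" and g: "g \<in> uq_hom Y Y'"
  shows "ten_mor I X X' Y Y' (cls X X' f) (cls Y Y' g) = cls (uq_tensor X Y) (uq_tensor X' Y') (kron f g)"
proof -
  have w: "wrep v X" "wrep v X'" "wrep v Y" "wrep v Y'" using T by auto
  have "cls (uq_tensor X Y) (uq_tensor X' Y') (kron f' g') = cls (uq_tensor X Y) (uq_tensor X' Y') (kron f g)"
    if "g' \<in> cls Y Y' g" "f' \<in> cls X X' f" for f' g'
    using that eqv_kron[OF T, of f' f g' g] hom_kron[OF w] f g w
    by (subst cls_eq_iff) (auto simp: in_cls dest: eqv_hom)
  then show ?thesis
    unfolding I_def semisimplification_def using w f g by (simp add: cls_nonempty)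
qed

end

section \<open>Graded objects\<close>

lemma smult_smult: "a \<cdot>\<^sub>m (b \<cdot>\<^sub>m A) = (a * b) \<cdot>\<^sub>m (A :: 'a::semigroup_mult mat)"
  by (intro eq_matI) (auto simp: mult.assoc)

text \<open>Addition of matrices has no neutral element common to all dimensions, so the dimensions of a sum, which
  may be empty, are given explicitly.\<close>

definition msum :: "nat \<Rightarrow> nat \<Rightarrow> nat set \<Rightarrow> (nat \<Rightarrow> 'a::comm_monoid_add mat) \<Rightarrow> 'a mat" where
  "msum a b S f = mat a b (\<lambda>ij. \<Sum>t\<in>S. f t $$ ij)"

lemma msum_dim [simp]: "dim_row (msum a b S f) = a" "dim_col (msum a b S f) = b"
  by (simp_all add: msum_def)
lemma msum_index [simp]: "i < a \<Longrightarrow> j < b \<Longrightarrow> msum a b S f $$ (i, j) = (\<Sum>t\<in>S. f t $$ (i, j))"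
  by (simp add: msum_def)
lemma msum_empty: "msum a b {} f = 0\<^sub>m a b"
  by (intro eq_matI) auto
lemma msum_insert: "finite S \<Longrightarrow> t \<notin> S \<Longrightarrow> dim_row (f t) = a \<Longrightarrow> dim_col (f t) = b \<Longrightarrow> msum a b (insert t S) f = f t + msum a b S f"
  by (intro eq_matI) auto
lemma msum_cong: "(\<And>t. t \<in> S \<Longrightarrow> f t = g t) \<Longrightarrow> msum a b S f = msum a b S g"
  by (intro eq_matI) (auto intro: sum.cong)

lemma mult_msum:
  fixes A :: "'a::semiring_0 mat"
  assumes "finite S" "\<And>t. t \<in> S \<Longrightarrow> dim_row (f t) = dim_col A \<and> dim_col (f t) = b"
  shows "A * msum (dim_col A) b S f = msum (dim_row A) b S (\<lambda>t. A * f t)"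
  using assms by (intro eq_matI) (auto simp: mult_index_sum sum_distrib_left sum.swap[of _ "S"] simp del: index_mult_mat(1))

lemma msum_mult:
  fixes A :: "'a::semiring_0 mat"
  assumes "finite S" "\<And>t. t \<in> S \<Longrightarrow> dim_row (f t) = a \<and> dim_col (f t) = dim_row A"
  shows "msum a (dim_row A) S f * A = msum a (dim_col A) S (\<lambda>t. f t * A)"
  using assms by (intro eq_matI) (auto simp: mult_index_sum sum_distrib_right sum.swap[of _ "S"] simp del: index_mult_mat(1))

lemma msum_delta:
  assumes "finite S" "t0 \<in> S" "dim_row (f t0) = a" "dim_col (f t0) = b" "\<And>t. t \<in> S \<Longrightarrow> t \<noteq> t0 \<Longrightarrow> f t = 0\<^sub>m a b"
  shows "msum a b S f = f t0"
proof (rule eq_matI)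
  fix i j assume ij: "i < dim_row (f t0)" "j < dim_col (f t0)"
  have "(\<Sum>t\<in>S. f t $$ (i, j)) = (\<Sum>t\<in>S. if t = t0 then f t0 $$ (i, j) else 0)"
    using assms ij by (intro sum.cong) auto
  then show "msum a b S f $$ (i, j) = f t0 $$ (i, j)" using assms ij by simp
qed (use assms in auto)

lemma msum_swap: "msum a b S (\<lambda>s. msum a b R (\<lambda>r. f s r)) = msum a b R (\<lambda>r. msum a b S (\<lambda>s. f s r))"
  by (intro eq_matI) (auto intro: sum.swap)

lemma concat_map_nth:
  "i < length xs * length ys \<Longrightarrow> concat (map (\<lambda>x. map (\<lambda>y. h x y) ys) xs) ! i = h (xs ! (i div length ys)) (ys ! (i mod length ys))"
proof (induction xs arbitrary: i)
  case (Cons x xs)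
  show ?case
  proof (cases "i < length ys")
    case True
    then show ?thesis by (simp add: nth_append)
  next
    case False
    have "length ys > 0" using Cons.prems by (cases ys) auto
    moreover have "i - length ys < length xs * length ys" using Cons.prems False by auto
    ultimately show ?thesis using False Cons.IH[of "i - length ys"]
      by (simp add: nth_append le_div_geq le_mod_geq)
  qed
qed auto

lemma length_concat_map: "length (concat (map (\<lambda>x. map (\<lambda>y. h x y) ys) xs)) = length xs * length ys"
  by (induction xs) auto

context ising_parameter
begin

lemma msum_hom:
  assumes "wrep v X" "wrep v Y" "finite S" "\<And>t. t \<in> S \<Longrightarrow> f t \<in> uq_hom X Y"
  shows "msum (rep_dim Y) (rep_dim X) S f \<in> uq_hom X Y"
  using assms(3,4)
proof (induction S)
  case empty
  then show ?case using hom_zero assms by (simp add: msum_empty)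
next
  case (insert t S)
  have ft: "f t \<in> uq_hom X Y" using insert by simp
  show ?case using insert uq_homD(1,2)[OF ft] ft assms(1,2) by (simp add: msum_insert hadd)
qed

lemma hom_sum_cls:
  assumes w: "wrep v X" "wrep v Y" and "distinct ts" "\<And>t. t \<in> set ts \<Longrightarrow> f t \<in> uq_hom X Y"
  shows "hom_sum I X Y (map (\<lambda>t. cls X Y (f t)) ts) = cls X Y (msum (rep_dim Y) (rep_dim X) (set ts) f)"
  using assms(3,4)
proof (induction ts)
  case Nil
  then show ?case by (simp add: hom_sum_def msum_empty)
next
  case (Cons t ts)
  then have "hom_sum I X Y (map (\<lambda>t. cls X Y (f t)) (t # ts)) = cat_add I X Y (cls X Y (f t)) (cls X Y (msum (rep_dim Y) (rep_dim X) (set ts) f))"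
    by (simp add: hom_sum_def)
  also have "\<dots> = cls X Y (f t + msum (rep_dim Y) (rep_dim X) (set ts) f)"
    using Cons w by (intro I_add msum_hom) auto
  finally show ?case using Cons uq_homD(1,2)[of "f t" X Y] by (simp add: msum_insert)
qed

subsection \<open>The fourth power of \<open>K\<close>\<close>

text \<open>\<open>K^4\<close> commutes with \<open>E\<close> and \<open>F\<close>, because \<open>v^8 = 1\<close>; so it is a natural monoidal automorphism.\<close>

definition K4 :: "'k uq_rep \<Rightarrow> 'k mat" where
  "K4 M = rep_K M * (rep_K M * (rep_K M * rep_K M))"

lemma K4_dim [simp]: "wrep v M \<Longrightarrow> dim_row (K4 M) = rep_dim M" "wrep v M \<Longrightarrow> dim_col (K4 M) = rep_dim M"
  by (simp_all add: K4_def)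

lemma K4_natural:
  assumes "wrep v M" "wrep v N" "f \<in> uq_hom M N"
  shows "f * K4 M = K4 N * f"
proof -
  note d = uq_homD(1,2)[OF assms(3)] wrep_dims[OF assms(1)] wrep_dims[OF assms(2)] and c = uq_homD(6)[OF assms(3)]
  have c': "f * (rep_K M * A) = rep_K N * (f * A)" if "dim_row A = rep_dim M" for A
    using that d c by (metis mult_assoc_dim)
  show ?thesis unfolding K4_def using d by (simp add: c' c mult_assoc_dim)
qed

lemma K4_hom [simp]:
  assumes w: "wrep v M"
  shows "K4 M \<in> uq_hom M M"
proof -
  note d = wrep_dims[OF w]
  have pw: "rep_K M * (c \<cdot>\<^sub>m A) = c \<cdot>\<^sub>m (rep_K M * A)" if "dim_row A = rep_dim M" for c A using that d by (simp add: mult_smult_dim)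
  have *: "K4 M * A = A * K4 M" if c: "rep_K M * A = s \<cdot>\<^sub>m (A * rep_K M)" and s: "s ^ 4 = 1" and A: "dim_row A = rep_dim M" "dim_col A = rep_dim M" for s A
  proof -
    have c': "rep_K M * (A * B) = s \<cdot>\<^sub>m (A * (rep_K M * B))" if "dim_row B = rep_dim M" for B
      using that d A c by (metis mult_assoc_dim smult_mult_dim index_mult_mat(2,3))
    have "K4 M * A = (s * (s * (s * s))) \<cdot>\<^sub>m (A * K4 M)"
      unfolding K4_def using d A by (simp add: mult_assoc_dim c c' pw smult_smult mult.assoc)
    moreover have "s * (s * (s * s)) = 1" using s by (simp add: eval_nat_numeral)
    ultimately show ?thesis using d A by (auto intro!: eq_matI)
  qed
  have "(v\<^sup>2) ^ 4 = (v ^ 4) ^ 2" by (simp add: power_mult[symmetric])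
  then have s1: "(v\<^sup>2) ^ 4 = 1" using v4 by simp
  have s2: "(inverse (v\<^sup>2)) ^ 4 = 1" using s1 by (simp add: power_inverse)
  show ?thesis
    by (rule uq_homI)
      (use w *[OF _ s1, of "rep_E M"] *[OF _ s2, of "rep_F M"] d in \<open>auto simp: wrep_def K4_def mult_assoc_dim\<close>)
qed

lemma K4_tensor:
  assumes "wrep v M" "wrep v N"
  shows "K4 (uq_tensor M N) = kron (K4 M) (K4 N)"
  using assms by (simp add: K4_def kron_mult)

lemma K4_trivial: "K4 uq_trivial = 1\<^sub>m 1"
  by (simp add: K4_def)
lemma K4_V: "K4 V = (-1) \<cdot>\<^sub>m 1\<^sub>m 2"
  by (simp add: K4_def mat_eq_all alls sums mk_index mult_index_sum vs del: index_mult_mat(1))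

lemma K4_Vp: "K4 (Vp m) = (-1) ^ m \<cdot>\<^sub>m 1\<^sub>m (rep_dim (Vp m))"
proof (induction m)
  case (Suc m)
  have "K4 (Vp (Suc m)) = kron (K4 V) (K4 (Vp m))" by (simp add: K4_tensor)
  then show ?case unfolding Suc K4_V
    by (simp add: kron_smult_left kron_smult_right kron_one_one smult_smult)
qed (simp add: K4_trivial, auto intro!: eq_matI)

text \<open>\<open>K^4\<close> acts on the image of \<open>h\<close> by \<open>(-1)^j\<close>; for the identity this says that \<open>X\<close> has parity \<open>j\<close>.\<close>

definition par :: "'k uq_rep \<Rightarrow> nat \<Rightarrow> 'k mat \<Rightarrow> bool" where
  "par X j h \<longleftrightarrow> eqv X X (h * K4 X) ((-1) ^ j \<cdot>\<^sub>m h)"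

lemma par_eqv:
  assumes w: "wrep v X" and "par X j h" "eqv X X h' h"
  shows "par X j h'"
  unfolding par_def
proof (rule eqv_trans[OF w w])
  show "eqv X X (h' * K4 X) (h * K4 X)" using assms by (intro eqv_comp[OF w w w] eqv_refl) auto
  show "eqv X X (h * K4 X) ((-1) ^ j \<cdot>\<^sub>m h')"
    using eqv_trans[OF w w, of "h * K4 X" "(-1) ^ j \<cdot>\<^sub>m h"] assms eqv_smult[OF w w eqv_sym[OF w w assms(3)]] by (auto simp: par_def)
qed

lemma par_add:
  assumes w: "wrep v X" and "par X j h" "par X j h'" "h \<in> uq_hom X X" "h' \<in> uq_hom X X"
  shows "par X j (h + h')"
proof -
  note d = uq_homD(1,2)[OF assms(4)] uq_homD(1,2)[OF assms(5)]
  have "(h + h') * K4 X = h * K4 X + h' * K4 X" using d w by (simp add: add_mult_dim)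
  moreover have "(-1) ^ j \<cdot>\<^sub>m (h + h') = (-1) ^ j \<cdot>\<^sub>m h + (-1) ^ j \<cdot>\<^sub>m h'"
    using d by (intro eq_matI) (auto simp: algebra_simps)
  ultimately show ?thesis using assms unfolding par_def by (auto intro: eqv_add)
qed

lemma par_zero: "wrep v X \<Longrightarrow> par X j (0\<^sub>m (rep_dim X) (rep_dim X))"
proof -
  assume w: "wrep v X"
  have "0\<^sub>m (rep_dim X) (rep_dim X) * K4 X = 0\<^sub>m (rep_dim X) (rep_dim X)"
    using w by (intro left_mult_zero_mat) (auto intro!: carrier_matI)
  then show ?thesis unfolding par_def using w by (auto intro!: eqv_refl hom_zero)
qed

lemma par_msum:
  assumes w: "wrep v X" and "finite S" "\<And>t. t \<in> S \<Longrightarrow> par X j (f t) \<and> f t \<in> uq_hom X X"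
  shows "par X j (msum (rep_dim X) (rep_dim X) S f)"
  using assms(2,3)
proof (induction S)
  case empty
  then show ?case by (simp add: msum_empty par_zero w)
next
  case (insert t S)
  then show ?case using uq_homD(1,2)[of "f t" X X] by (subst msum_insert) (auto intro!: par_add[OF w] msum_hom w)
qed

lemma par_factor:
  assumes w: "wrep v X" "wrep v Y" and g: "g \<in> uq_hom X Y" and f: "f \<in> uq_hom Y X" and Y: "par Y j (1\<^sub>m (rep_dim Y))"
  shows "par X j (f * g)"
proof -
  note d = uq_homD(1,2)[OF f] uq_homD(1,2)[OF g]
  have "f * g * K4 X = f * (1\<^sub>m (rep_dim Y) * K4 Y) * g"
    using d w K4_natural[OF w g] by (simp add: mult_assoc_dim one_mult_dim)
  moreover have "eqv X X (f * (1\<^sub>m (rep_dim Y) * K4 Y) * g) (f * ((-1) ^ j \<cdot>\<^sub>m 1\<^sub>m (rep_dim Y)) * g)"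
    using Y w f g unfolding par_def by (intro eqv_comp[of X Y X] eqv_comp[of Y Y X] eqv_refl) auto
  moreover have "f * ((-1) ^ j \<cdot>\<^sub>m 1\<^sub>m (rep_dim Y)) * g = (-1) ^ j \<cdot>\<^sub>m (f * g)"
    using d by (simp add: mult_smult_dim smult_mult_dim mult_one_dim)
  ultimately show ?thesis by (simp add: par_def)
qed

end

locale graded_ising = ising_parameter v for v :: "'k::field_char_0" +
  fixes n :: nat
  assumes n_even: "even n" and n_pos: "n > 0"
begin

definition G :: "(nat \<Rightarrow> nat \<Rightarrow> nat \<Rightarrow> 'k) \<Rightarrow> (('k uq_rep \<times> nat) list, 'k mat set mat, 'k) lin_mon_cat" where
  "G w = graded_cat I n w"

abbreviation ten where "ten \<equiv> graded_ten_obj I n"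

definition GO :: "('k uq_rep \<times> nat) list \<Rightarrow> bool" where
  "GO X \<longleftrightarrow> set X \<subseteq> T \<times> {..<n}"

lemma GO_nth: "GO X \<Longrightarrow> i < length X \<Longrightarrow> fst (X ! i) \<in> T" "GO X \<Longrightarrow> i < length X \<Longrightarrow> wrep v (fst (X ! i))" "GO X \<Longrightarrow> i < length X \<Longrightarrow> snd (X ! i) < n"
proof -
  have "X ! i \<in> T \<times> {..<n}" if "GO X" "i < length X"
    using that nth_mem[of i X] unfolding GO_def by blast
  then show "GO X \<Longrightarrow> i < length X \<Longrightarrow> fst (X ! i) \<in> T" "GO X \<Longrightarrow> i < length X \<Longrightarrow> wrep v (fst (X ! i))" "GO X \<Longrightarrow> i < length X \<Longrightarrow> snd (X ! i) < n"
    by (auto simp: mem_Times_iff)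
qed

lemma length_ten [simp]: "length (ten X Y) = length X * length Y"
  by (simp add: graded_ten_obj_def length_concat_map)
lemma ten_nth: "i < length X * length Y \<Longrightarrow> ten X Y ! i = (uq_tensor (fst (X ! (i div length Y))) (fst (Y ! (i mod length Y))),
    (snd (X ! (i div length Y)) + snd (Y ! (i mod length Y))) mod n)"
  by (simp add: graded_ten_obj_def concat_map_nth)

lemma GO_ten [simp]: "GO X \<Longrightarrow> GO Y \<Longrightarrow> GO (ten X Y)"
  unfolding GO_def graded_ten_obj_def using n_pos by (fastforce)

lemma GO_simps [simp]: "GO []" "GO [(uq_trivial, 0)]" "GO (x # X) \<longleftrightarrow> fst x \<in> T \<and> snd x < n \<and> GO X"
  using n_pos by (auto simp: GO_def mem_Times_iff)

abbreviation unt :: "('k uq_rep \<times> nat) list" where "unt \<equiv> [(uq_trivial, 0)]"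

lemma ten_unit_left: "GO X \<Longrightarrow> ten unt X = X"
  by (rule nth_equalityI) (auto simp: ten_nth uq_tensor_unit[of v] GO_nth)
lemma ten_unit_right: "GO X \<Longrightarrow> ten X unt = X"
  by (rule nth_equalityI) (auto simp: ten_nth uq_tensor_unit[of v] GO_nth)

lemma ten_assoc_obj:
  assumes "GO X" "GO Y" "GO Z"
  shows "ten (ten X Y) Z = ten X (ten Y Z)"
proof (rule nth_equalityI)
  fix i assume i: "i < length (ten (ten X Y) Z)"
  then have i1: "i < length X * length Y * length Z" and i2: "i < length X * (length Y * length Z)" by (auto simp: mult.assoc)
  note a = div_less_mult[OF i1] mod_less_mult[OF i1] div_less_mult[OF i2] mod_less_mult[OF i2]
  have b: "i div length Z div length Y = i div (length Y * length Z)" by (simp add: div_mult2_eq[symmetric] mult.commute)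
  have c: "i mod (length Y * length Z) div length Z = i div length Z mod length Y"
    using i1 by (cases "length Z = 0") (auto simp: mod_mult2_eq mult.commute[of "length Y"])
  have e: "i mod (length Y * length Z) mod length Z = i mod length Z"
    by (simp add: mod_mult2_eq mult.commute[of "length Y"])
  have "i div length Z div length Y < length X" "i div length Z mod length Y < length Y" "i mod length Z < length Z"
    using a div_less_mult[OF a(1)] mod_less_mult[OF a(1)] by auto
  then show "ten (ten X Y) Z ! i = ten X (ten Y Z) ! i"
    using i1 i2 a assms by (simp add: ten_nth b c e uq_tensor_assoc[of v] GO_nth mod_simps add.assoc)
qed (simp add: mult.assoc)

subsection \<open>Representatives of graded morphisms\<close>

definition ghom :: "('k uq_rep \<times> nat) list \<Rightarrow> ('k uq_rep \<times> nat) list \<Rightarrow> (nat \<Rightarrow> nat \<Rightarrow> 'k mat) \<Rightarrow> bool" where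
  "ghom X Y \<phi> \<longleftrightarrow> (\<forall>r<length Y. \<forall>s<length X. \<phi> r s \<in> uq_hom (fst (X ! s)) (fst (Y ! r)) \<and>
     (snd (X ! s) \<noteq> snd (Y ! r) \<longrightarrow> \<phi> r s = 0\<^sub>m (rep_dim (fst (Y ! r))) (rep_dim (fst (X ! s)))))"

definition gm :: "('k uq_rep \<times> nat) list \<Rightarrow> ('k uq_rep \<times> nat) list \<Rightarrow> (nat \<Rightarrow> nat \<Rightarrow> 'k mat) \<Rightarrow> 'k mat set mat" where
  "gm X Y \<phi> = mat (length Y) (length X) (\<lambda>(r, s). cls (fst (X ! s)) (fst (Y ! r)) (\<phi> r s))"

definition gcomp :: "('k uq_rep \<times> nat) list \<Rightarrow> ('k uq_rep \<times> nat) list \<Rightarrow> ('k uq_rep \<times> nat) list \<Rightarrow> (nat \<Rightarrow> nat \<Rightarrow> 'k mat) \<Rightarrow> (nat \<Rightarrow> nat \<Rightarrow> 'k mat) \<Rightarrow> nat \<Rightarrow> nat \<Rightarrow> 'k mat" where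
  "gcomp X Y Z \<gamma> \<phi> r s = msum (rep_dim (fst (Z ! r))) (rep_dim (fst (X ! s))) {..<length Y} (\<lambda>t. \<gamma> r t * \<phi> t s)"

definition gid :: "('k uq_rep \<times> nat) list \<Rightarrow> nat \<Rightarrow> nat \<Rightarrow> 'k mat" where
  "gid X r s = (if r = s then 1\<^sub>m (rep_dim (fst (X ! r))) else 0\<^sub>m (rep_dim (fst (X ! r))) (rep_dim (fst (X ! s))))"

lemma ghomD: "ghom X Y \<phi> \<Longrightarrow> r < length Y \<Longrightarrow> s < length X \<Longrightarrow> \<phi> r s \<in> uq_hom (fst (X ! s)) (fst (Y ! r))"
  by (auto simp: ghom_def)
lemma ghom_dims: "ghom X Y \<phi> \<Longrightarrow> r < length Y \<Longrightarrow> s < length X \<Longrightarrow> dim_row (\<phi> r s) = rep_dim (fst (Y ! r)) \<and> dim_col (\<phi> r s) = rep_dim (fst (X ! s))"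
  using ghomD uq_homD(1,2) by blast
lemma ghom_zero: "ghom X Y \<phi> \<Longrightarrow> r < length Y \<Longrightarrow> s < length X \<Longrightarrow> snd (X ! s) \<noteq> snd (Y ! r) \<Longrightarrow> \<phi> r s = 0\<^sub>m (rep_dim (fst (Y ! r))) (rep_dim (fst (X ! s)))"
  by (auto simp: ghom_def)

lemma gm_dim [simp]: "dim_row (gm X Y \<phi>) = length Y" "dim_col (gm X Y \<phi>) = length X"
  by (auto simp: gm_def)
lemma gm_index: "r < length Y \<Longrightarrow> s < length X \<Longrightarrow> gm X Y \<phi> $$ (r, s) = cls (fst (X ! s)) (fst (Y ! r)) (\<phi> r s)"
  by (auto simp: gm_def)

lemma gm_eq_iff:
  assumes "GO X" "GO Y" "ghom X Y \<phi>" "ghom X Y \<psi>"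
  shows "gm X Y \<phi> = gm X Y \<psi> \<longleftrightarrow> (\<forall>r<length Y. \<forall>s<length X. eqv (fst (X ! s)) (fst (Y ! r)) (\<phi> r s) (\<psi> r s))"
  using assms by (auto simp: mat_eq_all gm_index cls_eq_iff GO_nth ghomD)

lemma gm_cong: "(\<And>r s. r < length Y \<Longrightarrow> s < length X \<Longrightarrow> \<phi> r s = \<psi> r s) \<Longrightarrow> gm X Y \<phi> = gm X Y \<psi>"
  by (rule eq_matI) (auto simp: gm_index)

lemma G_obj: "cat_obj (G w) = {X. GO X}"
  by (auto simp: G_def graded_cat_def GO_def)

lemma G_hom:
  assumes "GO X" "GO Y"
  shows "M \<in> cat_hom (G w) X Y \<longleftrightarrow> (\<exists>\<phi>. ghom X Y \<phi> \<and> M = gm X Y \<phi>)"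
proof
  assume "\<exists>\<phi>. ghom X Y \<phi> \<and> M = gm X Y \<phi>"
  then show "M \<in> cat_hom (G w) X Y"
    by (auto simp: G_def graded_cat_def gm_index ghom_def intro!: carrier_matI)
next
  assume M: "M \<in> cat_hom (G w) X Y"
  define \<phi> where "\<phi> r s = (if snd (X ! s) = snd (Y ! r) then (SOME f. f \<in> uq_hom (fst (X ! s)) (fst (Y ! r)) \<and> M $$ (r, s) = cls (fst (X ! s)) (fst (Y ! r)) f)
      else 0\<^sub>m (rep_dim (fst (Y ! r))) (rep_dim (fst (X ! s))))" for r s
  have "\<phi> r s \<in> uq_hom (fst (X ! s)) (fst (Y ! r)) \<and> M $$ (r, s) = cls (fst (X ! s)) (fst (Y ! r)) (\<phi> r s)" if rs: "r < length Y" "s < length X" for r s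
  proof (cases "snd (X ! s) = snd (Y ! r)")
    case True
    have "M $$ (r, s) \<in> (if snd (X ! s) = snd (Y ! r) then cat_hom I (fst (X ! s)) (fst (Y ! r)) else {cat_zero I (fst (X ! s)) (fst (Y ! r))})"
      using M rs by (simp add: G_def graded_cat_def)
    with True have "\<exists>f. f \<in> uq_hom (fst (X ! s)) (fst (Y ! r)) \<and> M $$ (r, s) = cls (fst (X ! s)) (fst (Y ! r)) f"
      by auto
    from someI_ex[OF this] show ?thesis using True by (simp add: \<phi>_def)
  next
    case False
    have "M $$ (r, s) \<in> (if snd (X ! s) = snd (Y ! r) then cat_hom I (fst (X ! s)) (fst (Y ! r)) else {cat_zero I (fst (X ! s)) (fst (Y ! r))})"
      using M rs by (simp add: G_def graded_cat_def)
    with False show ?thesis using rs assms by (simp add: \<phi>_def GO_nth hom_zero[of v])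
  qed
  moreover have "dim_row M = length Y" "dim_col M = length X" using M by (auto simp: G_def graded_cat_def)
  ultimately have "ghom X Y \<phi> \<and> M = gm X Y \<phi>" by (auto simp: ghom_def mat_eq_all gm_index \<phi>_def)
  then show "\<exists>\<phi>. ghom X Y \<phi> \<and> M = gm X Y \<phi>" by blast
qed

lemma ghom_mult:
  assumes "GO X" "GO Y" "GO Z" "ghom X Y \<phi>" "ghom Y Z \<gamma>" "r < length Z" "t < length Y" "s < length X"
  shows "\<gamma> r t * \<phi> t s \<in> uq_hom (fst (X ! s)) (fst (Z ! r))"
  by (rule hcomp[OF GO_nth(2)[OF assms(1,8)] GO_nth(2)[OF assms(2,7)] GO_nth(2)[OF assms(3,6)] ghomD[OF assms(4,7,8)] ghomD[OF assms(5,6,7)]])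

lemma ghom_comp:
  assumes "GO X" "GO Y" "GO Z" "ghom X Y \<phi>" "ghom Y Z \<gamma>"
  shows "ghom X Z (gcomp X Y Z \<gamma> \<phi>)"
  unfolding ghom_def
proof (intro allI impI conjI)
  fix r s assume rs: "r < length Z" "s < length X"
  have wr: "wrep v (fst (X ! s))" "wrep v (fst (Z ! r))" using rs assms by (auto simp: GO_nth)
  show "gcomp X Y Z \<gamma> \<phi> r s \<in> uq_hom (fst (X ! s)) (fst (Z ! r))"
    unfolding gcomp_def using rs assms wr by (intro msum_hom) (auto intro: ghom_mult)
  assume ne: "snd (X ! s) \<noteq> snd (Z ! r)"
  have "\<gamma> r t * \<phi> t s = 0\<^sub>m (rep_dim (fst (Z ! r))) (rep_dim (fst (X ! s)))" if t: "t < length Y" for t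
  proof (cases "snd (X ! s) = snd (Y ! t)")
    case True
    then have "\<gamma> r t = 0\<^sub>m (rep_dim (fst (Z ! r))) (rep_dim (fst (Y ! t)))" using ghom_zero[OF assms(5) rs(1) t] ne by simp
    then show ?thesis using ghom_dims[OF assms(4) t rs(2)] by (auto intro!: left_mult_zero_mat carrier_matI)
  next
    case False
    then have "\<phi> t s = 0\<^sub>m (rep_dim (fst (Y ! t))) (rep_dim (fst (X ! s)))" using ghom_zero[OF assms(4) t rs(2)] by simp
    then show ?thesis using ghom_dims[OF assms(5) rs(1) t] by (auto intro!: right_mult_zero_mat carrier_matI)
  qed
  then have z: "(\<gamma> r t * \<phi> t s) $$ (i, j) = 0" if "t < length Y" "i < rep_dim (fst (Z ! r))" "j < rep_dim (fst (X ! s))" for t i j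
    using that by simp
  show "gcomp X Y Z \<gamma> \<phi> r s = 0\<^sub>m (rep_dim (fst (Z ! r))) (rep_dim (fst (X ! s)))"
    unfolding gcomp_def by (intro eq_matI) (simp_all add: z del: index_mult_mat(1))
qed

lemma gm_comp:
  assumes "GO X" "GO Y" "GO Z" "ghom X Y \<phi>" "ghom Y Z \<gamma>"
  shows "cat_comp (G w) X Y Z (gm Y Z \<gamma>) (gm X Y \<phi>) = gm X Z (gcomp X Y Z \<gamma> \<phi>)"
proof (rule eq_matI)
  fix r s assume "r < dim_row (gm X Z (gcomp X Y Z \<gamma> \<phi>))" "s < dim_col (gm X Z (gcomp X Y Z \<gamma> \<phi>))"
  then have rs: "r < length Z" "s < length X" by auto
  have wr: "wrep v (fst (X ! s))" "wrep v (fst (Z ! r))" using rs assms by (auto simp: GO_nth)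
  have "cat_comp (G w) X Y Z (gm Y Z \<gamma>) (gm X Y \<phi>) $$ (r, s) =
     hom_sum I (fst (X ! s)) (fst (Z ! r)) (map (\<lambda>t. cls (fst (X ! s)) (fst (Z ! r)) (\<gamma> r t * \<phi> t s)) [0..<length Y])"
  proof -
    have "cat_comp I (fst (X ! s)) (fst (Y ! t)) (fst (Z ! r)) (gm Y Z \<gamma> $$ (r, t)) (gm X Y \<phi> $$ (t, s)) = cls (fst (X ! s)) (fst (Z ! r)) (\<gamma> r t * \<phi> t s)"
      if "t < length Y" for t
      using that rs assms by (simp add: gm_index) (intro I_comp; auto simp: GO_nth ghomD)
    then have m: "map (\<lambda>t. cat_comp I (fst (X ! s)) (fst (Y ! t)) (fst (Z ! r)) (gm Y Z \<gamma> $$ (r, t)) (gm X Y \<phi> $$ (t, s))) [0..<length Y]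
      = map (\<lambda>t. cls (fst (X ! s)) (fst (Z ! r)) (\<gamma> r t * \<phi> t s)) [0..<length Y]" by (intro map_cong) auto
    show ?thesis unfolding m[symmetric] using rs by (simp add: G_def graded_cat_def)
  qed
  also have "\<dots> = cls (fst (X ! s)) (fst (Z ! r)) (gcomp X Y Z \<gamma> \<phi> r s)"
    unfolding gcomp_def using rs assms wr
    by (subst hom_sum_cls) (auto intro: ghom_mult simp: atLeast0LessThan)
  finally show "cat_comp (G w) X Y Z (gm Y Z \<gamma>) (gm X Y \<phi>) $$ (r, s) = gm X Z (gcomp X Y Z \<gamma> \<phi>) $$ (r, s)"
    using rs by (simp add: gm_index)
qed (auto simp: G_def graded_cat_def)

lemma ghom_id: "GO X \<Longrightarrow> ghom X X (gid X)"
  by (auto simp: ghom_def gid_def GO_nth intro!: hom_id[of v] hom_zero[of v])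
lemma gm_id: "cat_id (G w) X = gm X X (gid X)"
  by (auto simp: G_def graded_cat_def diag_mor_def mat_eq_all gm_index gid_def)

lemma gcomp_id_left:
  assumes "GO X" "GO Y" "ghom X Y \<phi>" "r < length Y" "s < length X"
  shows "gcomp X Y Y (gid Y) \<phi> r s = \<phi> r s"
proof -
  have "msum (rep_dim (fst (Y ! r))) (rep_dim (fst (X ! s))) {..<length Y} (\<lambda>t. gid Y r t * \<phi> t s) = gid Y r r * \<phi> r s"
    using assms ghom_dims[OF assms(3)] by (intro msum_delta) (auto simp: gid_def one_mult_dim intro!: left_mult_zero_mat carrier_matI)
  then show ?thesis using assms ghom_dims[OF assms(3,4,5)] by (simp add: gcomp_def gid_def one_mult_dim)
qed

lemma gcomp_id_right:
  assumes "GO X" "GO Y" "ghom X Y \<phi>" "r < length Y" "s < length X"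
  shows "gcomp X X Y \<phi> (gid X) r s = \<phi> r s"
proof -
  have "msum (rep_dim (fst (Y ! r))) (rep_dim (fst (X ! s))) {..<length X} (\<lambda>t. \<phi> r t * gid X t s) = \<phi> r s * gid X s s"
    using assms ghom_dims[OF assms(3)] by (intro msum_delta) (auto simp: gid_def mult_one_dim intro!: right_mult_zero_mat carrier_matI)
  then show ?thesis using assms ghom_dims[OF assms(3,4,5)] by (simp add: gcomp_def gid_def mult_one_dim)
qed

lemma gcomp_assoc:
  assumes "GO X" "GO Y" "GO Z" "GO W" "ghom X Y \<phi>" "ghom Y Z \<gamma>" "ghom Z W \<delta>" "r < length W" "s < length X"
  shows "gcomp X Y W (gcomp Y Z W \<delta> \<gamma>) \<phi> r s = gcomp X Z W \<delta> (gcomp X Y Z \<gamma> \<phi>) r s"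
proof -
  let ?a = "rep_dim (fst (W ! r))" and ?b = "rep_dim (fst (X ! s))"
  note d1 = ghom_dims[OF assms(5)] and d2 = ghom_dims[OF assms(6)] and d3 = ghom_dims[OF assms(7)]
  have "gcomp X Y W (gcomp Y Z W \<delta> \<gamma>) \<phi> r s = msum ?a ?b {..<length Y} (\<lambda>t. msum ?a ?b {..<length Z} (\<lambda>u. \<delta> r u * \<gamma> u t * \<phi> t s))"
    unfolding gcomp_def
  proof (intro msum_cong)
    fix t assume "t \<in> {..<length Y}"
    then show "msum ?a (rep_dim (fst (Y ! t))) {..<length Z} (\<lambda>ta. \<delta> r ta * \<gamma> ta t) * \<phi> t s = msum ?a ?b {..<length Z} (\<lambda>u. \<delta> r u * \<gamma> u t * \<phi> t s)"
      using msum_mult[of "{..<length Z}" "\<lambda>ta. \<delta> r ta * \<gamma> ta t" ?a "\<phi> t s"] d1[of t s] d2 d3 assms by auto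
  qed
  also have "\<dots> = msum ?a ?b {..<length Z} (\<lambda>u. msum ?a ?b {..<length Y} (\<lambda>t. \<delta> r u * (\<gamma> u t * \<phi> t s)))"
    unfolding msum_swap[of _ _ "{..<length Y}"] using d1 d2 d3 assms by (intro msum_cong) (simp add: mult_assoc_dim)
  also have "\<dots> = gcomp X Z W \<delta> (gcomp X Y Z \<gamma> \<phi>) r s"
    unfolding gcomp_def
  proof (intro msum_cong)
    fix u assume "u \<in> {..<length Z}"
    then show "msum ?a ?b {..<length Y} (\<lambda>t. \<delta> r u * (\<gamma> u t * \<phi> t s)) = \<delta> r u * msum (rep_dim (fst (Z ! u))) ?b {..<length Y} (\<lambda>t. \<gamma> u t * \<phi> t s)"
      using mult_msum[of "{..<length Y}" "\<lambda>t. \<gamma> u t * \<phi> t s" "\<delta> r u" ?b] d1 d2 d3[of r u] assms by auto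
  qed
  finally show ?thesis .
qed

lemma G_comp_hom:
  assumes "GO X" "GO Y" "GO Z" "f \<in> cat_hom (G w) X Y" "g \<in> cat_hom (G w) Y Z"
  shows "cat_comp (G w') X Y Z g f \<in> cat_hom (G w) X Z"
proof -
  obtain \<phi> \<gamma> where *: "ghom X Y \<phi>" "ghom Y Z \<gamma>" "f = gm X Y \<phi>" "g = gm Y Z \<gamma>" using assms by (auto simp: G_hom)
  show ?thesis unfolding G_hom[OF assms(1,3)] *(3,4) using gm_comp[OF assms(1-3) *(1,2)] ghom_comp[OF assms(1-3) *(1,2)] by blast
qed

lemma G_assoc:
  assumes "GO X" "GO Y" "GO Z" "GO W" "f \<in> cat_hom (G w) X Y" "g \<in> cat_hom (G w) Y Z" "h \<in> cat_hom (G w) Z W"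
  shows "cat_comp (G w') X Y W (cat_comp (G w') Y Z W h g) f = cat_comp (G w') X Z W h (cat_comp (G w') X Y Z g f)"
proof -
  obtain \<phi> \<gamma> \<delta> where "ghom X Y \<phi>" "ghom Y Z \<gamma>" "ghom Z W \<delta>" "f = gm X Y \<phi>" "g = gm Y Z \<gamma>" "h = gm Z W \<delta>"
    using assms by (auto simp: G_hom)
  then show ?thesis using assms(1-4) by (simp add: gm_comp ghom_comp) (auto intro!: gm_cong gcomp_assoc)
qed

lemma G_id_hom: "GO X \<Longrightarrow> cat_id (G w') X \<in> cat_hom (G w) X X"
  unfolding gm_id using ghom_id by (subst G_hom) auto

lemma G_id_left: "GO X \<Longrightarrow> GO Y \<Longrightarrow> f \<in> cat_hom (G w) X Y \<Longrightarrow> cat_comp (G w') X Y Y (cat_id (G w'') Y) f = f"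
  by (auto simp: G_hom gm_id gm_comp ghom_id intro!: gm_cong gcomp_id_left)
lemma G_id_right: "GO X \<Longrightarrow> GO Y \<Longrightarrow> f \<in> cat_hom (G w) X Y \<Longrightarrow> cat_comp (G w') X X Y f (cat_id (G w'') X) = f"
  by (auto simp: G_hom gm_id gm_comp ghom_id intro!: gm_cong gcomp_id_right)

definition gten :: "('k uq_rep \<times> nat) list \<Rightarrow> ('k uq_rep \<times> nat) list \<Rightarrow> (nat \<Rightarrow> nat \<Rightarrow> 'k mat) \<Rightarrow> (nat \<Rightarrow> nat \<Rightarrow> 'k mat) \<Rightarrow> nat \<Rightarrow> nat \<Rightarrow> 'k mat" where
  "gten Y Y' \<phi> \<psi> r s = kron (\<phi> (r div length Y') (s div length Y)) (\<psi> (r mod length Y') (s mod length Y))"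

lemma ghom_ten:
  assumes "GO X" "GO X'" "GO Y" "GO Y'" "ghom X X' \<phi>" "ghom Y Y' \<psi>"
  shows "ghom (ten X Y) (ten X' Y') (gten Y Y' \<phi> \<psi>)"
  unfolding ghom_def
proof (intro allI impI conjI)
  fix r s assume "r < length (ten X' Y')" "s < length (ten X Y)"
  then have r: "r < length X' * length Y'" and s: "s < length X * length Y" by auto
  note rs = div_less_mult[OF r] mod_less_mult[OF r] div_less_mult[OF s] mod_less_mult[OF s]
  show "gten Y Y' \<phi> \<psi> r s \<in> uq_hom (fst (ten X Y ! s)) (fst (ten X' Y' ! r))"
    using rs r s assms by (auto simp: gten_def ten_nth GO_nth ghomD intro!: hkron)
  assume "snd (ten X Y ! s) \<noteq> snd (ten X' Y' ! r)"
  then have "snd (X ! (s div length Y)) \<noteq> snd (X' ! (r div length Y')) \<or> snd (Y ! (s mod length Y)) \<noteq> snd (Y' ! (r mod length Y'))"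
    using r s by (auto simp: ten_nth)
  then show "gten Y Y' \<phi> \<psi> r s = 0\<^sub>m (rep_dim (fst (ten X' Y' ! r))) (rep_dim (fst (ten X Y ! s)))"
    using rs r s ghom_zero[OF assms(5) rs(1,3)] ghom_zero[OF assms(6) rs(2,4)] ghom_dims[OF assms(5) rs(1,3)] ghom_dims[OF assms(6) rs(2,4)]
    by (auto simp: gten_def ten_nth)
qed

lemma gm_ten:
  assumes "GO X" "GO X'" "GO Y" "GO Y'" "ghom X X' \<phi>" "ghom Y Y' \<psi>"
  shows "ten_mor (G w) X X' Y Y' (gm X X' \<phi>) (gm Y Y' \<psi>) = gm (ten X Y) (ten X' Y') (gten Y Y' \<phi> \<psi>)"
proof (rule eq_matI)
  fix r s assume "r < dim_row (gm (ten X Y) (ten X' Y') (gten Y Y' \<phi> \<psi>))" "s < dim_col (gm (ten X Y) (ten X' Y') (gten Y Y' \<phi> \<psi>))"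
  then have r: "r < length X' * length Y'" and s: "s < length X * length Y" by auto
  note rs = div_less_mult[OF r] mod_less_mult[OF r] div_less_mult[OF s] mod_less_mult[OF s]
  show "ten_mor (G w) X X' Y Y' (gm X X' \<phi>) (gm Y Y' \<psi>) $$ (r, s) = gm (ten X Y) (ten X' Y') (gten Y Y' \<phi> \<psi>) $$ (r, s)"
    using rs r s assms by (simp add: G_def graded_cat_def gm_index ten_nth gten_def I_ten GO_nth ghomD)
qed (auto simp: G_def graded_cat_def)

lemma G_ten_hom:
  assumes "GO X" "GO X'" "GO Y" "GO Y'" "f \<in> cat_hom (G w) X X'" "g \<in> cat_hom (G w) Y Y'"
  shows "ten_mor (G w') X X' Y Y' f g \<in> cat_hom (G w) (ten X Y) (ten X' Y')"
proof -
  obtain \<phi> \<gamma> where *: "ghom X X' \<phi>" "ghom Y Y' \<gamma>" "f = gm X X' \<phi>" "g = gm Y Y' \<gamma>" using assms by (auto simp: G_hom)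
  show ?thesis unfolding G_hom[OF GO_ten[OF assms(1,3)] GO_ten[OF assms(2,4)]] *(3,4)
    using gm_ten[OF assms(1-4) *(1,2)] ghom_ten[OF assms(1-4) *(1,2)] by blast
qed

lemma gm_add:
  assumes "GO X" "GO Y" "ghom X Y \<phi>" "ghom X Y \<psi>"
  shows "cat_add (G w) X Y (gm X Y \<phi>) (gm X Y \<psi>) = gm X Y (\<lambda>r s. \<phi> r s + \<psi> r s)"
  using assms by (auto simp: G_def graded_cat_def mat_eq_all gm_index I_add GO_nth ghomD)

lemma ghom_add:
  assumes "GO X" "GO Y" "ghom X Y \<phi>" "ghom X Y \<psi>"
  shows "ghom X Y (\<lambda>r s. \<phi> r s + \<psi> r s)"
  using assms unfolding ghom_def by (auto intro!: hadd simp: GO_nth)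

lemma gm_scale:
  assumes "GO X" "GO Y" "ghom X Y \<phi>"
  shows "cat_scale (G w) X Y a (gm X Y \<phi>) = gm X Y (\<lambda>r s. a \<cdot>\<^sub>m \<phi> r s)"
  using assms by (auto simp: G_def graded_cat_def mat_eq_all gm_index I_scale GO_nth ghomD)

lemma G_simps [simp]: "ten_unit (G w) = unt" "ten_obj (G w) = ten"
  by (simp_all add: G_def graded_cat_def)

lemma G_lunit: "GO X \<Longrightarrow> ten_lunit (G w) X = cat_id (G w') X"
  by (auto simp: G_def graded_cat_def ten_unit_left[unfolded graded_ten_obj_def] ten_unit_left diag_mor_def mat_eq_all uq_tensor_unit[of v] GO_nth)
lemma G_runit: "GO X \<Longrightarrow> ten_runit (G w) X = cat_id (G w') X"
  by (auto simp: G_def graded_cat_def ten_unit_right diag_mor_def mat_eq_all uq_tensor_unit[of v] GO_nth)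

lemma G_assoc_1:
  assumes "GO X" "GO Y" "GO Z"
  shows "ten_assoc (G (\<lambda>_ _ _. 1)) X Y Z = cat_id (G w) (ten (ten X Y) Z)"
proof (rule eq_matI)
  note e = ten_assoc_obj[OF assms]
  fix r s assume "r < dim_row (cat_id (G w) (ten (ten X Y) Z))" "s < dim_col (cat_id (G w) (ten (ten X Y) Z))"
  then have r: "r < length X * length Y * length Z" and s: "s < length X * length Y * length Z" by (auto simp: gm_id)
  note a = div_less_mult[OF r] mod_less_mult[OF r]
  have b: "r div length Z div length Y = r div (length Y * length Z)" by (simp add: div_mult2_eq[symmetric] mult.commute)
  have c: "r div length Z div length Y < length X" "r div length Z mod length Y < length Y"
    using div_less_mult[OF a(1)] mod_less_mult[OF a(1)] .
  have wr: "wrep v (fst (X ! (r div length Z div length Y)))" "wrep v (fst (Y ! (r div length Z mod length Y)))" "wrep v (fst (Z ! (r mod length Z)))"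
    using a c assms by (auto simp: GO_nth)
  have fr: "fst (ten (ten X Y) Z ! r) = uq_tensor (uq_tensor (fst (X ! (r div length Z div length Y))) (fst (Y ! (r div length Z mod length Y)))) (fst (Z ! (r mod length Z)))"
    using r a by (simp add: ten_nth)
  have "ten_assoc (G (\<lambda>_ _ _. 1)) X Y Z $$ (r, s) = gm (ten (ten X Y) Z) (ten (ten X Y) Z) (gid (ten (ten X Y) Z)) $$ (r, s)"
  proof (cases "r = s")
    case True
    have "ten_assoc (G (\<lambda>_ _ _. 1)) X Y Z $$ (r, r) = cls (fst (ten (ten X Y) Z ! r)) (fst (ten (ten X Y) Z ! r)) (1 \<cdot>\<^sub>m 1\<^sub>m (rep_dim (fst (ten (ten X Y) Z ! r))))"
      using r wr by (simp add: G_def graded_cat_def diag_mor_def Let_def e[symmetric] mult.assoc[symmetric] b[symmetric] fr uq_tensor_assoc[of v])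
        (subst I_scale; simp add: uq_tensor_assoc[of v] mult.assoc; (rule hom_id[of v, THEN back_subst[of "\<lambda>x. 1\<^sub>m x \<in> _"]], auto simp: mult.assoc)?)
    moreover have "1 \<cdot>\<^sub>m 1\<^sub>m m = (1\<^sub>m m :: 'k mat)" for m by (auto intro!: eq_matI)
    ultimately show ?thesis using r s True by (simp add: gm_index gid_def)
  next
    case False
    then show ?thesis using r s
      by (simp add: G_def graded_cat_def diag_mor_def gm_index gid_def e[symmetric] mult.assoc[symmetric])
  qed
  then show "ten_assoc (G (\<lambda>_ _ _. 1)) X Y Z $$ (r, s) = cat_id (G w) (ten (ten X Y) Z) $$ (r, s)" by (simp add: gm_id)
qed (auto simp: gm_id G_def graded_cat_def diag_mor_def ten_assoc_obj[OF assms])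

section \<open>Objects generated by \<open>Z\<close>\<close>

abbreviation G1 where "G1 \<equiv> G (\<lambda>_ _ _. 1)"

definition GN :: "('k uq_rep \<times> nat) list set" where "GN = generated_objs G1 [(V, 1)]"

lemma n_ge2: "n \<ge> 2" using n_even n_pos by presburger
declare n_pos [simp]

lemma GN_GO [simp]: "X \<in> GN \<Longrightarrow> GO X"
  unfolding GN_def
  by (induction rule: generated_objs.induct) (auto simp: G_obj)

lemma GN_unit [simp]: "unt \<in> GN"
  using gen_unit[of G1 "[(V, 1)]"] by (simp add: GN_def)
lemma GN_Z [simp]: "[(V, Suc 0)] \<in> GN"
  using gen_base[of "[(V, 1)]" G1] n_ge2 by (simp add: G_obj GN_def)
lemma GN_ten [simp]: "X \<in> GN \<Longrightarrow> Y \<in> GN \<Longrightarrow> ten X Y \<in> GN"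
  unfolding GN_def using gen_tensor[of X G1 "[(V,1)]" Y] by simp

lemma GN_retract:
  assumes "A \<in> GN" "GO B" "i \<in> cat_hom G1 B A" "p \<in> cat_hom G1 A B" "cat_comp G1 B A B p i = cat_id G1 B"
  shows "B \<in> GN"
  unfolding GN_def by (rule gen_summand[of A]) (use assms in \<open>auto simp: GN_def G_obj retract_of_def\<close>)

definition incl :: "('k uq_rep \<times> nat) list \<Rightarrow> nat \<Rightarrow> nat \<Rightarrow> nat \<Rightarrow> 'k mat" where
  "incl X i r s = gid X r i"
definition proj :: "('k uq_rep \<times> nat) list \<Rightarrow> nat \<Rightarrow> nat \<Rightarrow> nat \<Rightarrow> 'k mat" where
  "proj X i r s = gid X i s"

lemma ghom_incl: "GO X \<Longrightarrow> i < length X \<Longrightarrow> ghom [X ! i] X (incl X i)"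
  using ghom_id[of X] by (auto simp: ghom_def incl_def)
lemma ghom_proj: "GO X \<Longrightarrow> i < length X \<Longrightarrow> ghom X [X ! i] (proj X i)"
  using ghom_id[of X] by (auto simp: ghom_def proj_def)
lemma GO_single: "GO X \<Longrightarrow> i < length X \<Longrightarrow> GO [X ! i]"
  by (simp add: GO_nth)

lemma GN_single:
  assumes X: "X \<in> GN" and i: "i < length X"
  shows "[X ! i] \<in> GN"
proof (rule GN_retract[OF X])
  have g: "GO X" "GO [X ! i]" using assms GO_single by auto
  show "GO [X ! i]" by fact
  show "gm [X ! i] X (incl X i) \<in> cat_hom G1 [X ! i] X" using g ghom_incl i by (subst G_hom) auto
  show "gm X [X ! i] (proj X i) \<in> cat_hom G1 X [X ! i]" using g ghom_proj i by (subst G_hom) auto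
  have "gcomp [X ! i] X [X ! i] (proj X i) (incl X i) r s = gid [X ! i] r s" if "r < 1" "s < 1" for r s
    using gcomp_id_left[OF g(1) g(1) ghom_id[OF g(1)] i i] that by (simp add: gcomp_def proj_def incl_def gid_def)
  then show "cat_comp G1 [X ! i] X [X ! i] (gm X [X ! i] (proj X i)) (gm [X ! i] X (incl X i)) = cat_id G1 [X ! i]"
    using g i by (simp add: gm_comp ghom_proj ghom_incl gm_id) (intro gm_cong, auto)
qed

lemma neg_one_mod: "(-1) ^ (j mod n) = ((-1) ^ j :: 'k)"
  using n_even by (simp add: minus_one_power_iff dvd_mod_iff)

lemma par_mod: "par X (j mod n) h \<longleftrightarrow> par X j h"
  by (simp add: par_def neg_one_mod)

lemma par_tensor:
  assumes T: "X \<in> T" "Y \<in> T" and "par X i (1\<^sub>m (rep_dim X))" "par Y j (1\<^sub>m (rep_dim Y))"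
  shows "par (uq_tensor X Y) (i + j) (1\<^sub>m (rep_dim (uq_tensor X Y)))"
proof -
  have "eqv (uq_tensor X Y) (uq_tensor X Y) (kron (1\<^sub>m (rep_dim X) * K4 X) (1\<^sub>m (rep_dim Y) * K4 Y))
     (kron ((-1) ^ i \<cdot>\<^sub>m 1\<^sub>m (rep_dim X)) ((-1) ^ j \<cdot>\<^sub>m 1\<^sub>m (rep_dim Y)))"
    using assms by (intro eqv_kron) (auto simp: par_def)
  then show ?thesis using T by (simp add: par_def one_mult_dim K4_tensor kron_smult_left kron_smult_right kron_one_one smult_smult power_add mult.commute)
qed

definition gpar :: "('k uq_rep \<times> nat) list \<Rightarrow> bool" where
  "gpar X \<longleftrightarrow> (\<forall>i<length X. par (fst (X ! i)) (snd (X ! i)) (1\<^sub>m (rep_dim (fst (X ! i)))))"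

lemma par_gcomp:
  assumes "GO S" "GO A" "gpar A" "ghom S A \<phi>" "ghom A S \<gamma>" and s: "s < length S"
  shows "par (fst (S ! s)) (snd (S ! s)) (gcomp S A S \<gamma> \<phi> s s)"
  unfolding gcomp_def
proof (rule par_msum)
  show w: "wrep v (fst (S ! s))" using assms GO_nth by blast
  fix t assume "t \<in> {..<length A}"
  then have t: "t < length A" by simp
  have wt: "wrep v (fst (A ! t))" using assms t GO_nth by blast
  have 1: "\<gamma> s t * \<phi> t s \<in> uq_hom (fst (S ! s)) (fst (S ! s))" by (rule ghom_mult[OF assms(1,2,1,4,5) s t s])
  moreover have "par (fst (S ! s)) (snd (S ! s)) (\<gamma> s t * \<phi> t s)"
  proof (cases "snd (S ! s) = snd (A ! t)")
    case True
    then show ?thesis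
      using par_factor[OF w wt ghomD[OF assms(4) t s] ghomD[OF assms(5) s t]] assms(3) t by (simp add: gpar_def)
  next
    case False
    then have "\<gamma> s t * \<phi> t s = 0\<^sub>m (rep_dim (fst (S ! s))) (rep_dim (fst (S ! s)))"
      using ghom_zero[OF assms(4) t s] ghom_dims[OF assms(5) s t] by (auto intro!: right_mult_zero_mat carrier_matI)
    then show ?thesis using par_zero[OF w] by simp
  qed
  ultimately show "par (fst (S ! s)) (snd (S ! s)) (\<gamma> s t * \<phi> t s) \<and> \<gamma> s t * \<phi> t s \<in> uq_hom (fst (S ! s)) (fst (S ! s))" by simp
qed simp

lemma inv_assoc_G1:
  assumes "GO X" "GO Y" "GO Z"
  shows "inv_mor G1 (ten (ten X Y) Z) (ten X (ten Y Z)) (ten_assoc G1 X Y Z) = cat_id G1 (ten (ten X Y) Z)"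
proof -
  let ?O = "ten (ten X Y) Z" and ?i = "cat_id G1 (ten (ten X Y) Z)"
  have O: "GO ?O" using assms by simp
  note i = G_id_hom[OF O]
  show ?thesis
    unfolding inv_mor_def inverse_mors_def ten_assoc_obj[OF assms, symmetric] G_assoc_1[OF assms, of "\<lambda>_ _ _. 1"]
  proof (rule the_equality)
    show "?i \<in> cat_hom G1 ?O ?O \<and> ?i \<in> cat_hom G1 ?O ?O \<and> cat_comp G1 ?O ?O ?O ?i ?i = ?i \<and> cat_comp G1 ?O ?O ?O ?i ?i = ?i"
      using i G_id_left[OF O O i] by blast
    fix g assume "?i \<in> cat_hom G1 ?O ?O \<and> g \<in> cat_hom G1 ?O ?O \<and> cat_comp G1 ?O ?O ?O g ?i = ?i \<and> cat_comp G1 ?O ?O ?O ?i g = ?i"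
    then show "g = ?i" using G_id_left[OF O O, of g] by metis
  qed
qed

text \<open>An evaluation is invariant under \<open>K^4\<close>, so the action on one factor can be traded for the action on the
  other, which is a sign.\<close>

lemma ev_par:
  assumes T: "B \<in> T" "A \<in> T" and ev: "ev \<in> uq_hom (uq_tensor B A) uq_trivial" and A: "par A i (1\<^sub>m (rep_dim A))"
  shows "eqv (uq_tensor B A) uq_trivial (ev * kron (K4 B) (1\<^sub>m (rep_dim A))) ((-1) ^ i \<cdot>\<^sub>m ev)"
    and "ev' \<in> uq_hom (uq_tensor A B) uq_trivial \<Longrightarrow> eqv (uq_tensor A B) uq_trivial (ev' * kron (1\<^sub>m (rep_dim A)) (K4 B)) ((-1) ^ i \<cdot>\<^sub>m ev')"
proof -
  have w: "wrep v B" "wrep v A" using T by auto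
  define s :: 'k where "s = (-1) ^ i"
  have ss: "s * s = 1" by (simp add: s_def power_add[symmetric] mult_2[symmetric] power_mult)
  have "eqv A A (s \<cdot>\<^sub>m (1\<^sub>m (rep_dim A) * K4 A)) (s \<cdot>\<^sub>m (s \<cdot>\<^sub>m 1\<^sub>m (rep_dim A)))"
    using A w by (intro eqv_smult) (auto simp: par_def s_def)
  moreover have "s \<cdot>\<^sub>m (s \<cdot>\<^sub>m 1\<^sub>m (rep_dim A)) = 1\<^sub>m (rep_dim A)" by (intro eq_matI) (auto simp: ss mult.assoc[symmetric])
  ultimately have k: "eqv A A (1\<^sub>m (rep_dim A)) (s \<cdot>\<^sub>m K4 A)"
    using w by (simp add: one_mult_dim eqv_sym[OF w(2) w(2)])
  have kb: "eqv B B (K4 B) (K4 B)" using w by (intro eqv_refl) auto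
  {
    have "eqv (uq_tensor B A) uq_trivial (ev * kron (K4 B) (1\<^sub>m (rep_dim A))) (ev * kron (K4 B) (s \<cdot>\<^sub>m K4 A))"
      using T w k kb ev by (intro eqv_comp[of _ "uq_tensor B A"] eqv_kron eqv_refl) auto
    moreover have "ev * kron (K4 B) (s \<cdot>\<^sub>m K4 A) = s \<cdot>\<^sub>m (ev * K4 (uq_tensor B A))"
      using w uq_homD(1,2)[OF ev] by (simp add: kron_smult_right mult_smult_dim K4_tensor)
    moreover have "ev * K4 (uq_tensor B A) = ev"
      using K4_natural[OF _ _ ev] w uq_homD(1)[OF ev] by (simp add: K4_trivial one_mult_dim)
    ultimately show "eqv (uq_tensor B A) uq_trivial (ev * kron (K4 B) (1\<^sub>m (rep_dim A))) ((-1) ^ i \<cdot>\<^sub>m ev)" by (simp add: s_def)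
  }
  assume ev: "ev' \<in> uq_hom (uq_tensor A B) uq_trivial"
  have "eqv (uq_tensor A B) uq_trivial (ev' * kron (1\<^sub>m (rep_dim A)) (K4 B)) (ev' * kron (s \<cdot>\<^sub>m K4 A) (K4 B))"
    using T w k kb ev by (intro eqv_comp[of _ "uq_tensor A B"] eqv_kron eqv_refl) auto
  moreover have "ev' * kron (s \<cdot>\<^sub>m K4 A) (K4 B) = s \<cdot>\<^sub>m (ev' * K4 (uq_tensor A B))"
    using w uq_homD(1,2)[OF ev] by (simp add: kron_smult_left mult_smult_dim K4_tensor)
  moreover have "ev' * K4 (uq_tensor A B) = ev'"
    using K4_natural[OF _ _ ev] w uq_homD(1)[OF ev] by (simp add: K4_trivial one_mult_dim)
  ultimately show "eqv (uq_tensor A B) uq_trivial (ev' * kron (1\<^sub>m (rep_dim A)) (K4 B)) ((-1) ^ i \<cdot>\<^sub>m ev')" by (simp add: s_def)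
qed

lemma neg_one_sum: "(i + j) mod n = 0 \<Longrightarrow> (-1) ^ i = ((-1) ^ j :: 'k)"
proof -
  assume "(i + j) mod n = 0"
  then have "n dvd i + j" by (simp add: mod_eq_0_iff_dvd)
  then have "even (i + j)" using n_even dvd_trans by blast
  then show ?thesis by (simp add: minus_one_power_iff)
qed

text \<open>Dualisation negates degrees and \<open>K^4\<close> is monoidal.  In coordinates, the zigzag identity writes the
  identity of a summand of \<open>B\<close> as a sum of composites through an evaluation \<open>ev\<close>, and \<open>ev_par\<close> moves
  \<open>K^4\<close> across it.\<close>

lemma gpar_dualA:
  assumes A: "GO A" "gpar A" and B: "GO B" and ld: "left_dual_of G1 A B"
  shows "gpar B"
proof -
  define a b where "a = length A" and "b = length B"
  note O = A(1) B
  from ld obtain E C where E: "E \<in> cat_hom G1 (ten B A) unt" and C: "C \<in> cat_hom G1 unt (ten A B)"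
    and z: "cat_comp G1 (ten B unt) (ten unt B) B (ten_lunit G1 B)
          (cat_comp G1 (ten B unt) (ten (ten B A) B) (ten unt B)
            (ten_mor G1 (ten B A) unt B B E (cat_id G1 B))
            (cat_comp G1 (ten B unt) (ten B (ten A B)) (ten (ten B A) B)
              (inv_mor G1 (ten (ten B A) B) (ten B (ten A B)) (ten_assoc G1 B A B))
              (ten_mor G1 B B unt (ten A B) (cat_id G1 B) C))) = ten_runit G1 B"
    unfolding left_dual_of_def Let_def by auto
  have E': "ten_mor G1 (ten B A) unt B B E (cat_id G1 B) \<in> cat_hom G1 (ten (ten B A) B) B"
    using G_ten_hom[of "ten B A" unt B B E _ "cat_id G1 B"] O E G_id_hom[OF B] by (simp add: ten_unit_left)
  have C': "ten_mor G1 B B unt (ten A B) (cat_id G1 B) C \<in> cat_hom G1 B (ten (ten B A) B)"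
    using G_ten_hom[of B B unt "ten A B" "cat_id G1 B" _ C] O C G_id_hom[OF B] by (simp add: ten_unit_right ten_assoc_obj)
  have z': "cat_comp G1 B (ten (ten B A) B) B (ten_mor G1 (ten B A) unt B B E (cat_id G1 B)) (ten_mor G1 B B unt (ten A B) (cat_id G1 B) C) = cat_id G1 B"
  proof -
    have O3: "GO (ten (ten B A) B)" using O by simp
    note z1 = z[unfolded inv_assoc_G1[OF B A(1) B] ten_unit_left[OF B] ten_unit_right[OF B],
        unfolded ten_assoc_obj[OF B A(1) B, symmetric] G_lunit[OF B, of _ "\<lambda>_ _ _. 1"] G_runit[OF B, of _ "\<lambda>_ _ _. 1"]]
    note ia = G_id_left[OF B O3 C', of "\<lambda>_ _ _. 1" "\<lambda>_ _ _. 1"]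
    note ib = G_id_left[OF B B G_comp_hom[OF B O3 B C' E'], of "\<lambda>_ _ _. 1" "\<lambda>_ _ _. 1"]
    show ?thesis using z1 unfolding ia ib .
  qed
  obtain ev where ev: "ghom (ten B A) unt ev" "E = gm (ten B A) unt ev" using E O by (auto simp: G_hom)
  obtain co where co: "ghom unt (ten A B) co" "C = gm unt (ten A B) co" using C O by (auto simp: G_hom)
  define x where "x = gten B B ev (gid B)"
  define y where "y = gten unt (ten A B) (gid B) co"
  have x: "ghom (ten (ten B A) B) B x" "ten_mor G1 (ten B A) unt B B E (cat_id G1 B) = gm (ten (ten B A) B) B x"
    using ghom_ten[OF _ _ B B ev(1) ghom_id[OF B]] gm_ten[OF _ _ B B ev(1) ghom_id[OF B]] O by (simp_all add: x_def ev gm_id ten_unit_left)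
  have y: "ghom B (ten (ten B A) B) y" "ten_mor G1 B B unt (ten A B) (cat_id G1 B) C = gm B (ten (ten B A) B) y"
    using ghom_ten[OF B B _ _ ghom_id[OF B] co(1)] gm_ten[OF B B _ _ ghom_id[OF B] co(1)] O by (simp_all add: y_def co gm_id ten_unit_right ten_assoc_obj)
  have "gm B B (gcomp B (ten (ten B A) B) B x y) = gm B B (gid B)"
    using z' O x y by (simp add: gm_comp gm_id)
  then have all: "\<forall>r<length B. \<forall>s<length B. eqv (fst (B ! s)) (fst (B ! r)) (gcomp B (ten (ten B A) B) B x y r s) (gid B r s)"
    using gm_eq_iff[OF B B ghom_comp[OF B _ B y(1) x(1)] ghom_id[OF B]] O by simp
  have id: "eqv (fst (B ! s)) (fst (B ! s)) (gcomp B (ten (ten B A) B) B x y s s) (1\<^sub>m (rep_dim (fst (B ! s))))" if "s < length B" for s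
    using all[rule_format, OF that that] by (simp add: gid_def)
  show ?thesis
    unfolding gpar_def
  proof (intro allI impI)
    fix s assume s: "s < length B"
    let ?B = "fst (B ! s)" and ?j = "snd (B ! s)"
    have w: "wrep v ?B" and TB: "?B \<in> T" and jn: "?j < n" using s B GO_nth by blast+
    show "par ?B ?j (1\<^sub>m (rep_dim ?B))"
    proof (rule par_eqv[OF w _ eqv_sym[OF w w id[OF s]]])
      show "par ?B ?j (gcomp B (ten (ten B A) B) B x y s s)"
        unfolding gcomp_def
      proof (rule par_msum[OF w])
        fix t assume "t \<in> {..<length (ten (ten B A) B)}"
        then have t: "t < b * a * b" by (simp add: a_def b_def)
        then have t': "t < b * (a * b)" by (simp add: mult.assoc)
        have tL: "t < length (ten (ten B A) B)" using t by (simp add: a_def b_def)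
        have O3: "GO (ten (ten B A) B)" using O by simp
        have hm: "x s t * y t s \<in> uq_hom ?B ?B" by (rule ghom_mult[OF B O3 B y(1) x(1) s tL s])
        define p where "p = t div b" define q where "q = t mod b"
        define p1 where "p1 = t div (a * b)" define q1 where "q1 = t mod (a * b)"
        have pq: "p < b * a" "q < b" "p1 < b" "q1 < a * b"
          using div_less_mult[OF t] mod_less_mult[OF t] div_less_mult[OF t'] mod_less_mult[OF t'] by (auto simp: p_def q_def p1_def q1_def)
        have pb: "p div a = p1" by (simp add: p_def p1_def div_mult2_eq[symmetric] mult.commute)
        have xs: "x s t = kron (ev 0 p) (gid B s q)" using s by (simp add: x_def gten_def p_def q_def b_def)
        have ys: "y t s = kron (gid B p1 s) (co q1 0)" by (simp add: y_def gten_def p1_def q1_def a_def b_def)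
        have pa: "p mod a < a" using mod_less_mult[OF pq(1)] .
        let ?A = "fst (A ! (p mod a))"
        have wA: "wrep v ?A" and TA: "?A \<in> T" using pa A(1) GO_nth by (auto simp: a_def)
        have d_co: "dim_row (co q1 0) = rep_dim (fst (ten A B ! q1))" "dim_col (co q1 0) = 1"
          using ghom_dims[OF co(1), of q1 0] pq by (auto simp: a_def b_def)
        have "par ?B ?j (x s t * y t s)"
        proof (cases "p1 = s")
          case False
          have "y t s = 0\<^sub>m (dim_row (y t s)) (rep_dim ?B)"
            using False d_co by (simp add: ys gid_def)
          then have "x s t * y t s = 0\<^sub>m (rep_dim ?B) (rep_dim ?B)"
            using ghom_dims[OF x(1) s tL] ghom_dims[OF y(1) tL s] by (metis carrier_matI right_mult_zero_mat)
          then show ?thesis using par_zero[OF w] by simp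
        next
          case True
          have fB: "fst (ten B A ! p) = uq_tensor ?B ?A" "snd (ten B A ! p) = (?j + snd (A ! (p mod a))) mod n"
            using pq(1) True pb by (simp_all add: ten_nth a_def b_def)
          have evh: "ev 0 p \<in> uq_hom (uq_tensor ?B ?A) uq_trivial"
            using ghomD[OF ev(1), of 0 p] pq(1) fB by (simp add: a_def b_def)
          note dev = uq_homD(1,2)[OF evh]
          have wq: "wrep v (fst (B ! q))" and Tq: "fst (B ! q) \<in> T" using pq(2) B GO_nth by (auto simp: b_def)
          let ?Q = "fst (B ! q)"
          have gq: "gid B s q \<in> uq_hom ?Q ?B" using ghomD[OF ghom_id[OF B] s, of q] pq(2) by (simp add: b_def)
          note dq = uq_homD(1,2)[OF gq]
          have q1: "q1 div b = p mod a" "q1 mod b = q"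
          proof -
            have "b > 0" using pq(2) by simp
            have "q1 = b * (t div b mod a) + t mod b" by (simp add: q1_def mod_mult2_eq[symmetric] mult.commute)
            then show "q1 div b = p mod a" "q1 mod b = q" using \<open>b > 0\<close> by (simp_all add: p_def q_def)
          qed
          have fq: "fst (ten A B ! q1) = uq_tensor ?A ?Q" using pq(4) q1 by (simp add: ten_nth a_def b_def)
          have coh: "co q1 0 \<in> uq_hom uq_trivial (uq_tensor ?A ?Q)"
            using ghomD[OF co(1), of q1 0] pq(4) fq by (simp add: a_def b_def)
          note dco = uq_homD(1,2)[OF coh]
          have y1: "y t s = kron (1\<^sub>m (rep_dim ?B)) (co q1 0)" using True by (simp add: ys gid_def)
          have f2: "eqv (uq_tensor ?B ?A) uq_trivial (ev 0 p * kron (K4 ?B) (1\<^sub>m (rep_dim ?A))) ((-1) ^ ?j \<cdot>\<^sub>m ev 0 p)"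
          proof (cases "(?j + snd (A ! (p mod a))) mod n = 0")
            case True
            have "(-1) ^ snd (A ! (p mod a)) = ((-1) ^ ?j :: 'k)" using neg_one_sum[OF True] by simp
            then show ?thesis using ev_par(1)[OF TB TA evh, of "snd (A ! (p mod a))"] A(2) pa by (simp add: gpar_def a_def)
          next
            case False
            then have z: "ev 0 p = 0\<^sub>m 1 (rep_dim ?B * rep_dim ?A)" using ghom_zero[OF ev(1), of 0 p] pq(1) fB by (simp add: a_def b_def)
            have "0\<^sub>m 1 (rep_dim ?B * rep_dim ?A) * kron (K4 ?B) (1\<^sub>m (rep_dim ?A)) = 0\<^sub>m 1 (rep_dim ?B * rep_dim ?A)"
              using w by (intro left_mult_zero_mat) (auto intro!: carrier_matI)
            then show ?thesis using evh w wA unfolding z by (auto intro!: eqv_refl)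
          qed
          have "x s t * y t s * K4 ?B = kron (ev 0 p * kron (K4 ?B) (1\<^sub>m (rep_dim ?A))) (gid B s q) * kron (1\<^sub>m (rep_dim ?B)) (co q1 0)"
          proof -
            have "y t s * K4 ?B = kron (K4 ?B) (co q1 0)"
            proof -
              have "K4 ?B = kron (K4 ?B) (1\<^sub>m 1)" by simp
              then have e: "y t s * K4 ?B = kron (1\<^sub>m (rep_dim ?B)) (co q1 0) * kron (K4 ?B) (1\<^sub>m 1)" by (metis y1)
              have "kron (1\<^sub>m (rep_dim ?B)) (co q1 0) * kron (K4 ?B) (1\<^sub>m 1) = kron (1\<^sub>m (rep_dim ?B) * K4 ?B) (co q1 0 * 1\<^sub>m 1)"
                using dco w by (intro kron_mult) auto
              then show ?thesis unfolding e using dco w by (simp only: one_mult_dim K4_dim mult_one_dim rep_trivial_simps)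
            qed
            also have "\<dots> = kron (kron (K4 ?B) (1\<^sub>m (rep_dim ?A))) (1\<^sub>m (rep_dim ?Q)) * kron (1\<^sub>m (rep_dim ?B)) (co q1 0)"
              using dco w by (simp add: kron_assoc kron_one_one kron_mult one_mult_dim mult_one_dim)
            finally have 1: "y t s * K4 ?B = kron (kron (K4 ?B) (1\<^sub>m (rep_dim ?A))) (1\<^sub>m (rep_dim ?Q)) * kron (1\<^sub>m (rep_dim ?B)) (co q1 0)" .
            have "x s t * y t s * K4 ?B = x s t * (y t s * K4 ?B)"
              using ghom_dims[OF x(1) s tL] ghom_dims[OF y(1) tL s] w by (simp add: mult_assoc_dim)
            also have "\<dots> = (kron (ev 0 p) (gid B s q) * kron (kron (K4 ?B) (1\<^sub>m (rep_dim ?A))) (1\<^sub>m (rep_dim ?Q))) * kron (1\<^sub>m (rep_dim ?B)) (co q1 0)"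
              unfolding 1 xs using dev dq dco w by (simp add: mult_assoc_dim mult.assoc)
            also have "kron (ev 0 p) (gid B s q) * kron (kron (K4 ?B) (1\<^sub>m (rep_dim ?A))) (1\<^sub>m (rep_dim ?Q)) = kron (ev 0 p * kron (K4 ?B) (1\<^sub>m (rep_dim ?A))) (gid B s q)"
              using dev dq w by (simp add: kron_mult mult_one_dim)
            finally show ?thesis .
          qed
          moreover have "eqv ?B ?B (kron (ev 0 p * kron (K4 ?B) (1\<^sub>m (rep_dim ?A))) (gid B s q) * kron (1\<^sub>m (rep_dim ?B)) (co q1 0))
             (kron ((-1) ^ ?j \<cdot>\<^sub>m ev 0 p) (gid B s q) * kron (1\<^sub>m (rep_dim ?B)) (co q1 0))"
          proof (rule eqv_comp[of _ "uq_tensor (uq_tensor ?B ?A) ?Q"])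
            show "eqv ?B (uq_tensor (uq_tensor ?B ?A) ?Q) (kron (1\<^sub>m (rep_dim ?B)) (co q1 0)) (kron (1\<^sub>m (rep_dim ?B)) (co q1 0))"
              using hkron[OF w w wrep_trivial _ hom_id[OF w] coh] w wA wq
              by (intro eqv_refl) (auto simp: uq_tensor_unit[of v] uq_tensor_assoc[of v])
            show "eqv (uq_tensor (uq_tensor ?B ?A) ?Q) ?B (kron (ev 0 p * kron (K4 ?B) (1\<^sub>m (rep_dim ?A))) (gid B s q)) (kron ((-1) ^ ?j \<cdot>\<^sub>m ev 0 p) (gid B s q))"
              using eqv_kron[OF _ _ Tq TB f2 eqv_refl[OF wq w gq]] TB TA w by (simp add: uq_tensor_unit[of v])
          qed (use w wA wq in auto)
          moreover have "kron ((-1) ^ ?j \<cdot>\<^sub>m ev 0 p) (gid B s q) * kron (1\<^sub>m (rep_dim ?B)) (co q1 0) = (-1) ^ ?j \<cdot>\<^sub>m (x s t * y t s)"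
            unfolding xs y1 using dev dq dco by (simp add: kron_smult_left smult_mult_dim mult.assoc)
          ultimately show ?thesis by (simp add: par_def)
        qed
        then show "par ?B ?j (x s t * y t s) \<and> x s t * y t s \<in> uq_hom ?B ?B" using hm by simp
      qed simp
    qed
  qed
qed

text \<open>The mirror image of the previous argument.\<close>

lemma gpar_dualB:
  assumes A: "GO A" "gpar A" and B: "GO B" and ld: "left_dual_of G1 B A"
  shows "gpar B"
proof -
  define a b where "a = length A" and "b = length B"
  note O = A(1) B
  from ld obtain E C where E: "E \<in> cat_hom G1 (ten A B) unt" and C: "C \<in> cat_hom G1 unt (ten B A)"
    and z: "cat_comp G1 (ten unt B) (ten B unt) B (ten_runit G1 B)
          (cat_comp G1 (ten unt B) (ten B (ten A B)) (ten B unt)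
            (ten_mor G1 B B (ten A B) unt (cat_id G1 B) E)
            (cat_comp G1 (ten unt B) (ten (ten B A) B) (ten B (ten A B))
              (ten_assoc G1 B A B)
              (ten_mor G1 unt (ten B A) B B C (cat_id G1 B)))) = ten_lunit G1 B"
    unfolding left_dual_of_def Let_def by auto
  have E': "ten_mor G1 B B (ten A B) unt (cat_id G1 B) E \<in> cat_hom G1 (ten (ten B A) B) B"
    using G_ten_hom[of B B "ten A B" unt "cat_id G1 B" _ E] O E G_id_hom[OF B] by (simp add: ten_unit_right ten_assoc_obj)
  have C': "ten_mor G1 unt (ten B A) B B C (cat_id G1 B) \<in> cat_hom G1 B (ten (ten B A) B)"
    using G_ten_hom[of unt "ten B A" B B C _ "cat_id G1 B"] O C G_id_hom[OF B] by (simp add: ten_unit_left)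
  have z': "cat_comp G1 B (ten (ten B A) B) B (ten_mor G1 B B (ten A B) unt (cat_id G1 B) E) (ten_mor G1 unt (ten B A) B B C (cat_id G1 B)) = cat_id G1 B"
  proof -
    have O3: "GO (ten (ten B A) B)" using O by simp
    note z1 = z[unfolded G_assoc_1[OF B A(1) B, of "\<lambda>_ _ _. 1"] ten_unit_left[OF B] ten_unit_right[OF B],
        unfolded ten_assoc_obj[OF B A(1) B, symmetric] G_lunit[OF B, of _ "\<lambda>_ _ _. 1"] G_runit[OF B, of _ "\<lambda>_ _ _. 1"]]
    note ia = G_id_left[OF B O3 C', of "\<lambda>_ _ _. 1" "\<lambda>_ _ _. 1"]
    note ib = G_id_left[OF B B G_comp_hom[OF B O3 B C' E'], of "\<lambda>_ _ _. 1" "\<lambda>_ _ _. 1"]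
    show ?thesis using z1 unfolding ia ib .
  qed
  obtain ev where ev: "ghom (ten A B) unt ev" "E = gm (ten A B) unt ev" using E O by (auto simp: G_hom)
  obtain co where co: "ghom unt (ten B A) co" "C = gm unt (ten B A) co" using C O by (auto simp: G_hom)
  define x where "x = gten (ten A B) unt (gid B) ev"
  define y where "y = gten B B co (gid B)"
  have x: "ghom (ten (ten B A) B) B x" "ten_mor G1 B B (ten A B) unt (cat_id G1 B) E = gm (ten (ten B A) B) B x"
    using ghom_ten[OF B B _ _ ghom_id[OF B] ev(1)] gm_ten[OF B B _ _ ghom_id[OF B] ev(1)] O by (simp_all add: x_def ev gm_id ten_unit_right ten_assoc_obj)
  have y: "ghom B (ten (ten B A) B) y" "ten_mor G1 unt (ten B A) B B C (cat_id G1 B) = gm B (ten (ten B A) B) y"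
    using ghom_ten[OF _ _ B B co(1) ghom_id[OF B]] gm_ten[OF _ _ B B co(1) ghom_id[OF B]] O by (simp_all add: y_def co gm_id ten_unit_left)
  have "gm B B (gcomp B (ten (ten B A) B) B x y) = gm B B (gid B)"
    using z' O x y by (simp add: gm_comp gm_id)
  then have all: "\<forall>r<length B. \<forall>s<length B. eqv (fst (B ! s)) (fst (B ! r)) (gcomp B (ten (ten B A) B) B x y r s) (gid B r s)"
    using gm_eq_iff[OF B B ghom_comp[OF B _ B y(1) x(1)] ghom_id[OF B]] O by simp
  have id: "eqv (fst (B ! s)) (fst (B ! s)) (gcomp B (ten (ten B A) B) B x y s s) (1\<^sub>m (rep_dim (fst (B ! s))))" if "s < length B" for s
    using all[rule_format, OF that that] by (simp add: gid_def)
  show ?thesis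
    unfolding gpar_def
  proof (intro allI impI)
    fix s assume s: "s < length B"
    let ?B = "fst (B ! s)" and ?j = "snd (B ! s)"
    have w: "wrep v ?B" and TB: "?B \<in> T" and jn: "?j < n" using s B GO_nth by blast+
    show "par ?B ?j (1\<^sub>m (rep_dim ?B))"
    proof (rule par_eqv[OF w _ eqv_sym[OF w w id[OF s]]])
      show "par ?B ?j (gcomp B (ten (ten B A) B) B x y s s)"
        unfolding gcomp_def
      proof (rule par_msum[OF w])
        fix t assume "t \<in> {..<length (ten (ten B A) B)}"
        then have t: "t < b * a * b" by (simp add: a_def b_def)
        then have t': "t < b * (a * b)" by (simp add: mult.assoc)
        have tL: "t < length (ten (ten B A) B)" using t by (simp add: a_def b_def)
        have O3: "GO (ten (ten B A) B)" using O by simp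
        have hm: "x s t * y t s \<in> uq_hom ?B ?B" by (rule ghom_mult[OF B O3 B y(1) x(1) s tL s])
        define p where "p = t div b" define q where "q = t mod b"
        define p1 where "p1 = t div (a * b)" define q1 where "q1 = t mod (a * b)"
        have pq: "p < b * a" "q < b" "p1 < b" "q1 < a * b"
          using div_less_mult[OF t] mod_less_mult[OF t] div_less_mult[OF t'] mod_less_mult[OF t'] by (auto simp: p_def q_def p1_def q1_def)
        have pb: "p div a = p1" by (simp add: p_def p1_def div_mult2_eq[symmetric] mult.commute)
        have xs: "x s t = kron (gid B s p1) (ev 0 q1)" using s by (simp add: x_def gten_def p1_def q1_def a_def b_def)
        have ys: "y t s = kron (co p 0) (gid B q s)" using s by (simp add: y_def gten_def p_def q_def b_def)
        have pa: "p mod a < a" using mod_less_mult[OF pq(1)] .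
        let ?A = "fst (A ! (p mod a))" and ?P = "fst (B ! p1)"
        have wA: "wrep v ?A" and TA: "?A \<in> T" using pa A(1) GO_nth by (auto simp: a_def)
        have wP: "wrep v ?P" and TP: "?P \<in> T" using pq(3) B GO_nth by (auto simp: b_def)
        have q1: "q1 div b = p mod a" "q1 mod b = q"
        proof -
          have "b > 0" using pq(2) by simp
          have "q1 = b * (t div b mod a) + t mod b" by (simp add: q1_def mod_mult2_eq[symmetric] mult.commute)
          then show "q1 div b = p mod a" "q1 mod b = q" using \<open>b > 0\<close> by (simp_all add: p_def q_def)
        qed
        have fP: "fst (ten B A ! p) = uq_tensor ?P ?A" using pq(1) pb by (simp add: ten_nth a_def b_def)
        have coh: "co p 0 \<in> uq_hom uq_trivial (uq_tensor ?P ?A)"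
          using ghomD[OF co(1), of p 0] pq(1) fP by (simp add: a_def b_def)
        note dco = uq_homD(1,2)[OF coh]
        have "par ?B ?j (x s t * y t s)"
        proof (cases "q = s")
          case False
          have "y t s = 0\<^sub>m (dim_row (y t s)) (rep_dim ?B)"
            using False dco by (simp add: ys gid_def)
          then have "x s t * y t s = 0\<^sub>m (rep_dim ?B) (rep_dim ?B)"
            using ghom_dims[OF x(1) s tL] ghom_dims[OF y(1) tL s] by (metis carrier_matI right_mult_zero_mat)
          then show ?thesis using par_zero[OF w] by simp
        next
          case True
          have fB: "fst (ten A B ! q1) = uq_tensor ?A ?B" "snd (ten A B ! q1) = (snd (A ! (p mod a)) + ?j) mod n"
            using pq(4) True q1 by (simp_all add: ten_nth a_def b_def)
          have evh: "ev 0 q1 \<in> uq_hom (uq_tensor ?A ?B) uq_trivial"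
            using ghomD[OF ev(1), of 0 q1] pq(4) fB by (simp add: a_def b_def)
          note dev = uq_homD(1,2)[OF evh]
          have gq: "gid B s p1 \<in> uq_hom ?P ?B" using ghomD[OF ghom_id[OF B] s, of p1] pq(3) by (simp add: b_def)
          note dq = uq_homD(1,2)[OF gq]
          have y1: "y t s = kron (co p 0) (1\<^sub>m (rep_dim ?B))" using True by (simp add: ys gid_def)
          have f2: "eqv (uq_tensor ?A ?B) uq_trivial (ev 0 q1 * kron (1\<^sub>m (rep_dim ?A)) (K4 ?B)) ((-1) ^ ?j \<cdot>\<^sub>m ev 0 q1)"
          proof (cases "(snd (A ! (p mod a)) + ?j) mod n = 0")
            case True
            have e: "(-1) ^ snd (A ! (p mod a)) = ((-1) ^ ?j :: 'k)" using neg_one_sum[OF True] by simp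
            have z0: "0\<^sub>m 1 (rep_dim ?B * rep_dim ?A) \<in> uq_hom (uq_tensor ?B ?A) uq_trivial"
              using hom_zero[OF wrep_ten[OF w wA] wrep_trivial] by simp
            show ?thesis using ev_par(2)[OF TB TA z0 _ evh, of "snd (A ! (p mod a))"] A(2) pa e by (simp add: gpar_def a_def)
          next
            case False
            then have z: "ev 0 q1 = 0\<^sub>m 1 (rep_dim ?A * rep_dim ?B)" using ghom_zero[OF ev(1), of 0 q1] pq(4) fB by (simp add: a_def b_def)
            have "0\<^sub>m 1 (rep_dim ?A * rep_dim ?B) * kron (1\<^sub>m (rep_dim ?A)) (K4 ?B) = 0\<^sub>m 1 (rep_dim ?A * rep_dim ?B)"
              using w by (intro left_mult_zero_mat) (auto intro!: carrier_matI)
            then show ?thesis using evh w wA unfolding z by (auto intro!: eqv_refl)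
          qed
          have "x s t * y t s * K4 ?B = kron (gid B s p1) (ev 0 q1 * kron (1\<^sub>m (rep_dim ?A)) (K4 ?B)) * kron (co p 0) (1\<^sub>m (rep_dim ?B))"
          proof -
            have "y t s * K4 ?B = kron (co p 0) (K4 ?B)"
            proof -
              have "K4 ?B = kron (1\<^sub>m 1) (K4 ?B)" by simp
              then have e: "y t s * K4 ?B = kron (co p 0) (1\<^sub>m (rep_dim ?B)) * kron (1\<^sub>m 1) (K4 ?B)" by (metis y1)
              have "kron (co p 0) (1\<^sub>m (rep_dim ?B)) * kron (1\<^sub>m 1) (K4 ?B) = kron (co p 0 * 1\<^sub>m 1) (1\<^sub>m (rep_dim ?B) * K4 ?B)"
                using dco w by (intro kron_mult) auto
              then show ?thesis unfolding e using dco w by (simp only: one_mult_dim K4_dim mult_one_dim rep_trivial_simps)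
            qed
            also have "\<dots> = kron (1\<^sub>m (rep_dim ?P)) (kron (1\<^sub>m (rep_dim ?A)) (K4 ?B)) * kron (co p 0) (1\<^sub>m (rep_dim ?B))"
              using dco w by (simp add: kron_assoc[symmetric] kron_one_one kron_mult one_mult_dim mult_one_dim)
            finally have 1: "y t s * K4 ?B = kron (1\<^sub>m (rep_dim ?P)) (kron (1\<^sub>m (rep_dim ?A)) (K4 ?B)) * kron (co p 0) (1\<^sub>m (rep_dim ?B))" .
            have "x s t * y t s * K4 ?B = x s t * (y t s * K4 ?B)"
              using ghom_dims[OF x(1) s tL] ghom_dims[OF y(1) tL s] w by (simp add: mult_assoc_dim)
            also have "\<dots> = (kron (gid B s p1) (ev 0 q1) * kron (1\<^sub>m (rep_dim ?P)) (kron (1\<^sub>m (rep_dim ?A)) (K4 ?B))) * kron (co p 0) (1\<^sub>m (rep_dim ?B))"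
              unfolding 1 xs using dev dq dco w by (simp add: mult_assoc_dim mult.assoc)
            also have "kron (gid B s p1) (ev 0 q1) * kron (1\<^sub>m (rep_dim ?P)) (kron (1\<^sub>m (rep_dim ?A)) (K4 ?B)) = kron (gid B s p1) (ev 0 q1 * kron (1\<^sub>m (rep_dim ?A)) (K4 ?B))"
              using dev dq w by (simp add: kron_mult mult_one_dim)
            finally show ?thesis .
          qed
          moreover have "eqv ?B ?B (kron (gid B s p1) (ev 0 q1 * kron (1\<^sub>m (rep_dim ?A)) (K4 ?B)) * kron (co p 0) (1\<^sub>m (rep_dim ?B)))
             (kron (gid B s p1) ((-1) ^ ?j \<cdot>\<^sub>m ev 0 q1) * kron (co p 0) (1\<^sub>m (rep_dim ?B)))"
          proof (rule eqv_comp[of _ "uq_tensor ?P (uq_tensor ?A ?B)"])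
            show "eqv ?B (uq_tensor ?P (uq_tensor ?A ?B)) (kron (co p 0) (1\<^sub>m (rep_dim ?B))) (kron (co p 0) (1\<^sub>m (rep_dim ?B)))"
              using hkron[OF wrep_trivial _ w w coh hom_id[OF w]] w wA wP
              by (intro eqv_refl) (auto simp: uq_tensor_unit[of v] uq_tensor_assoc[of v])
            show "eqv (uq_tensor ?P (uq_tensor ?A ?B)) ?B (kron (gid B s p1) (ev 0 q1 * kron (1\<^sub>m (rep_dim ?A)) (K4 ?B))) (kron (gid B s p1) ((-1) ^ ?j \<cdot>\<^sub>m ev 0 q1))"
              using eqv_kron[OF TP TB _ _ eqv_refl[OF wP w gq] f2] TB TA w by (simp add: uq_tensor_unit[of v])
          qed (use w wA wP in auto)
          moreover have "kron (gid B s p1) ((-1) ^ ?j \<cdot>\<^sub>m ev 0 q1) * kron (co p 0) (1\<^sub>m (rep_dim ?B)) = (-1) ^ ?j \<cdot>\<^sub>m (x s t * y t s)"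
            unfolding xs y1 using dev dq dco by (simp add: kron_smult_right smult_mult_dim mult.assoc)
          ultimately show ?thesis by (simp add: par_def)
        qed
        then show "par ?B ?j (x s t * y t s) \<and> x s t * y t s \<in> uq_hom ?B ?B" using hm by simp
      qed simp
    qed
  qed
qed

lemma par_Vp: "par (Vp m) m (1\<^sub>m (rep_dim (Vp m)))"
proof -
  have w: "wrep v (Vp m)" by (rule Vp_wrep)
  have "(-1) ^ m \<cdot>\<^sub>m 1\<^sub>m (rep_dim (Vp m)) \<in> uq_hom (Vp m) (Vp m)" using w hsm hom_id[OF w] by blast
  then show ?thesis using w unfolding par_def K4_Vp
    by (simp add: one_mult_dim del: Vp.simps) (rule eqv_refl[OF w w])
qed

text \<open>The grading refines the parity of \<open>K^4\<close>: both are \<open>1\<close> on \<open>Z\<close>, and compatible with all closure operations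
  because \<open>n\<close> is even.\<close>

lemma GN_gpar: "X \<in> GN \<Longrightarrow> gpar X"
  unfolding GN_def
proof (induction rule: generated_objs.induct)
  case gen_base
  show ?case using par_Vp[of 1] by (simp add: gpar_def Vp_1 uq_tensor_unit[of v])
next
  case gen_unit
  show ?case using par_Vp[of 0] by (simp add: gpar_def)
next
  case (gen_tensor A B)
  have O: "GO A" "GO B" using gen_tensor.hyps GN_GO by (auto simp: GN_def)
  show ?case
    unfolding gpar_def
  proof (intro allI impI)
    fix i assume "i < length (ten_obj G1 A B)"
    then have i: "i < length A * length B" by simp
    note di = div_less_mult[OF i] mod_less_mult[OF i]
    show "par (fst (ten_obj G1 A B ! i)) (snd (ten_obj G1 A B ! i)) (1\<^sub>m (rep_dim (fst (ten_obj G1 A B ! i))))"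
      using par_tensor[OF GO_nth(1)[OF O(1) di(1)] GO_nth(1)[OF O(2) di(2)]] gen_tensor.IH di i
      by (simp add: ten_nth par_mod gpar_def)
  qed
next
  case (gen_sum A B S)
  have O: "GO A" "GO B" "GO S" using gen_sum.hyps GN_GO by (auto simp: GN_def G_obj)
  from gen_sum.hyps(4) obtain i j p r where h: "i \<in> cat_hom G1 A S" "j \<in> cat_hom G1 B S" "p \<in> cat_hom G1 S A" "r \<in> cat_hom G1 S B"
    and e: "cat_add G1 S S (cat_comp G1 S A S i p) (cat_comp G1 S B S j r) = cat_id G1 S"
    unfolding biproduct_of_def by blast
  obtain \<iota> \<kappa> \<pi> \<rho> where g: "ghom A S \<iota>" "ghom B S \<kappa>" "ghom S A \<pi>" "ghom S B \<rho>"
    and m: "i = gm A S \<iota>" "j = gm B S \<kappa>" "p = gm S A \<pi>" "r = gm S B \<rho>"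
    using h O by (auto simp: G_hom)
  note c = ghom_comp[OF O(3,1,3) g(3,1)] ghom_comp[OF O(3,2,3) g(4,2)]
  have "gm S S (\<lambda>x y. gcomp S A S \<iota> \<pi> x y + gcomp S B S \<kappa> \<rho> x y) = gm S S (gid S)"
    using e m g O c by (simp add: gm_comp gm_add gm_id)
  then have all: "\<forall>x<length S. \<forall>y<length S. eqv (fst (S ! y)) (fst (S ! x)) (gcomp S A S \<iota> \<pi> x y + gcomp S B S \<kappa> \<rho> x y) (gid S x y)"
    using gm_eq_iff[OF O(3,3) ghom_add[OF O(3,3) c] ghom_id[OF O(3)]] by simp
  show ?case
    unfolding gpar_def
  proof (intro allI impI)
    fix s assume s: "s < length S"
    note w = GO_nth(2)[OF O(3) s]
    have "eqv (fst (S ! s)) (fst (S ! s)) (1\<^sub>m (rep_dim (fst (S ! s)))) (gcomp S A S \<iota> \<pi> s s + gcomp S B S \<kappa> \<rho> s s)"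
      using eqv_sym[OF w w all[rule_format, OF s s]] by (simp add: gid_def)
    moreover have "par (fst (S ! s)) (snd (S ! s)) (gcomp S A S \<iota> \<pi> s s + gcomp S B S \<kappa> \<rho> s s)"
      using par_gcomp[OF O(3,1) gen_sum.IH(1) g(3,1) s] par_gcomp[OF O(3,2) gen_sum.IH(2) g(4,2) s] ghomD[OF c(1) s s] ghomD[OF c(2) s s]
      by (intro par_add[OF w])
    ultimately show "par (fst (S ! s)) (snd (S ! s)) (1\<^sub>m (rep_dim (fst (S ! s))))" by (rule par_eqv[OF w, rotated])
  qed
next
  case (gen_summand A S)
  have O: "GO A" "GO S" using gen_summand.hyps GN_GO by (auto simp: GN_def G_obj)
  from gen_summand.hyps(3) obtain i p where h: "i \<in> cat_hom G1 S A" "p \<in> cat_hom G1 A S"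
    and e: "cat_comp G1 S A S p i = cat_id G1 S"
    unfolding retract_of_def by blast
  obtain \<iota> \<pi> where g: "ghom S A \<iota>" "ghom A S \<pi>" and m: "i = gm S A \<iota>" "p = gm A S \<pi>"
    using h O by (auto simp: G_hom)
  note c = ghom_comp[OF O(2,1,2) g]
  have "gm S S (gcomp S A S \<pi> \<iota>) = gm S S (gid S)"
    using e m g O c by (simp add: gm_comp gm_id)
  then have all: "\<forall>x<length S. \<forall>y<length S. eqv (fst (S ! y)) (fst (S ! x)) (gcomp S A S \<pi> \<iota> x y) (gid S x y)"
    using gm_eq_iff[OF O(2,2) c ghom_id[OF O(2)]] by simp
  show ?case
    unfolding gpar_def
  proof (intro allI impI)
    fix s assume s: "s < length S"
    note w = GO_nth(2)[OF O(2) s]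
    have "eqv (fst (S ! s)) (fst (S ! s)) (1\<^sub>m (rep_dim (fst (S ! s)))) (gcomp S A S \<pi> \<iota> s s)"
      using eqv_sym[OF w w all[rule_format, OF s s]] by (simp add: gid_def)
    then show "par (fst (S ! s)) (snd (S ! s)) (1\<^sub>m (rep_dim (fst (S ! s))))"
      using par_eqv[OF w par_gcomp[OF O(2,1) gen_summand.IH g s]] by blast
  qed
next
  case (gen_dual A B)
  have O: "GO A" "GO B" using gen_dual.hyps GN_GO by (auto simp: GN_def G_obj)
  show ?case using gen_dual.hyps(3) gpar_dualA[OF O(1) gen_dual.IH O(2)] gpar_dualB[OF O(1) gen_dual.IH O(2)] by blast
qed

lemma ethru_parity:
  assumes "thru (range Vp) Y Y h" and w: "wrep v Y" and p: "par Y j (1\<^sub>m (rep_dim Y))"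
  shows "ethru {Vp m |m. even m = even j} Y Y h"
  using assms(1)
proof (induction)
  case thru_zero
  then show ?case using w by (intro thru_ethru thru.thru_zero)
next
  case (thru_add W g f h)
  then obtain m where W: "W = Vp m" by auto
  have fg: "f * g \<in> uq_hom Y Y" using hcomp[OF w thru_add(2) w thru_add(3,4)] .
  note d = uq_homD(1,2)[OF fg]
  have "ethru {Vp m |m. even m = even j} Y Y (f * g)"
  proof (cases "even m = even j")
    case True
    then show ?thesis using thru_add W w by (intro thru_ethru thru_base[of W]) auto
  next
    case False
    then have s: "(-1) ^ m = (- ((-1) ^ j) :: 'k)" by (simp add: minus_one_power_iff)
    define t :: 'k where "t = (-1) ^ j"
    have tt: "t * t = 1" by (simp add: t_def power_add[symmetric] mult_2[symmetric] power_mult)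
    have "par Y m (f * g)"
      using par_factor[OF w thru_add(2,3,4)] par_Vp W by blast
    then have 1: "eqv Y Y (f * g * K4 Y) ((- t) \<cdot>\<^sub>m (f * g))" by (simp add: par_def s t_def)
    have 2: "eqv Y Y (f * g * K4 Y) (t \<cdot>\<^sub>m (f * g))"
    proof -
      have "eqv Y Y (f * g * (1\<^sub>m (rep_dim Y) * K4 Y)) (f * g * (t \<cdot>\<^sub>m 1\<^sub>m (rep_dim Y)))"
        using p fg w unfolding par_def t_def by (intro eqv_comp[of Y Y Y] eqv_refl) auto
      then show ?thesis using d w by (simp add: one_mult_dim mult_smult_dim mult_one_dim)
    qed
    have "eqv Y Y (t \<cdot>\<^sub>m (f * g)) ((- t) \<cdot>\<^sub>m (f * g))"
      using eqv_trans[OF w w eqv_sym[OF w w 2] 1] .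
    then obtain k where k: "k \<in> Neg Y Y" "t \<cdot>\<^sub>m (f * g) = (- t) \<cdot>\<^sub>m (f * g) + k" by (auto simp: eqv_def)
    have "f * g = (t / 2) \<cdot>\<^sub>m k"
    proof (rule eq_matI)
      fix a b assume "a < dim_row ((t / 2) \<cdot>\<^sub>m k)" "b < dim_col ((t / 2) \<cdot>\<^sub>m k)"
      then have ab: "a < rep_dim Y" "b < rep_dim Y" using uq_homD(1,2)[OF Neg_hom[OF k(1)]] by auto
      define x where "x = (f * g) $$ (a, b)"
      have "(t \<cdot>\<^sub>m (f * g)) $$ (a, b) = ((- t) \<cdot>\<^sub>m (f * g) + k) $$ (a, b)" using k(2) by simp
      then have "t * x = - t * x + k $$ (a, b)"
        using ab d uq_homD(1,2)[OF Neg_hom[OF k(1)]] by (simp add: x_def del: index_mult_mat(1))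
      then have "k $$ (a, b) = 2 * (t * x)" by (simp add: algebra_simps)
      then have "t / 2 * k $$ (a, b) = t * t * x" by (simp add: mult.assoc)
      then show "(f * g) $$ (a, b) = ((t / 2) \<cdot>\<^sub>m k) $$ (a, b)"
        using ab uq_homD(1,2)[OF Neg_hom[OF k(1)]] by (simp add: tt x_def del: index_mult_mat(1))
    qed (use d uq_homD(1,2)[OF Neg_hom[OF k(1)]] in auto)
    then have "eqv Y Y (f * g) (0\<^sub>m (rep_dim Y) (rep_dim Y))"
      using Neg_smult[OF w w k(1)] eqv_zero_iff[OF w w] by simp
    then show ?thesis using ethru_eqv[OF thru_ethru[OF thru.thru_zero w w] _ w w] by blast
  qed
  then show ?case using thru_add w by (intro ethru_plus) auto
qed

text \<open>\<open>\<one>\<close> is a summand of \<open>V \<otimes> V\<close>.\<close>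

lemma Vp_shift: "thru {Vp (m + 2 * k)} (Vp m) (Vp m) (1\<^sub>m (rep_dim (Vp m)))"
proof (induction k)
  case 0
  have "thru {Vp m} (Vp m) (Vp m) (1\<^sub>m (rep_dim (Vp m)) * 1\<^sub>m (rep_dim (Vp m)))"
    by (rule thru_base[of "Vp m"]) (auto intro: hom_id[OF Vp_wrep] simp del: Vp.simps)
  then show ?case by simp
next
  case (Suc k)
  let ?m = "m + 2 * k" and ?i = "1\<^sub>m (rep_dim (Vp (m + 2 * k)))"
  have e: "Vp (m + 2 * Suc k) = uq_tensor V2 (Vp ?m)"
    using Vp_add[of 2 ?m] by (simp add: Vp_2 add.commute del: Vp.simps)
  have i: "?i \<in> uq_hom (Vp ?m) (Vp ?m)" by (rule hom_id[OF Vp_wrep])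
  have "kron (inverse d \<cdot>\<^sub>m cap) ?i \<in> uq_hom (uq_tensor V2 (Vp ?m)) (uq_tensor uq_trivial (Vp ?m))" "kron cup ?i \<in> uq_hom (uq_tensor uq_trivial (Vp ?m)) (uq_tensor V2 (Vp ?m))"
    by (auto intro!: hkron hsm cap_hom cup_hom i Vp_wrep)
  then have h: "kron (inverse d \<cdot>\<^sub>m cap) ?i \<in> uq_hom (uq_tensor V2 (Vp ?m)) (Vp ?m)" "kron cup ?i \<in> uq_hom (Vp ?m) (uq_tensor V2 (Vp ?m))"
    by (simp_all only: uq_tensor_unit[OF Vp_wrep])
  have "thru {Vp (m + 2 * Suc k)} (Vp ?m) (Vp ?m) (kron (inverse d \<cdot>\<^sub>m cap) ?i * kron cup ?i)"
    unfolding e by (rule thru_base[OF _ _ _ _ h(2,1)]) (auto intro: Vp_wrep)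
  also have "kron (inverse d \<cdot>\<^sub>m cap) ?i * kron cup ?i = ?i"
  proof -
    have "(inverse d \<cdot>\<^sub>m cap) * cup = 1\<^sub>m 1" using d_nz by (simp add: smult_mult_dim cap_cup smult_smult) (auto intro!: eq_matI)
    then show ?thesis by (simp add: kron_mult one_mult_dim)
  qed
  finally show ?case using Suc by (intro thru_refine[OF Suc Vp_wrep Vp_wrep]) (simp only: singleton_iff)
qed

text \<open>Parity selects the tensor powers \<open>V^{\<otimes>m}\<close> with \<open>m\<close> congruent to \<open>j\<close> modulo \<open>2\<close>; enlarging \<open>m\<close> by an even
  number makes it congruent modulo \<open>n\<close>.\<close>

lemma GN_ethru:
  assumes "[(Y, j)] \<in> GN"
  shows "ethru {Vp m |m. m mod n = j} Y Y (1\<^sub>m (rep_dim Y))"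
proof -
  have Y: "Y \<in> T" "j < n" using GN_GO[OF assms] by auto
  have p: "par Y j (1\<^sub>m (rep_dim Y))" using GN_gpar[OF assms] by (simp add: gpar_def)
  note w = T_wrep[OF Y(1)]
  show ?thesis
  proof (rule ethru_refine[OF ethru_parity[OF thru_T[OF Y(1)] w p] w w])
    fix W assume "W \<in> {Vp m |m. even m = even j}"
    then obtain m where W: "W = Vp m" and e: "even m = even j" by auto
    have "odd (n - 1)" using n_even n_pos by presburger
    then have "even (j + (n - 1) * m)" using e by (metis even_add even_mult_iff)
    then obtain k where k: "j + (n - 1) * m = 2 * k" by blast
    obtain n' where n': "n = Suc n'" using n_pos gr0_implies_Suc by blast
    have "m + 2 * k = j + n * m" by (simp only: k[symmetric] n' diff_Suc_1 mult_Suc add.left_commute)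
    then have "(m + 2 * k) mod n = j" using Y(2) by simp
    then have "thru {Vp m |m. m mod n = j} W W (1\<^sub>m (rep_dim W))"
      unfolding W
    proof (intro thru_refine[OF Vp_shift[of m k] Vp_wrep Vp_wrep])
      fix U assume U: "U \<in> {Vp (m + 2 * k)}"
      have "thru {Vp m |m. m mod n = j} U U (1\<^sub>m (rep_dim U) * 1\<^sub>m (rep_dim U))"
        using U \<open>(m + 2 * k) mod n = j\<close> Vp_wrep hom_id[OF Vp_wrep] by (intro thru_base[of U]) auto
      then show "thru {Vp m |m. m mod n = j} U U (1\<^sub>m (rep_dim U))" by simp
    qed
    then show "ethru {Vp m |m. m mod n = j} W W (1\<^sub>m (rep_dim W))"
      using W Vp_wrep by (intro thru_ethru) auto
  qed
qed

section \<open>Homogeneous objects\<close>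

abbreviation hO :: "'k uq_rep \<times> nat \<Rightarrow> bool" where "hO x \<equiv> fst x \<in> T \<and> snd x < n"
abbreviation H :: "'k uq_rep \<times> nat \<Rightarrow> bool" where "H x \<equiv> [x] \<in> GN"

definition tn :: "'k uq_rep \<times> nat \<Rightarrow> 'k uq_rep \<times> nat \<Rightarrow> 'k uq_rep \<times> nat" where
  "tn x y = (uq_tensor (fst x) (fst y), (snd x + snd y) mod n)"

lemma tn_simps [simp]: "fst (tn x y) = uq_tensor (fst x) (fst y)" "snd (tn x y) = (snd x + snd y) mod n"
  by (simp_all add: tn_def)

lemma H_hO: "H x \<Longrightarrow> fst x \<in> T" "H x \<Longrightarrow> wrep v (fst x)" "H x \<Longrightarrow> snd x < n"
  using GN_GO[of "[x]"] by auto

lemma ten_single: "ten [x] [y] = [tn x y]"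
  by (simp add: graded_ten_obj_def tn_def)
lemma H_tn [simp]: "H x \<Longrightarrow> H y \<Longrightarrow> H (tn x y)"
  using GN_ten[of "[x]" "[y]"] by (simp add: ten_single)
lemma tn_assoc: "hO x \<Longrightarrow> hO y \<Longrightarrow> hO z \<Longrightarrow> tn (tn x y) z = tn x (tn y z)"
  by (simp add: tn_def uq_tensor_assoc[of v] mod_simps add.assoc)

definition sg :: "'k uq_rep \<times> nat \<Rightarrow> 'k uq_rep \<times> nat \<Rightarrow> 'k mat \<Rightarrow> 'k mat set mat" where
  "sg x y f = gm [x] [y] (\<lambda>_ _. f)"

lemma ghom_sg: "f \<in> uq_hom (fst x) (fst y) \<Longrightarrow> snd x = snd y \<Longrightarrow> ghom [x] [y] (\<lambda>_ _. f)"
  by (simp add: ghom_def)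

lemma sg_hom: "hO x \<Longrightarrow> hO y \<Longrightarrow> f \<in> uq_hom (fst x) (fst y) \<Longrightarrow> snd x = snd y \<Longrightarrow> sg x y f \<in> cat_hom (G u) [x] [y]"
  unfolding sg_def using ghom_sg[of f x y] by (subst G_hom) auto

lemma hom_sg:
  assumes "hO x" "hO y" "M \<in> cat_hom (G u) [x] [y]"
  obtains f where "f \<in> uq_hom (fst x) (fst y)" "M = sg x y f"
proof -
  obtain \<phi> where "ghom [x] [y] \<phi>" "M = gm [x] [y] \<phi>" using assms by (auto simp: G_hom)
  then have "\<phi> 0 0 \<in> uq_hom (fst x) (fst y)" "M = sg x y (\<phi> 0 0)"
    by (auto simp: ghom_def sg_def intro!: gm_cong)
  then show ?thesis using that by blast
qed

lemma hom_sg_zero: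
  assumes "hO x" "hO y" "M \<in> cat_hom (G u) [x] [y]" "snd x \<noteq> snd y"
  shows "M = sg x y (0\<^sub>m (rep_dim (fst y)) (rep_dim (fst x)))"
proof -
  obtain \<phi> where "ghom [x] [y] \<phi>" "M = gm [x] [y] \<phi>" using assms by (auto simp: G_hom)
  then show ?thesis using assms(4) by (auto simp: ghom_def sg_def intro!: gm_cong)
qed

lemma sg_comp:
  assumes "hO x" "hO y" "hO z" "f \<in> uq_hom (fst x) (fst y)" "g \<in> uq_hom (fst y) (fst z)" "snd x = snd y" "snd y = snd z"
  shows "cat_comp (G u) [x] [y] [z] (sg y z g) (sg x y f) = sg x z (g * f)"
proof -
  have "gcomp [x] [y] [z] (\<lambda>_ _. g) (\<lambda>_ _. f) r s = g * f" if "r < 1" "s < 1" for r s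
    unfolding gcomp_def using that uq_homD(1,2)[OF assms(4)] uq_homD(1,2)[OF assms(5)]
    by (intro msum_delta[of _ 0]) auto
  then show ?thesis
    unfolding sg_def using assms by (simp add: gm_comp ghom_sg) (rule gm_cong, simp)
qed

lemma sg_eq:
  assumes "hO x" "hO y" "f \<in> uq_hom (fst x) (fst y)" "g \<in> uq_hom (fst x) (fst y)" "snd x = snd y"
  shows "sg x y f = sg x y g \<longleftrightarrow> eqv (fst x) (fst y) f g"
  unfolding sg_def using assms by (subst gm_eq_iff) (auto simp: ghom_sg)

lemma sg_ten:
  assumes "hO x" "hO y" "hO x'" "hO y'" "f \<in> uq_hom (fst x) (fst x')" "g \<in> uq_hom (fst y) (fst y')" "snd x = snd x'" "snd y = snd y'"
  shows "ten_mor (G u) [x] [x'] [y] [y'] (sg x x' f) (sg y y' g) = sg (tn x y) (tn x' y') (kron f g)"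
  unfolding sg_def using assms by (subst gm_ten) (auto simp: ghom_sg ten_single gten_def intro!: gm_cong)

lemma sg_id: "cat_id (G u) [x] = sg x x (1\<^sub>m (rep_dim (fst x)))"
  unfolding gm_id sg_def by (rule gm_cong) (simp add: gid_def)

lemma sg_assoc:
  assumes "hO x" "hO y" "hO z"
  shows "ten_assoc (G u) [x] [y] [z] = sg (tn x (tn y z)) (tn x (tn y z)) (u (snd x) (snd y) (snd z) \<cdot>\<^sub>m 1\<^sub>m (rep_dim (fst x) * rep_dim (fst y) * rep_dim (fst z)))"
proof -
  let ?O = "uq_tensor (fst x) (uq_tensor (fst y) (fst z))"
  have w: "wrep v (fst x)" "wrep v (fst y)" "wrep v (fst z)" using assms by auto
  have i: "1\<^sub>m (rep_dim (fst x) * rep_dim (fst y) * rep_dim (fst z)) \<in> uq_hom ?O ?O"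
    using hom_id[of v ?O] w by (simp add: mult.assoc)
  note e = uq_tensor_assoc[OF w]
  show ?thesis
    unfolding sg_def
    by (rule eq_matI)
      (simp_all add: G_def graded_cat_def diag_mor_def ten_single gm_index ten_single[unfolded tn_def] I_scale[OF _ _ i] e w)
qed

lemma H_retract:
  assumes "H x" "Y \<in> T" "i \<in> uq_hom Y (fst x)" "p \<in> uq_hom (fst x) Y" "p * i = 1\<^sub>m (rep_dim Y)"
  shows "H (Y, snd x)"
proof (rule GN_retract[OF assms(1)])
  note x = H_hO[OF assms(1)]
  show "GO [(Y, snd x)]" using assms x by simp
  show "sg (Y, snd x) x i \<in> cat_hom G1 [(Y, snd x)] [x]" "sg x (Y, snd x) p \<in> cat_hom G1 [x] [(Y, snd x)]"
    using assms x by (auto intro!: sg_hom)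
  show "cat_comp G1 [(Y, snd x)] [x] [(Y, snd x)] (sg x (Y, snd x) p) (sg (Y, snd x) x i) = cat_id G1 [(Y, snd x)]"
    using assms x by (simp add: sg_comp sg_id)
qed

lemma H_unit [simp]: "H (uq_trivial, 0)" by simp
lemma H_Z [simp]: "H (V, Suc 0)" by simp

lemma H_Vp: "H (Vp m, m mod n)"
proof (induction m)
  case (Suc m)
  have "H (tn (V, Suc 0) (Vp m, m mod n))" using Suc by simp
  then show ?case by (simp add: tn_def mod_Suc_eq)
qed simp

end

lemma mult_scalars: "dim_row f = m \<Longrightarrow> (a \<cdot>\<^sub>m 1\<^sub>m m) * f = a \<cdot>\<^sub>m (f :: 'a::comm_semiring_1 mat)"
  "dim_col f = m \<Longrightarrow> f * (a \<cdot>\<^sub>m 1\<^sub>m m) = a \<cdot>\<^sub>m (f :: 'a::comm_semiring_1 mat)"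
  by (simp_all add: smult_mult_dim mult_smult_dim one_mult_dim mult_one_dim)

section \<open>Braidings\<close>

text \<open>All operations of \<open>C\<close> except the associator are those of the untwisted category \<open>G1\<close>, in which
  computations take place.\<close>

locale braided_ising = graded_ising v n for v :: "'k::field_char_0" and n +
  fixes w :: "nat \<Rightarrow> nat \<Rightarrow> nat \<Rightarrow> 'k"
    and C :: "(('k uq_rep \<times> nat) list, 'k mat set mat, 'k) lin_mon_cat"
    and c :: "('k uq_rep \<times> nat) list \<Rightarrow> ('k uq_rep \<times> nat) list \<Rightarrow> 'k mat set mat"
  assumes w_nz: "w i j l \<noteq> 0"
    and C_eq: "C = G1\<lparr>cat_obj := GN, ten_assoc := ten_assoc (G w)\<rparr>"
    and br: "braiding C c"
begin

lemma C_simps [simp]: "cat_obj C = GN" "cat_hom C = cat_hom G1" "cat_id C = cat_id G1" "cat_comp C = cat_comp G1"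
  "cat_zero C = cat_zero G1" "cat_add C = cat_add G1" "cat_scale C = cat_scale G1"
  "ten_unit C = unt" "ten_obj C = ten" "ten_mor C = ten_mor G1" "ten_assoc C = ten_assoc (G w)" "ten_lunit C = ten_lunit G1" "ten_runit C = ten_runit G1"
  by (simp_all add: C_eq)

lemma inv_C: "inv_mor C X Y f = (THE g. f \<in> cat_hom G1 X Y \<and> g \<in> cat_hom G1 Y X \<and>
     cat_comp G1 X Y X g f = cat_id G1 X \<and> cat_comp G1 Y X Y f g = cat_id G1 Y)"
  by (simp add: inv_mor_def inverse_mors_def)

lemma br_iso: "X \<in> GN \<Longrightarrow> Y \<in> GN \<Longrightarrow> \<exists>g. c X Y \<in> cat_hom G1 (ten X Y) (ten Y X) \<and> g \<in> cat_hom G1 (ten Y X) (ten X Y) \<and>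
    cat_comp G1 (ten X Y) (ten Y X) (ten X Y) g (c X Y) = cat_id G1 (ten X Y) \<and> cat_comp G1 (ten Y X) (ten X Y) (ten Y X) (c X Y) g = cat_id G1 (ten Y X)"
  using br unfolding braiding_def Let_def iso_mor_def inverse_mors_def by simp

lemma br_nat: "X \<in> GN \<Longrightarrow> X' \<in> GN \<Longrightarrow> Y \<in> GN \<Longrightarrow> Y' \<in> GN \<Longrightarrow> f \<in> cat_hom G1 X X' \<Longrightarrow> g \<in> cat_hom G1 Y Y' \<Longrightarrow>
   cat_comp G1 (ten X Y) (ten X' Y') (ten Y' X') (c X' Y') (ten_mor G1 X X' Y Y' f g)
     = cat_comp G1 (ten X Y) (ten Y X) (ten Y' X') (ten_mor G1 Y Y' X X' g f) (c X Y)"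
  using br unfolding braiding_def Let_def by simp

lemma br_hex1: "X \<in> GN \<Longrightarrow> Y \<in> GN \<Longrightarrow> Z \<in> GN \<Longrightarrow>
   cat_comp G1 (ten (ten X Y) Z) (ten (ten Y Z) X) (ten Y (ten Z X)) (ten_assoc (G w) Y Z X)
      (cat_comp G1 (ten (ten X Y) Z) (ten X (ten Y Z)) (ten (ten Y Z) X) (c X (ten Y Z)) (ten_assoc (G w) X Y Z))
   = cat_comp G1 (ten (ten X Y) Z) (ten Y (ten X Z)) (ten Y (ten Z X))
      (ten_mor G1 Y Y (ten X Z) (ten Z X) (cat_id G1 Y) (c X Z))
      (cat_comp G1 (ten (ten X Y) Z) (ten (ten Y X) Z) (ten Y (ten X Z)) (ten_assoc (G w) Y X Z)
        (ten_mor G1 (ten X Y) (ten Y X) Z Z (c X Y) (cat_id G1 Z)))"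
  using br unfolding braiding_def Let_def by simp

lemma br_hex2: "X \<in> GN \<Longrightarrow> Y \<in> GN \<Longrightarrow> Z \<in> GN \<Longrightarrow>
   cat_comp G1 (ten X (ten Y Z)) (ten Z (ten X Y)) (ten (ten Z X) Y) (inv_mor C (ten (ten Z X) Y) (ten Z (ten X Y)) (ten_assoc (G w) Z X Y))
      (cat_comp G1 (ten X (ten Y Z)) (ten (ten X Y) Z) (ten Z (ten X Y)) (c (ten X Y) Z) (inv_mor C (ten (ten X Y) Z) (ten X (ten Y Z)) (ten_assoc (G w) X Y Z)))
   = cat_comp G1 (ten X (ten Y Z)) (ten (ten X Z) Y) (ten (ten Z X) Y)
      (ten_mor G1 (ten X Z) (ten Z X) Y Y (c X Z) (cat_id G1 Y))
      (cat_comp G1 (ten X (ten Y Z)) (ten X (ten Z Y)) (ten (ten X Z) Y) (inv_mor C (ten (ten X Z) Y) (ten X (ten Z Y)) (ten_assoc (G w) X Z Y))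
        (ten_mor G1 X X (ten Y Z) (ten Z Y) (cat_id G1 X) (c Y Z)))"
  using br unfolding braiding_def Let_def by simp

definition Gam :: "'k uq_rep \<times> nat \<Rightarrow> 'k uq_rep \<times> nat \<Rightarrow> 'k mat" where
  "Gam x y = (SOME f. f \<in> uq_hom (uq_tensor (fst x) (fst y)) (uq_tensor (fst y) (fst x)) \<and> c [x] [y] = sg (tn x y) (tn y x) f)"

lemma Gam:
  assumes "H x" "H y"
  shows Gam_hom: "Gam x y \<in> uq_hom (uq_tensor (fst x) (fst y)) (uq_tensor (fst y) (fst x))"
    and c_Gam: "c [x] [y] = sg (tn x y) (tn y x) (Gam x y)"
proof -
  have "c [x] [y] \<in> cat_hom G1 [tn x y] [tn y x]" using br_iso[OF assms] by (auto simp: ten_single)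
  then obtain f where "f \<in> uq_hom (fst (tn x y)) (fst (tn y x))" "c [x] [y] = sg (tn x y) (tn y x) f"
    by (rule hom_sg[rotated 2]) (use assms H_hO in auto)
  then have "\<exists>f. f \<in> uq_hom (uq_tensor (fst x) (fst y)) (uq_tensor (fst y) (fst x)) \<and> c [x] [y] = sg (tn x y) (tn y x) f" by auto
  from someI_ex[OF this, folded Gam_def] show
    "Gam x y \<in> uq_hom (uq_tensor (fst x) (fst y)) (uq_tensor (fst y) (fst x))" "c [x] [y] = sg (tn x y) (tn y x) (Gam x y)" by auto
qed

lemma Gam_dim:
  assumes "H x" "H y"
  shows "dim_row (Gam x y) = rep_dim (fst y) * rep_dim (fst x)" "dim_col (Gam x y) = rep_dim (fst x) * rep_dim (fst y)"
  using uq_homD(1,2)[OF Gam_hom[OF assms]] by auto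

lemma Gam_inv:
  assumes "H x" "H y"
  obtains g where "g \<in> uq_hom (uq_tensor (fst y) (fst x)) (uq_tensor (fst x) (fst y))"
    "eqv (uq_tensor (fst x) (fst y)) (uq_tensor (fst x) (fst y)) (g * Gam x y) (1\<^sub>m (rep_dim (fst x) * rep_dim (fst y)))"
    "eqv (uq_tensor (fst y) (fst x)) (uq_tensor (fst y) (fst x)) (Gam x y * g) (1\<^sub>m (rep_dim (fst y) * rep_dim (fst x)))"
proof -
  note o = H_hO[OF assms(1)] H_hO[OF assms(2)]
  obtain g where g: "g \<in> cat_hom G1 [tn y x] [tn x y]"
    "cat_comp G1 [tn x y] [tn y x] [tn x y] g (c [x] [y]) = cat_id G1 [tn x y]"
    "cat_comp G1 [tn y x] [tn x y] [tn y x] (c [x] [y]) g = cat_id G1 [tn y x]"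
    using br_iso[OF assms] by (auto simp: ten_single)
  obtain f where f: "f \<in> uq_hom (fst (tn y x)) (fst (tn x y))" "g = sg (tn y x) (tn x y) f"
    by (rule hom_sg[OF _ _ g(1)]) (use o in auto)
  note gh = Gam_hom[OF assms]
  have gf: "f * Gam x y \<in> uq_hom (uq_tensor (fst x) (fst y)) (uq_tensor (fst x) (fst y))"
    "Gam x y * f \<in> uq_hom (uq_tensor (fst y) (fst x)) (uq_tensor (fst y) (fst x))"
    using f gh o by (auto intro!: hcomp)
  have idh: "1\<^sub>m (rep_dim (fst x) * rep_dim (fst y)) \<in> uq_hom (uq_tensor (fst x) (fst y)) (uq_tensor (fst x) (fst y))"
    "1\<^sub>m (rep_dim (fst y) * rep_dim (fst x)) \<in> uq_hom (uq_tensor (fst y) (fst x)) (uq_tensor (fst y) (fst x))"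
    using hom_id[of v "uq_tensor (fst x) (fst y)"] hom_id[of v "uq_tensor (fst y) (fst x)"] o by auto
  have "sg (tn x y) (tn x y) (f * Gam x y) = sg (tn x y) (tn x y) (1\<^sub>m (rep_dim (fst x) * rep_dim (fst y)))"
    using g(2) f gh o by (simp add: c_Gam[OF assms] sg_comp sg_id add.commute)
  then have 1: "eqv (uq_tensor (fst x) (fst y)) (uq_tensor (fst x) (fst y)) (f * Gam x y) (1\<^sub>m (rep_dim (fst x) * rep_dim (fst y)))"
    using o gf idh by (simp add: sg_eq)
  have "sg (tn y x) (tn y x) (Gam x y * f) = sg (tn y x) (tn y x) (1\<^sub>m (rep_dim (fst y) * rep_dim (fst x)))"
    using g(3) f gh o by (simp add: c_Gam[OF assms] sg_comp sg_id add.commute)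
  then have 2: "eqv (uq_tensor (fst y) (fst x)) (uq_tensor (fst y) (fst x)) (Gam x y * f) (1\<^sub>m (rep_dim (fst y) * rep_dim (fst x)))"
    using o gf idh by (simp add: sg_eq)
  show ?thesis using that f(1) 1 2 by simp
qed

lemma Gam_nat:
  assumes "H x" "H y" "H x'" "H y'" "f \<in> uq_hom (fst x) (fst x')" "g \<in> uq_hom (fst y) (fst y')" "snd x = snd x'" "snd y = snd y'"
  shows "eqv (uq_tensor (fst x) (fst y)) (uq_tensor (fst y') (fst x')) (Gam x' y' * kron f g) (kron g f * Gam x y)"
proof -
  note o = H_hO[OF assms(1)] H_hO[OF assms(2)] H_hO[OF assms(3)] H_hO[OF assms(4)]
  note gh = Gam_hom[OF assms(1,2)] Gam_hom[OF assms(3,4)]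
  have k: "kron f g \<in> uq_hom (uq_tensor (fst x) (fst y)) (uq_tensor (fst x') (fst y'))"
     "kron g f \<in> uq_hom (uq_tensor (fst y) (fst x)) (uq_tensor (fst y') (fst x'))" using assms o by (auto intro!: hkron)
  have kk: "Gam x' y' * kron f g \<in> uq_hom (uq_tensor (fst x) (fst y)) (uq_tensor (fst y') (fst x'))"
    "kron g f * Gam x y \<in> uq_hom (uq_tensor (fst x) (fst y)) (uq_tensor (fst y') (fst x'))"
    using hcomp[OF _ _ _ k(1) gh(2)] hcomp[OF _ _ _ gh(1) k(2)] o by auto
  have "sg (tn x y) (tn y' x') (Gam x' y' * kron f g) = sg (tn x y) (tn y' x') (kron g f * Gam x y)"
    using br_nat[OF assms(1,3,2,4), of "sg x x' f" "sg y y' g"] assms(5-) o gh k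
    by (simp add: sg_hom sg_ten ten_single c_Gam assms(1-4) sg_comp add.commute)
  then show ?thesis using o kk assms(7,8) by (simp add: sg_eq add.commute)
qed

lemma inv_assoc_C:
  assumes "hO x" "hO y" "hO z"
  shows "inv_mor C (ten (ten [x] [y]) [z]) (ten [x] (ten [y] [z])) (ten_assoc (G w) [x] [y] [z])
    = sg (tn x (tn y z)) (tn x (tn y z)) (inverse (w (snd x) (snd y) (snd z)) \<cdot>\<^sub>m 1\<^sub>m (rep_dim (fst x) * rep_dim (fst y) * rep_dim (fst z)))"
proof -
  let ?m = "tn x (tn y z)" and ?s = "w (snd x) (snd y) (snd z)"
  define N where "N = rep_dim (fst x) * rep_dim (fst y) * rep_dim (fst z)"
  have N: "rep_dim (fst ?m) = N" by (simp add: N_def mult.assoc)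
  have hm: "hO ?m" using assms by simp
  have i: "1\<^sub>m N \<in> uq_hom (fst ?m) (fst ?m)" using hom_id[of v "fst ?m"] hm by (simp only: N T_wrep)
  have si: "t \<cdot>\<^sub>m 1\<^sub>m N \<in> uq_hom (fst ?m) (fst ?m)" for t using hm i by (intro hsm) auto
  have e: "ten (ten [x] [y]) [z] = [?m]" "ten [x] (ten [y] [z]) = [?m]" using assms by (simp_all add: ten_single tn_assoc)
  have prod: "(t \<cdot>\<^sub>m 1\<^sub>m N) * (t' \<cdot>\<^sub>m 1\<^sub>m N) = (t * t') \<cdot>\<^sub>m 1\<^sub>m N" for t t' :: 'k
    by (simp add: smult_mult_dim mult_smult_dim one_mult_dim smult_smult mult.commute)
  have one: "1 \<cdot>\<^sub>m 1\<^sub>m N = (1\<^sub>m N :: 'k mat)" by (intro eq_matI) auto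
  show ?thesis
    unfolding inv_C e sg_assoc[OF assms] N_def[symmetric]
  proof (rule the_equality)
    show "sg ?m ?m (?s \<cdot>\<^sub>m 1\<^sub>m N) \<in> cat_hom G1 [?m] [?m] \<and> sg ?m ?m (inverse ?s \<cdot>\<^sub>m 1\<^sub>m N) \<in> cat_hom G1 [?m] [?m] \<and>
      cat_comp G1 [?m] [?m] [?m] (sg ?m ?m (inverse ?s \<cdot>\<^sub>m 1\<^sub>m N)) (sg ?m ?m (?s \<cdot>\<^sub>m 1\<^sub>m N)) = cat_id G1 [?m] \<and>
      cat_comp G1 [?m] [?m] [?m] (sg ?m ?m (?s \<cdot>\<^sub>m 1\<^sub>m N)) (sg ?m ?m (inverse ?s \<cdot>\<^sub>m 1\<^sub>m N)) = cat_id G1 [?m]"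
      using sg_hom[OF hm hm si] sg_comp[OF hm hm hm si si] w_nz by (simp add: sg_id prod one N del: tn_simps)
    fix g assume g: "sg ?m ?m (?s \<cdot>\<^sub>m 1\<^sub>m N) \<in> cat_hom G1 [?m] [?m] \<and> g \<in> cat_hom G1 [?m] [?m] \<and>
      cat_comp G1 [?m] [?m] [?m] g (sg ?m ?m (?s \<cdot>\<^sub>m 1\<^sub>m N)) = cat_id G1 [?m] \<and>
      cat_comp G1 [?m] [?m] [?m] (sg ?m ?m (?s \<cdot>\<^sub>m 1\<^sub>m N)) g = cat_id G1 [?m]"
    obtain f where f: "f \<in> uq_hom (fst ?m) (fst ?m)" "g = sg ?m ?m f" by (rule hom_sg[of ?m ?m g]) (use hm g in auto)
    have df: "dim_row f = N" "dim_col f = N" using uq_homD(1,2)[OF f(1)] N by auto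
    have "sg ?m ?m (f * (?s \<cdot>\<^sub>m 1\<^sub>m N)) = sg ?m ?m (1\<^sub>m N)"
      using g sg_comp[OF hm hm hm si f(1)] by (simp add: f(2) sg_id N del: tn_simps)
    then have "eqv (fst ?m) (fst ?m) (f * (?s \<cdot>\<^sub>m 1\<^sub>m N)) (1\<^sub>m N)"
      using sg_eq[OF hm hm hcomp[OF _ _ _ si f(1)] i] hm by simp
    then have "eqv (fst ?m) (fst ?m) (inverse ?s \<cdot>\<^sub>m (f * (?s \<cdot>\<^sub>m 1\<^sub>m N))) (inverse ?s \<cdot>\<^sub>m 1\<^sub>m N)"
      using hm by (intro eqv_smult) auto
    moreover have "inverse ?s \<cdot>\<^sub>m (f * (?s \<cdot>\<^sub>m 1\<^sub>m N)) = f"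
      using df w_nz by (simp add: mult_scalars smult_smult) (intro eq_matI, auto)
    ultimately have "eqv (fst ?m) (fst ?m) f (inverse ?s \<cdot>\<^sub>m 1\<^sub>m N)" by simp
    then show "g = sg ?m ?m (inverse ?s \<cdot>\<^sub>m 1\<^sub>m N)" using sg_eq[OF hm hm f(1) si] f(2) by simp
  qed
qed

lemma hex1:
  assumes "H x" "H y" "H z"
  shows "eqv (uq_tensor (fst x) (uq_tensor (fst y) (fst z))) (uq_tensor (fst y) (uq_tensor (fst z) (fst x)))
    ((w (snd y) (snd z) (snd x) * w (snd x) (snd y) (snd z)) \<cdot>\<^sub>m Gam x (tn y z))
    (w (snd y) (snd x) (snd z) \<cdot>\<^sub>m (kron (1\<^sub>m (rep_dim (fst y))) (Gam x z) * kron (Gam x y) (1\<^sub>m (rep_dim (fst z)))))"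
proof -
  let ?X = "fst x" and ?Y = "fst y" and ?Z = "fst z"
  note o = H_hO[OF assms(1)] H_hO[OF assms(2)] H_hO[OF assms(3)]
  have ho: "hO x" "hO y" "hO z" using o by auto
  define N where "N = rep_dim ?X * rep_dim ?Y * rep_dim ?Z"
  have g1: "Gam x (tn y z) \<in> uq_hom (uq_tensor ?X (uq_tensor ?Y ?Z)) (uq_tensor ?Y (uq_tensor ?Z ?X))"
    using Gam_hom[OF assms(1) H_tn[OF assms(2,3)]] o by (simp add: uq_tensor_assoc[of v])
  have g2: "kron (1\<^sub>m (rep_dim ?Y)) (Gam x z) \<in> uq_hom (uq_tensor ?Y (uq_tensor ?X ?Z)) (uq_tensor ?Y (uq_tensor ?Z ?X))"
    using Gam_hom[OF assms(1,3)] o hom_id[of v ?Y] by (intro hkron) auto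
  have g3: "kron (Gam x y) (1\<^sub>m (rep_dim ?Z)) \<in> uq_hom (uq_tensor ?X (uq_tensor ?Y ?Z)) (uq_tensor ?Y (uq_tensor ?X ?Z))"
    using hkron[OF _ _ _ _ Gam_hom[OF assms(1,2)] hom_id[of v ?Z]] o by (simp add: uq_tensor_assoc[of v])
  have i1: "t \<cdot>\<^sub>m 1\<^sub>m N \<in> uq_hom (uq_tensor ?X (uq_tensor ?Y ?Z)) (uq_tensor ?X (uq_tensor ?Y ?Z))" for t
    using hom_id[of v "uq_tensor ?X (uq_tensor ?Y ?Z)"] o by (intro hsm) (auto simp: N_def mult.assoc)
  have i2: "t \<cdot>\<^sub>m 1\<^sub>m N \<in> uq_hom (uq_tensor ?Y (uq_tensor ?Z ?X)) (uq_tensor ?Y (uq_tensor ?Z ?X))" for t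
    using hom_id[of v "uq_tensor ?Y (uq_tensor ?Z ?X)"] o by (intro hsm) (auto simp: N_def ac_simps)
  have i3: "t \<cdot>\<^sub>m 1\<^sub>m N \<in> uq_hom (uq_tensor ?Y (uq_tensor ?X ?Z)) (uq_tensor ?Y (uq_tensor ?X ?Z))" for t
    using hom_id[of v "uq_tensor ?Y (uq_tensor ?X ?Z)"] o by (intro hsm) (auto simp: N_def ac_simps)
  let ?a = "w (snd y) (snd z) (snd x)" and ?b = "w (snd x) (snd y) (snd z)" and ?cc = "w (snd y) (snd x) (snd z)"
  have deg: "snd (tn x (tn y z)) = snd (tn y (tn z x))" "snd (tn x (tn y z)) = snd (tn y (tn x z))" by (simp_all add: mod_simps ac_simps)
  have hm: "hO (tn x (tn y z))" "hO (tn y (tn z x))" "hO (tn y (tn x z))" using o by auto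
  have NN: "rep_dim ?Y * rep_dim ?Z * rep_dim ?X = N" "rep_dim ?Y * rep_dim ?X * rep_dim ?Z = N" by (auto simp: N_def ac_simps)
  have h1: "Gam x (tn y z) * (?b \<cdot>\<^sub>m 1\<^sub>m N) \<in> uq_hom (uq_tensor ?X (uq_tensor ?Y ?Z)) (uq_tensor ?Y (uq_tensor ?Z ?X))"
    using hcomp[OF _ _ _ i1 g1] o by simp
  have h2: "(?cc \<cdot>\<^sub>m 1\<^sub>m N) * kron (Gam x y) (1\<^sub>m (rep_dim ?Z)) \<in> uq_hom (uq_tensor ?X (uq_tensor ?Y ?Z)) (uq_tensor ?Y (uq_tensor ?X ?Z))"
    using hcomp[OF _ _ _ g3 i3] o by simp
  have L: "cat_comp G1 [tn x (tn y z)] [tn y (tn z x)] [tn y (tn z x)] (sg (tn y (tn z x)) (tn y (tn z x)) (?a \<cdot>\<^sub>m 1\<^sub>m N))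
      (cat_comp G1 [tn x (tn y z)] [tn x (tn y z)] [tn y (tn z x)] (sg (tn x (tn y z)) (tn y (tn z x)) (Gam x (tn y z))) (sg (tn x (tn y z)) (tn x (tn y z)) (?b \<cdot>\<^sub>m 1\<^sub>m N)))
    = sg (tn x (tn y z)) (tn y (tn z x)) ((?a \<cdot>\<^sub>m 1\<^sub>m N) * (Gam x (tn y z) * (?b \<cdot>\<^sub>m 1\<^sub>m N)))"
    using i1 i2 g1 h1 by (subst sg_comp[OF hm(1,1,2)]; (subst sg_comp[OF hm(1,2,2)])?) (auto simp: deg[simplified])
  have R: "cat_comp G1 [tn x (tn y z)] [tn y (tn x z)] [tn y (tn z x)] (sg (tn y (tn x z)) (tn y (tn z x)) (kron (1\<^sub>m (rep_dim ?Y)) (Gam x z)))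
      (cat_comp G1 [tn x (tn y z)] [tn y (tn x z)] [tn y (tn x z)] (sg (tn y (tn x z)) (tn y (tn x z)) (?cc \<cdot>\<^sub>m 1\<^sub>m N))
         (sg (tn x (tn y z)) (tn y (tn x z)) (kron (Gam x y) (1\<^sub>m (rep_dim ?Z)))))
    = sg (tn x (tn y z)) (tn y (tn z x)) (kron (1\<^sub>m (rep_dim ?Y)) (Gam x z) * ((?cc \<cdot>\<^sub>m 1\<^sub>m N) * kron (Gam x y) (1\<^sub>m (rep_dim ?Z))))"
    using i3 g2 g3 h2 by (subst sg_comp[OF hm(1,3,3)]; (subst sg_comp[OF hm(1,3,2)])?) (auto simp: deg[simplified] add.commute)
  have t1: "ten_mor G1 [y] [y] [tn x z] [tn z x] (cat_id G1 [y]) (c [x] [z]) = sg (tn y (tn x z)) (tn y (tn z x)) (kron (1\<^sub>m (rep_dim ?Y)) (Gam x z))"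
    using sg_ten[OF ho(2) _ ho(2) _ hom_id[OF o(5)], of "tn x z" "tn z x" "Gam x z"] o Gam_hom[OF assms(1,3)]
    by (simp add: sg_id c_Gam[OF assms(1,3)] add.commute)
  have t2: "ten_mor G1 [tn x y] [tn y x] [z] [z] (c [x] [y]) (cat_id G1 [z]) = sg (tn x (tn y z)) (tn y (tn x z)) (kron (Gam x y) (1\<^sub>m (rep_dim ?Z)))"
    using sg_ten[of "tn x y" z "tn y x" z "Gam x y" "1\<^sub>m (rep_dim ?Z)"] o Gam_hom[OF assms(1,2)] hom_id[OF o(8)]
    by (simp add: sg_id c_Gam[OF assms(1,2)] add.commute tn_assoc)
  have "sg (tn x (tn y z)) (tn y (tn z x)) ((?a \<cdot>\<^sub>m 1\<^sub>m N) * (Gam x (tn y z) * (?b \<cdot>\<^sub>m 1\<^sub>m N)))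
    = sg (tn x (tn y z)) (tn y (tn z x)) (kron (1\<^sub>m (rep_dim ?Y)) (Gam x z) * ((?cc \<cdot>\<^sub>m 1\<^sub>m N) * kron (Gam x y) (1\<^sub>m (rep_dim ?Z))))"
    using br_hex1[OF assms] L R
    by (simp only: ten_single tn_assoc[OF ho(1,2,3)] tn_assoc[OF ho(2,3,1)] tn_assoc[OF ho(2,1,3)] sg_assoc[OF ho(1,2,3)] sg_assoc[OF ho(2,3,1)]
       sg_assoc[OF ho(2,1,3)] t1 t2 c_Gam[OF assms(1) H_tn[OF assms(2,3)]] N_def[symmetric] NN)
  then have "eqv (uq_tensor ?X (uq_tensor ?Y ?Z)) (uq_tensor ?Y (uq_tensor ?Z ?X)) ((?a \<cdot>\<^sub>m 1\<^sub>m N) * (Gam x (tn y z) * (?b \<cdot>\<^sub>m 1\<^sub>m N)))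
     (kron (1\<^sub>m (rep_dim ?Y)) (Gam x z) * ((?cc \<cdot>\<^sub>m 1\<^sub>m N) * kron (Gam x y) (1\<^sub>m (rep_dim ?Z))))"
    using sg_eq[OF hm(1,2) _ _ deg(1)] hcomp[OF _ _ _ h1 i2, of ?a] hcomp[OF _ _ _ h2 g2] o by simp
  moreover have "(?a \<cdot>\<^sub>m 1\<^sub>m N) * (Gam x (tn y z) * (?b \<cdot>\<^sub>m 1\<^sub>m N)) = (?a * ?b) \<cdot>\<^sub>m Gam x (tn y z)"
    using uq_homD(1,2)[OF g1] by (simp add: mult_scalars N_def smult_smult ac_simps)
  moreover have "kron (1\<^sub>m (rep_dim ?Y)) (Gam x z) * ((?cc \<cdot>\<^sub>m 1\<^sub>m N) * kron (Gam x y) (1\<^sub>m (rep_dim ?Z))) = ?cc \<cdot>\<^sub>m (kron (1\<^sub>m (rep_dim ?Y)) (Gam x z) * kron (Gam x y) (1\<^sub>m (rep_dim ?Z)))"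
    using uq_homD(1,2)[OF g2] uq_homD(1,2)[OF g3] by (simp add: mult_scalars mult_smult_dim N_def ac_simps del: dim_kron)
  ultimately show ?thesis by simp
qed

lemma hex2:
  assumes "H x" "H y" "H z"
  shows "eqv (uq_tensor (fst x) (uq_tensor (fst y) (fst z))) (uq_tensor (fst z) (uq_tensor (fst x) (fst y)))
    ((inverse (w (snd z) (snd x) (snd y)) * inverse (w (snd x) (snd y) (snd z))) \<cdot>\<^sub>m Gam (tn x y) z)
    (inverse (w (snd x) (snd z) (snd y)) \<cdot>\<^sub>m (kron (Gam x z) (1\<^sub>m (rep_dim (fst y))) * kron (1\<^sub>m (rep_dim (fst x))) (Gam y z)))"
proof -
  let ?X = "fst x" and ?Y = "fst y" and ?Z = "fst z"
  note o = H_hO[OF assms(1)] H_hO[OF assms(2)] H_hO[OF assms(3)]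
  have ho: "hO x" "hO y" "hO z" using o by auto
  define N where "N = rep_dim ?X * rep_dim ?Y * rep_dim ?Z"
  have g1: "Gam (tn x y) z \<in> uq_hom (uq_tensor ?X (uq_tensor ?Y ?Z)) (uq_tensor ?Z (uq_tensor ?X ?Y))"
    using Gam_hom[OF H_tn[OF assms(1,2)] assms(3)] o by (simp add: uq_tensor_assoc[of v])
  have g2: "kron (1\<^sub>m (rep_dim ?X)) (Gam y z) \<in> uq_hom (uq_tensor ?X (uq_tensor ?Y ?Z)) (uq_tensor ?X (uq_tensor ?Z ?Y))"
    using Gam_hom[OF assms(2,3)] o hom_id[of v ?X] by (intro hkron) auto
  have g3: "kron (Gam x z) (1\<^sub>m (rep_dim ?Y)) \<in> uq_hom (uq_tensor ?X (uq_tensor ?Z ?Y)) (uq_tensor ?Z (uq_tensor ?X ?Y))"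
    using hkron[OF _ _ _ _ Gam_hom[OF assms(1,3)] hom_id[of v ?Y]] o by (simp add: uq_tensor_assoc[of v])
  have i1: "t \<cdot>\<^sub>m 1\<^sub>m N \<in> uq_hom (uq_tensor ?X (uq_tensor ?Y ?Z)) (uq_tensor ?X (uq_tensor ?Y ?Z))" for t
    using hom_id[of v "uq_tensor ?X (uq_tensor ?Y ?Z)"] o by (intro hsm) (auto simp: N_def mult.assoc)
  have i2: "t \<cdot>\<^sub>m 1\<^sub>m N \<in> uq_hom (uq_tensor ?Z (uq_tensor ?X ?Y)) (uq_tensor ?Z (uq_tensor ?X ?Y))" for t
    using hom_id[of v "uq_tensor ?Z (uq_tensor ?X ?Y)"] o by (intro hsm) (auto simp: N_def ac_simps)
  have i3: "t \<cdot>\<^sub>m 1\<^sub>m N \<in> uq_hom (uq_tensor ?X (uq_tensor ?Z ?Y)) (uq_tensor ?X (uq_tensor ?Z ?Y))" for t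
    using hom_id[of v "uq_tensor ?X (uq_tensor ?Z ?Y)"] o by (intro hsm) (auto simp: N_def ac_simps)
  let ?a = "inverse (w (snd z) (snd x) (snd y))" and ?b = "inverse (w (snd x) (snd y) (snd z))" and ?cc = "inverse (w (snd x) (snd z) (snd y))"
  let ?p = "tn x (tn y z)" and ?q = "tn z (tn x y)" and ?r = "tn x (tn z y)"
  have deg: "snd ?p = snd ?q" "snd ?p = snd ?r" by (simp_all add: mod_simps ac_simps)
  have hm: "hO ?p" "hO ?q" "hO ?r" using o by auto
  have NN: "rep_dim ?Z * rep_dim ?X * rep_dim ?Y = N" "rep_dim ?X * rep_dim ?Z * rep_dim ?Y = N" by (auto simp: N_def ac_simps)
  have h1: "Gam (tn x y) z * (?b \<cdot>\<^sub>m 1\<^sub>m N) \<in> uq_hom (uq_tensor ?X (uq_tensor ?Y ?Z)) (uq_tensor ?Z (uq_tensor ?X ?Y))"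
    using hcomp[OF _ _ _ i1 g1] o by simp
  have h2: "(?cc \<cdot>\<^sub>m 1\<^sub>m N) * kron (1\<^sub>m (rep_dim ?X)) (Gam y z) \<in> uq_hom (uq_tensor ?X (uq_tensor ?Y ?Z)) (uq_tensor ?X (uq_tensor ?Z ?Y))"
    using hcomp[OF _ _ _ g2 i3] o by simp
  have L: "cat_comp G1 [?p] [?q] [?q] (sg ?q ?q (?a \<cdot>\<^sub>m 1\<^sub>m N)) (cat_comp G1 [?p] [?p] [?q] (sg ?p ?q (Gam (tn x y) z)) (sg ?p ?p (?b \<cdot>\<^sub>m 1\<^sub>m N)))
    = sg ?p ?q ((?a \<cdot>\<^sub>m 1\<^sub>m N) * (Gam (tn x y) z * (?b \<cdot>\<^sub>m 1\<^sub>m N)))"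
    using i1 i2 g1 h1 by (subst sg_comp[OF hm(1,1,2)]; (subst sg_comp[OF hm(1,2,2)])?) (auto simp: deg[simplified])
  have R: "cat_comp G1 [?p] [?r] [?q] (sg ?r ?q (kron (Gam x z) (1\<^sub>m (rep_dim ?Y))))
      (cat_comp G1 [?p] [?r] [?r] (sg ?r ?r (?cc \<cdot>\<^sub>m 1\<^sub>m N)) (sg ?p ?r (kron (1\<^sub>m (rep_dim ?X)) (Gam y z))))
    = sg ?p ?q (kron (Gam x z) (1\<^sub>m (rep_dim ?Y)) * ((?cc \<cdot>\<^sub>m 1\<^sub>m N) * kron (1\<^sub>m (rep_dim ?X)) (Gam y z)))"
    using i3 g2 g3 h2 by (subst sg_comp[OF hm(1,3,3)]; (subst sg_comp[OF hm(1,3,2)])?) (auto simp: deg[simplified] add.commute)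
  have t1: "ten_mor G1 [tn x z] [tn z x] [y] [y] (c [x] [z]) (cat_id G1 [y]) = sg ?r ?q (kron (Gam x z) (1\<^sub>m (rep_dim ?Y)))"
    using sg_ten[of "tn x z" y "tn z x" y "Gam x z" "1\<^sub>m (rep_dim ?Y)"] o Gam_hom[OF assms(1,3)] hom_id[OF o(5)]
    by (simp add: sg_id c_Gam[OF assms(1,3)] add.commute tn_assoc)
  have t2: "ten_mor G1 [x] [x] [tn y z] [tn z y] (cat_id G1 [x]) (c [y] [z]) = sg ?p ?r (kron (1\<^sub>m (rep_dim ?X)) (Gam y z))"
    using sg_ten[of x "tn y z" x "tn z y" "1\<^sub>m (rep_dim ?X)" "Gam y z"] o Gam_hom[OF assms(2,3)] hom_id[OF o(2)]
    by (simp add: sg_id c_Gam[OF assms(2,3)] add.commute)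
  have "sg ?p ?q ((?a \<cdot>\<^sub>m 1\<^sub>m N) * (Gam (tn x y) z * (?b \<cdot>\<^sub>m 1\<^sub>m N)))
    = sg ?p ?q (kron (Gam x z) (1\<^sub>m (rep_dim ?Y)) * ((?cc \<cdot>\<^sub>m 1\<^sub>m N) * kron (1\<^sub>m (rep_dim ?X)) (Gam y z)))"
    using br_hex2[OF assms, unfolded inv_assoc_C[OF ho(1,2,3)] inv_assoc_C[OF ho(3,1,2)] inv_assoc_C[OF ho(1,3,2)]] L R
    by (simp only: ten_single tn_assoc[OF ho(1,2,3)] tn_assoc[OF ho(3,1,2)] tn_assoc[OF ho(1,3,2)]
       t1 t2 c_Gam[OF H_tn[OF assms(1,2)] assms(3)] N_def[symmetric] NN)
  then have "eqv (uq_tensor ?X (uq_tensor ?Y ?Z)) (uq_tensor ?Z (uq_tensor ?X ?Y)) ((?a \<cdot>\<^sub>m 1\<^sub>m N) * (Gam (tn x y) z * (?b \<cdot>\<^sub>m 1\<^sub>m N)))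
     (kron (Gam x z) (1\<^sub>m (rep_dim ?Y)) * ((?cc \<cdot>\<^sub>m 1\<^sub>m N) * kron (1\<^sub>m (rep_dim ?X)) (Gam y z)))"
    using sg_eq[OF hm(1,2) _ _ deg(1)] hcomp[OF _ _ _ h1 i2, of ?a] hcomp[OF _ _ _ h2 g3] o by simp
  moreover have "(?a \<cdot>\<^sub>m 1\<^sub>m N) * (Gam (tn x y) z * (?b \<cdot>\<^sub>m 1\<^sub>m N)) = (?a * ?b) \<cdot>\<^sub>m Gam (tn x y) z"
    using uq_homD(1,2)[OF g1] by (simp add: mult_scalars N_def smult_smult ac_simps)
  moreover have "kron (Gam x z) (1\<^sub>m (rep_dim ?Y)) * ((?cc \<cdot>\<^sub>m 1\<^sub>m N) * kron (1\<^sub>m (rep_dim ?X)) (Gam y z)) = ?cc \<cdot>\<^sub>m (kron (Gam x z) (1\<^sub>m (rep_dim ?Y)) * kron (1\<^sub>m (rep_dim ?X)) (Gam y z))"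
    using uq_homD(1,2)[OF g2] uq_homD(1,2)[OF g3] by (simp add: mult_scalars mult_smult_dim N_def ac_simps del: dim_kron)
  ultimately show ?thesis by simp
qed

end

lemma smult_one: "1 \<cdot>\<^sub>m A = (A :: 'a::monoid_mult mat)"
  by (intro eq_matI) auto

context ising_parameter
begin

lemma eqv_rescale:
  assumes "wrep v X" "wrep v Y" "eqv X Y (a \<cdot>\<^sub>m f) (b \<cdot>\<^sub>m g)" "a \<noteq> 0"
  shows "eqv X Y f ((b / a) \<cdot>\<^sub>m g)"
proof -
  have "eqv X Y (inverse a \<cdot>\<^sub>m (a \<cdot>\<^sub>m f)) (inverse a \<cdot>\<^sub>m (b \<cdot>\<^sub>m g))"
    using assms by (intro eqv_smult) auto
  then show ?thesis using assms(4) by (simp add: smult_smult smult_one field_simps)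
qed

lemma eqv_scalar_eq:
  assumes w: "wrep v X" and "eqv X X (a \<cdot>\<^sub>m 1\<^sub>m (rep_dim X)) (b \<cdot>\<^sub>m 1\<^sub>m (rep_dim X))" and t: "mtr (rep_K X) \<noteq> 0"
  shows "a = b"
  using eqv_trace[OF assms(1,2)] t w by (simp add: mult_smult_dim mult_one_dim mtr_smult)

lemma mtr_kron: "dim_row A = dim_col A \<Longrightarrow> dim_row B = dim_col B \<Longrightarrow> mtr (kron A B) = mtr A * mtr (B :: 'k mat)"
  by (simp add: mtr_def sum_product sum_div_mod[of "\<lambda>i j. A $$ (i, i) * B $$ (j, j)", symmetric])

end

context braided_ising
begin

section \<open>Monodromy\<close>

definition M :: "'k uq_rep \<times> nat \<Rightarrow> 'k uq_rep \<times> nat \<Rightarrow> 'k mat" where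
  "M x y = Gam y x * Gam x y"

definition Msc :: "'k uq_rep \<times> nat \<Rightarrow> 'k uq_rep \<times> nat \<Rightarrow> 'k \<Rightarrow> bool" where
  "Msc x y a \<longleftrightarrow> eqv (uq_tensor (fst x) (fst y)) (uq_tensor (fst x) (fst y)) (M x y) (a \<cdot>\<^sub>m 1\<^sub>m (rep_dim (fst x) * rep_dim (fst y)))"

lemma M_hom: "H x \<Longrightarrow> H y \<Longrightarrow> M x y \<in> uq_hom (uq_tensor (fst x) (fst y)) (uq_tensor (fst x) (fst y))"
  unfolding M_def by (intro hcomp[OF _ _ _ Gam_hom Gam_hom]) (auto simp: H_hO)

lemma M_dim: "H x \<Longrightarrow> H y \<Longrightarrow> dim_row (M x y) = rep_dim (fst x) * rep_dim (fst y)" "H x \<Longrightarrow> H y \<Longrightarrow> dim_col (M x y) = rep_dim (fst x) * rep_dim (fst y)"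
  using uq_homD(1,2)[OF M_hom] by auto

lemma M_nat:
  assumes "H x" "H y" "H x'" "H y'" "f \<in> uq_hom (fst x) (fst x')" "g \<in> uq_hom (fst y) (fst y')" "snd x = snd x'" "snd y = snd y'"
  shows "eqv (uq_tensor (fst x) (fst y)) (uq_tensor (fst x') (fst y')) (M x' y' * kron f g) (kron f g * M x y)"
proof -
  note o = H_hO[OF assms(1)] H_hO[OF assms(2)] H_hO[OF assms(3)] H_hO[OF assms(4)]
  let ?A = "uq_tensor (fst x) (fst y)" and ?B = "uq_tensor (fst x') (fst y')" and ?A' = "uq_tensor (fst y) (fst x)" and ?B' = "uq_tensor (fst y') (fst x')"
  have w: "wrep v ?A" "wrep v ?B" "wrep v ?A'" "wrep v ?B'" using o by auto
  note d = uq_homD(1,2)[OF assms(5)] uq_homD(1,2)[OF assms(6)] Gam_dim[OF assms(1,2)] Gam_dim[OF assms(2,1)] Gam_dim[OF assms(3,4)] Gam_dim[OF assms(4,3)]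
  have "eqv ?A ?B (Gam y' x' * (Gam x' y' * kron f g)) (Gam y' x' * (kron g f * Gam x y))"
    by (rule eqv_comp[OF w(1,4,2) Gam_nat[OF assms] eqv_refl[OF w(4,2) Gam_hom[OF assms(4,3)]]])
  moreover have "eqv ?A ?B ((Gam y' x' * kron g f) * Gam x y) ((kron f g * Gam y x) * Gam x y)"
    by (rule eqv_comp[OF w(1,3,2) eqv_refl[OF w(1,3) Gam_hom[OF assms(1,2)]] Gam_nat[OF assms(2,1,4,3,6,5,8,7)]])
  ultimately have "eqv ?A ?B (Gam y' x' * (Gam x' y' * kron f g)) ((kron f g * Gam y x) * Gam x y)"
    using d eqv_trans[OF w(1,2)] by (simp add: mult_assoc_dim)
  then show ?thesis using d by (simp add: M_def mult_assoc_dim)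
qed

text \<open>In the composite of the two hexagons the scalars from the associativity constraints cancel.\<close>

lemma M_tensR:
  assumes "H x" "H y" "H z"
  shows "eqv (uq_tensor (fst x) (uq_tensor (fst y) (fst z))) (uq_tensor (fst x) (uq_tensor (fst y) (fst z))) (M x (tn y z))
    (kron (Gam y x) (1\<^sub>m (rep_dim (fst z))) * (kron (1\<^sub>m (rep_dim (fst y))) (M x z) * kron (Gam x y) (1\<^sub>m (rep_dim (fst z)))))"
proof -
  note o = H_hO[OF assms(1)] H_hO[OF assms(2)] H_hO[OF assms(3)]
  let ?A = "uq_tensor (fst x) (uq_tensor (fst y) (fst z))" and ?B = "uq_tensor (fst y) (uq_tensor (fst z) (fst x))"
  have w: "wrep v ?A" "wrep v ?B" using o by auto
  let ?p = "w (snd y) (snd z) (snd x)" and ?q = "w (snd x) (snd y) (snd z)" and ?r = "w (snd y) (snd x) (snd z)"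
  let ?A1 = "kron (1\<^sub>m (rep_dim (fst y))) (Gam x z)" and ?A2 = "kron (Gam x y) (1\<^sub>m (rep_dim (fst z)))"
  let ?B1 = "kron (Gam y x) (1\<^sub>m (rep_dim (fst z)))" and ?B2 = "kron (1\<^sub>m (rep_dim (fst y))) (Gam z x)"
  note d = Gam_dim[OF assms(1,2)] Gam_dim[OF assms(2,1)] Gam_dim[OF assms(1,3)] Gam_dim[OF assms(3,1)]
  have nz: "?p * ?q \<noteq> 0" "inverse ?q * inverse ?p \<noteq> 0" using w_nz by auto
  have 1: "eqv ?A ?B (Gam x (tn y z)) ((?r / (?p * ?q)) \<cdot>\<^sub>m (?A1 * ?A2))"
    by (rule eqv_rescale[OF w hex1[OF assms] nz(1)])
  have 2: "eqv ?B ?A (Gam (tn y z) x) ((inverse ?r / (inverse ?q * inverse ?p)) \<cdot>\<^sub>m (?B1 * ?B2))"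
    by (rule eqv_rescale[OF w(2,1) hex2[OF assms(2,3,1)] nz(2)])
  have "eqv ?A ?A (M x (tn y z)) (((inverse ?r / (inverse ?q * inverse ?p)) \<cdot>\<^sub>m (?B1 * ?B2)) * ((?r / (?p * ?q)) \<cdot>\<^sub>m (?A1 * ?A2)))"
    unfolding M_def by (rule eqv_comp[OF w(1,2,1) 1 2])
  also have "((inverse ?r / (inverse ?q * inverse ?p)) \<cdot>\<^sub>m (?B1 * ?B2)) * ((?r / (?p * ?q)) \<cdot>\<^sub>m (?A1 * ?A2))
    = ((?r / (?p * ?q)) * (inverse ?r / (inverse ?q * inverse ?p))) \<cdot>\<^sub>m ((?B1 * ?B2) * (?A1 * ?A2))"
    using d by (simp add: smult_mult_dim mult_smult_dim smult_smult ac_simps)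
  also have "(?r / (?p * ?q)) * (inverse ?r / (inverse ?q * inverse ?p)) = 1" using w_nz by (simp add: field_simps)
  also have "1 \<cdot>\<^sub>m ((?B1 * ?B2) * (?A1 * ?A2)) = ?B1 * ((?B2 * ?A1) * ?A2)" using d by (simp add: smult_one mult_assoc_dim ac_simps)
  also have "?B2 * ?A1 = kron (1\<^sub>m (rep_dim (fst y))) (M x z)" using d by (simp add: kron_mult one_mult_dim M_def)
  finally show ?thesis .
qed

lemma M_tensL:
  assumes "H x" "H y" "H z"
  shows "eqv (uq_tensor (fst x) (uq_tensor (fst y) (fst z))) (uq_tensor (fst x) (uq_tensor (fst y) (fst z))) (M (tn x y) z)
    (kron (1\<^sub>m (rep_dim (fst x))) (Gam z y) * (kron (M x z) (1\<^sub>m (rep_dim (fst y))) * kron (1\<^sub>m (rep_dim (fst x))) (Gam y z)))"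
proof -
  note o = H_hO[OF assms(1)] H_hO[OF assms(2)] H_hO[OF assms(3)]
  let ?A = "uq_tensor (fst x) (uq_tensor (fst y) (fst z))" and ?B = "uq_tensor (fst z) (uq_tensor (fst x) (fst y))"
  have w: "wrep v ?A" "wrep v ?B" using o by auto
  let ?p = "w (snd x) (snd y) (snd z)" and ?q = "w (snd z) (snd x) (snd y)" and ?r = "w (snd x) (snd z) (snd y)"
  let ?A1 = "kron (Gam x z) (1\<^sub>m (rep_dim (fst y)))" and ?A2 = "kron (1\<^sub>m (rep_dim (fst x))) (Gam y z)"
  let ?B1 = "kron (1\<^sub>m (rep_dim (fst x))) (Gam z y)" and ?B2 = "kron (Gam z x) (1\<^sub>m (rep_dim (fst y)))"
  note d = Gam_dim[OF assms(1,3)] Gam_dim[OF assms(3,1)] Gam_dim[OF assms(2,3)] Gam_dim[OF assms(3,2)]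
  have nz: "?p * ?q \<noteq> 0" "inverse ?q * inverse ?p \<noteq> 0" using w_nz by auto
  have 1: "eqv ?B ?A (Gam z (tn x y)) ((?r / (?p * ?q)) \<cdot>\<^sub>m (?B1 * ?B2))"
    by (rule eqv_rescale[OF w(2,1) hex1[OF assms(3,1,2)] nz(1)])
  have 2: "eqv ?A ?B (Gam (tn x y) z) ((inverse ?r / (inverse ?q * inverse ?p)) \<cdot>\<^sub>m (?A1 * ?A2))"
    by (rule eqv_rescale[OF w hex2[OF assms] nz(2)])
  have "eqv ?A ?A (M (tn x y) z) (((?r / (?p * ?q)) \<cdot>\<^sub>m (?B1 * ?B2)) * ((inverse ?r / (inverse ?q * inverse ?p)) \<cdot>\<^sub>m (?A1 * ?A2)))"
    unfolding M_def by (rule eqv_comp[OF w(1,2,1) 2 1])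
  also have "((?r / (?p * ?q)) \<cdot>\<^sub>m (?B1 * ?B2)) * ((inverse ?r / (inverse ?q * inverse ?p)) \<cdot>\<^sub>m (?A1 * ?A2))
    = ((inverse ?r / (inverse ?q * inverse ?p)) * (?r / (?p * ?q))) \<cdot>\<^sub>m ((?B1 * ?B2) * (?A1 * ?A2))"
    using d by (simp add: smult_mult_dim mult_smult_dim smult_smult ac_simps)
  also have "(inverse ?r / (inverse ?q * inverse ?p)) * (?r / (?p * ?q)) = 1" using w_nz by (simp add: field_simps)
  also have "1 \<cdot>\<^sub>m ((?B1 * ?B2) * (?A1 * ?A2)) = ?B1 * ((?B2 * ?A1) * ?A2)" using d by (simp add: smult_one mult_assoc_dim ac_simps)
  also have "?B2 * ?A1 = kron (M x z) (1\<^sub>m (rep_dim (fst y)))" using d by (simp add: kron_mult one_mult_dim M_def)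
  finally show ?thesis .
qed

lemma Msc_tensR:
  assumes "H x" "H y" "H z" "Msc x y a" "Msc x z b"
  shows "Msc x (tn y z) (a * b)"
proof -
  note o = H_hO[OF assms(1)] H_hO[OF assms(2)] H_hO[OF assms(3)]
  let ?X = "fst x" and ?Y = "fst y" and ?Z = "fst z"
  let ?A = "uq_tensor ?X (uq_tensor ?Y ?Z)" and ?B = "uq_tensor ?Y (uq_tensor ?X ?Z)"
  have w: "wrep v ?A" "wrep v ?B" "wrep v (uq_tensor ?X ?Y)" using o by auto
  let ?i = "1\<^sub>m (rep_dim ?Z)"
  note d = Gam_dim[OF assms(1,2)] Gam_dim[OF assms(2,1)]
  have e: "uq_tensor (uq_tensor ?X ?Y) ?Z = ?A" "uq_tensor (uq_tensor ?Y ?X) ?Z = ?B" using o by (simp_all add: uq_tensor_assoc[of v])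
  have k1: "eqv ?A ?B (kron (Gam x y) ?i) (kron (Gam x y) ?i)" and k2: "eqv ?B ?A (kron (Gam y x) ?i) (kron (Gam y x) ?i)"
    unfolding e[symmetric] using o Gam_hom[OF assms(1,2)] Gam_hom[OF assms(2,1)] hom_id[OF o(8)] by (auto intro!: eqv_refl hkron)
  have k3: "eqv ?B ?B (kron (1\<^sub>m (rep_dim ?Y)) (M x z)) (kron (1\<^sub>m (rep_dim ?Y)) (b \<cdot>\<^sub>m 1\<^sub>m (rep_dim ?X * rep_dim ?Z)))"
    using assms(5) o hom_id[OF o(5)] unfolding Msc_def by (intro eqv_kron eqv_refl) auto
  note 1 = eqv_trans[OF w(1,1) M_tensR[OF assms(1-3)] eqv_comp[OF w(1,2,1) eqv_comp[OF w(1,2,2) k1 k3] k2]]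
  also have "kron (Gam y x) ?i * (kron (1\<^sub>m (rep_dim ?Y)) (b \<cdot>\<^sub>m 1\<^sub>m (rep_dim ?X * rep_dim ?Z)) * kron (Gam x y) ?i) = kron (M x y) (b \<cdot>\<^sub>m ?i)"
  proof -
    have "kron (1\<^sub>m (rep_dim ?Y)) (b \<cdot>\<^sub>m 1\<^sub>m (rep_dim ?X * rep_dim ?Z)) = b \<cdot>\<^sub>m 1\<^sub>m (rep_dim ?Y * rep_dim ?X * rep_dim ?Z)"
      by (simp add: kron_smult_right kron_one_one mult.assoc)
    then show ?thesis using d by (simp add: mult_scalars mult_smult_dim kron_mult one_mult_dim M_def kron_smult_right)
  qed
  finally have 2: "eqv ?A ?A (M x (tn y z)) (kron (M x y) (b \<cdot>\<^sub>m ?i))" .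
  have "eqv ?A ?A (kron (M x y) (b \<cdot>\<^sub>m ?i)) (kron (a \<cdot>\<^sub>m 1\<^sub>m (rep_dim ?X * rep_dim ?Y)) (b \<cdot>\<^sub>m ?i))"
    unfolding e[symmetric] using assms(4) o hom_id[OF o(8)] unfolding Msc_def by (intro eqv_kron eqv_refl) (auto intro!: hsm)
  from eqv_trans[OF w(1,1) 2 this] show ?thesis
    by (simp add: Msc_def kron_smult_left kron_smult_right kron_one_one smult_smult mult.assoc mult.commute[of b])
qed

lemma M_tensL_scalar:
  assumes "H x" "H y" "H z" "Msc x z a"
  shows "eqv (uq_tensor (fst x) (uq_tensor (fst y) (fst z))) (uq_tensor (fst x) (uq_tensor (fst y) (fst z))) (M (tn x y) z) (a \<cdot>\<^sub>m kron (1\<^sub>m (rep_dim (fst x))) (M y z))"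
proof -
  note o = H_hO[OF assms(1)] H_hO[OF assms(2)] H_hO[OF assms(3)]
  let ?X = "fst x" and ?Y = "fst y" and ?Z = "fst z"
  let ?A = "uq_tensor ?X (uq_tensor ?Y ?Z)" and ?B = "uq_tensor ?X (uq_tensor ?Z ?Y)"
  have w: "wrep v ?A" "wrep v ?B" using o by auto
  let ?i = "1\<^sub>m (rep_dim ?X)"
  note d = Gam_dim[OF assms(2,3)] Gam_dim[OF assms(3,2)]
  have e: "uq_tensor (uq_tensor ?X ?Z) ?Y = ?B" using o by (simp_all add: uq_tensor_assoc[of v])
  have k1: "eqv ?A ?B (kron ?i (Gam y z)) (kron ?i (Gam y z))" and k2: "eqv ?B ?A (kron ?i (Gam z y)) (kron ?i (Gam z y))"
    using o Gam_hom[OF assms(2,3)] Gam_hom[OF assms(3,2)] hom_id[OF o(2)] by (auto intro!: eqv_refl hkron)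
  have k3: "eqv ?B ?B (kron (M x z) (1\<^sub>m (rep_dim ?Y))) (kron (a \<cdot>\<^sub>m 1\<^sub>m (rep_dim ?X * rep_dim ?Z)) (1\<^sub>m (rep_dim ?Y)))"
    unfolding e[symmetric] using assms(4) o hom_id[OF o(5)] unfolding Msc_def by (intro eqv_kron eqv_refl) auto
  note 1 = eqv_trans[OF w(1,1) M_tensL[OF assms(1-3)] eqv_comp[OF w(1,2,1) eqv_comp[OF w(1,2,2) k1 k3] k2]]
  also have "kron ?i (Gam z y) * (kron (a \<cdot>\<^sub>m 1\<^sub>m (rep_dim ?X * rep_dim ?Z)) (1\<^sub>m (rep_dim ?Y)) * kron ?i (Gam y z)) = a \<cdot>\<^sub>m kron ?i (M y z)"
  proof -
    have "kron (a \<cdot>\<^sub>m 1\<^sub>m (rep_dim ?X * rep_dim ?Z)) (1\<^sub>m (rep_dim ?Y)) = a \<cdot>\<^sub>m 1\<^sub>m (rep_dim ?X * (rep_dim ?Z * rep_dim ?Y))"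
      by (simp add: kron_smult_left kron_one_one mult.assoc)
    then show ?thesis using d by (simp add: mult_scalars mult_smult_dim kron_mult one_mult_dim M_def)
  qed
  finally show ?thesis .
qed

lemma Msc_tensL:
  assumes "H x" "H y" "H z" "Msc x z a" "Msc y z b"
  shows "Msc (tn x y) z (a * b)"
proof -
  note o = H_hO[OF assms(1)] H_hO[OF assms(2)] H_hO[OF assms(3)]
  let ?X = "fst x" and ?Y = "fst y" and ?Z = "fst z"
  let ?A = "uq_tensor ?X (uq_tensor ?Y ?Z)"
  have w: "wrep v ?A" using o by auto
  have "eqv ?A ?A (a \<cdot>\<^sub>m kron (1\<^sub>m (rep_dim ?X)) (M y z)) (a \<cdot>\<^sub>m kron (1\<^sub>m (rep_dim ?X)) (b \<cdot>\<^sub>m 1\<^sub>m (rep_dim ?Y * rep_dim ?Z)))"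
    using assms(5) o hom_id[OF o(2)] unfolding Msc_def by (intro eqv_smult eqv_kron eqv_refl) auto
  from eqv_trans[OF w w M_tensL_scalar[OF assms(1-4)] this] show ?thesis
    using o by (simp add: Msc_def kron_smult_right kron_one_one smult_smult mult.assoc uq_tensor_assoc[of v])
qed

lemma Msc_sym:
  assumes "H x" "H y" "Msc x y 1"
  shows "Msc y x 1"
proof -
  note o = H_hO[OF assms(1)] H_hO[OF assms(2)]
  let ?A = "uq_tensor (fst x) (fst y)" and ?B = "uq_tensor (fst y) (fst x)"
  have w: "wrep v ?A" "wrep v ?B" using o by auto
  obtain g where g: "g \<in> uq_hom ?B ?A" "eqv ?B ?B (Gam x y * g) (1\<^sub>m (rep_dim (fst y) * rep_dim (fst x)))"
    using Gam_inv[OF assms(1,2)] by blast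
  note d = Gam_dim[OF assms(1,2)] Gam_dim[OF assms(2,1)] uq_homD(1,2)[OF g(1)]
  note G = Gam_hom[OF assms(1,2)] and G' = Gam_hom[OF assms(2,1)]
  have Mh: "M y x \<in> uq_hom ?B ?B" by (rule M_hom[OF assms(2,1)])
  have "eqv ?B ?B (M y x * (1\<^sub>m (rep_dim (fst y) * rep_dim (fst x)))) (M y x * (Gam x y * g))"
    by (rule eqv_comp[OF w(2,2,2) eqv_sym[OF w(2,2) g(2)] eqv_refl[OF w(2,2) Mh]])
  moreover have "M y x * (Gam x y * g) = Gam x y * (M x y * g)" using d by (simp add: M_def mult_assoc_dim)
  moreover have "eqv ?B ?B (Gam x y * (M x y * g)) (Gam x y * ((1 \<cdot>\<^sub>m 1\<^sub>m (rep_dim (fst x) * rep_dim (fst y))) * g))"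
    using assms(3) unfolding Msc_def by (intro eqv_comp[OF w(2,1,2) eqv_comp[OF w(2,1,1)]] eqv_refl w g(1) G)
  moreover have "Gam x y * ((1 \<cdot>\<^sub>m 1\<^sub>m (rep_dim (fst x) * rep_dim (fst y))) * g) = Gam x y * g"
    using d by (simp add: mult_scalars smult_one)
  moreover have "M y x * (1\<^sub>m (rep_dim (fst y) * rep_dim (fst x))) = M y x" using M_dim[OF assms(2,1)] by (simp add: mult_one_dim)
  ultimately have "eqv ?B ?B (M y x) (1\<^sub>m (rep_dim (fst y) * rep_dim (fst x)))"
    using g(2) eqv_trans[OF w(2,2)] by metis
  then show ?thesis by (simp add: Msc_def smult_one)
qed

lemma Msc_unit:
  assumes y: "H y"
  shows "Msc (uq_trivial, 0) y 1"
proof -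
  let ?o = "(uq_trivial, 0) :: 'k uq_rep \<times> nat"
  note o = H_hO[OF y]
  let ?Y = "fst y"
  have oo: "tn ?o ?o = ?o" by (simp add: tn_def)
  note u1 = uq_tensor_unit[OF o(2)]
  define t where "t = Gam y ?o" define u where "u = Gam ?o y"
  have h: "t \<in> uq_hom ?Y ?Y" "u \<in> uq_hom ?Y ?Y" using Gam_hom[OF y H_unit] Gam_hom[OF H_unit y] by (simp_all add: t_def u_def u1)
  obtain t' where t': "t' \<in> uq_hom ?Y ?Y" "eqv ?Y ?Y (t' * t) (1\<^sub>m (rep_dim ?Y))"
    using Gam_inv[OF y H_unit] by (simp add: t_def u1) blast
  obtain u' where u': "u' \<in> uq_hom ?Y ?Y" "eqv ?Y ?Y (u * u') (1\<^sub>m (rep_dim ?Y))"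
    using Gam_inv[OF H_unit y] by (simp add: u_def u1) blast
  note d = uq_homD(1,2)[OF h(1)] uq_homD(1,2)[OF h(2)] uq_homD(1,2)[OF t'(1)] uq_homD(1,2)[OF u'(1)]
  note w = o(2)
  have "eqv ?Y ?Y (t * u) (t * ((t * u) * u))"
    using M_tensL[OF H_unit H_unit y] by (simp add: oo u1 M_def t_def u_def)
  then have "eqv ?Y ?Y (t' * ((t * u) * u')) (t' * ((t * ((t * u) * u)) * u'))"
    using t' u' w by (intro eqv_comp[OF w w w eqv_comp[OF w w w]] eqv_refl) auto
  moreover have "eqv ?Y ?Y ((t' * t) * (u * u')) (1\<^sub>m (rep_dim ?Y) * 1\<^sub>m (rep_dim ?Y))"
    by (rule eqv_comp[OF w w w u'(2) t'(2)])
  moreover have "eqv ?Y ?Y ((t' * t) * ((t * u) * (u * u'))) (1\<^sub>m (rep_dim ?Y) * ((t * u) * 1\<^sub>m (rep_dim ?Y)))"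
    using hcomp[OF w w w h(2,1)] by (intro eqv_comp[OF w w w eqv_comp[OF w w w u'(2)] t'(2)] eqv_refl w)
  moreover have "t' * ((t * u) * u') = (t' * t) * (u * u')" "t' * ((t * ((t * u) * u)) * u') = (t' * t) * ((t * u) * (u * u'))"
    "1\<^sub>m (rep_dim ?Y) * ((t * u) * 1\<^sub>m (rep_dim ?Y)) = t * u" "1\<^sub>m (rep_dim ?Y) * 1\<^sub>m (rep_dim ?Y) = (1\<^sub>m (rep_dim ?Y) :: 'k mat)"
    using d by (simp_all add: mult_assoc_dim one_mult_dim mult_one_dim)
  ultimately have "eqv ?Y ?Y (t * u) (1\<^sub>m (rep_dim ?Y))"
    using eqv_trans[OF w w] eqv_sym[OF w w] by metis
  then show ?thesis by (simp add: Msc_def u1 M_def t_def u_def smult_one)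
qed

lemma Msc_thru:
  assumes x: "H x" and y: "H (Y, j)" and h: "thru S Y Y h" and S: "\<And>W. W \<in> S \<Longrightarrow> H (W, j) \<and> Msc x (W, j) a"
  shows "eqv (uq_tensor (fst x) Y) (uq_tensor (fst x) Y) (M x (Y, j) * kron (1\<^sub>m (rep_dim (fst x))) h) (a \<cdot>\<^sub>m kron (1\<^sub>m (rep_dim (fst x))) h)"
  using h
proof (induction)
  note o = H_hO[OF x] H_hO[OF y, simplified]
  let ?X = "fst x" and ?i = "1\<^sub>m (rep_dim (fst x))"
  let ?A = "uq_tensor ?X Y"
  have w: "wrep v ?A" using o by auto
  note Md = M_dim[OF x y, simplified]
  {
    case thru_zero
    have "M x (Y, j) * 0\<^sub>m (rep_dim ?X * rep_dim Y) (rep_dim ?X * rep_dim Y) = 0\<^sub>m (rep_dim ?X * rep_dim Y) (rep_dim ?X * rep_dim Y)"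
      using Md by (intro right_mult_zero_mat) (auto intro: carrier_matI)
    then show ?case using hom_zero[OF w w] w by (auto intro!: eqv_refl)
  next
    case (thru_add W g f h)
    have HW: "H (W, j)" "Msc x (W, j) a" using S thru_add by auto
    have oW: "W \<in> T" "wrep v W" using H_hO[OF HW(1)] by auto
    let ?B = "uq_tensor ?X W"
    have wB: "wrep v ?B" using o oW by auto
    note d = Md uq_homD(1,2)[OF thru_add(3)] uq_homD(1,2)[OF thru_add(4)] uq_homD(1,2)[OF thru_hom[OF thru_add(5) o(5,5)]] M_dim[OF x HW(1), simplified]
    have kf: "kron ?i f \<in> uq_hom ?B ?A" and kg: "kron ?i g \<in> uq_hom ?A ?B"
      using thru_add o oW hom_id[OF o(2)] by (auto intro!: hkron)
    have "eqv ?B ?A (M x (Y, j) * kron ?i f) (kron ?i f * M x (W, j))"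
      using M_nat[OF x HW(1) x y hom_id[OF o(2)], of f] thru_add(4) by simp
    moreover have "eqv ?B ?A (kron ?i f * M x (W, j)) (kron ?i f * (a \<cdot>\<^sub>m 1\<^sub>m (rep_dim ?X * rep_dim W)))"
      using HW(2) kf w wB unfolding Msc_def by (intro eqv_comp[of _ ?B] eqv_refl) auto
    ultimately have fa: "eqv ?B ?A (M x (Y, j) * kron ?i f) (kron ?i f * (a \<cdot>\<^sub>m 1\<^sub>m (rep_dim ?X * rep_dim W)))"
      using eqv_trans[OF wB w] by blast
    have "eqv ?A ?A ((M x (Y, j) * kron ?i f) * kron ?i g) ((kron ?i f * (a \<cdot>\<^sub>m 1\<^sub>m (rep_dim ?X * rep_dim W))) * kron ?i g)"
      by (rule eqv_comp[OF w wB w eqv_refl[OF w wB kg] fa])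
    also have "(M x (Y, j) * kron ?i f) * kron ?i g = M x (Y, j) * kron ?i (f * g)"
      using d by (simp add: mult_assoc_dim kron_mult one_mult_dim)
    also have "(kron ?i f * (a \<cdot>\<^sub>m 1\<^sub>m (rep_dim ?X * rep_dim W))) * kron ?i g = a \<cdot>\<^sub>m kron ?i (f * g)"
      using d by (simp add: mult_scalars smult_mult_dim kron_mult one_mult_dim)
    finally have 1: "eqv ?A ?A (M x (Y, j) * kron ?i (f * g)) (a \<cdot>\<^sub>m kron ?i (f * g))" .
    have "M x (Y, j) * kron ?i (f * g + h) = M x (Y, j) * kron ?i (f * g) + M x (Y, j) * kron ?i h"
      using d by (simp add: kron_add_right mult_add_dim)
    moreover have "a \<cdot>\<^sub>m kron ?i (f * g + h) = a \<cdot>\<^sub>m kron ?i (f * g) + a \<cdot>\<^sub>m kron ?i h"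
      using d by (simp add: kron_add_right) (intro eq_matI; simp add: algebra_simps)
    ultimately show ?case using eqv_add[OF w w 1 thru_add(6)] by simp
  }
qed

lemma Msc_ethru:
  assumes x: "H x" and y: "H (Y, j)" and h: "ethru S Y Y (1\<^sub>m (rep_dim Y))" and S: "\<And>W. W \<in> S \<Longrightarrow> H (W, j) \<and> Msc x (W, j) a"
  shows "Msc x (Y, j) a"
proof -
  note o = H_hO[OF x] H_hO[OF y, simplified]
  let ?X = "fst x" and ?i = "1\<^sub>m (rep_dim (fst x))"
  let ?A = "uq_tensor ?X Y"
  have w: "wrep v ?A" using o by auto
  obtain k where k: "thru S Y Y k" "eqv Y Y (1\<^sub>m (rep_dim Y)) k" using h by (auto simp: ethru_def)
  have 1: "eqv ?A ?A (kron ?i (1\<^sub>m (rep_dim Y))) (kron ?i k)"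
    using k o hom_id[OF o(2)] by (intro eqv_kron eqv_refl) auto
  have "eqv ?A ?A (M x (Y, j) * kron ?i (1\<^sub>m (rep_dim Y))) (M x (Y, j) * kron ?i k)"
    using 1 w M_hom[OF x y] by (intro eqv_comp[OF w w w] eqv_refl) auto
  moreover note Msc_thru[OF x y k(1) S]
  moreover have "eqv ?A ?A (a \<cdot>\<^sub>m kron ?i k) (a \<cdot>\<^sub>m kron ?i (1\<^sub>m (rep_dim Y)))"
    by (rule eqv_smult[OF w w eqv_sym[OF w w 1]])
  ultimately have "eqv ?A ?A (M x (Y, j) * kron ?i (1\<^sub>m (rep_dim Y))) (a \<cdot>\<^sub>m kron ?i (1\<^sub>m (rep_dim Y)))"
    using eqv_trans[OF w w] by blast
  then show ?thesis using M_dim[OF x y] by (simp add: Msc_def kron_one_one mult_one_dim)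
qed

text \<open>\<open>Z\<close> generates: the monodromy is multiplicative in the tensor powers of \<open>Z\<close>, and any \<open>y\<close> is a summand of
  powers in its own degree.\<close>

lemma central_all:
  assumes x: "H x" and Z: "Msc x (V, Suc 0) 1" and y: "H y"
  shows "Msc x y 1"
proof -
  have p: "Msc x (Vp m, m mod n) 1" for m
  proof (induction m)
    case 0
    show ?case using Msc_sym[OF H_unit x Msc_unit[OF x]] by simp
  next
    case (Suc m)
    have "Msc x (tn (V, Suc 0) (Vp m, m mod n)) (1 * 1)" by (rule Msc_tensR[OF x H_Z H_Vp Z Suc])
    then show ?case by (simp add: tn_def mod_Suc_eq)
  qed
  obtain Y j where yy: "y = (Y, j)" by (cases y)
  show ?thesis unfolding yy
    by (rule Msc_ethru[OF x _ GN_ethru]) (use y yy p H_Vp in auto)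
qed

section \<open>Transparent objects\<close>

abbreviation dmono where "dmono X Y \<equiv> cat_comp G1 (ten X Y) (ten Y X) (ten X Y) (c Y X) (c X Y)"

lemma c_hom: "X \<in> GN \<Longrightarrow> Y \<in> GN \<Longrightarrow> c X Y \<in> cat_hom G1 (ten X Y) (ten Y X)"
  using br_iso by blast

lemma dmono_rep:
  assumes X: "X \<in> GN" and Y: "Y \<in> GN"
  obtains \<mu> where "ghom (ten X Y) (ten X Y) \<mu>" "dmono X Y = gm (ten X Y) (ten X Y) \<mu>"
    "\<And>r t. r < length X * length Y \<Longrightarrow> t < length X * length Y \<Longrightarrow>
       eqv (fst (ten X Y ! t)) (fst (ten X Y ! r)) (\<mu> r t) (gid (ten X Y) r t * M (X ! (t div length Y)) (Y ! (t mod length Y)))"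
proof -
  have O: "GO X" "GO Y" "GO (ten X Y)" "GO (ten Y X)" using X Y by auto
  have "dmono X Y \<in> cat_hom G1 (ten X Y) (ten X Y)"
    by (rule G_comp_hom[OF O(3,4,3) c_hom[OF X Y] c_hom[OF Y X]])
  then obtain \<mu> where \<mu>: "ghom (ten X Y) (ten X Y) \<mu>" "dmono X Y = gm (ten X Y) (ten X Y) \<mu>" using O by (auto simp: G_hom)
  have "eqv (fst (ten X Y ! t)) (fst (ten X Y ! r)) (\<mu> r t) (gid (ten X Y) r t * M (X ! (t div length Y)) (Y ! (t mod length Y)))"
    if r: "r < length X * length Y" and t: "t < length X * length Y" for r t
  proof -
    define i k where "i = t div length Y" and "k = t mod length Y"
    have ik: "i < length X" "k < length Y" using div_less_mult[OF t] mod_less_mult[OF t] by (auto simp: i_def k_def)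
    define x y where "x = X ! i" and "y = Y ! k"
    have Hx: "H x" "H y" using GN_single X Y ik by (auto simp: x_def y_def)
    note o = H_hO[OF Hx(1)] H_hO[OF Hx(2)]
    have tt: "ten X Y ! t = tn x y" using t by (simp add: ten_nth tn_def x_def y_def i_def k_def)
    have sO: "GO [x]" "GO [y]" "GO [tn x y]" "GO [tn y x]" using o by auto
    define \<iota> \<kappa> where "\<iota> = gm [x] X (incl X i)" and "\<kappa> = gm [y] Y (incl Y k)"
    have gi: "ghom [x] X (incl X i)" "ghom [y] Y (incl Y k)" using ghom_incl[OF O(1) ik(1)] ghom_incl[OF O(2) ik(2)] by (simp_all add: x_def y_def)
    have h: "\<iota> \<in> cat_hom G1 [x] X" "\<kappa> \<in> cat_hom G1 [y] Y" using gi O sO by (auto simp: \<iota>_def \<kappa>_def G_hom)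
    let ?ik = "ten_mor G1 [x] X [y] Y \<iota> \<kappa>" and ?ki = "ten_mor G1 [y] Y [x] X \<kappa> \<iota>"
    have hik: "?ik \<in> cat_hom G1 [tn x y] (ten X Y)" "?ki \<in> cat_hom G1 [tn y x] (ten Y X)"
      using G_ten_hom[OF sO(1) O(1) sO(2) O(2) h] G_ten_hom[OF sO(2) O(2) sO(1) O(1) h(2,1)] by (simp_all add: ten_single)
    have ikr: "?ik = gm [tn x y] (ten X Y) (incl (ten X Y) t)"
    proof -
      have "?ik = gm [tn x y] (ten X Y) (gten [y] Y (incl X i) (incl Y k))"
        unfolding \<iota>_def \<kappa>_def by (subst gm_ten[OF sO(1) O(1) sO(2) O(2) gi]) (simp add: ten_single)
      also have "\<dots> = gm [tn x y] (ten X Y) (incl (ten X Y) t)"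
      proof (rule gm_cong)
        fix r s assume rs: "r < length (ten X Y)" "s < length [tn x y]"
        then have r: "r < length X * length Y" by simp
        note rd = div_less_mult[OF r] mod_less_mult[OF r]
        have "r = t \<longleftrightarrow> r div length Y = i \<and> r mod length Y = k" using div_mod_eqI[of r "length Y" t] by (auto simp: i_def k_def)
        then show "gten [y] Y (incl X i) (incl Y k) r s = incl (ten X Y) t r s"
          using rs r t rd ik by (auto simp: gten_def incl_def gid_def ten_nth kron_one_one i_def[symmetric] k_def[symmetric])
      qed
      finally show ?thesis .
    qed
    have n1: "cat_comp G1 [tn x y] (ten X Y) (ten Y X) (c X Y) ?ik = cat_comp G1 [tn x y] [tn y x] (ten Y X) ?ki (c [x] [y])"
      using br_nat[OF Hx(1) X Hx(2) Y h] by (simp add: ten_single)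
    have n2: "cat_comp G1 [tn y x] (ten Y X) (ten X Y) (c Y X) ?ki = cat_comp G1 [tn y x] [tn x y] (ten X Y) ?ik (c [y] [x])"
      using br_nat[OF Hx(2) Y Hx(1) X h(2,1)] by (simp add: ten_single)
    have cs: "c [x] [y] \<in> cat_hom G1 [tn x y] [tn y x]" "c [y] [x] \<in> cat_hom G1 [tn y x] [tn x y]"
      using c_hom[OF Hx] c_hom[OF Hx(2,1)] by (simp_all add: ten_single)
    have "cat_comp G1 [tn x y] (ten X Y) (ten X Y) (dmono X Y) ?ik = cat_comp G1 [tn x y] (ten Y X) (ten X Y) (c Y X) (cat_comp G1 [tn x y] (ten X Y) (ten Y X) (c X Y) ?ik)"
      by (rule G_assoc[OF sO(3) O(3,4,3) hik(1) c_hom[OF X Y] c_hom[OF Y X]])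
    also have "\<dots> = cat_comp G1 [tn x y] [tn y x] (ten X Y) (cat_comp G1 [tn y x] (ten Y X) (ten X Y) (c Y X) ?ki) (c [x] [y])"
      unfolding n1 by (rule G_assoc[OF sO(3,4) O(4,3) cs(1) hik(2) c_hom[OF Y X], symmetric])
    also have "\<dots> = cat_comp G1 [tn x y] [tn x y] (ten X Y) ?ik (cat_comp G1 [tn x y] [tn y x] [tn x y] (c [y] [x]) (c [x] [y]))"
      unfolding n2 by (rule G_assoc[OF sO(3,4,3) O(3) cs hik(1)])
    also have "cat_comp G1 [tn x y] [tn y x] [tn x y] (c [y] [x]) (c [x] [y]) = sg (tn x y) (tn x y) (M x y)"
      unfolding c_Gam[OF Hx] c_Gam[OF Hx(2,1)] M_def using o Gam_hom[OF Hx] Gam_hom[OF Hx(2,1)] by (subst sg_comp) (auto simp: add.commute)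
    finally have main: "cat_comp G1 [tn x y] (ten X Y) (ten X Y) (gm (ten X Y) (ten X Y) \<mu>) (gm [tn x y] (ten X Y) (incl (ten X Y) t))
      = cat_comp G1 [tn x y] [tn x y] (ten X Y) (gm [tn x y] (ten X Y) (incl (ten X Y) t)) (gm [tn x y] [tn x y] (\<lambda>_ _. M x y))"
      unfolding \<mu>(2) ikr sg_def .
    have gI: "ghom [tn x y] (ten X Y) (incl (ten X Y) t)" using ghom_incl[OF O(3), of t] t tt by simp
    have gM: "ghom [tn x y] [tn x y] (\<lambda>_ _. M x y)" using M_hom[OF Hx] by (intro ghom_sg) auto
    have "gm [tn x y] (ten X Y) (gcomp [tn x y] (ten X Y) (ten X Y) \<mu> (incl (ten X Y) t)) = gm [tn x y] (ten X Y) (gcomp [tn x y] [tn x y] (ten X Y) (incl (ten X Y) t) (\<lambda>_ _. M x y))"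
      using main by (simp only: gm_comp[OF sO(3) O(3,3) gI \<mu>(1)] gm_comp[OF sO(3,3) O(3) gM gI])
    then have "eqv (fst (tn x y)) (fst (ten X Y ! r)) (gcomp [tn x y] (ten X Y) (ten X Y) \<mu> (incl (ten X Y) t) r 0) (gcomp [tn x y] [tn x y] (ten X Y) (incl (ten X Y) t) (\<lambda>_ _. M x y) r 0)"
      using gm_eq_iff[OF sO(3) O(3) ghom_comp[OF sO(3) O(3,3) gI \<mu>(1)] ghom_comp[OF sO(3,3) O(3) gM gI]] r by simp
    moreover have "gcomp [tn x y] (ten X Y) (ten X Y) \<mu> (incl (ten X Y) t) r 0 = \<mu> r t"
      using gcomp_id_right[OF O(3,3) \<mu>(1), of r t] r t tt by (simp add: gcomp_def incl_def)
    moreover have "gcomp [tn x y] [tn x y] (ten X Y) (incl (ten X Y) t) (\<lambda>_ _. M x y) r 0 = gid (ten X Y) r t * M x y"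
    proof -
      have "msum (rep_dim (fst (ten X Y ! r))) (rep_dim (fst (tn x y))) {..<length [tn x y]} (\<lambda>u. incl (ten X Y) t r u * M x y) = incl (ten X Y) t r 0 * M x y"
        using M_dim[OF Hx] by (intro msum_delta[of _ 0]) (auto simp: incl_def gid_def)
      then show ?thesis by (simp add: gcomp_def incl_def)
    qed
    ultimately show ?thesis by (simp add: tt x_def y_def i_def k_def)
  qed
  then show ?thesis using that \<mu> by blast
qed

lemma dmono_id_iff:
  assumes X: "X \<in> GN" and Y: "Y \<in> GN"
  shows "dmono X Y = cat_id G1 (ten X Y) \<longleftrightarrow> (\<forall>i<length X. \<forall>k<length Y. Msc (X ! i) (Y ! k) 1)"
proof -
  have O: "GO X" "GO Y" "GO (ten X Y)" using X Y by auto
  obtain \<mu> where \<mu>: "ghom (ten X Y) (ten X Y) \<mu>" "dmono X Y = gm (ten X Y) (ten X Y) \<mu>"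
    and e: "\<And>r t. r < length X * length Y \<Longrightarrow> t < length X * length Y \<Longrightarrow>
       eqv (fst (ten X Y ! t)) (fst (ten X Y ! r)) (\<mu> r t) (gid (ten X Y) r t * M (X ! (t div length Y)) (Y ! (t mod length Y)))"
    using dmono_rep[OF X Y] by blast
  have iff: "dmono X Y = cat_id G1 (ten X Y) \<longleftrightarrow> (\<forall>r<length (ten X Y). \<forall>s<length (ten X Y). eqv (fst (ten X Y ! s)) (fst (ten X Y ! r)) (\<mu> r s) (gid (ten X Y) r s))"
    unfolding \<mu>(2) gm_id by (rule gm_eq_iff[OF O(3,3) \<mu>(1) ghom_id[OF O(3)]])
  show ?thesis
  proof
    assume L: "dmono X Y = cat_id G1 (ten X Y)"
    show "\<forall>i<length X. \<forall>k<length Y. Msc (X ! i) (Y ! k) 1"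
    proof (intro allI impI)
      fix i k assume ik: "i < length X" "k < length Y"
      define t where "t = i * length Y + k"
      have "length Y \<noteq> 0" using ik by linarith
      then have t: "t < length X * length Y" "t div length Y = i" "t mod length Y = k" using mult_add_less[OF ik] ik by (auto simp: t_def)
      have f: "fst (ten X Y ! t) = uq_tensor (fst (X ! i)) (fst (Y ! k))" using t by (simp add: ten_nth)
      have Hx: "H (X ! i)" "H (Y ! k)" using GN_single X Y ik by auto
      have w: "wrep v (uq_tensor (fst (X ! i)) (fst (Y ! k)))" using H_hO[OF Hx(1)] H_hO[OF Hx(2)] by simp
      have "gid (ten X Y) t t * M (X ! i) (Y ! k) = M (X ! i) (Y ! k)" using M_dim[OF Hx] f by (simp add: gid_def one_mult_dim)
      moreover have "eqv (fst (ten X Y ! t)) (fst (ten X Y ! t)) (\<mu> t t) (gid (ten X Y) t t)" using L iff t by auto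
      ultimately have "eqv (uq_tensor (fst (X ! i)) (fst (Y ! k))) (uq_tensor (fst (X ! i)) (fst (Y ! k))) (M (X ! i) (Y ! k)) (gid (ten X Y) t t)"
        using e[OF t(1,1)] t(2,3) f eqv_trans[OF w w] eqv_sym[OF w w] by metis
      then show "Msc (X ! i) (Y ! k) 1" using f by (simp add: Msc_def gid_def smult_one)
    qed
  next
    assume R: "\<forall>i<length X. \<forall>k<length Y. Msc (X ! i) (Y ! k) 1"
    show "dmono X Y = cat_id G1 (ten X Y)"
      unfolding iff
    proof (intro allI impI)
      fix r t assume "r < length (ten X Y)" "t < length (ten X Y)"
      then have rt: "r < length X * length Y" "t < length X * length Y" by auto
      define i k where "i = t div length Y" and "k = t mod length Y"
      have ik: "i < length X" "k < length Y" using div_less_mult[OF rt(2)] mod_less_mult[OF rt(2)] by (auto simp: i_def k_def)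
      have Hx: "H (X ! i)" "H (Y ! k)" using GN_single X Y ik by auto
      have f: "fst (ten X Y ! t) = uq_tensor (fst (X ! i)) (fst (Y ! k))" using rt by (simp add: ten_nth i_def k_def)
      have w: "wrep v (fst (ten X Y ! t))" "wrep v (fst (ten X Y ! r))" using GO_nth(2)[OF O(3)] rt by auto
      have gh: "gid (ten X Y) r t \<in> uq_hom (fst (ten X Y ! t)) (fst (ten X Y ! r))" using ghomD[OF ghom_id[OF O(3)], of r t] rt by simp
      have "eqv (fst (ten X Y ! t)) (fst (ten X Y ! r)) (gid (ten X Y) r t * M (X ! i) (Y ! k)) (gid (ten X Y) r t * (1 \<cdot>\<^sub>m 1\<^sub>m (rep_dim (fst (X ! i)) * rep_dim (fst (Y ! k)))))"
        using R ik gh w unfolding Msc_def f by (intro eqv_comp[of _ "uq_tensor (fst (X ! i)) (fst (Y ! k))"] eqv_refl) auto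
      moreover have "gid (ten X Y) r t * (1 \<cdot>\<^sub>m 1\<^sub>m (rep_dim (fst (X ! i)) * rep_dim (fst (Y ! k)))) = gid (ten X Y) r t"
        using uq_homD(1,2)[OF gh] f by (simp add: smult_one mult_one_dim)
      ultimately show "eqv (fst (ten X Y ! t)) (fst (ten X Y ! r)) (\<mu> r t) (gid (ten X Y) r t)"
        using eqv_trans[OF w e[OF rt]] by (simp add: i_def k_def)
    qed
  qed
qed

lemma center_iff:
  "X \<in> cat_obj (mueger_center C c) \<longleftrightarrow> X \<in> GN \<and> (\<forall>i<length X. \<forall>y. H y \<longrightarrow> Msc (X ! i) y 1)"
proof -
  have "X \<in> cat_obj (mueger_center C c) \<longleftrightarrow> X \<in> GN \<and> (\<forall>Y\<in>GN. dmono X Y = cat_id G1 (ten X Y))"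
    by (simp add: mueger_center_def full_subcat_def)
  also have "\<dots> \<longleftrightarrow> X \<in> GN \<and> (\<forall>i<length X. \<forall>y. H y \<longrightarrow> Msc (X ! i) y 1)"
  proof (intro conj_cong refl iffI ballI allI impI)
    fix i y assume X: "X \<in> GN" and h: "\<forall>Y\<in>GN. dmono X Y = cat_id G1 (ten X Y)" and i: "i < length X" and y: "H y"
    then show "Msc (X ! i) y 1" using dmono_id_iff[OF X y] by auto
  next
    fix Y assume X: "X \<in> GN" and h: "\<forall>i<length X. \<forall>y. H y \<longrightarrow> Msc (X ! i) y 1" and Y: "Y \<in> GN"
    then show "dmono X Y = cat_id G1 (ten X Y)" using dmono_id_iff[OF X Y] GN_single[OF Y] by blast
  qed
  finally show ?thesis .
qed

section \<open>The braiding of \<open>Z\<close> with itself\<close>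

abbreviation Z where "Z \<equiv> (V, Suc 0)"
definition dg :: nat where "dg = Suc (Suc 0) mod n"

lemma ZZ: "tn Z Z = (V2, dg)" by (simp add: tn_def V2_def dg_def)
lemma H_V2: "H (V2, dg)" using H_tn[OF H_Z H_Z] by (simp add: ZZ)

lemma H_two: "H (uq_trivial, dg)"
proof -
  have "((inverse d \<cdot>\<^sub>m cap) * cup) = 1\<^sub>m 1" using d_nz by (simp add: smult_mult_dim cap_cup smult_smult smult_one)
  then show ?thesis
    using H_retract[OF H_V2, of uq_trivial cup "inverse d \<cdot>\<^sub>m cap"] cup_hom hsm[OF V2_wrep wrep_trivial cap_hom] by simp
qed

lemma H_D: "H (D, dg)"
  using H_retract[OF H_V2, of D iD rD] iD_hom rD_hom rD_iD by simp

definition ra where "ra = Gam Z Z $$ (0, 0)"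
definition rb where "rb = Gam Z Z $$ (1, 2)"

text \<open>\<open>1\<close> and \<open>cup * cap\<close> span the endomorphisms of \<open>V \<otimes> V\<close>; the entries read off the coefficients.\<close>

lemma R_eq: "Gam Z Z = ra \<cdot>\<^sub>m 1\<^sub>m 4 + rb \<cdot>\<^sub>m (cup * cap)"
  using End_V2[of "Gam Z Z"] Gam_hom[OF H_Z H_Z] by (simp add: ra_def rb_def V2_def)

abbreviation R1 where "R1 \<equiv> kron (Gam Z Z) (1\<^sub>m 2)"
abbreviation R2 where "R2 \<equiv> kron (1\<^sub>m 2) (Gam Z Z)"

lemma R_dim [simp]: "dim_row (Gam Z Z) = 4" "dim_col (Gam Z Z) = 4"
  using Gam_dim[OF H_Z H_Z] by auto

lemma R12: "R1 = ra \<cdot>\<^sub>m 1\<^sub>m 8 + rb \<cdot>\<^sub>m (u1 * c1)" "R2 = ra \<cdot>\<^sub>m 1\<^sub>m 8 + rb \<cdot>\<^sub>m (u2 * c2)"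
  unfolding R_eq by (simp_all add: kron_add_left kron_add_right kron_smult_left kron_smult_right kron_one_one kron_mult one_mult_dim)

text \<open>The braid generators act on the multiplicity space of \<open>Z\<close> in \<open>Z \<otimes> Z \<otimes> Z\<close>, which has the
  basis \<open>u1\<close>, \<open>u2\<close>; \<open>lc a b\<close> is the vector with coordinates \<open>a\<close>, \<open>b\<close>.\<close>

definition lc where "lc a b = a \<cdot>\<^sub>m u1 + b \<cdot>\<^sub>m u2"

lemma lc_dim [simp]: "dim_row (lc a b) = 8" "dim_col (lc a b) = 2" by (simp_all add: lc_def)

lemma lc_add: "lc a b + lc a' b' = lc (a + a') (b + b')"
  by (intro eq_matI) (auto simp: lc_def algebra_simps)
lemma lc_smult: "s \<cdot>\<^sub>m lc a b = lc (s * a) (s * b)"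
  by (intro eq_matI) (auto simp: lc_def algebra_simps)
lemma lc_u: "u1 = lc 1 0" "u2 = lc 0 1"
  by (intro eq_matI; simp add: lc_def)+

lemma c_lc: "c1 * lc a b = (a * d + b) \<cdot>\<^sub>m 1\<^sub>m 2" "c2 * lc a b = (a + b * d) \<cdot>\<^sub>m 1\<^sub>m 2"
proof -
  have "c1 * lc a b = a \<cdot>\<^sub>m (d \<cdot>\<^sub>m 1\<^sub>m 2) + b \<cdot>\<^sub>m 1\<^sub>m 2" "c2 * lc a b = a \<cdot>\<^sub>m 1\<^sub>m 2 + b \<cdot>\<^sub>m (d \<cdot>\<^sub>m 1\<^sub>m 2)"
    unfolding lc_def by (simp_all add: mult_add_dim mult_smult_dim cu)
  then show "c1 * lc a b = (a * d + b) \<cdot>\<^sub>m 1\<^sub>m 2" "c2 * lc a b = (a + b * d) \<cdot>\<^sub>m 1\<^sub>m 2"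
    by (simp_all) (intro eq_matI; simp add: algebra_simps)+
qed

lemma R_lc: "R1 * lc a b = lc (ra * a + rb * (a * d + b)) (ra * b)" "R2 * lc a b = lc (ra * a) (ra * b + rb * (a + b * d))"
proof -
  have "R1 * lc a b = ra \<cdot>\<^sub>m lc a b + rb \<cdot>\<^sub>m (u1 * (c1 * lc a b))" "R2 * lc a b = ra \<cdot>\<^sub>m lc a b + rb \<cdot>\<^sub>m (u2 * (c2 * lc a b))"
    unfolding R12 by (simp_all add: add_mult_dim smult_mult_dim one_mult_dim mult_assoc_dim)
  moreover have "u1 * (s \<cdot>\<^sub>m 1\<^sub>m 2) = lc s 0" "u2 * (s \<cdot>\<^sub>m 1\<^sub>m 2) = lc 0 s" for s
    by (simp_all add: mult_scalars) (intro eq_matI; simp add: lc_def)+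
  ultimately show "R1 * lc a b = lc (ra * a + rb * (a * d + b)) (ra * b)" "R2 * lc a b = lc (ra * a) (ra * b + rb * (a + b * d))"
    by (simp_all add: c_lc lc_smult lc_add)
qed

lemma trV: "mtr (rep_K V) \<noteq> 0" using traces d_nz by simp

lemma lc_eqv:
  assumes "eqv V V3 (lc a b) (lc a' b')"
  shows "a = a'" "b = b'"
proof -
  have e: "eqv V V (k * lc a b) (k * lc a' b')" if "k \<in> uq_hom V3 V" for k
    using assms that by (intro eqv_comp[of V V3 V] eqv_refl) auto
  have s: "s = s'" if "eqv V V (s \<cdot>\<^sub>m 1\<^sub>m 2) (s' \<cdot>\<^sub>m 1\<^sub>m 2)" for s s'
    using eqv_scalar_eq[OF V_wrep _ trV, of s s'] that by simp
  have 1: "a * d + b = a' * d + b'" using e[OF u_homs(3)] s by (simp add: c_lc)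
  have 2: "a + b * d = a' + b' * d" using e[OF u_homs(4)] s by (simp add: c_lc)
  have "(a * d + b) * d - (a + b * d) = (a' * d + b') * d - (a' + b' * d)" using 1 2 by simp
  moreover have "(a * d + b) * d - (a + b * d) = a * (d * d) - a" "(a' * d + b') * d - (a' + b' * d) = a' * (d * d) - a'" by (simp_all add: algebra_simps)
  ultimately show "a = a'" by (simp add: d2)
  then show "b = b'" using 1 by simp
qed

lemma Gam_scalar:
  assumes "H (uq_trivial, j)"
  shows "\<exists>s. Gam (uq_trivial, j) Z = s \<cdot>\<^sub>m 1\<^sub>m 2"
  using Gam_hom[OF assms H_Z] End_V by (auto simp: uq_tensor_unit[of v])

text \<open>Braiding \<open>Z \<otimes> Z\<close> past \<open>Z\<close> is \<open>R1 * R2\<close> up to a scalar, by a hexagon; as \<open>cup\<close> passes through the braiding,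
  it takes \<open>u1\<close> to a multiple of \<open>u2\<close>.  The relation is the vanishing of the coefficient of \<open>u1\<close>.\<close>

lemma kauffman_relation: "ra * ra + ra * rb * d + rb * rb = 0"
proof -
  let ?w = "w (Suc 0) (Suc 0) (Suc 0)"
  have w3: "uq_tensor V (uq_tensor V V) = V3" by (simp add: V3_def V2_def)
  have "eqv V3 V3 ((inverse ?w * inverse ?w) \<cdot>\<^sub>m Gam (tn Z Z) Z) (inverse ?w \<cdot>\<^sub>m (R1 * R2))"
    using hex2[OF H_Z H_Z H_Z] by (simp add: w3)
  then have h: "eqv V3 V3 (Gam (V2, dg) Z) ((inverse ?w / (inverse ?w * inverse ?w)) \<cdot>\<^sub>m (R1 * R2))"
    unfolding ZZ using w_nz by (intro eqv_rescale) auto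
  define s where "s = inverse ?w / (inverse ?w * inverse ?w)"
  have s: "s \<noteq> 0" using w_nz by (simp add: s_def)
  obtain t where t: "Gam (uq_trivial, dg) Z = t \<cdot>\<^sub>m 1\<^sub>m 2" using Gam_scalar[OF H_two] by blast
  have V3': "uq_tensor V2 V = V3" unfolding V3_def V2_def by (simp add: uq_tensor_assoc[of v])
  have "eqv V V3 (Gam (V2, dg) Z * kron cup (1\<^sub>m 2)) (kron (1\<^sub>m 2) cup * Gam (uq_trivial, dg) Z)"
    using Gam_nat[OF H_two H_Z H_V2 H_Z, of cup "1\<^sub>m 2"] cup_hom hom_id[OF V_wrep]
    by (simp add: uq_tensor_unit[of v] V3_def[symmetric])
  moreover have "eqv V V3 (Gam (V2, dg) Z * u1) ((s \<cdot>\<^sub>m (R1 * R2)) * u1)"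
    using h u_homs(1) unfolding s_def by (intro eqv_comp[of V V3 V3] eqv_refl) auto
  ultimately have "eqv V V3 ((s \<cdot>\<^sub>m (R1 * R2)) * u1) (u2 * (t \<cdot>\<^sub>m 1\<^sub>m 2))"
    using eqv_trans[OF V_wrep V3_wrep] eqv_sym[OF V_wrep V3_wrep] unfolding t by blast
  moreover have "(s \<cdot>\<^sub>m (R1 * R2)) * u1 = s \<cdot>\<^sub>m (R1 * (R2 * lc 1 0))"
    by (simp add: smult_mult_dim mult_assoc_dim lc_u)
  moreover have "u2 * (t \<cdot>\<^sub>m 1\<^sub>m 2) = lc 0 t" by (simp add: mult_scalars) (simp add: lc_u lc_smult)
  ultimately have "eqv V V3 (lc (s * (ra * ra + rb * (ra * d + rb))) (s * (ra * rb))) (lc 0 t)"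
    by (simp add: R_lc lc_smult)
  from lc_eqv(1)[OF this] have "s * (ra * ra + ra * rb * d + rb * rb) = 0" by (simp add: algebra_simps)
  with s show ?thesis by simp
qed

lemma rb_nz: "rb \<noteq> 0" and ra_nz: "ra \<noteq> 0"
proof -
  have *: "ra = 0 \<and> rb = 0" if "ra = 0 \<or> rb = 0" using kauffman_relation that by auto
  have False if "ra = 0" "rb = 0"
  proof -
    have R0: "Gam Z Z = 0\<^sub>m 4 4" unfolding R_eq that by (intro eq_matI) auto
    obtain g where g: "g \<in> uq_hom V2 V2" "eqv V2 V2 (g * Gam Z Z) (1\<^sub>m 4)"
      using Gam_inv[OF H_Z H_Z] by (auto simp: V2_def)
    have "g * Gam Z Z = 0\<^sub>m 4 4" unfolding R0 using uq_homD(1,2)[OF g(1)] by (intro right_mult_zero_mat) (auto simp: V2_simps intro: carrier_matI)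
    then have "eqv V2 V2 (0\<^sub>m 4 4) (1\<^sub>m 4)" using g by simp
    from eqv_trace[OF V2_wrep this] have "mtr (rep_K V2 * 0\<^sub>m 4 4) = mtr (rep_K V2 * 1\<^sub>m 4)" .
    moreover have "rep_K V2 * 0\<^sub>m 4 4 = 0\<^sub>m 4 4" by (intro right_mult_zero_mat) (auto simp: V2_simps intro: carrier_matI)
    moreover have "rep_K V2 * 1\<^sub>m 4 = kron (rep_K V) (rep_K V)"
    proof -
      have "rep_K V2 * 1\<^sub>m 4 = rep_K V2" by (rule mult_one_dim) (simp add: V2_simps)
      also have "\<dots> = kron (rep_K V) (rep_K V)" unfolding V2_def by (simp only: rep_tensor_simps)
      finally show ?thesis .
    qed
    moreover have "mtr (0\<^sub>m 4 4 :: 'k mat) = 0" by (simp add: mtr_def)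
    ultimately have "mtr (kron (rep_K V) (rep_K V)) = 0" by (simp only:)
    moreover have "mtr (kron (rep_K V) (rep_K V)) = mtr (rep_K V) * mtr (rep_K V)" by (rule mtr_kron) auto
    ultimately show False using trV by (metis mult_eq_0_iff)
  qed
  then show "rb \<noteq> 0" "ra \<noteq> 0" using * by metis+
qed

definition chi where "chi = ra * ra * (rb * rb)"

definition L where "L = R2 * (R1 * (R1 * R2))"

lemma L_dim [simp]: "dim_row L = 8" "dim_col L = 8" by (simp_all add: L_def)

lemma M_V2_Z: "eqv V3 V3 (M (V2, dg) Z) L"
proof -
  have w3: "uq_tensor V (uq_tensor V V) = V3" by (simp add: V3_def V2_def)
  have "eqv V3 V3 (M (tn Z Z) Z) (R2 * (kron (M Z Z) (1\<^sub>m 2) * R2))"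
    using M_tensL[OF H_Z H_Z H_Z] by (simp add: w3)
  also have "kron (M Z Z) (1\<^sub>m 2) * R2 = R1 * (R1 * R2)"
  proof -
    have "kron (M Z Z) (1\<^sub>m 2) = R1 * R1" by (simp add: M_def kron_mult one_mult_dim)
    then show ?thesis by (simp add: mult_assoc_dim)
  qed
  finally show ?thesis by (simp add: L_def ZZ)
qed

lemma L_lc: "L * lc 1 0 = lc chi 0" "L * lc 0 1 = lc (chi * d) (- chi)"
proof -
  have LL: "L * lc p q = R2 * (R1 * (R1 * (R2 * lc p q)))" for p q by (simp add: L_def mult_assoc_dim)
  have "R2 * lc 1 0 = lc ra rb" by (simp add: R_lc)
  moreover have "R1 * lc ra rb = lc 0 (ra * rb)"
    using kauffman_relation by (simp add: R_lc algebra_simps)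
  moreover have "R1 * lc 0 (ra * rb) = lc (ra * rb * rb) (ra * ra * rb)"
    by (simp add: R_lc mult_ac)
  moreover have "R2 * lc (ra * rb * rb) (ra * ra * rb) = lc chi 0"
  proof -
    have "ra * (ra * ra * rb) + rb * (ra * rb * rb + ra * ra * rb * d) = ra * rb * (ra * ra + ra * rb * d + rb * rb)"
      by (simp add: algebra_simps)
    then have "ra * (ra * ra * rb) + rb * (ra * rb * rb + ra * ra * rb * d) = 0" by (simp only: kauffman_relation mult_zero_right)
    then show ?thesis by (simp add: R_lc chi_def mult_ac)
  qed
  ultimately show "L * lc 1 0 = lc chi 0" by (simp only: LL)
  have "R2 * lc 0 1 = lc 0 (ra + rb * d)" by (simp add: R_lc)
  moreover have "R1 * lc 0 (ra + rb * d) = lc (rb * (ra + rb * d)) (- (rb * rb))"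
  proof -
    have "ra * (ra + rb * d) = - (rb * rb)" using kauffman_relation by (simp add: algebra_simps eq_neg_iff_add_eq_0)
    then show ?thesis by (simp add: R_lc)
  qed
  moreover have "R1 * lc (rb * (ra + rb * d)) (- (rb * rb)) = lc (ra * rb * rb * d) (- (ra * rb * rb))"
  proof -
    have "ra * (rb * (ra + rb * d)) + rb * (rb * (ra + rb * d) * d + - (rb * rb)) = ra * rb * rb * d"
    proof -
      have "ra * (rb * (ra + rb * d)) + rb * (rb * (ra + rb * d) * d + - (rb * rb))
        = rb * (ra * ra + ra * rb * d + rb * rb) + ra * rb * rb * d + rb * rb * rb * (d * d - 2)"
        by (simp add: algebra_simps)
      then show ?thesis by (simp add: kauffman_relation d2)
    qed
    then show ?thesis by (simp add: R_lc mult_ac)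
  qed
  moreover have "R2 * lc (ra * rb * rb * d) (- (ra * rb * rb)) = lc (chi * d) (- chi)"
    by (simp add: R_lc chi_def mult_ac)
  ultimately show "L * lc 0 1 = lc (chi * d) (- chi)" by (simp only: LL)
qed

text \<open>\<open>cup\<close> embeds \<open>(\<one>, 2)\<close> into \<open>Z \<otimes> Z\<close>, and \<open>u1\<close> is an eigenvector of the monodromy \<open>L\<close> there.\<close>

lemma M_two_Z: "Msc (uq_trivial, dg) Z chi"
proof -
  obtain s where s: "M (uq_trivial, dg) Z = s \<cdot>\<^sub>m 1\<^sub>m 2"
    using M_hom[OF H_two H_Z] End_V by (auto simp: uq_tensor_unit[of v])
  have V3': "uq_tensor V2 V = V3" unfolding V3_def V2_def by (simp add: uq_tensor_assoc[of v])
  have "eqv V V3 (M (V2, dg) Z * u1) (u1 * M (uq_trivial, dg) Z)"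
    using M_nat[OF H_two H_Z H_V2 H_Z, of cup "1\<^sub>m 2"] cup_hom hom_id[OF V_wrep]
    by (simp add: uq_tensor_unit[of v] V3')
  moreover have "eqv V V3 (M (V2, dg) Z * u1) (L * u1)"
    using M_V2_Z u_homs(1) by (intro eqv_comp[of V V3 V3] eqv_refl) auto
  ultimately have "eqv V V3 (L * u1) (u1 * M (uq_trivial, dg) Z)"
    using eqv_trans[OF V_wrep V3_wrep] eqv_sym[OF V_wrep V3_wrep] by blast
  moreover have "u1 * (s \<cdot>\<^sub>m 1\<^sub>m 2) = lc s 0" by (simp add: mult_scalars) (simp add: lc_u lc_smult)
  ultimately have "eqv V V3 (lc chi 0) (lc s 0)" by (simp add: s lc_u(1) L_lc)
  from lc_eqv(1)[OF this] have "chi = s" .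
  then show ?thesis using s M_hom[OF H_two H_Z] by (auto simp: Msc_def uq_tensor_unit[of v])
qed

text \<open>Up to negligible morphisms the inclusion of \<open>D \<otimes> V\<close> into \<open>V \<otimes> V \<otimes> V\<close> factors through the vector
  \<open>d u2 - u1\<close>, the other eigenvector of \<open>L\<close>.\<close>

lemma M_D_Z: "Msc (D, dg) Z (- chi)"
proof -
  let ?j = "kron iD (1\<^sub>m 2)" and ?r = "kron rD (1\<^sub>m 2)"
  let ?A = "uq_tensor D V"
  have V3': "uq_tensor V2 V = V3" unfolding V3_def V2_def by (simp add: uq_tensor_assoc[of v])
  have w: "wrep v ?A" by simp
  have j: "?j \<in> uq_hom ?A V3" "?r \<in> uq_hom V3 ?A"
    using hkron[OF D_wrep V2_wrep V_wrep V_wrep iD_hom] hkron[OF V2_wrep D_wrep V_wrep V_wrep rD_hom] hom_id[OF V_wrep] by (auto simp: V3')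
  have rj: "?r * ?j = 1\<^sub>m 6" by (simp add: kron_mult rD_iD one_mult_dim kron_one_one)
  have cj: "c1 * ?j = 0\<^sub>m 2 6" by (simp add: kron_mult cap_iD)
  define e where "e = c2 * ?j"
  have e: "e \<in> uq_hom ?A V" unfolding e_def by (rule hcomp[OF w V3_wrep V_wrep j(1) u_homs(4)])
  have de [simp]: "dim_row e = 2" "dim_col e = 6" by (simp_all add: e_def)
  have aj: "a1 * ?j = (-1) \<cdot>\<^sub>m e" "a2 * ?j = d \<cdot>\<^sub>m e"
  proof -
    have "a1 * ?j = d \<cdot>\<^sub>m (c1 * ?j) + (-1) \<cdot>\<^sub>m e" "a2 * ?j = d \<cdot>\<^sub>m e + (-1) \<cdot>\<^sub>m (c1 * ?j)"
      by (simp_all add: a1_def a2_def add_mult_dim smult_mult_dim e_def)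
    then show "a1 * ?j = (-1) \<cdot>\<^sub>m e" "a2 * ?j = d \<cdot>\<^sub>m e" unfolding cj by (auto intro!: eq_matI)
  qed
  have "eqv ?A V3 (1\<^sub>m 8 * ?j) ((u1 * a1 + u2 * a2) * ?j)"
    using V3_eqv j(1) by (intro eqv_comp[of ?A V3 V3] eqv_refl) auto
  moreover have "(u1 * a1 + u2 * a2) * ?j = lc (-1) d * e"
    by (simp add: add_mult_dim mult_assoc_dim aj mult_smult_dim lc_def smult_mult_dim)
  ultimately have je: "eqv ?A V3 ?j (lc (-1) d * e)" by (simp add: one_mult_dim)
  have A: "eqv ?A V3 (M (V2, dg) Z * ?j) (?j * M (D, dg) Z)"
    using M_nat[OF H_D H_Z H_V2 H_Z, of iD "1\<^sub>m 2"] iD_hom hom_id[OF V_wrep] by (simp add: V3')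
  have B: "eqv ?A V3 (M (V2, dg) Z * ?j) (L * (lc (-1) d * e))"
    by (rule eqv_comp[OF w V3_wrep V3_wrep je M_V2_Z])
  have C: "L * (lc (-1) d * e) = (- chi) \<cdot>\<^sub>m (lc (-1) d * e)"
  proof -
    have "lc (-1) d = (-1) \<cdot>\<^sub>m lc 1 0 + d \<cdot>\<^sub>m lc 0 1" by (simp add: lc_smult lc_add)
    then have "L * lc (-1) d = (-1) \<cdot>\<^sub>m (L * lc 1 0) + d \<cdot>\<^sub>m (L * lc 0 1)" by (simp add: mult_add_dim mult_smult_dim)
    also have "\<dots> = lc (- chi + d * (chi * d)) (- (d * chi))" by (simp add: L_lc lc_smult lc_add)
    also have "- chi + d * (chi * d) = chi"
    proof -
      have "d * (chi * d) = chi * (d * d)" by (simp only: mult_ac)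
      then show ?thesis by (simp add: d2)
    qed
    finally have "L * lc (-1) d = (- chi) \<cdot>\<^sub>m lc (-1) d" by (simp add: lc_smult mult.commute)
    then show ?thesis by (simp add: mult_assoc_dim[symmetric] smult_mult_dim)
  qed
  have E: "eqv ?A V3 ((- chi) \<cdot>\<^sub>m ?j) ((- chi) \<cdot>\<^sub>m (lc (-1) d * e))" by (rule eqv_smult[OF w V3_wrep je])
  have "eqv ?A V3 (?j * M (D, dg) Z) ((- chi) \<cdot>\<^sub>m ?j)"
    by (rule eqv_trans[OF w V3_wrep eqv_sym[OF w V3_wrep A] eqv_trans[OF w V3_wrep B[unfolded C] eqv_sym[OF w V3_wrep E]]])
  then have "eqv ?A ?A (?r * (?j * M (D, dg) Z)) (?r * ((- chi) \<cdot>\<^sub>m ?j))"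
    using j(2) by (intro eqv_comp[of ?A V3 ?A] eqv_refl) auto
  moreover have "?r * (?j * M (D, dg) Z) = M (D, dg) Z"
    using M_dim[OF H_D H_Z] by (simp add: mult_assoc_dim[symmetric] rj one_mult_dim)
  moreover have "?r * ((- chi) \<cdot>\<^sub>m ?j) = (- chi) \<cdot>\<^sub>m 1\<^sub>m 6" by (simp add: mult_smult_dim rj)
  ultimately show ?thesis by (simp add: Msc_def)
qed

text \<open>On the two summands of \<open>Z \<otimes> Z\<close> the braiding is \<open>ra + rb * d\<close> and \<open>ra\<close>.  If both squares were \<open>1\<close>, the
  quadratic relation would give \<open>ra * ra = -1\<close>.\<close>

lemma Z_not_central: "\<not> Msc Z Z 1"
proof
  assume "Msc Z Z 1"
  then have m: "eqv V2 V2 (M Z Z) (1\<^sub>m 4)" by (simp add: Msc_def V2_def smult_one)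
  have tD: "mtr (rep_K D) \<noteq> 0" using traces by simp
  have dM: "dim_row (M Z Z) = 4" "dim_col (M Z Z) = 4" by (simp_all add: M_def)
  have "eqv uq_trivial V2 (M Z Z * cup) (1\<^sub>m 4 * cup)"
    using m cup_hom by (intro eqv_comp[of _ V2 V2] eqv_refl) auto
  then have "eqv uq_trivial uq_trivial (cap * (M Z Z * cup)) (cap * (1\<^sub>m 4 * cup))"
    using cap_hom by (intro eqv_comp[of _ V2 uq_trivial] eqv_refl) auto
  moreover have Rc: "Gam Z Z * cup = (ra + rb * d) \<cdot>\<^sub>m cup"
  proof -
    have "Gam Z Z * cup = ra \<cdot>\<^sub>m cup + rb \<cdot>\<^sub>m (d \<cdot>\<^sub>m cup)"
      unfolding R_eq by (simp add: add_mult_dim smult_mult_dim one_mult_dim mult_assoc_dim cap_cup mult_scalars)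
    then show ?thesis by (simp) (intro eq_matI; simp add: algebra_simps)
  qed
  have "cap * (M Z Z * cup) = ((ra + rb * d) * (ra + rb * d) * d) \<cdot>\<^sub>m 1\<^sub>m 1"
    by (simp add: M_def mult_assoc_dim Rc mult_smult_dim cap_cup smult_smult)
  moreover have "cap * (1\<^sub>m 4 * cup) = d \<cdot>\<^sub>m 1\<^sub>m 1" by (simp add: one_mult_dim cap_cup)
  ultimately have "(ra + rb * d) * (ra + rb * d) * d = d"
    using eqv_scalar_eq[OF wrep_trivial, of "(ra + rb * d) * (ra + rb * d) * d" d] by (simp add: mtr_def)
  then have 1: "(ra + rb * d) * (ra + rb * d) = 1" using d_nz by simp
  have "eqv D V2 (M Z Z * iD) (1\<^sub>m 4 * iD)"
    using m iD_hom by (intro eqv_comp[of _ V2 V2] eqv_refl) auto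
  then have "eqv D D (rD * (M Z Z * iD)) (rD * (1\<^sub>m 4 * iD))"
    using rD_hom by (intro eqv_comp[of _ V2 D] eqv_refl) auto
  moreover have Ri: "Gam Z Z * iD = ra \<cdot>\<^sub>m iD"
  proof -
    have "Gam Z Z * iD = ra \<cdot>\<^sub>m iD + rb \<cdot>\<^sub>m (cup * 0\<^sub>m 1 3)"
      unfolding R_eq by (simp add: add_mult_dim smult_mult_dim one_mult_dim mult_assoc_dim cap_iD)
    moreover have "cup * 0\<^sub>m 1 3 = 0\<^sub>m 4 3" by (intro right_mult_zero_mat) (auto intro: carrier_matI)
    ultimately show ?thesis by (auto intro!: eq_matI)
  qed
  have "rD * (M Z Z * iD) = (ra * ra) \<cdot>\<^sub>m 1\<^sub>m 3"
    by (simp add: M_def mult_assoc_dim Ri mult_smult_dim rD_iD smult_smult)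
  moreover have "rD * (1\<^sub>m 4 * iD) = 1 \<cdot>\<^sub>m 1\<^sub>m 3" by (simp add: one_mult_dim rD_iD smult_one)
  ultimately have 2: "ra * ra = 1" using eqv_scalar_eq[OF D_wrep _ tD, of "ra * ra" 1] by simp
  have "1 = 2 * (ra * ra + ra * rb * d + rb * rb) + rb * rb * (d * d - 2) - ra * ra"
    unfolding 1[symmetric] by (simp add: algebra_simps)
  then have "- (ra * ra) = 1" by (simp add: kauffman_relation d2)
  then show False using 2 by simp
qed

lemma Msc_unique:
  assumes m: "Msc x y s" "Msc x y s'" and w: "wrep v (uq_tensor (fst x) (fst y))"
    and t: "mtr (rep_K (uq_tensor (fst x) (fst y))) \<noteq> 0"
  shows "s = s'"
proof -
  let ?X = "uq_tensor (fst x) (fst y)"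
  note m = m[unfolded Msc_def rep_tensor_simps(1)[symmetric]]
  have "eqv ?X ?X (s \<cdot>\<^sub>m 1\<^sub>m (rep_dim ?X)) (s' \<cdot>\<^sub>m 1\<^sub>m (rep_dim ?X))"
    by (rule eqv_trans[OF w w eqv_sym[OF w w m(1)] m(2)])
  then show ?thesis by (rule eqv_scalar_eq[OF w _ t])
qed

text \<open>For \<open>n = 2\<close> the object \<open>(\<one>, 2)\<close> is the unit itself, so \<open>chi = 1\<close>.\<close>

lemma D_not_central: "n = 2 \<Longrightarrow> \<not> Msc (D, 0) Z 1"
proof
  assume n: "n = 2" and c: "Msc (D, 0) Z 1"
  have dg: "dg = 0" unfolding dg_def by (simp add: n)
  have t: "mtr (rep_K (uq_tensor D V)) \<noteq> 0" using traces d_nz by (simp add: mtr_kron)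
  have tV: "mtr (rep_K (uq_tensor uq_trivial V)) \<noteq> 0" using trV by (simp add: uq_tensor_unit[of v])
  have "chi = 1"
    by (rule Msc_unique[OF M_two_Z[unfolded dg] Msc_unit[OF H_Z]]) (use tV in simp_all)
  moreover have "- chi = 1"
    by (rule Msc_unique[OF M_D_Z[unfolded dg] c]) (use t in simp_all)
  ultimately show False by simp
qed

text \<open>The monodromies of \<open>(\<one>, n/2)\<close> and \<open>(\<delta>, n/2)\<close> with \<open>Z\<close> are a sign \<open>s\<close> and its negative: the former object
  squares to the unit, and the latter is \<open>(\<one>, n/2 - 2) \<otimes> (\<delta>, 2)\<close>.\<close>

lemma transparent_exists:
  assumes n: "4 dvd n"
  obtains g where "H g" "snd g \<noteq> 0" "\<And>y. H y \<Longrightarrow> Msc g y 1" "mtr (rep_K (fst g)) \<noteq> 0"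
proof -
  define h where "h = n div 2"
  have n4: "n \<ge> 4" using n n_pos dvd_imp_le by blast
  have dgn: "dg = 2" using n4 by (simp add: dg_def)
  have hev: "even h" using n by (auto simp: h_def)
  have h: "h \<ge> 2" "h < n" "h + h = n" using n4 n_even by (auto simp: h_def)
  let ?one = "\<lambda>j. (uq_trivial, j) :: 'k uq_rep \<times> nat"
  have HH: "H (?one (2 * m mod n))" for m
  proof (induction m)
    case (Suc m)
    have "H (tn (?one dg) (?one (2 * m mod n)))" using H_two Suc by simp
    then show ?case by (simp add: tn_def dgn mod_simps)
  qed simp
  have Heven: "H (?one j)" if "even j" "j < n" for j
    using HH[of "j div 2"] that by simp
  have sc: "\<exists>s. Msc (?one j) Z s" if "H (?one j)" for j
  proof -
    have "M (?one j) Z \<in> uq_hom V V" using M_hom[OF that H_Z] by (simp add: uq_tensor_unit[of v])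
    then obtain s where s: "M (?one j) Z = s \<cdot>\<^sub>m 1\<^sub>m 2" using End_V by blast
    have "Msc (?one j) Z s"
      using eqv_refl[OF _ _ M_hom[OF that H_Z]] s unfolding Msc_def by simp
    then show ?thesis by blast
  qed
  have tV: "mtr (rep_K (uq_tensor uq_trivial V)) \<noteq> 0" using trV by (simp add: uq_tensor_unit[of v])
  have uniq: "s = t" if "Msc (?one j) Z s" "Msc (?one j) Z t" for j s t
    by (rule Msc_unique[OF that]) (use tV in simp_all)
  have H1: "H (?one h)" "H (?one (h - 2))" using Heven hev h by auto
  obtain s where s: "Msc (?one h) Z s" using sc[OF H1(1)] by blast
  obtain t where t: "Msc (?one (h - 2)) Z t" using sc[OF H1(2)] by blast
  have "tn (?one h) (?one h) = ?one 0" using h by (simp add: tn_def)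
  then have "Msc (?one 0) Z (s * s)" using Msc_tensL[OF H1(1,1) H_Z s s] by simp
  then have ss: "s * s = 1" using uniq Msc_unit[OF H_Z] by blast
  have "tn (?one (h - 2)) (?one dg) = ?one h" using h by (simp add: tn_def dgn)
  then have "Msc (?one h) Z (t * chi)" using Msc_tensL[OF H1(2) H_two H_Z t M_two_Z] by simp
  then have st: "s = t * chi" using uniq s by blast
  have D: "tn (?one (h - 2)) (D, dg) = (D, h)" using h by (simp add: tn_def dgn uq_tensor_unit[of v])
  then have HD: "H (D, h)" and MD: "Msc (D, h) Z (t * - chi)"
    using H_tn[OF H1(2) H_D] Msc_tensL[OF H1(2) H_D H_Z t M_D_Z] by simp_all
  show ?thesis
  proof (cases "s = 1")
    case True
    show ?thesis
      using that[OF H1(1)] h central_all[OF H1(1)] s True by (simp add: mtr_def)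
  next
    case False
    then have "s = -1" using ss by (metis square_eq_1_iff)
    then have "t * - chi = 1" using st by simp
    then show ?thesis using that[OF HD] h central_all[OF HD] MD traces by simp
  qed
qed

end

(* The size of 1-by-1 matrices stays in the form 1 instead of Suc 0. *)
declare One_nat_def [simp del]

context graded_ising
begin

section \<open>Multiples of the unit object\<close>

text \<open>\<open>U\<close> and \<open>UF\<close> are the functor from \<open>Vec_cat\<close> on objects and on morphisms.\<close>

definition U :: "nat \<Rightarrow> ('k uq_rep \<times> nat) list" where "U m = replicate m (uq_trivial, 0)"

definition UF :: "nat \<Rightarrow> nat \<Rightarrow> 'k mat \<Rightarrow> 'k mat set mat" where
  "UF m k A = gm (U m) (U k) (\<lambda>r s. A $$ (r, s) \<cdot>\<^sub>m 1\<^sub>m 1)"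

lemma length_U [simp]: "length (U m) = m" by (simp add: U_def)
lemma U_nth [simp]: "i < m \<Longrightarrow> U m ! i = (uq_trivial, 0)" by (simp add: U_def)
lemma U_1: "U 1 = unt" by (simp add: U_def One_nat_def)
lemma GO_U [simp]: "GO (U m)" by (auto simp: U_def GO_def)
lemma ten_U [simp]: "ten (U m) (U k) = U (m * k)"
  by (rule nth_equalityI) (auto simp: ten_nth div_less_mult mod_less_mult uq_tensor_unit[of v])

lemma scalar_hom: "(a :: 'k) \<cdot>\<^sub>m 1\<^sub>m 1 \<in> uq_hom uq_trivial uq_trivial"
  using hsm[OF wrep_trivial wrep_trivial hom_id[OF wrep_trivial]] by simp

lemma ghom_UF: "ghom (U m) (U k) (\<lambda>r s. f r s \<cdot>\<^sub>m 1\<^sub>m 1)"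
  by (simp add: ghom_def scalar_hom)

lemma UF_hom: "UF m k A \<in> cat_hom (G u) (U m) (U k)"
  unfolding UF_def G_hom[OF GO_U GO_U] by (rule exI, rule conjI[OF ghom_UF refl])

lemma UF_id: "UF m m (1\<^sub>m m) = cat_id (G u) (U m)"
  unfolding UF_def gm_id by (intro gm_cong) (auto simp: gid_def intro!: eq_matI)

lemma scalar_mult: "(a \<cdot>\<^sub>m 1\<^sub>m 1) * (b \<cdot>\<^sub>m 1\<^sub>m 1) = (a * b) \<cdot>\<^sub>m (1\<^sub>m 1 :: 'k mat)"
  by (simp add: mult_scalars smult_smult mult.commute)

lemma msum_scalar: "msum 1 1 S (\<lambda>t. f t \<cdot>\<^sub>m 1\<^sub>m 1) = (\<Sum>t\<in>S. f t) \<cdot>\<^sub>m (1\<^sub>m 1 :: 'k mat)"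
  by (intro eq_matI) auto

lemma UF_comp:
  assumes "A \<in> carrier_mat k m" "B \<in> carrier_mat l k"
  shows "cat_comp (G u) (U m) (U k) (U l) (UF k l B) (UF m k A) = UF m l (B * A)"
proof -
  have "cat_comp (G u) (U m) (U k) (U l) (UF k l B) (UF m k A) = gm (U m) (U l) (gcomp (U m) (U k) (U l) (\<lambda>r s. B $$ (r, s) \<cdot>\<^sub>m 1\<^sub>m 1) (\<lambda>r s. A $$ (r, s) \<cdot>\<^sub>m 1\<^sub>m 1))"
    unfolding UF_def by (rule gm_comp) (simp_all add: ghom_UF)
  also have "\<dots> = UF m l (B * A)"
    unfolding UF_def
  proof (rule gm_cong)
    fix r s assume "r < length (U l)" "s < length (U m)"
    then have rs: "r < l" "s < m" by auto
    have "(B * A) $$ (r, s) = (\<Sum>t<k. B $$ (r, t) * A $$ (t, s))"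
      using assms rs mult_index_sum[of r B s A] by auto
    then show "gcomp (U m) (U k) (U l) (\<lambda>r s. B $$ (r, s) \<cdot>\<^sub>m 1\<^sub>m 1) (\<lambda>r s. A $$ (r, s) \<cdot>\<^sub>m 1\<^sub>m 1) r s = (B * A) $$ (r, s) \<cdot>\<^sub>m 1\<^sub>m 1"
      using rs by (simp add: gcomp_def scalar_mult msum_scalar del: index_mult_mat)
  qed
  finally show ?thesis .
qed

lemma UF_add:
  assumes "A \<in> carrier_mat k m" "B \<in> carrier_mat k m"
  shows "cat_add (G u) (U m) (U k) (UF m k A) (UF m k B) = UF m k (A + B)"
  unfolding UF_def by (subst gm_add) (use assms in \<open>auto simp: ghom_UF add_smult_distrib_right_mat[of _ 1 1] intro!: gm_cong eq_matI distrib_right\<close>)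

lemma UF_scale:
  assumes "A \<in> carrier_mat k m"
  shows "cat_scale (G u) (U m) (U k) a (UF m k A) = UF m k (a \<cdot>\<^sub>m A)"
  unfolding UF_def by (subst gm_scale) (use assms in \<open>auto simp: ghom_UF smult_smult intro!: gm_cong\<close>)

lemma UF_zero: "UF m k (0\<^sub>m k m) = cat_zero (G u) (U m) (U k)"
  by (rule eq_matI) (auto simp: UF_def gm_index G_def graded_cat_def intro!: arg_cong[of _ _ "cls uq_trivial uq_trivial"] eq_matI)

lemma UF_ten:
  assumes "A \<in> carrier_mat m' m" "B \<in> carrier_mat k' k"
  shows "ten_mor (G u) (U m) (U m') (U k) (U k') (UF m m' A) (UF k k' B) = UF (m * k) (m' * k') (kron A B)"
proof -
  have "ten_mor (G u) (U m) (U m') (U k) (U k') (UF m m' A) (UF k k' B)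
    = gm (U (m * k)) (U (m' * k')) (gten (U k) (U k') (\<lambda>r s. A $$ (r, s) \<cdot>\<^sub>m 1\<^sub>m 1) (\<lambda>r s. B $$ (r, s) \<cdot>\<^sub>m 1\<^sub>m 1))"
    unfolding UF_def using gm_ten[OF GO_U GO_U GO_U GO_U ghom_UF ghom_UF] by simp
  also have "\<dots> = UF (m * k) (m' * k') (kron A B)"
    unfolding UF_def
    by (rule gm_cong) (use assms in \<open>auto simp: gten_def kron_smult_left kron_smult_right kron_one_one smult_smult kron_def\<close>)
  finally show ?thesis .
qed

lemma triv_eqv_iff: "eqv uq_trivial uq_trivial (a \<cdot>\<^sub>m 1\<^sub>m 1) (b \<cdot>\<^sub>m 1\<^sub>m 1) \<longleftrightarrow> a = b"
proof
  assume "eqv uq_trivial uq_trivial (a \<cdot>\<^sub>m 1\<^sub>m 1) (b \<cdot>\<^sub>m 1\<^sub>m 1)"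
  then show "a = b" using eqv_scalar_eq[OF wrep_trivial, of a b] by (simp add: mtr_def)
qed (auto intro!: eqv_refl scalar_hom)

lemma UF_bij: "bij_betw (UF m k) (carrier_mat k m) (cat_hom (G u) (U m) (U k))"
proof (intro bij_betwI')
  fix A B :: "'k mat" assume AB: "A \<in> carrier_mat k m" "B \<in> carrier_mat k m"
  have "UF m k A = UF m k B \<longleftrightarrow> (\<forall>r<k. \<forall>s<m. A $$ (r, s) = B $$ (r, s))"
    unfolding UF_def gm_eq_iff[OF GO_U GO_U ghom_UF ghom_UF] by (simp add: triv_eqv_iff)
  also have "\<dots> \<longleftrightarrow> A = B" using AB by (auto simp: mat_eq_all)
  finally show "UF m k A = UF m k B \<longleftrightarrow> A = B" .
next
  fix M assume "M \<in> cat_hom (G u) (U m) (U k)"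
  then obtain \<phi> where \<phi>: "ghom (U m) (U k) \<phi>" "M = gm (U m) (U k) \<phi>" using G_hom[of "U m" "U k"] by auto
  have "\<phi> r s = \<phi> r s $$ (0, 0) \<cdot>\<^sub>m 1\<^sub>m 1" if "r < k" "s < m" for r s
    using End_triv[of "\<phi> r s"] ghomD[OF \<phi>(1), of r s] that by simp
  then have "M = UF m k (mat k m (\<lambda>(r, s). \<phi> r s $$ (0, 0)))"
    unfolding \<phi>(2) UF_def by (intro gm_cong) simp
  then show "\<exists>A\<in>carrier_mat k m. M = UF m k A" by (intro bexI) auto
qed (rule UF_hom)

text \<open>Direct sums in the generated subcategory come from biproduct diagrams, here images of matrix identities.\<close>

lemma U_GN: "U m \<in> GN"
proof (induction m)
  case 0
  show ?case
  proof (rule GN_retract[OF GN_unit])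
    have "cat_comp G1 (U 0) (U 1) (U 0) (UF 1 0 (0\<^sub>m 0 1)) (UF 0 1 (0\<^sub>m 1 0)) = UF 0 0 (0\<^sub>m 0 1 * 0\<^sub>m 1 0)"
      by (rule UF_comp) auto
    also have "\<dots> = cat_id G1 (U 0)" unfolding UF_id[symmetric] by (rule arg_cong[of _ _ "UF 0 0"]) (auto intro!: eq_matI)
    finally show "cat_comp G1 (U 0) unt (U 0) (UF 1 0 (0\<^sub>m 0 1)) (UF 0 1 (0\<^sub>m 1 0)) = cat_id G1 (U 0)"
      by (simp add: U_1)
  qed (use UF_hom[of 0 1] UF_hom[of 1 0] in \<open>simp_all add: U_1\<close>)
next
  case (Suc m)
  let ?i = "mat (Suc m) 1 (\<lambda>(r, s). if r = 0 then 1 else 0) :: 'k mat"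
  let ?j = "mat (Suc m) m (\<lambda>(r, s). if r = Suc s then 1 else 0) :: 'k mat"
  let ?p = "mat 1 (Suc m) (\<lambda>(s, r). if r = 0 then 1 else 0) :: 'k mat"
  let ?r = "mat m (Suc m) (\<lambda>(s, r). if r = Suc s then 1 else 0) :: 'k mat"
  have e: "?p * ?i = 1\<^sub>m 1" "?r * ?j = 1\<^sub>m m" "?p * ?j = 0\<^sub>m 1 m" "?r * ?i = 0\<^sub>m m 1"
    by (intro eq_matI; simp add: mult_index_sum if_distrib[of "\<lambda>x. x * _"] if_distrib[of "\<lambda>x. _ * x"] del: index_mult_mat(1) cong: if_cong)+
  have f: "?i * ?p + ?j * ?r = 1\<^sub>m (Suc m)"
  proof (rule eq_matI)
    fix a b assume "a < dim_row (1\<^sub>m (Suc m) :: 'k mat)" "b < dim_col (1\<^sub>m (Suc m) :: 'k mat)"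
    then show "(?i * ?p + ?j * ?r) $$ (a, b) = 1\<^sub>m (Suc m) $$ (a, b)"
      by (cases a; cases b) (auto simp: mult_index_sum if_distrib[of "\<lambda>x. x * _"] if_distrib[of "\<lambda>x. _ * x"] simp del: index_mult_mat(1) cong: if_cong)
  qed auto
  have g: "?i * ?p \<in> carrier_mat (Suc m) (Suc m)" "?j * ?r \<in> carrier_mat (Suc m) (Suc m)" by (auto intro: carrier_matI)
  have "biproduct_of G1 (U 1) (U m) (U (Suc m))"
    unfolding biproduct_of_def
    apply (rule bexI[of _ "UF 1 (Suc m) ?i"])
     apply (rule bexI[of _ "UF m (Suc m) ?j"])
      apply (rule bexI[of _ "UF (Suc m) 1 ?p"])
       apply (rule bexI[of _ "UF (Suc m) m ?r"])
    by (simp_all add: UF_comp UF_add[OF g, unfolded f] e UF_id[symmetric] UF_zero[symmetric] UF_hom)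
  then show ?case
    using gen_sum[of "U 1" G1 "[(V, 1)]" "U m" "U (Suc m)"] Suc GN_unit by (simp add: GN_def G_obj U_1)
qed

lemma assoc_U:
  assumes "u 0 0 0 = 1"
  shows "ten_assoc (G u) (U l) (U m) (U k) = cat_id (G u') (U (l * m * k))"
proof -
  have "ten_assoc (G u) (U l) (U m) (U k) = ten_assoc (G (\<lambda>_ _ _. 1)) (U l) (U m) (U k)"
  proof -
    have "i div k mod m < m" "i mod k < k" if "i < l * m * k" for i
      using that by (auto intro!: mod_less_divisor intro: gr0I)
    then show ?thesis using assms
      by (auto simp: G_def graded_cat_def diag_mor_def Let_def mat_eq_all ten_nth div_less_mult mod_less_mult simp flip: mult.assoc)
  qed
  also have "\<dots> = cat_id (G u') (U (l * m * k))" by (subst G_assoc_1) auto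
  finally show ?thesis .
qed

end

section \<open>Splitting off multiples of the unit object\<close>

text \<open>A non-zero row of \<open>1 - P\<close> annihilates \<open>P\<close>, so some row of \<open>P\<close> is a combination of the others.  Deleting it
  leaves \<open>B\<close>, and \<open>A\<close> restores it.\<close>

lemma singular_idempotent_factors:
  fixes P :: "'a::field mat"
  assumes P: "P \<in> carrier_mat m m" "P * P = P" "P \<noteq> 1\<^sub>m m"
  obtains A B k where "k < m" "A \<in> carrier_mat m k" "B \<in> carrier_mat k m" "A * B = P"
proof -
  let ?Q = "1\<^sub>m m - P"
  have "\<exists>a<m. \<exists>b<m. ?Q $$ (a, b) \<noteq> 0"
  proof (rule ccontr)
    assume "\<not> ?thesis"
    then have "1\<^sub>m m $$ (a, b) = P $$ (a, b)" if "a < m" "b < m" for a b using that P(1) by auto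
    then have "1\<^sub>m m = P" using P(1) by (intro eq_matI) auto
    then show False using P(3) by simp
  qed
  then obtain a b where ab: "a < m" "b < m" "?Q $$ (a, b) \<noteq> 0" by blast
  then obtain k where m: "m = Suc k" by (cases m) auto
  define \<alpha> where "\<alpha> r i = (if r = b then - ?Q $$ (a, i) / ?Q $$ (a, b) else if r = i then 1 else 0)" for r i
  define A where "A = mat m k (\<lambda>(r, s). \<alpha> r (insert_index b s))"
  define B where "B = mat k m (\<lambda>(s, j). P $$ (insert_index b s, j))"
  have "?Q * P = P - P * P" using P(1) by (simp add: minus_mult_distrib_mat[of _ m m])
  then have Q0: "(\<Sum>i<m. ?Q $$ (a, i) * P $$ (i, j)) = 0" if "j < m" for j
    using mult_index_sum[of a ?Q j P] that ab P by auto
  have "A * B = P"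
  proof (rule eq_matI)
    fix r j assume "r < dim_row P" "j < dim_col P"
    then have rj: "r < m" "j < m" using P(1) by auto
    have ran: "insert_index b ` {..<k} = {..<m} - {b}"
      using insert_index_image[of b k] ab m by (simp add: lessThan_atLeast0)
    have "(A * B) $$ (r, j) = (\<Sum>s<k. \<alpha> r (insert_index b s) * P $$ (insert_index b s, j))"
      using rj by (subst mult_index_sum) (auto simp: A_def B_def)
    also have "\<dots> = (\<Sum>i\<in>{..<m} - {b}. \<alpha> r i * P $$ (i, j))"
      unfolding ran[symmetric] by (rule sum.reindex[symmetric, unfolded o_def]) (rule insert_index_inj_on)
    also have "\<dots> = P $$ (r, j)"
    proof (cases "r = b")
      case True
      have "0 = ?Q $$ (a, b) * P $$ (b, j) + (\<Sum>i\<in>{..<m} - {b}. ?Q $$ (a, i) * P $$ (i, j))"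
        using Q0[OF rj(2)] ab(2) by (simp add: sum.remove[of "{..<m}" b])
      then have "(\<Sum>i\<in>{..<m} - {b}. ?Q $$ (a, i) * P $$ (i, j)) = - (?Q $$ (a, b) * P $$ (b, j))"
        by (simp add: eq_neg_iff_add_eq_0 add.commute)
      moreover have "(\<Sum>i\<in>{..<m} - {b}. \<alpha> r i * P $$ (i, j)) = - (\<Sum>i\<in>{..<m} - {b}. ?Q $$ (a, i) * P $$ (i, j)) / ?Q $$ (a, b)"
        by (simp add: \<alpha>_def True sum_divide_distrib sum_negf)
      ultimately show ?thesis using ab(3) True by simp
    next
      case False
      have "(\<Sum>i\<in>{..<m} - {b}. \<alpha> r i * P $$ (i, j)) = (\<Sum>i\<in>{..<m} - {b}. if r = i then P $$ (i, j) else 0)"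
        using False by (intro sum.cong) (auto simp: \<alpha>_def)
      then show ?thesis using False rj by simp
    qed
    finally show "(A * B) $$ (r, j) = P $$ (r, j)" .
  qed (use P(1) in \<open>auto simp: A_def B_def\<close>)
  then show ?thesis using that[of k A B] m by (auto simp: A_def B_def)
qed

context graded_ising
begin

lemma G_cancel_left:
  assumes "GO X" "GO Y" "GO Z" "x \<in> cat_hom (G u) X Y" "y \<in> cat_hom (G u) X Y" "a \<in> cat_hom (G u) Y Z" "b \<in> cat_hom (G u) Z Y"
    "cat_comp (G u) Y Z Y b a = cat_id (G u) Y" "cat_comp (G u) X Y Z a x = cat_comp (G u) X Y Z a y"
  shows "x = y"
  using G_assoc[OF assms(1,2,3,2) assms(4,6,7), of u] G_assoc[OF assms(1,2,3,2) assms(5,6,7), of u] G_id_left[OF assms(1,2,4)] G_id_left[OF assms(1,2,5)] assms(8,9) by metis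

lemma G_cancel_right:
  assumes "GO X" "GO Y" "GO Z" "x \<in> cat_hom (G u) Y Z" "y \<in> cat_hom (G u) Y Z" "a \<in> cat_hom (G u) X Y" "b \<in> cat_hom (G u) Y X"
    "cat_comp (G u) Y X Y a b = cat_id (G u) Y" "cat_comp (G u) X Y Z x a = cat_comp (G u) X Y Z y a"
  shows "x = y"
  using G_assoc[OF assms(2,1,2,3) assms(7,6,4), of u] G_assoc[OF assms(2,1,2,3) assms(7,6,5), of u] G_id_right[OF assms(2,3,4)] G_id_right[OF assms(2,3,5)] assms(8,9) by metis

definition unit_retract :: "nat \<Rightarrow> ('k uq_rep \<times> nat) list \<Rightarrow> bool" where
  "unit_retract m X \<longleftrightarrow> (\<exists>F\<in>cat_hom G1 (U m) X. \<exists>K\<in>cat_hom G1 X (U m). cat_comp G1 X (U m) X F K = cat_id G1 X)"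

text \<open>Take \<open>m\<close> minimal.  The idempotent \<open>K F\<close> on \<open>U m\<close> is a matrix; were it not the identity, it would factor
  through a smaller \<open>U k\<close>, and \<open>X\<close> would be a retract of that.\<close>

lemma unit_retract_iso:
  assumes X: "GO X" and "unit_retract m0 X"
  obtains m F K where "F \<in> cat_hom G1 (U m) X" "K \<in> cat_hom G1 X (U m)"
    "cat_comp G1 X (U m) X F K = cat_id G1 X" "cat_comp G1 (U m) X (U m) K F = cat_id G1 (U m)"
proof -
  define m where "m = (LEAST m. unit_retract m X)"
  have "unit_retract m X" and least: "\<And>k. unit_retract k X \<Longrightarrow> m \<le> k"
    unfolding m_def using assms(2) by (auto intro: LeastI Least_le)
  then obtain F K where F: "F \<in> cat_hom G1 (U m) X" and K: "K \<in> cat_hom G1 X (U m)" and FK: "cat_comp G1 X (U m) X F K = cat_id G1 X"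
    by (auto simp: unit_retract_def)
  let ?E = "cat_comp G1 (U m) X (U m) K F"
  have E: "?E \<in> cat_hom G1 (U m) (U m)" using G_comp_hom[OF GO_U X GO_U F K] .
  then obtain P where P: "P \<in> carrier_mat m m" "?E = UF m m P"
    using UF_bij[of m m] by (auto simp: bij_betw_def)
  have FE: "cat_comp G1 (U m) (U m) X F ?E = F"
    using G_assoc[OF GO_U X GO_U X F K F, of "\<lambda>_ _ _. 1"] FK G_id_left[OF GO_U X F] by simp
  have "cat_comp G1 (U m) (U m) (U m) ?E ?E = ?E"
    using G_assoc[OF GO_U GO_U X GO_U E F K, of "\<lambda>_ _ _. 1"] FE by simp
  then have "UF m m (P * P) = UF m m P" using UF_comp[OF P(1) P(1)] P(2) by simp
  then have PP: "P * P = P" using UF_bij[of m m] P(1) by (auto simp: bij_betw_def inj_on_def)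
  have "P = 1\<^sub>m m"
  proof (rule ccontr)
    assume "P \<noteq> 1\<^sub>m m"
    then obtain A B k where k: "k < m" "A \<in> carrier_mat m k" "B \<in> carrier_mat k m" "A * B = P"
      using singular_idempotent_factors[OF P(1) PP] by metis
    let ?A = "UF k m A" and ?B = "UF m k B"
    let ?F = "cat_comp G1 (U k) (U m) X F ?A" and ?K = "cat_comp G1 X (U m) (U k) ?B K"
    have h: "?F \<in> cat_hom G1 (U k) X" "?K \<in> cat_hom G1 X (U k)"
      using G_comp_hom[OF GO_U GO_U X UF_hom F] G_comp_hom[OF X GO_U GO_U K UF_hom] by auto
    have "cat_comp G1 X (U k) X ?F ?K = cat_comp G1 X (U m) X F (cat_comp G1 X (U k) (U m) ?A ?K)"
      by (rule G_assoc[OF X GO_U GO_U X h(2) UF_hom F])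
    also have "cat_comp G1 X (U k) (U m) ?A ?K = cat_comp G1 X (U m) (U m) (cat_comp G1 (U m) (U k) (U m) ?A ?B) K"
      by (rule G_assoc[OF X GO_U GO_U GO_U K UF_hom UF_hom, symmetric])
    also have "cat_comp G1 (U m) (U k) (U m) ?A ?B = ?E" using UF_comp[OF k(3,2)] k(4) P(2) by simp
    also have "cat_comp G1 X (U m) X F (cat_comp G1 X (U m) (U m) ?E K) = cat_comp G1 X (U m) X (cat_comp G1 (U m) (U m) X F ?E) K"
      by (rule G_assoc[OF X GO_U GO_U X K E F, symmetric])
    finally have "cat_comp G1 X (U k) X ?F ?K = cat_id G1 X" by (simp add: FE FK)
    then have "unit_retract k X" using h unfolding unit_retract_def by blast
    then show False using least k(1) by fastforce
  qed
  then have "?E = cat_id G1 (U m)" using P(2) UF_id by simp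
  then show ?thesis using that F K FK by blast
qed

text \<open>Up to negligible morphisms \<open>\<Phi>\<close> factors through a multiple of the unit.  Factorisations of the identities of
  the single summands are collected one composite at a time, until \<open>\<Phi>\<close> is the identity of \<open>X\<close>.\<close>

definition cover :: "('k uq_rep \<times> nat) list \<Rightarrow> (nat \<Rightarrow> nat \<Rightarrow> 'k mat) \<Rightarrow> bool" where
  "cover X \<Phi> \<longleftrightarrow> (\<exists>m F K. ghom (U m) X F \<and> ghom X (U m) K \<and>
     (\<forall>r<length X. \<forall>s<length X. eqv (fst (X ! s)) (fst (X ! r)) (\<Phi> r s) (gcomp X (U m) X F K r s)))"

lemma cover_zero: "GO X \<Longrightarrow> cover X (\<lambda>r s. 0\<^sub>m (rep_dim (fst (X ! r))) (rep_dim (fst (X ! s))))"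
  unfolding cover_def
  by (rule exI[of _ 0], intro exI) (auto simp: ghom_def gcomp_def msum_empty GO_nth intro!: eqv_refl hom_zero[of v])

lemma cover_eqv:
  assumes X: "GO X" and "cover X \<Phi>" and e: "\<And>r s. r < length X \<Longrightarrow> s < length X \<Longrightarrow> eqv (fst (X ! s)) (fst (X ! r)) (\<Psi> r s) (\<Phi> r s)"
  shows "cover X \<Psi>"
proof -
  obtain m F K where "ghom (U m) X F" "ghom X (U m) K" and
    c: "\<And>r s. r < length X \<Longrightarrow> s < length X \<Longrightarrow> eqv (fst (X ! s)) (fst (X ! r)) (\<Phi> r s) (gcomp X (U m) X F K r s)"
    using assms(2) unfolding cover_def by blast
  moreover have "eqv (fst (X ! s)) (fst (X ! r)) (\<Psi> r s) (gcomp X (U m) X F K r s)" if "r < length X" "s < length X" for r s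
    by (rule eqv_trans[OF GO_nth(2)[OF X that(2)] GO_nth(2)[OF X that(1)] e[OF that] c[OF that]])
  ultimately show ?thesis unfolding cover_def by blast
qed

lemma cover_hom:
  assumes "cover X \<Phi>" "r < length X" "s < length X"
  shows "\<Phi> r s \<in> uq_hom (fst (X ! s)) (fst (X ! r))"
  using assms eqv_hom unfolding cover_def by blast

lemma cover_add:
  assumes X: "GO X" and "cover X \<Phi>" and f: "ghom unt X (\<lambda>r _. f r)" and g: "ghom X unt (\<lambda>_ s. g s)"
  shows "cover X (\<lambda>r s. f r * g s + \<Phi> r s)"
proof -
  obtain m F K where F: "ghom (U m) X F" and K: "ghom X (U m) K" and
    c: "\<And>r s. r < length X \<Longrightarrow> s < length X \<Longrightarrow> eqv (fst (X ! s)) (fst (X ! r)) (\<Phi> r s) (gcomp X (U m) X F K r s)"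
    using assms(2) unfolding cover_def by blast
  define F' where "F' r i = (if i = m then f r else F r i)" for r i
  define K' where "K' i s = (if i = m then g s else K i s)" for i s
  have "ghom (U (Suc m)) X F'" "ghom X (U (Suc m)) K'"
    using F K f g by (auto simp: ghom_def F'_def K'_def less_Suc_eq)
  moreover have "eqv (fst (X ! s)) (fst (X ! r)) (f r * g s + \<Phi> r s) (gcomp X (U (Suc m)) X F' K' r s)"
    if rs: "r < length X" "s < length X" for r s
  proof -
    have w: "wrep v (fst (X ! s))" "wrep v (fst (X ! r))" using X rs by (auto simp: GO_nth)
    have fg: "f r \<in> uq_hom uq_trivial (fst (X ! r))" "g s \<in> uq_hom (fst (X ! s)) uq_trivial"
      using ghomD[OF f, of r 0] ghomD[OF g, of 0 s] rs by simp_all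
    have "{..<Suc m} = insert m {..<m}" by auto
    then have "gcomp X (U (Suc m)) X F' K' r s = F' r m * K' m s + msum (rep_dim (fst (X ! r))) (rep_dim (fst (X ! s))) {..<m} (\<lambda>t. F' r t * K' t s)"
      unfolding gcomp_def using uq_homD(1,2)[OF fg(1)] uq_homD(1,2)[OF fg(2)] by (simp add: msum_insert F'_def K'_def)
    also have "\<dots> = f r * g s + gcomp X (U m) X F K r s"
    proof -
      have "msum (rep_dim (fst (X ! r))) (rep_dim (fst (X ! s))) {..<m} (\<lambda>t. F' r t * K' t s) = gcomp X (U m) X F K r s"
        unfolding gcomp_def length_U by (rule msum_cong) (auto simp: F'_def K'_def)
      then show ?thesis by (simp add: F'_def K'_def)
    qed
    finally show ?thesis
      using eqv_add[OF w eqv_refl[OF w hcomp[OF w(1) wrep_trivial w(2) fg(2,1)]] c[OF rs]] by simp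
  qed
  ultimately show ?thesis unfolding cover_def by blast
qed

lemma cover_thru:
  assumes X: "GO X" and t: "t < length X" "snd (X ! t) = 0" and "thru {uq_trivial} (fst (X ! t)) (fst (X ! t)) h" and c: "cover X \<Phi>"
  shows "cover X (\<lambda>r s. if r = t \<and> s = t then h + \<Phi> r s else \<Phi> r s)"
  using assms(4)
proof induction
  case thru_zero
  have "0\<^sub>m (rep_dim (fst (X ! t))) (rep_dim (fst (X ! t))) + \<Phi> t t = \<Phi> t t"
    using left_add_zero_mat[OF uq_homD(3)[OF cover_hom[OF c t(1) t(1)]]] .
  then show ?case
    by (intro cover_eqv[OF X c]) (use X cover_hom[OF c] in \<open>auto simp: GO_nth intro!: eqv_refl\<close>)
next
  case (thru_add W g f h)
  then have W: "W = uq_trivial" by simp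
  note fg = thru_add(3,4)[unfolded W]
  note df = uq_homD(1,2)[OF fg(1)] uq_homD(1,2)[OF fg(2)]
  let ?f = "\<lambda>r. if r = t then f else 0\<^sub>m (rep_dim (fst (X ! r))) 1"
  let ?g = "\<lambda>s. if s = t then g else 0\<^sub>m 1 (rep_dim (fst (X ! s)))"
  have z: "0\<^sub>m (rep_dim (fst (X ! r))) 1 \<in> uq_hom uq_trivial (fst (X ! r))" "0\<^sub>m 1 (rep_dim (fst (X ! r))) \<in> uq_hom (fst (X ! r)) uq_trivial"
    if "r < length X" for r using that X hom_zero[of v uq_trivial "fst (X ! r)"] hom_zero[of v "fst (X ! r)" uq_trivial] by (auto simp: GO_nth)
  have "ghom unt X (\<lambda>r _. ?f r)" "ghom X unt (\<lambda>_ s. ?g s)"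
    using fg t z by (auto simp: ghom_def)
  from cover_add[OF X thru_add.IH this]
  show ?case
  proof (rule cover_eqv[OF X])
    fix r s assume rs: "r < length X" "s < length X"
    have w: "wrep v (fst (X ! s))" "wrep v (fst (X ! r))" using X rs by (auto simp: GO_nth)
    note p = cover_hom[OF c rs]
    have h: "h \<in> uq_hom (fst (X ! t)) (fst (X ! t))" using thru_hom[OF thru_add(5)] X t by (simp add: GO_nth)
    have fgh: "f * g \<in> uq_hom (fst (X ! t)) (fst (X ! t))" using hcomp[OF _ wrep_trivial _ fg] X t by (simp add: GO_nth)
    have "(if r = t \<and> s = t then f * g + h + \<Phi> r s else \<Phi> r s) = ?f r * ?g s + (if r = t \<and> s = t then h + \<Phi> r s else \<Phi> r s)"
    proof (cases "r = t \<and> s = t")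
      case True
      then show ?thesis using assoc_add_mat[of "f * g" _ _ h "\<Phi> r s"] uq_homD(3)[OF fgh] uq_homD(3)[OF h] uq_homD(3)[OF p] by auto
    next
      case False
      then have "?f r * ?g s = 0\<^sub>m (rep_dim (fst (X ! r))) (rep_dim (fst (X ! s)))"
        using df by (auto intro!: left_mult_zero_mat right_mult_zero_mat carrier_matI)
      then show ?thesis using False uq_homD(3)[OF p] by auto
    qed
    moreover have "(if r = t \<and> s = t then f * g + h + \<Phi> r s else \<Phi> r s) \<in> uq_hom (fst (X ! s)) (fst (X ! r))"
    proof (cases "r = t \<and> s = t")
      case True
      then have e: "fst (X ! s) = fst (X ! t)" "fst (X ! r) = fst (X ! t)" by auto
      have "f * g + h + \<Phi> r s \<in> uq_hom (fst (X ! s)) (fst (X ! r))"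
        by (rule hadd[OF w hadd[OF w] p]) (use fgh h e in simp_all)
      then show ?thesis using True by simp
    next
      case False
      then show ?thesis using p by (simp only: if_False)
    qed
    ultimately show "eqv (fst (X ! s)) (fst (X ! r)) (if r = t \<and> s = t then f * g + h + \<Phi> r s else \<Phi> r s) (?f r * ?g s + (if r = t \<and> s = t then h + \<Phi> r s else \<Phi> r s))"
      using eqv_refl[OF w, of "if r = t \<and> s = t then f * g + h + \<Phi> r s else \<Phi> r s"] by (simp only:)
  qed
qed

lemma cover_id:
  assumes X: "GO X" and t: "\<And>t. t < length X \<Longrightarrow> snd (X ! t) = 0 \<and> ethru {uq_trivial} (fst (X ! t)) (fst (X ! t)) (1\<^sub>m (rep_dim (fst (X ! t))))
      \<or> eqv (fst (X ! t)) (fst (X ! t)) (1\<^sub>m (rep_dim (fst (X ! t)))) (0\<^sub>m (rep_dim (fst (X ! t))) (rep_dim (fst (X ! t))))"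
  shows "cover X (gid X)"
proof -
  define \<Phi> where "\<Phi> t r s = (if r < t then gid X r s else 0\<^sub>m (rep_dim (fst (X ! r))) (rep_dim (fst (X ! s))))" for t r s
  have "cover X (\<Phi> t)" if "t \<le> length X" for t
    using that
  proof (induction t)
    case 0
    then show ?case using cover_zero[OF X] by (simp add: \<Phi>_def)
  next
    case (Suc t)
    then have tX: "t < length X" and IH: "cover X (\<Phi> t)" by auto
    let ?Y = "fst (X ! t)"
    have w: "wrep v ?Y" using X tX by (simp add: GO_nth)
    have step: "cover X (\<Phi> (Suc t))" if c: "cover X \<Psi>" and e: "eqv ?Y ?Y (1\<^sub>m (rep_dim ?Y)) (\<Psi> t t)"
      and o: "\<And>r s. r < length X \<Longrightarrow> s < length X \<Longrightarrow> \<not> (r = t \<and> s = t) \<Longrightarrow> \<Psi> r s = \<Phi> t r s" for \<Psi>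
    proof (rule cover_eqv[OF X c])
      fix r s assume rs: "r < length X" "s < length X"
      have wr: "wrep v (fst (X ! s))" "wrep v (fst (X ! r))" using X rs by (auto simp: GO_nth)
      show "eqv (fst (X ! s)) (fst (X ! r)) (\<Phi> (Suc t) r s) (\<Psi> r s)"
      proof (cases "r = t \<and> s = t")
        case True
        then show ?thesis using e by (simp add: \<Phi>_def gid_def)
      next
        case False
        then have "\<Phi> (Suc t) r s = \<Psi> r s" using o[OF rs False] by (auto simp: \<Phi>_def gid_def less_Suc_eq)
        then show ?thesis using eqv_refl[OF wr cover_hom[OF c rs]] by simp
      qed
    qed
    from t[OF tX] show ?case
    proof
      assume a: "snd (X ! t) = 0 \<and> ethru {uq_trivial} ?Y ?Y (1\<^sub>m (rep_dim ?Y))"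
      then obtain h where h: "thru {uq_trivial} ?Y ?Y h" "eqv ?Y ?Y (1\<^sub>m (rep_dim ?Y)) h" by (auto simp: ethru_def)
      have "h + \<Phi> t t t = h" using uq_homD(3)[OF thru_hom[OF h(1) w w]] by (simp add: \<Phi>_def)
      then show ?thesis using h(2) by (intro step[OF cover_thru[OF X tX _ h(1) IH]]) (use a in auto)
    next
      assume "eqv ?Y ?Y (1\<^sub>m (rep_dim ?Y)) (0\<^sub>m (rep_dim ?Y) (rep_dim ?Y))"
      then show ?thesis by (intro step[OF IH]) (auto simp: \<Phi>_def)
    qed
  qed
  from this[OF order_refl] show ?thesis
    by (rule cover_eqv[OF X]) (use X in \<open>auto simp: \<Phi>_def intro!: eqv_refl ghomD[OF ghom_id] GO_nth\<close>)
qed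

lemma cover_unit_retract:
  assumes X: "GO X" and "cover X (gid X)"
  obtains m where "unit_retract m X"
proof -
  obtain m F K where FK: "ghom (U m) X F" "ghom X (U m) K" and
    c: "\<And>r s. r < length X \<Longrightarrow> s < length X \<Longrightarrow> eqv (fst (X ! s)) (fst (X ! r)) (gid X r s) (gcomp X (U m) X F K r s)"
    using assms(2) unfolding cover_def by blast
  have h: "gm (U m) X F \<in> cat_hom G1 (U m) X" "gm X (U m) K \<in> cat_hom G1 X (U m)"
    using G_hom[OF GO_U X] G_hom[OF X GO_U] FK by blast+
  have "cat_comp G1 X (U m) X (gm (U m) X F) (gm X (U m) K) = gm X X (gcomp X (U m) X F K)"
    by (rule gm_comp[OF X GO_U X FK(2,1)])
  also have "\<dots> = cat_id G1 X"
    unfolding gm_id using gm_eq_iff[OF X X ghom_id[OF X] ghom_comp[OF X GO_U X FK(2,1)]] c by auto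
  finally show ?thesis using that h unfolding unit_retract_def by blast
qed

text \<open>A composite through an object to which \<open>Y\<close> has only negligible morphisms does not count.\<close>

lemma ethru_drop:
  assumes "ethru S Y Y' h" and w: "wrep v Y" "wrep v Y'" and S: "\<And>W g. W \<in> S \<Longrightarrow> W \<notin> S' \<Longrightarrow> g \<in> uq_hom Y W \<Longrightarrow> g \<in> Neg Y W"
  shows "ethru S' Y Y' h"
proof -
  obtain h0 where h0: "thru S Y Y' h0" "eqv Y Y' h h0" using assms(1) by (auto simp: ethru_def)
  from h0(1) have "ethru S' Y Y' h0"
  proof induction
    case thru_zero
    show ?case by (intro thru_ethru thru.thru_zero w)
  next
    case (thru_add W g f h)
    have fg: "f * g \<in> uq_hom Y Y'" using hcomp[OF w(1) thru_add(2) w(2) thru_add(3,4)] .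
    show ?case
    proof (cases "W \<in> S'")
      case True
      have "thru S' Y Y' (f * g + 0\<^sub>m (rep_dim Y') (rep_dim Y))"
        using thru.thru_add[OF True thru_add(2,3,4) thru.thru_zero] .
      then have "ethru S' Y Y' (f * g)" using uq_homD(3)[OF fg] by (simp add: thru_ethru w)
      then show ?thesis using ethru_plus[OF w] thru_add.IH by blast
    next
      case False
      have "f * g \<in> Neg Y Y'" by (rule Neg_compL[OF w(1) thru_add(2) w(2) S[OF thru_add(1) False thru_add(3)] thru_add(4)])
      then have "eqv Y Y' (f * g) (0\<^sub>m (rep_dim Y') (rep_dim Y))" using eqv_zero_iff[OF w] by blast
      then have "ethru S' Y Y' (f * g)" unfolding ethru_def using thru.thru_zero by blast
      then show ?thesis using ethru_plus[OF w] thru_add.IH by blast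
    qed
  qed
  then show ?thesis using ethru_eqv h0(2) w by blast
qed

end

context braided_ising
begin

section \<open>Non-degeneracy\<close>

abbreviation MC where "MC \<equiv> mueger_center C c"

lemma MC_simps [simp]: "cat_hom MC = cat_hom G1" "cat_id MC = cat_id G1" "cat_comp MC = cat_comp G1"
  "cat_add MC = cat_add G1" "cat_scale MC = cat_scale G1"
  "ten_unit MC = unt" "ten_obj MC = ten" "ten_mor MC = ten_mor G1" "ten_assoc MC = ten_assoc (G w)" "ten_lunit MC = ten_lunit G1" "ten_runit MC = ten_runit G1"
  by (simp_all add: mueger_center_def full_subcat_def)

lemma U_MC [simp]: "U m \<in> cat_obj MC"
  unfolding center_iff by (auto simp: U_GN Msc_unit)

lemma MC_GO: "X \<in> cat_obj MC \<Longrightarrow> GO X" by (auto simp: center_iff)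

text \<open>An equivalence from \<open>Vec\<close> would send some \<open>m\<close> to \<open>[g]\<close>.  As \<open>g\<close> has non-zero degree, there is only one
  morphism from the unit to \<open>[g]\<close>, so \<open>m = 0\<close>; but then the identity of \<open>[g]\<close> would be zero.\<close>

lemma degenerate:
  assumes g: "H g" "snd g \<noteq> 0" "\<And>y. H y \<Longrightarrow> Msc g y 1" "mtr (rep_K (fst g)) \<noteq> 0"
  shows "\<not> nondegenerate C c"
proof
  assume "nondegenerate C c"
  then obtain F0 F1 J e where mf: "monoidal_functor Vec_cat MC F0 F1 J e"
    and bij: "\<And>m k. bij_betw (F1 m k) (carrier_mat k m) (cat_hom G1 (F0 m) (F0 k))"
    and es: "\<And>X. X \<in> cat_obj MC \<Longrightarrow> \<exists>m. isomorphic_objs MC (F0 m) X"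
    unfolding nondegenerate_def monoidally_equivalent_def by (auto simp: Vec_cat_def)
  have F0: "GO (F0 m)" for m
    using mf unfolding monoidal_functor_def Let_def by (auto simp: Vec_cat_def intro!: MC_GO)
  obtain e' where e: "e \<in> cat_hom G1 unt (F0 1)" "e' \<in> cat_hom G1 (F0 1) unt" "cat_comp G1 (F0 1) unt (F0 1) e e' = cat_id G1 (F0 1)"
    using mf unfolding monoidal_functor_def Let_def by (auto simp: Vec_cat_def iso_mor_def inverse_mors_def)
  have gMC: "[g] \<in> cat_obj MC" unfolding center_iff using g by auto
  note Gg = MC_GO[OF gMC]
  obtain m f f' where f: "f \<in> cat_hom G1 (F0 m) [g]" "f' \<in> cat_hom G1 [g] (F0 m)"
      "cat_comp G1 (F0 m) [g] (F0 m) f' f = cat_id G1 (F0 m)" "cat_comp G1 [g] (F0 m) [g] f f' = cat_id G1 [g]"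
    using es[OF gMC] by (auto simp: isomorphic_objs_def iso_mor_def inverse_mors_def)
  have Gu: "GO unt" by simp
  have z: "x = sg (uq_trivial, 0) g (0\<^sub>m (rep_dim (fst g)) 1)" if "x \<in> cat_hom G1 unt [g]" for x
    using hom_sg_zero[of "(uq_trivial, 0)" g x] that g H_hO[OF g(1)] by simp
  have eq: "A = B" if A: "A \<in> carrier_mat m 1" and B: "B \<in> carrier_mat m 1" for A B :: "'k mat"
  proof -
    have h: "F1 1 m A \<in> cat_hom G1 (F0 1) (F0 m)" "F1 1 m B \<in> cat_hom G1 (F0 1) (F0 m)" using bij A B by (auto simp: bij_betw_def)
    note fh = G_comp_hom[OF F0 F0 Gg h(1) f(1)] G_comp_hom[OF F0 F0 Gg h(2) f(1)]
    have "cat_comp G1 unt (F0 1) [g] (cat_comp G1 (F0 1) (F0 m) [g] f (F1 1 m A)) e = cat_comp G1 unt (F0 1) [g] (cat_comp G1 (F0 1) (F0 m) [g] f (F1 1 m B)) e"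
      using z[OF G_comp_hom[OF Gu F0 Gg e(1) fh(1)]] z[OF G_comp_hom[OF Gu F0 Gg e(1) fh(2)]] by simp
    then have "cat_comp G1 (F0 1) (F0 m) [g] f (F1 1 m A) = cat_comp G1 (F0 1) (F0 m) [g] f (F1 1 m B)"
      by (rule G_cancel_right[OF Gu F0 Gg fh e(1,2,3)])
    then have "F1 1 m A = F1 1 m B" by (rule G_cancel_left[OF F0 F0 Gg h f(1,2,3)])
    then show ?thesis using bij[of 1 m] A B by (auto simp: bij_betw_def inj_on_def)
  qed
  have "m = 0"
  proof (rule ccontr)
    assume "m \<noteq> 0"
    have "mat m 1 (\<lambda>_. 0) = (mat m 1 (\<lambda>_. 1) :: 'k mat)" by (rule eq) auto
    then have "mat m 1 (\<lambda>_. 0) $$ (0, 0) = (mat m 1 (\<lambda>_. 1) :: 'k mat) $$ (0, 0)" by simp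
    with \<open>m \<noteq> 0\<close> show False by simp
  qed
  then have single: "x = y" if "x \<in> cat_hom G1 (F0 m) (F0 m)" "y \<in> cat_hom G1 (F0 m) (F0 m)" for x y
  proof -
    have "x \<in> F1 m m ` carrier_mat m m" "y \<in> F1 m m ` carrier_mat m m"
      using bij[of m m] that by (simp_all add: bij_betw_def)
    then obtain A B where "A \<in> carrier_mat m m" "x = F1 m m A" "B \<in> carrier_mat m m" "y = F1 m m B" by blast
    moreover have "A = B" using calculation(1,3) \<open>m = 0\<close> by (intro eq_matI) auto
    ultimately show ?thesis by simp
  qed
  let ?d = "rep_dim (fst g)"
  have w: "wrep v (fst g)" using H_hO[OF g(1)] by simp
  have ho: "hO g" using H_hO[OF g(1)] by simp
  have zh: "0\<^sub>m ?d ?d \<in> uq_hom (fst g) (fst g)" by (rule hom_zero[OF w w])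
  have i: "sg g g (1\<^sub>m ?d) \<in> cat_hom G1 [g] [g]" "sg g g (0\<^sub>m ?d ?d) \<in> cat_hom G1 [g] [g]"
    by (rule sg_hom[OF ho ho hom_id[OF w] refl], rule sg_hom[OF ho ho zh refl])
  note fi = G_comp_hom[OF Gg Gg F0 i(1) f(2)] G_comp_hom[OF Gg Gg F0 i(2) f(2)]
  have "cat_comp G1 (F0 m) [g] (F0 m) (cat_comp G1 [g] [g] (F0 m) f' (sg g g (1\<^sub>m ?d))) f = cat_comp G1 (F0 m) [g] (F0 m) (cat_comp G1 [g] [g] (F0 m) f' (sg g g (0\<^sub>m ?d ?d))) f"
    by (rule single[OF G_comp_hom[OF F0 Gg F0 f(1) fi(1)] G_comp_hom[OF F0 Gg F0 f(1) fi(2)]])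
  then have "cat_comp G1 [g] [g] (F0 m) f' (sg g g (1\<^sub>m ?d)) = cat_comp G1 [g] [g] (F0 m) f' (sg g g (0\<^sub>m ?d ?d))"
    by (rule G_cancel_right[OF F0 Gg F0 fi f(1,2,4)])
  then have "sg g g (1\<^sub>m ?d) = sg g g (0\<^sub>m ?d ?d)" by (rule G_cancel_left[OF Gg Gg F0 i f(2,1,4)])
  then have "eqv (fst g) (fst g) (1\<^sub>m ?d) (0\<^sub>m ?d ?d)" using sg_eq[OF ho ho hom_id[OF w] zh refl] by blast
  moreover have "1 \<cdot>\<^sub>m 1\<^sub>m ?d = (1\<^sub>m ?d :: 'k mat)" "0 \<cdot>\<^sub>m 1\<^sub>m ?d = (0\<^sub>m ?d ?d :: 'k mat)" by (auto intro!: eq_matI)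
  ultimately have "(1 :: 'k) = 0" using eqv_scalar_eq[OF w _ g(4), of 1 0] by simp
  then show False by simp
qed

lemma Msc_retract:
  assumes x: "H x" and y: "H y" and m: "Msc x y 1" and Y: "Y \<in> T" and i: "i \<in> uq_hom Y (fst x)" and p: "p \<in> uq_hom (fst x) Y" and pi: "p * i = 1\<^sub>m (rep_dim Y)"
  shows "Msc (Y, snd x) y 1"
proof -
  have x': "H (Y, snd x)" by (rule H_retract[OF x Y i p pi])
  let ?A = "uq_tensor Y (fst y)" and ?B = "uq_tensor (fst x) (fst y)" and ?e = "1\<^sub>m (rep_dim (fst y)) :: 'k mat"
  have w: "wrep v (fst x)" "wrep v (fst y)" "wrep v Y" using H_hO[OF x] H_hO[OF y] Y by auto
  have wA: "wrep v ?A" and wB: "wrep v ?B" using w by auto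
  let ?kp = "kron p ?e" and ?ki = "kron i ?e"
  have kp: "?kp \<in> uq_hom ?B ?A" by (rule hkron[OF w(1,3,2,2) p hom_id[OF w(2)]])
  have ki: "?ki \<in> uq_hom ?A ?B" by (rule hkron[OF w(3,1,2,2) i hom_id[OF w(2)]])
  note dd = uq_homD(1,2)[OF i] uq_homD(1,2)[OF p] M_dim[OF x y] M_dim[OF x' y]
  have k1: "?kp * ?ki = 1\<^sub>m (rep_dim Y * rep_dim (fst y))"
    using dd by (simp add: kron_mult pi one_mult_dim kron_one_one)
  have "eqv ?B ?A (M (Y, snd x) y * ?kp) (?kp * M x y)"
    using M_nat[OF x y x' y, of p ?e] p hom_id[OF w(2)] by simp
  moreover have "eqv ?B ?A (?kp * M x y) (?kp * (1 \<cdot>\<^sub>m 1\<^sub>m (rep_dim (fst x) * rep_dim (fst y))))"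
    by (rule eqv_comp[OF wB wB wA m[unfolded Msc_def] eqv_refl[OF wB wA kp]])
  ultimately have "eqv ?B ?A (M (Y, snd x) y * ?kp) (?kp * (1 \<cdot>\<^sub>m 1\<^sub>m (rep_dim (fst x) * rep_dim (fst y))))"
    by (rule eqv_trans[OF wB wA])
  moreover have "?kp * (1 \<cdot>\<^sub>m 1\<^sub>m (rep_dim (fst x) * rep_dim (fst y))) = ?kp" using dd by (simp add: smult_one mult_one_dim)
  ultimately have "eqv ?B ?A (M (Y, snd x) y * ?kp) ?kp" by simp
  from eqv_comp[OF wA wB wA eqv_refl[OF wA wB ki] this]
  have "eqv ?A ?A (M (Y, snd x) y * ?kp * ?ki) (?kp * ?ki)" .
  moreover have "M (Y, snd x) y * ?kp * ?ki = M (Y, snd x) y" using dd by (simp add: mult_assoc_dim k1 mult_one_dim)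
  ultimately show ?thesis by (simp add: Msc_def k1 smult_one)
qed

text \<open>\<open>K^4\<close> acts on \<open>W\<close> by one sign only, as the identity of \<open>W\<close> is not negligible.\<close>

lemma degree_parity:
  assumes "H (W, i)" "H (W, j)" and t: "mtr (rep_K W) \<noteq> 0"
  shows "even i = even j"
proof -
  have w: "wrep v W" using H_hO(2)[OF assms(1)] by simp
  have "par W i (1\<^sub>m (rep_dim W))" "par W j (1\<^sub>m (rep_dim W))" using GN_gpar[OF assms(1)] GN_gpar[OF assms(2)] by (auto simp: gpar_def)
  then have "eqv W W ((-1) ^ i \<cdot>\<^sub>m 1\<^sub>m (rep_dim W)) ((-1) ^ j \<cdot>\<^sub>m 1\<^sub>m (rep_dim W))"
    unfolding par_def using eqv_trans[OF w w] eqv_sym[OF w w] by blast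
  from eqv_scalar_eq[OF w this t] show ?thesis by (auto simp: minus_one_power_iff split: if_splits)
qed

text \<open>By Schur's lemma a non-negligible morphism from \<open>Y\<close> to \<open>V\<close> or \<open>D\<close> would make that object a transparent
  summand of \<open>Y\<close>.  Parity excludes the wrong degrees, and \<open>Z_not_central\<close> and \<open>D_not_central\<close> the others.\<close>

lemma center_summand:
  assumes n: "n = 2" and x: "H (Y, j)" and c: "\<And>y. H y \<Longrightarrow> Msc (Y, j) y 1"
  shows "j = 0 \<and> ethru {uq_trivial} Y Y (1\<^sub>m (rep_dim Y)) \<or> eqv Y Y (1\<^sub>m (rep_dim Y)) (0\<^sub>m (rep_dim Y) (rep_dim Y))"
proof -
  have Y: "Y \<in> T" "wrep v Y" "j < 2" using H_hO[OF x] n by auto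
  have j: "j = 0 \<or> j = 1" using Y(3) by auto
  have dg: "dg = 0" unfolding dg_def by (simp add: n)
  have EV: "\<exists>s. f = s \<cdot>\<^sub>m 1\<^sub>m (rep_dim V)" if "f \<in> uq_hom V V" for f using End_V[OF that] by auto
  have ED: "\<exists>s. f = s \<cdot>\<^sub>m 1\<^sub>m (rep_dim D)" if "f \<in> uq_hom D D" for f using End_D[OF that] by auto
  have E1: "\<exists>s. f = s \<cdot>\<^sub>m 1\<^sub>m (rep_dim uq_trivial)" if "f \<in> uq_hom uq_trivial uq_trivial" for f :: "'k mat" using End_triv[OF that] by auto
  have ret: "H (W, j) \<and> Msc (W, j) Z 1" if W: "W \<in> T" and E: "\<And>f. f \<in> uq_hom W W \<Longrightarrow> \<exists>s. f = s \<cdot>\<^sub>m 1\<^sub>m (rep_dim W)" and g: "g \<in> uq_hom Y W" "g \<notin> Neg Y W" for W g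
  proof -
    obtain h where h: "h \<in> uq_hom W Y" "g * h = 1\<^sub>m (rep_dim W)" using schur[OF Y(2) T_wrep[OF W] E g] by blast
    then show ?thesis using H_retract[OF x W, of h g] Msc_retract[OF x H_Z c[OF H_Z] W, of h g] g(1) by simp
  qed
  have nV: "g \<in> Neg Y V" if "g \<in> uq_hom Y V" for g
  proof (rule ccontr)
    assume "g \<notin> Neg Y V"
    then have r: "H (V, j)" "Msc (V, j) Z 1" using ret[OF T_V EV that] by auto
    then have "odd j" using degree_parity[OF H_Z r(1) trV] by simp
    then have "j = 1" using j by auto
    then show False using r(2) Z_not_central by (simp add: One_nat_def)
  qed
  have tD: "mtr (rep_K D) \<noteq> 0" using traces by simp
  have nD: "g \<in> Neg Y D" if "g \<in> uq_hom Y D" for g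
  proof (rule ccontr)
    assume "g \<notin> Neg Y D"
    then have r: "H (D, j)" "Msc (D, j) Z 1" using ret[OF T_D ED that] by auto
    then have "even j" using degree_parity[OF H_D r(1) tD] by (simp add: dg)
    then have "j = 0" using j by auto
    then show False using r(2) D_not_central[OF n] by simp
  qed
  show ?thesis
  proof (cases "j = 0")
    case True
    have "ethru {uq_trivial} Y Y (1\<^sub>m (rep_dim Y))"
      by (rule ethru_drop[OF T_simple[OF Y(1)] Y(2,2)]) (use nV nD in auto)
    then show ?thesis using True by blast
  next
    case False
    have n1: "g \<in> Neg Y uq_trivial" if "g \<in> uq_hom Y uq_trivial" for g
    proof (rule ccontr)
      assume "g \<notin> Neg Y uq_trivial"
      then have r: "H (uq_trivial, j)" using ret[OF T_unit E1 that] by auto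
      then have "even j" using degree_parity[OF H_unit r] by (simp add: mtr_def)
      then show False using False j by auto
    qed
    have "ethru {} Y Y (1\<^sub>m (rep_dim Y))"
      by (rule ethru_drop[OF T_simple[OF Y(1)] Y(2,2)]) (use nV nD n1 in auto)
    then obtain h where h: "thru {} Y Y h" "eqv Y Y (1\<^sub>m (rep_dim Y)) h" by (auto simp: ethru_def)
    from h(1) have "h = 0\<^sub>m (rep_dim Y) (rep_dim Y)" by cases auto
    then show ?thesis using h(2) by simp
  qed
qed

lemma nondegenerate_2:
  assumes n: "n = 2" and w0: "w 0 0 0 = 1"
  shows "nondegenerate C c"
proof -
  have mf: "monoidal_functor Vec_cat MC U UF (\<lambda>a b. cat_id G1 (U (a * b))) (cat_id G1 unt)"
  proof -
    have iso: "iso_mor MC (U a) (U a) (UF a a (1\<^sub>m a))" for a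
      unfolding iso_mor_def inverse_mors_def
      by (rule exI[of _ "UF a a (1\<^sub>m a)"]) (simp add: UF_hom UF_comp UF_id[symmetric])
    have un: "cat_id G1 unt = UF 1 1 (1\<^sub>m 1)" "unt = U 1" unfolding U_1[symmetric] by (rule UF_id[symmetric]) simp
    have l: "ten_lunit G1 (U a) = UF a a (1\<^sub>m a)" "ten_runit G1 (U a) = UF a a (1\<^sub>m a)" for a
      by (simp_all add: G_lunit[of _ _ "\<lambda>_ _ _. 1"] G_runit[of _ _ "\<lambda>_ _ _. 1"] UF_id[symmetric])
    have as: "ten_assoc (G w) (U a) (U b) (U d) = UF (a * b * d) (a * b * d) (1\<^sub>m (a * b * d))" for a b d
      by (simp add: assoc_U[of w _ _ _ "\<lambda>_ _ _. 1", OF w0] UF_id[symmetric])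
    show ?thesis
      unfolding monoidal_functor_def Let_def un(1)
      by (simp add: Vec_cat_def un(2) iso UF_hom UF_id[symmetric] UF_comp UF_add UF_scale UF_ten l as mult.assoc kron_one_one)
  qed
  moreover have "\<exists>m. isomorphic_objs MC (U m) X" if X: "X \<in> cat_obj MC" for X
  proof -
    have GX: "GO X" using MC_GO[OF X] .
    have "cover X (gid X)"
    proof (rule cover_id[OF GX])
      fix t assume t: "t < length X"
      have "H (fst (X ! t), snd (X ! t))" using X t GN_single by (auto simp: center_iff)
      then show "snd (X ! t) = 0 \<and> ethru {uq_trivial} (fst (X ! t)) (fst (X ! t)) (1\<^sub>m (rep_dim (fst (X ! t)))) \<or>
         eqv (fst (X ! t)) (fst (X ! t)) (1\<^sub>m (rep_dim (fst (X ! t)))) (0\<^sub>m (rep_dim (fst (X ! t))) (rep_dim (fst (X ! t))))"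
        by (rule center_summand[OF n]) (use X t in \<open>auto simp: center_iff\<close>)
    qed
    then obtain m0 where "unit_retract m0 X" using cover_unit_retract[OF GX] by blast
    then obtain m F K where "F \<in> cat_hom G1 (U m) X" "K \<in> cat_hom G1 X (U m)"
      "cat_comp G1 X (U m) X F K = cat_id G1 X" "cat_comp G1 (U m) X (U m) K F = cat_id G1 (U m)"
      using unit_retract_iso[OF GX] by blast
    then have "isomorphic_objs MC (U m) X"
      unfolding isomorphic_objs_def iso_mor_def inverse_mors_def by auto
    then show ?thesis by blast
  qed
  ultimately show ?thesis
    unfolding nondegenerate_def monoidally_equivalent_def
    by (intro exI[of _ U] exI[of _ UF] exI[of _ "\<lambda>a b. cat_id G1 (U (a * b))"] exI[of _ "cat_id G1 unt"])
      (simp add: Vec_cat_def UF_bij)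
qed

end

theorem mainTheorem4:
  fixes q :: "'k::{alg_closed_field, field_char_0}"
    and N :: nat
    and C :: "('k ising_obj, 'k ising_mor, 'k) lin_mon_cat"
    and c :: "'k ising_obj \<Rightarrow> 'k ising_obj \<Rightarrow> 'k ising_mor"
  assumes "q ^ 4 = -1"
    and "N \<ge> 1"
    and "N_Ising_category q N C"
    and "braiding C c"
  shows "nondegenerate C c \<longleftrightarrow> N = 1"
proof -
  obtain z where z: "z ^ (2 ^ N) = 1" and C: "C = Ising_N_twisted q N z"
    using assms(3) by (auto simp: N_Ising_category_def)
  interpret graded_ising "- q" "2 ^ N"
    by unfold_locales (use assms(1,2) in auto)
  have z0: "z \<noteq> 0" using z by (auto simp: power_0_left)
  have Ising: "Ising_cat q = I" by (simp add: Ising_cat_def I_def)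
  interpret braided_ising "- q" "2 ^ N" "omega_cocycle N z" C c
  proof
    show "omega_cocycle N z i j l \<noteq> 0" for i j l using z0 by (simp add: omega_cocycle_def)
    show "C = G1\<lparr>cat_obj := GN, ten_assoc := ten_assoc (G (omega_cocycle N z))\<rparr>"
      unfolding C Ising_N_twisted_def Ising_N_def generated_subcat_def full_subcat_def Ising G_def GN_def ..
    show "braiding C c" by fact
  qed
  show ?thesis
  proof
    assume "N = 1"
    then show "nondegenerate C c" by (intro nondegenerate_2) (auto simp: omega_cocycle_def)
  next
    assume nd: "nondegenerate C c"
    show "N = 1"
    proof (rule ccontr)
      assume "N \<noteq> 1"
      then have "N = 2 + (N - 2)" using assms(2) by simp
      then have "(2::nat) ^ N = 2 ^ 2 * 2 ^ (N - 2)" by (metis power_add)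
      then have "4 dvd (2::nat) ^ N" by simp
      then obtain g where "H g" "snd g \<noteq> 0" "\<And>y. H y \<Longrightarrow> Msc g y 1" "mtr (rep_K (fst g)) \<noteq> 0"
        by (rule transparent_exists) blast
      then show False using degenerate nd by blast
    qed
  qed
qed

end
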